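(* Let $F$ be a field with $\operatorname{char} F \neq 2$, let $m\ge 1$, and let $X \in \mathrm{GL}_{2m}(F)$ leave invariant some non-degenerate alternating bilinear form on $F^{2m}$, i.e. $\mathcal{A}(X) \neq \emptyset$. (a) (Reduction.) Suppose $X = \mathrm{diag}(X_1,\dots,X_r)$ is block diagonal, where for each $i$ there is a monic irreducible polynomial $g_i(t) \ne t$ over $F$ such that every elementary divisor of $X_i$ is a power of $g_i$ or of $g_i^-$, and $g_j \notin \{g_i, g_i^-\}$ for $i \neq j$ (every $X$ is conjugate in $\mathrm{GL}_{2m}(F)$ to a matrix of this form). Then every $A \in \mathcal{A}(X)$ is block diagonal, $A = \mathrm{diag}(A_1,\dots,A_r)$ with $A_i \in \mathcal{A}(X_i)$, and two elements $\mathrm{diag}(A_1,\dots,A_r)$ and $\mathrm{diag}(\tilde A_1,\dots,\tilde A_r)$ of $\mathcal{A}(X)$ lie in the same orbit of the centraliser of $X$ if and only if, for every $i$, $A_i$ and $\tilde A_i$ lie in the same orbit of the centraliser of $X_i$. (b) (Case $g \ne g^-$.) Suppose there is a monic irreducible polynomial $g(t) \neq t$ over $F$ with $g \neq g^-$ such that every elementary divisor of $X$ is a power of $g$ or of $g^-$. Then for every non-degenerate alternating bilinear form $f_0$ on $F^{2m}$, the conjugacy class of $X$ in $\mathrm{GL}_{2m}(F)$ intersects $\mathrm{Sp}(f_0)$ in a single conjugacy class of $\mathrm{Sp}(f_0)$. (c) (Case $g = g^-$.) Suppose that $g(t)\neq t$ is monic irreducible over $F$, that $g = g^-$, and that $g$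 is the only elementary divisor of $X$, occurring with multiplicity $n$. Let $d = \deg g = 2m/n$. (c1) If $d = 1$, then $X = I_{2m}$ or $X = -I_{2m}$, and the centraliser $\mathrm{GL}_{2m}(F)$ of $X$ has a single orbit on $\mathcal{A}(X)$. (c2) If $d \geq 2$, assume (as one may, after conjugation in $\mathrm{GL}_{2m}(F)$) that $X = \mathrm{diag}(R,\dots,R)$ ($n$ blocks), where $R \in \mathrm{GL}_d(F)$ has characteristic polynomial $g$. Let $K = F[R]$, a field, with the automorphism of order $2$ given by $\phi(R) \mapsto \phi(R^{-1})$ for $\phi\in F[t]$. Then there is a skew-symmetric $T \in \mathrm{GL}_d(F)$ with $R T R' = T$, and for any such $T$ and any non-degenerate alternating form $f_0(u,v) = uA_0v'$ on $F^{2m}$ the following holds: the conjugacy classes of $\mathrm{Sp}(f_0)$ consisting of elements that are conjugate to $X$ in $\mathrm{GL}_{2m}(F)$ correspond bijectively to the $\ast$-congruence classes of Hermitian matrices $B \in \mathrm{GL}_n(K)$ (i.e. to the congruence classes of non-degenerate Hermitian forms on $K^n$), where the class of $S^{-1}XS \in \mathrm{Sp}(f_0)$, with $S \in \mathrm{GL}_{2m}(F)$, corresponds to the class of the matrix $B$ determined by $S A_0 S' = B\,\mathrm{diag}(T,\dots,T)$. In particular, if $F$ is finite, then there is only one such class, so the conjugacy class of $X$ in $\mathrm{GL}_{2m}(F)$ meets $\mathrm{Sp}(f_0)$ in a single conjugacy class of $\mathrm{Sp}(f_0)$.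
   Context: Vectors are row vectors, matrices act on the right, and $'$ denotes matrix transpose over $F$. For a non-degenerate alternating bilinear form $f$ on $F^{2m}$, $\mathrm{Sp}(f)$ is the group of all $S\in \mathrm{GL}_{2m}(F)$ with $f(uS,vS)=f(u,v)$ for all $u,v$. For an invertible square matrix $Z$ over $F$ of size $k$, $\mathcal{A}(Z)$ denotes the set of all $A \in \mathrm{GL}_{k}(F)$ with $A = -A'$ and $A = ZAZ'$ (equivalently, the Gram matrices of the non-degenerate alternating forms $(u,v)\mapsto uAv'$ invariant under $Z$). The centraliser of $Z$ in $\mathrm{GL}_k(F)$ acts on $\mathcal{A}(Z)$ by $A \mapsto YAY'$; "orbit" refers to this action. For a monic polynomial $f(t)$ with $f(0)\neq 0$, $f^-(t)$ is the monic polynomial whose roots are the reciprocals of those of $f$, i.e. $f^-(t) = f(0)^{-1}t^{\deg f} f(1/t)$. Elementary divisors of a matrix are the usual ones over $F$: the powers $g(t)^\lambda$ of monic irreducible polynomials, counted with multiplicity, such that the matrix is similar to the direct sum of the companion matrices of the $g(t)^\lambda$. In (c2), $\mathrm{GL}_n(K)$ is identified with the group of nonsingular $n\times n$ block matrices $(\phi_{ij}(R))$, $\phi_{ij}\in F[t]$, inside $\mathrm{GL}_{2m}(F)$; it is the centraliser of $X$. For $Y = (\phi_{ij}(R))\in \mathrm{GL}_n(K)$ put $Y^\ast = (\phi_{ji}(R^{-1}))$. $Y$ is Hermitian if $Y^\ast = Y$; $Y_1,Y_2$ are $\ast$-congruent if $Y_2 = CY_1C^\ast$ for some $C\in \mathrm{GL}_n(K)$.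 *)

theory Defs
  imports
    "Jordan_Normal_Form.Char_Poly"
    "HOL-Algebra.Group_Action"
    "HOL-Algebra.QuotRing"
    "HOL-Library.Multiset"
begin

definition GL :: "nat \<Rightarrow> 'a::field mat monoid" where
  "GL k = units_of (ring_mat TYPE('a) k ())"

definition conj_class :: "('b, 'c) monoid_scheme \<Rightarrow> 'b \<Rightarrow> 'b set" where
  "conj_class G x = {inv\<^bsub>G\<^esub> h \<otimes>\<^bsub>G\<^esub> x \<otimes>\<^bsub>G\<^esub> h | h. h \<in> carrier G}"

text \<open>Row vectors: \<open>row_act u S\<close> is \<open>u S\<close> (the library only has the action on columns).\<close>

definition row_act :: "'a::field vec \<Rightarrow> 'a mat \<Rightarrow> 'a vec" where
  "row_act u S = transpose_mat S *\<^sub>v u"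

text \<open>A form on row vectors of length \<open>N\<close> is a function whose values outside
  \<^term>\<open>carrier_vec N\<close> are irrelevant.\<close>

definition nondeg_alternating_form :: "nat \<Rightarrow> ('a::field vec \<Rightarrow> 'a vec \<Rightarrow> 'a) \<Rightarrow> bool" where
  "nondeg_alternating_form N f \<longleftrightarrow>
     (\<forall>u\<in>carrier_vec N. \<forall>v\<in>carrier_vec N. \<forall>w\<in>carrier_vec N.
        f (u + v) w = f u w + f v w \<and> f w (u + v) = f w u + f w v) \<and>
     (\<forall>c. \<forall>u\<in>carrier_vec N. \<forall>v\<in>carrier_vec N.
        f (c \<cdot>\<^sub>v u) v = c * f u v \<and> f u (c \<cdot>\<^sub>v v) = c * f u v) \<and>
     (\<forall>u\<in>carrier_vec N. f u u = 0) \<and>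
     (\<forall>u\<in>carrier_vec N. (\<forall>v\<in>carrier_vec N. f u v = 0) \<longrightarrow> u = 0\<^sub>v N)"

definition Sp :: "nat \<Rightarrow> ('a::field vec \<Rightarrow> 'a vec \<Rightarrow> 'a) \<Rightarrow> 'a mat monoid" where
  "Sp N f = (GL N)\<lparr>carrier := {S \<in> carrier (GL N).
     \<forall>u\<in>carrier_vec N. \<forall>v\<in>carrier_vec N. f (row_act u S) (row_act v S) = f u v}\<rparr>"

definition centraliser :: "'a::field mat \<Rightarrow> 'a mat monoid" where
  "centraliser Z = (GL (dim_row Z))\<lparr>carrier := {Y \<in> carrier (GL (dim_row Z)). Y * Z = Z * Y}\<rparr>"

text \<open>\<open>inv_gram Z\<close> is the set \<open>\<A>(Z)\<close>.\<close>

definition inv_gram :: "'a::field mat \<Rightarrow> 'a mat set" where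
  "inv_gram Z = {A \<in> carrier (GL (dim_row Z)). A = - transpose_mat A \<and> A = Z * A * transpose_mat Z}"

definition congr_act :: "'a::field mat \<Rightarrow> 'a mat \<Rightarrow> 'a mat" where
  "congr_act Y A = Y * A * transpose_mat Y"

text \<open>The polynomial \<open>f\<^sup>-\<close>; for \<open>f(0) \<noteq> 0\<close>, \<open>reflect_poly f\<close> is \<open>t ^ degree f * f(1/t)\<close>.\<close>

definition recip_poly :: "'a::field poly \<Rightarrow> 'a poly" where
  "recip_poly f = Polynomial.smult (inverse (poly f 0)) (reflect_poly f)"

definition companion_mat :: "'a::field poly \<Rightarrow> 'a mat" where
  "companion_mat p = mat (degree p) (degree p)
     (\<lambda>(i, j). if i = degree p - 1 then - coeff p j else if j = Suc i then 1 else 0)"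

text \<open>A relation rather than a function, so that the definition presupposes neither the existence
  nor the uniqueness of the multiset of elementary divisors.\<close>

definition elementary_divisors :: "'a::field mat \<Rightarrow> 'a poly multiset \<Rightarrow> bool" where
  "elementary_divisors Z E \<longleftrightarrow>
     (\<exists>es. mset es = E \<and>
        (\<forall>e\<in>set es. \<exists>g l. monic g \<and> irreducible g \<and> l \<ge> 1 \<and> e = g ^ l) \<and>
        similar_mat Z (diag_block_mat (map companion_mat es)))"

definition elem_divs_powers_of :: "'a::field mat \<Rightarrow> 'a poly set \<Rightarrow> bool" where
  "elem_divs_powers_of Z G \<longleftrightarrow>
     (\<exists>E. elementary_divisors Z E \<and> (\<forall>e\<in>#E. \<exists>g\<in>G. \<exists>l. e = g ^ l))"

definition primary_blocks :: "'a::field mat list \<Rightarrow> 'a poly list \<Rightarrow> bool" where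
  "primary_blocks Xs gs \<longleftrightarrow> length gs = length Xs \<and>
     (\<forall>i<length Xs. (\<exists>k>0. Xs ! i \<in> carrier (GL k)) \<and>
        monic (gs ! i) \<and> irreducible (gs ! i) \<and> gs ! i \<noteq> [:0, 1:] \<and>
        elem_divs_powers_of (Xs ! i) {gs ! i, recip_poly (gs ! i)}) \<and>
     (\<forall>i<length Xs. \<forall>j<length Xs. i \<noteq> j \<longrightarrow> gs ! j \<notin> {gs ! i, recip_poly (gs ! i)})"

definition poly_mat :: "'a::field poly \<Rightarrow> 'a mat \<Rightarrow> 'a mat" where
  "poly_mat p R = mat (dim_row R) (dim_row R)
     (\<lambda>(i, j). \<Sum>k\<le>degree p. coeff p k * (R ^\<^sub>m k) $$ (i, j))"

text \<open>The ring \<open>K = F[R]\<close>, and the map \<open>\<phi>(R) \<mapsto> \<phi>(R\<^sup>-\<^sup>1)\<close> on it, computed from an arbitrary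
  \<open>\<phi>\<close> representing the argument.\<close>

definition poly_ring :: "'a::field mat \<Rightarrow> 'a mat ring" where
  "poly_ring R = (ring_mat TYPE('a) (dim_row R) ())\<lparr>carrier := {poly_mat p R | p. True}\<rparr>"

definition poly_conj :: "'a::field mat \<Rightarrow> 'a mat \<Rightarrow> 'a mat" where
  "poly_conj R a = poly_mat (SOME p. poly_mat p R = a) (inv\<^bsub>GL (dim_row R)\<^esub> R)"

text \<open>Square matrices of size \<open>n d\<close> as \<open>n \<times> n\<close> matrices of \<open>d \<times> d\<close> blocks, both indexed from 0.\<close>

definition blocks_mat :: "nat \<Rightarrow> nat \<Rightarrow> (nat \<Rightarrow> nat \<Rightarrow> 'a mat) \<Rightarrow> 'a mat" where
  "blocks_mat n d B = mat (n * d) (n * d) (\<lambda>(i, j). B (i div d) (j div d) $$ (i mod d, j mod d))"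

definition block_of :: "nat \<Rightarrow> 'a mat \<Rightarrow> nat \<Rightarrow> nat \<Rightarrow> 'a mat" where
  "block_of d Y i j = mat d d (\<lambda>(a, b). Y $$ (i * d + a, j * d + b))"

text \<open>\<open>GL\<^sub>n(K)\<close> inside \<open>GL\<^sub>n\<^sub>d(F)\<close>, where \<open>R\<close> has size \<open>d\<close>.\<close>

definition GLK :: "nat \<Rightarrow> 'a::field mat \<Rightarrow> 'a mat monoid" where
  "GLK n R = (GL (n * dim_row R))\<lparr>carrier := {Y \<in> carrier (GL (n * dim_row R)).
     \<exists>\<phi>. Y = blocks_mat n (dim_row R) (\<lambda>i j. poly_mat (\<phi> i j) R)}\<rparr>"

definition star :: "nat \<Rightarrow> 'a::field mat \<Rightarrow> 'a mat \<Rightarrow> 'a mat" where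
  "star n R Y = blocks_mat n (dim_row R) (\<lambda>i j. poly_conj R (block_of (dim_row R) Y j i))"

definition hermitian_GLK :: "nat \<Rightarrow> 'a::field mat \<Rightarrow> 'a mat set" where
  "hermitian_GLK n R = {B \<in> carrier (GLK n R). star n R B = B}"

definition star_congr_class :: "nat \<Rightarrow> 'a::field mat \<Rightarrow> 'a mat \<Rightarrow> 'a mat set" where
  "star_congr_class n R B = {C * B * star n R C | C. C \<in> carrier (GLK n R)}"

end

theory Submission
  imports Defs
begin

text \<open>All non-degenerate alternating forms of the same size are congruent. Hence, for a fixed form with
  Gram matrix \<open>A\<^sub>0\<close>, the conjugates \<open>S\<^sup>-\<^sup>1 X S\<close> lying in its symplectic group correspond to the elements
  \<open>S A\<^sub>0 S'\<close> of \<open>\<A>(X)\<close>, and symplectic conjugacy becomes equivalence under the centraliser of \<open>X\<close>.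
  An \<open>A \<in> \<A>(X)\<close> satisfies \<open>\<phi>(X) A = A \<phi>(X\<^sup>-\<^sup>1)'\<close>, so it vanishes between blocks whose annihilating
  polynomials, one of them reciprocated, are coprime; this is the reduction (a).
  If \<open>g \<noteq> g\<^sup>-\<close>, the primary components \<open>P, Q\<close> of \<open>X\<close> are totally isotropic for every form in
  \<open>\<A>(X)\<close>, and \<open>Y = P A B\<^sup>-\<^sup>1 + Q\<close> commutes with \<open>X\<close> and carries \<open>B\<close> to \<open>A\<close>.
  If \<open>X = diag(R, \<dots>, R)\<close>, a quotient of two elements of \<open>\<A>(X)\<close> commutes with \<open>X\<close>, hence is a matrix
  over \<open>K = F[R]\<close>; relative to \<open>D = diag(T, \<dots>, T)\<close> the involution is \<open>Y\<^sup>* = D Y' D\<^sup>-\<^sup>1\<close>, so \<open>B D\<close> is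
  skew-symmetric exactly when \<open>B\<close> is Hermitian. Splitting off one block at a time diagonalises such
  forms, and over a finite field each diagonal entry is a norm from \<open>K\<close>.\<close>

section \<open>Square matrices\<close>

text \<open>The diagonalisation is carried out for an arbitrary invertible block \<open>R\<close>
  whose invariant skew-symmetric matrices are either zero or congruent to one fixed
  \<open>T\<close>, and it is used twice. With \<open>R\<close> the identity of size 2 it yields the
  congruence of all non-degenerate alternating forms of the same size; blocks of size 2 are forced
  there, because an alternating form vanishes on every line. With \<open>R\<close> generating
  \<open>K\<close> over a finite field it yields the single orbit in (c2). The choice Y = P A B^{-1}
  + Q corrects only one of the two isotropic components: a form for which both are isotropic is
  determined by the pairing between them, so adjusting one side is enough. The bijection in (c2) is
  obtained without an explicit inverse. Symplectic classes and classes of Hermitian matrices are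
  images of one and the same set of matrices \<open>S\<close>, under two maps with equal fibres.
  That every \<open>X\<close> can be brought to the shape assumed in (a) rests on the existence of
  elementary divisors over an arbitrary field. It is proved by splitting off one primary cyclic
  summand at a time, where a complement is found as the annihilator of a cyclic space of column
  vectors.\<close>

lemma sq_mult_carrier [simp]:
  "A \<in> carrier_mat n n \<Longrightarrow> B \<in> carrier_mat n n \<Longrightarrow> A * B \<in> carrier_mat n n"
  by simp

lemma sq_add_carrier [simp]:
  "A \<in> carrier_mat n n \<Longrightarrow> B \<in> carrier_mat n n \<Longrightarrow> A + B \<in> carrier_mat n n"
  by simp

lemma sq_minus_carrier [simp]:
  "A \<in> carrier_mat n n \<Longrightarrow> B \<in> carrier_mat n n \<Longrightarrow> A - B \<in> carrier_mat n n"
  by (rule minus_carrier_mat)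

text \<open>With one dimension \<open>n\<close> for all factors, a single instantiation
  \<open>where n=n\<close> turns these laws into rewrite rules for products of square matrices; the
  rectangular laws carry inner dimensions that the rewritten term does not determine.\<close>

lemma sq_assoc:
  fixes A :: "'a::semiring_0 mat"
  shows "A \<in> carrier_mat n n \<Longrightarrow> B \<in> carrier_mat n n \<Longrightarrow> C \<in> carrier_mat n n \<Longrightarrow>
    (A * B) * C = A * (B * C)"
  by (rule assoc_mult_mat)

lemma sq_transpose_mult:
  fixes A :: "'a::comm_semiring_0 mat"
  shows "A \<in> carrier_mat n n \<Longrightarrow> B \<in> carrier_mat n n \<Longrightarrow>
    transpose_mat (A * B) = transpose_mat B * transpose_mat A"
  by (rule transpose_mult)

lemma sq_one:
  fixes A :: "'a::semiring_1 mat"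
  shows "A \<in> carrier_mat n n \<Longrightarrow> 1\<^sub>m n * A = A" "A \<in> carrier_mat n n \<Longrightarrow> A * 1\<^sub>m n = A"
  by simp_all

lemma sq_zero:
  fixes A :: "'a::semiring_0 mat"
  shows "A \<in> carrier_mat n n \<Longrightarrow> 0\<^sub>m n n * A = 0\<^sub>m n n" "A \<in> carrier_mat n n \<Longrightarrow> A * 0\<^sub>m n n = 0\<^sub>m n n"
  by simp_all

lemmas sq_simps = sq_mult_carrier sq_add_carrier sq_minus_carrier sq_assoc sq_transpose_mult sq_one sq_zero

lemma sq_distrib:
  fixes A :: "'a::semiring_0 mat"
  shows "A \<in> carrier_mat n n \<Longrightarrow> B \<in> carrier_mat n n \<Longrightarrow> C \<in> carrier_mat n n \<Longrightarrow> (A + B) * C = A * C + B * C"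
    "A \<in> carrier_mat n n \<Longrightarrow> B \<in> carrier_mat n n \<Longrightarrow> C \<in> carrier_mat n n \<Longrightarrow> A * (B + C) = A * B + A * C"
  by (auto intro: add_mult_distrib_mat mult_add_distrib_mat)

lemma GL_mult [simp]: "x \<otimes>\<^bsub>GL n\<^esub> y = x * y"
  by (simp add: GL_def units_of_mult ring_mat_simps)

lemma GL_one [simp]: "\<one>\<^bsub>GL n\<^esub> = 1\<^sub>m n"
  by (simp add: GL_def units_of_one ring_mat_simps)

lemma group_GL: "Group.group (GL n)"
proof -
  interpret R: Ring.ring "ring_mat TYPE('a) n ()" by (rule ring_mat)
  show ?thesis unfolding GL_def by (rule R.units_group)
qed

lemma GL_iff: "A \<in> carrier (GL n) \<longleftrightarrow> A \<in> carrier_mat n n \<and> (\<exists>B\<in>carrier_mat n n. A * B = 1\<^sub>m n \<and> B * A = 1\<^sub>m n)"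
  unfolding GL_def units_of_carrier Units_def ring_mat_simps by auto

lemma GL_carrier: "A \<in> carrier (GL n) \<Longrightarrow> A \<in> carrier_mat n n"
  by (simp add: GL_iff)

lemma GL_I:
  assumes "A \<in> carrier_mat n n" "B \<in> carrier_mat n n" "A * B = 1\<^sub>m n"
  shows "A \<in> carrier (GL n)"
  using assms mat_mult_left_right_inverse[OF assms] by (auto simp: GL_iff)

lemma GL_I2:
  assumes "A \<in> carrier_mat n n" "B \<in> carrier_mat n n" "B * A = 1\<^sub>m n"
  shows "A \<in> carrier (GL n)"
  using assms mat_mult_left_right_inverse[OF assms(2,1,3)] by (auto simp: GL_iff)

lemma GL_det:
  assumes "A \<in> carrier_mat n n"
  shows "A \<in> carrier (GL n) \<longleftrightarrow> det A \<noteq> 0"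
  using det_non_zero_imp_unit[OF assms, of "()"] unit_imp_det_non_zero[of A n "()"]
  by (auto simp: GL_def units_of_carrier)

lemma GL_transpose: "A \<in> carrier (GL n) \<Longrightarrow> transpose_mat A \<in> carrier (GL n)"
  using GL_det[of A n] GL_det[of "transpose_mat A" n] det_transpose[of A n] GL_carrier[of A n] by simp

lemma GL_inv_closed [simp]: "A \<in> carrier (GL n) \<Longrightarrow> inv\<^bsub>GL n\<^esub> A \<in> carrier (GL n)"
  using group.inv_closed[OF group_GL] .

lemma GL_inv_carrier [simp]: "A \<in> carrier (GL n) \<Longrightarrow> inv\<^bsub>GL n\<^esub> A \<in> carrier_mat n n"
  using GL_carrier[OF GL_inv_closed] .

lemma GL_mult_closed [simp]: "A \<in> carrier (GL n) \<Longrightarrow> B \<in> carrier (GL n) \<Longrightarrow> A * B \<in> carrier (GL n)"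
  using monoid.m_closed[OF group.is_monoid[OF group_GL], of A n B] by simp

lemma GL_one_closed [simp]: "1\<^sub>m n \<in> carrier (GL n)"
  using monoid.one_closed[OF group.is_monoid[OF group_GL], of n] by simp

lemma GL_r_inv [simp]: "A \<in> carrier (GL n) \<Longrightarrow> A * inv\<^bsub>GL n\<^esub> A = 1\<^sub>m n"
  using group.r_inv[OF group_GL, of A n] by simp

lemma GL_l_inv [simp]: "A \<in> carrier (GL n) \<Longrightarrow> inv\<^bsub>GL n\<^esub> A * A = 1\<^sub>m n"
  using group.l_inv[OF group_GL, of A n] by simp

lemma GL_inv_inv [simp]: "A \<in> carrier (GL n) \<Longrightarrow> inv\<^bsub>GL n\<^esub> (inv\<^bsub>GL n\<^esub> A) = A"
  using group.inv_inv[OF group_GL] .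

lemma GL_inv_mult: "A \<in> carrier (GL n) \<Longrightarrow> B \<in> carrier (GL n) \<Longrightarrow>
  inv\<^bsub>GL n\<^esub> (A * B) = inv\<^bsub>GL n\<^esub> B * inv\<^bsub>GL n\<^esub> A"
  using group.inv_mult_group[OF group_GL, of A n B] by simp

lemma GL_inv_unique:
  assumes "A \<in> carrier_mat n n" "B \<in> carrier_mat n n" "A * B = 1\<^sub>m n"
  shows "inv\<^bsub>GL n\<^esub> A = B"
  by (rule group.inv_equality[OF group_GL])
     (use mat_mult_left_right_inverse[OF assms] GL_I[OF assms] GL_I2[OF assms(2,1) assms(3)] in simp_all)

lemma GL_r_inv_cancel [simp]:
  assumes "A \<in> carrier (GL n)" "dim_row C = n" shows "A * (inv\<^bsub>GL n\<^esub> A * C) = C"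
proof -
  have C: "C \<in> carrier_mat n (dim_col C)" using assms by auto
  show ?thesis
    unfolding assoc_mult_mat[OF GL_carrier[OF assms(1)] GL_inv_carrier[OF assms(1)] C, symmetric]
    using assms C by simp
qed

lemma GL_l_inv_cancel [simp]:
  assumes "A \<in> carrier (GL n)" "dim_row C = n" shows "inv\<^bsub>GL n\<^esub> A * (A * C) = C"
  using GL_r_inv_cancel[OF GL_inv_closed[OF assms(1)] assms(2)] unfolding GL_inv_inv[OF assms(1)] .

lemma GL_left_cancel:
  assumes "A \<in> carrier (GL n)" "dim_row C = n" "dim_row D = n" "A * C = A * D"
  shows "C = D"
  by (metis GL_l_inv_cancel assms)

lemma GL_right_cancel:
  assumes "A \<in> carrier (GL n)" "C \<in> carrier_mat k n" "D \<in> carrier_mat k n" "C * A = D * A"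
  shows "C = D"
proof -
  have "(C * A) * inv\<^bsub>GL n\<^esub> A = (D * A) * inv\<^bsub>GL n\<^esub> A" using assms(4) by (rule arg_cong)
  thus ?thesis unfolding assoc_mult_mat[OF assms(2) GL_carrier[OF assms(1)] GL_inv_carrier[OF assms(1)]]
     assoc_mult_mat[OF assms(3) GL_carrier[OF assms(1)] GL_inv_carrier[OF assms(1)]] GL_r_inv[OF assms(1)]
     right_mult_one_mat[OF assms(2)] right_mult_one_mat[OF assms(3)] .
qed

lemma GL_inv_transpose: "A \<in> carrier (GL n) \<Longrightarrow> inv\<^bsub>GL n\<^esub> (transpose_mat A) = transpose_mat (inv\<^bsub>GL n\<^esub> A)"
  using transpose_mult[OF GL_inv_carrier[of A n] GL_carrier[of A n]]
  by (intro GL_inv_unique) (auto simp: GL_carrier GL_inv_carrier)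

section \<open>Comaximal polynomials\<close>

text \<open>Polynomials over an arbitrary field are not an instance of the library's gcd classes, so
  coprimality is used in its Bezout form.\<close>

definition comaximal :: "'a::comm_semiring_1 \<Rightarrow> 'a \<Rightarrow> bool" where
  "comaximal p q \<longleftrightarrow> (\<exists>a b. a * p + b * q = 1)"

lemma comaximal_sym: "comaximal p q \<Longrightarrow> comaximal q p"
  unfolding comaximal_def by (metis add.commute)

lemma comaximal_1 [simp]: "comaximal p 1"
  unfolding comaximal_def by (intro exI[of _ 0] exI[of _ 1]) simp

lemma comaximal_mult:
  fixes p :: "'a::comm_ring_1"
  assumes "comaximal p q" "comaximal p r"
  shows "comaximal p (q * r)"
proof -
  obtain a b c d where 1: "a * p + b * q = 1" and 2: "c * p + d * r = 1"
    using assms by (auto simp: comaximal_def)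
  have "(a * p + b * q) * (c * p + d * r) = (a * c * p + a * d * r + b * c * q) * p + (b * d) * (q * r)"
    by (simp add: algebra_simps)
  thus ?thesis unfolding comaximal_def 1 2 by (metis mult_1)
qed

lemma comaximal_power: "comaximal (p :: 'a::comm_ring_1) q \<Longrightarrow> comaximal p (q ^ k)"
  by (induction k) (auto intro: comaximal_mult)

lemma comaximal_powers: "comaximal (p :: 'a::comm_ring_1) q \<Longrightarrow> comaximal (p ^ j) (q ^ k)"
  using comaximal_power[OF comaximal_sym[OF comaximal_power[OF comaximal_sym]], of p q j k] by blast

lemma comaximal_dvd_mult:
  fixes p :: "'a::comm_ring_1"
  assumes "comaximal p q" "p dvd q * r"
  shows "p dvd r"
proof -
  obtain a b where 1: "a * p + b * q = 1" using assms by (auto simp: comaximal_def)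
  have "p dvd (a * r) * p + b * (q * r)" using assms(2) by (intro dvd_add) auto
  also have "(a * r) * p + b * (q * r) = (a * p + b * q) * r" by (simp add: algebra_simps)
  finally show ?thesis unfolding 1 by simp
qed

text \<open>A non-zero element \<open>d\<close> of least degree in the ideal generated by
  \<open>g\<close> and \<open>p\<close> divides every element of that ideal, by division with
  remainder. As a divisor of \<open>g\<close> and of \<open>p\<close> it must be a unit.\<close>

lemma irreducible_comaximal:
  fixes g :: "'a::field poly"
  assumes g: "irreducible g" and ndvd: "\<not> g dvd p"
  shows "comaximal g p"
proof -
  define P where "P d \<longleftrightarrow> d \<noteq> 0 \<and> (\<exists>a b. d = a * g + b * p)" for d
  have "P g" unfolding P_def
    by (intro conjI exI[of _ 1] exI[of _ 0]) (use g in \<open>auto simp: irreducible_def\<close>)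
  then obtain d where d: "P d" and min: "\<And>d'. P d' \<Longrightarrow> degree d \<le> degree d'"
    using ex_has_least_nat[of P g degree] by blast
  then obtain a b where ab: "d = a * g + b * p" and d0: "d \<noteq> 0" by (auto simp: P_def)
  have dvd: "d dvd c" if "\<exists>x y. c = x * g + y * p" for c
  proof (rule ccontr)
    assume nd: "\<not> d dvd c"
    from that obtain x y where c: "c = x * g + y * p" by blast
    have "c mod d = c - (c div d) * d" by (simp add: minus_div_mult_eq_mod)
    also have "\<dots> = (x - (c div d) * a) * g + (y - (c div d) * b) * p"
      unfolding c ab by (simp add: algebra_simps)
    finally have "P (c mod d)" unfolding P_def using nd by (auto simp: dvd_eq_mod_eq_0)
    from min[OF this] show False using degree_mod_less'[of d c] d0 nd by (auto simp: dvd_eq_mod_eq_0)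
  qed
  have "d dvd g" by (rule dvd) (intro exI[of _ 1] exI[of _ 0], simp)
  moreover have "d dvd p" by (rule dvd) (intro exI[of _ 0] exI[of _ 1], simp)
  ultimately have "is_unit d" using g ndvd by (meson dvd_trans irreducibleD')
  then obtain e where "1 = d * e" by (rule dvdE)
  hence "(e * a) * g + (e * b) * p = 1" unfolding ab by (simp add: algebra_simps)
  thus ?thesis unfolding comaximal_def by blast
qed

lemma monic_irreducible_dvd_eq:
  fixes g :: "'a::field poly"
  assumes "monic g" "irreducible g" "monic h" "irreducible h" "g dvd h"
  shows "g = h"
proof -
  have "h dvd g" using assms irreducibleD'[of h g] by (auto simp: irreducible_def)
  thus ?thesis using poly_dvd_antisym[of g h] assms(1,3,5) by simp
qed

lemma monic_irreducible_comaximal: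
  fixes g :: "'a::field poly"
  assumes "monic g" "irreducible g" "monic h" "irreducible h" "g \<noteq> h"
  shows "comaximal g h"
  using irreducible_comaximal[OF assms(2)] monic_irreducible_dvd_eq[OF assms(1-4)] assms(5) by blast

lemma exists_monic_irreducible_factor:
  fixes p :: "'a::field poly"
  assumes "degree p > 0"
  shows "\<exists>g. monic g \<and> irreducible g \<and> g dvd p"
  using assms
proof (induction "degree p" arbitrary: p rule: less_induct)
  case less
  hence p0: "p \<noteq> 0" "\<not> is_unit p" by (auto simp: is_unit_iff_degree)
  show ?case
  proof (cases "irreducible p")
    case True
    let ?g = "Polynomial.smult (inverse (lead_coeff p)) p"
    have "irreducible ?g" using True p0 irreducible_mult_unit_left[of "[:inverse (lead_coeff p):]" p]
      by (simp add: is_unit_iff_degree)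
    thus ?thesis using p0 by (intro exI[of _ ?g]) (auto simp: smult_dvd_iff)
  next
    case False
    then obtain a b where ab: "p = a * b" "\<not> is_unit a" "\<not> is_unit b" using p0 by (auto simp: irreducible_def)
    hence nz: "a \<noteq> 0" "b \<noteq> 0" using p0 by auto
    hence "degree a > 0" "degree b > 0" using ab by (auto simp: is_unit_iff_degree)
    moreover have "degree p = degree a + degree b" using nz ab by (simp add: degree_mult_eq)
    ultimately have "\<exists>g. monic g \<and> irreducible g \<and> g dvd a" using less(1)[of a] by auto
    thus ?thesis using ab(1) by auto
  qed
qed

section \<open>Polynomials in a matrix\<close>

lemma poly_mat_carrier [simp]: "R \<in> carrier_mat n n \<Longrightarrow> poly_mat p R \<in> carrier_mat n n"
  by (auto simp: poly_mat_def)

lemma poly_mat_dim [simp]: "dim_row (poly_mat p R) = dim_row R" "dim_col (poly_mat p R) = dim_row R"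
  by (auto simp: poly_mat_def)

text \<open>The bound \<open>N\<close> may exceed the degree, so that polynomials of different
  degrees can be evaluated over a common range of summation.\<close>

lemma poly_mat_index:
  assumes "degree p \<le> N" "i < dim_row R" "j < dim_row R"
  shows "poly_mat p R $$ (i, j) = (\<Sum>k\<le>N. coeff p k * (R ^\<^sub>m k) $$ (i, j))"
proof -
  have "(\<Sum>k\<le>degree p. coeff p k * (R ^\<^sub>m k) $$ (i, j)) = (\<Sum>k\<le>N. coeff p k * (R ^\<^sub>m k) $$ (i, j))"
    using assms(1) by (intro sum.mono_neutral_left) (auto simp: coeff_eq_0)
  thus ?thesis using assms by (simp add: poly_mat_def)
qed

lemma pow_mat_Suc_left: "R \<in> carrier_mat n n \<Longrightarrow> R ^\<^sub>m (Suc k) = R * R ^\<^sub>m k"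
proof (induction k)
  case (Suc k)
  thus ?case using assoc_mult_mat[of R n n "R ^\<^sub>m k" n R n] by simp
qed simp

lemma poly_mat_0 [simp]: "poly_mat 0 R = 0\<^sub>m (dim_row R) (dim_row R)"
  by (rule eq_matI) (auto simp: poly_mat_def)

lemma poly_mat_pCons:
  assumes R: "R \<in> carrier_mat n n"
  shows "poly_mat (pCons a p) R = a \<cdot>\<^sub>m 1\<^sub>m n + R * poly_mat p R"
proof (rule eq_matI)
  fix i j assume "i < dim_row (a \<cdot>\<^sub>m 1\<^sub>m n + R * poly_mat p R)" "j < dim_col (a \<cdot>\<^sub>m 1\<^sub>m n + R * poly_mat p R)"
  hence ij: "i < n" "j < n" using R by auto
  have rp: "(R * B) $$ (i,j) = (\<Sum>l<n. R $$ (i,l) * B $$ (l,j))" if "B \<in> carrier_mat n n" for B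
    using ij R that by (auto simp: scalar_prod_def atLeast0LessThan intro!: sum.cong)
  have "poly_mat (pCons a p) R $$ (i,j) = (\<Sum>k\<le>Suc (degree p). coeff (pCons a p) k * (R ^\<^sub>m k) $$ (i, j))"
    using ij R by (intro poly_mat_index) (auto simp: degree_pCons_le)
  also have "\<dots> = a * (1\<^sub>m n) $$ (i,j) + (\<Sum>k\<le>degree p. coeff p k * (R * (R ^\<^sub>m k)) $$ (i, j))"
    unfolding sum.atMost_Suc_shift using R by (simp add: pow_mat_Suc_left[OF R, symmetric])
  also have "(\<Sum>k\<le>degree p. coeff p k * (R * (R ^\<^sub>m k)) $$ (i, j)) =
     (\<Sum>l<n. R $$ (i,l) * (\<Sum>k\<le>degree p. coeff p k * (R ^\<^sub>m k) $$ (l, j)))"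
    unfolding rp[OF pow_carrier_mat[OF R]] sum_distrib_left
    by (subst sum.swap) (auto intro!: sum.cong simp: ac_simps)
  also have "\<dots> = (R * poly_mat p R) $$ (i,j)"
    unfolding rp[OF poly_mat_carrier[OF R]] using R ij by (intro sum.cong) (auto simp: poly_mat_def)
  finally show "poly_mat (pCons a p) R $$ (i,j) = (a \<cdot>\<^sub>m 1\<^sub>m n + R * poly_mat p R) $$ (i,j)"
    using ij R by simp
qed (use R in auto)

lemma poly_mat_const: "R \<in> carrier_mat n n \<Longrightarrow> poly_mat [:a:] R = a \<cdot>\<^sub>m 1\<^sub>m n"
  using poly_mat_pCons[of R n a 0] by simp

lemma poly_mat_1 [simp]: "R \<in> carrier_mat n n \<Longrightarrow> poly_mat 1 R = 1\<^sub>m n"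
  using poly_mat_const[of R n 1] by (auto simp: one_pCons intro!: eq_matI)

lemma poly_mat_X: "R \<in> carrier_mat n n \<Longrightarrow> poly_mat [:0, 1:] R = R"
  using poly_mat_pCons[of R n 0 1] poly_mat_1[of R n] by (auto simp: one_pCons intro!: eq_matI)

lemma poly_mat_add:
  assumes R: "R \<in> carrier_mat n n"
  shows "poly_mat (p + q) R = poly_mat p R + poly_mat q R"
proof (rule eq_matI)
  fix i j assume "i < dim_row (poly_mat p R + poly_mat q R)" "j < dim_col (poly_mat p R + poly_mat q R)"
  hence ij: "i < dim_row R" "j < dim_row R" using R by auto
  let ?N = "max (degree p) (degree q)"
  show "poly_mat (p + q) R $$ (i,j) = (poly_mat p R + poly_mat q R) $$ (i,j)"
    using poly_mat_index[of "p+q" ?N i R j] poly_mat_index[of p ?N i R j] poly_mat_index[of q ?N i R j] ij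
    by (simp add: degree_add_le_max sum.distrib algebra_simps)
qed (use R in auto)

lemma poly_mat_smult:
  assumes R: "R \<in> carrier_mat n n"
  shows "poly_mat (Polynomial.smult c p) R = c \<cdot>\<^sub>m poly_mat p R"
proof (rule eq_matI)
  fix i j assume "i < dim_row (c \<cdot>\<^sub>m poly_mat p R)" "j < dim_col (c \<cdot>\<^sub>m poly_mat p R)"
  hence ij: "i < dim_row R" "j < dim_row R" using R by auto
  show "poly_mat (Polynomial.smult c p) R $$ (i,j) = (c \<cdot>\<^sub>m poly_mat p R) $$ (i,j)"
    using poly_mat_index[of "Polynomial.smult c p" "degree p" i R j] poly_mat_index[of p "degree p" i R j] ij
    by (simp add: degree_smult_le sum_distrib_left algebra_simps)
qed (use R in auto)

lemma poly_mat_minus: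
  assumes R: "R \<in> carrier_mat n n"
  shows "poly_mat (p - q) R = poly_mat p R - poly_mat q R"
proof -
  have "poly_mat (p - q) R = poly_mat p R + poly_mat (Polynomial.smult (-1) q) R"
    by (simp add: poly_mat_add[OF R, symmetric])
  also have "\<dots> = poly_mat p R - poly_mat q R" unfolding poly_mat_smult[OF R]
    using R by (intro eq_matI) auto
  finally show ?thesis .
qed

lemma poly_mat_mult:
  assumes R: "R \<in> carrier_mat n n"
  shows "poly_mat (p * q) R = poly_mat p R * poly_mat q R"
proof (induction p)
  case 0
  thus ?case using R by simp
next
  case (pCons a p)
  note [simp] = sq_simps[where n=n]
  have Z: "0 \<cdot>\<^sub>m 1\<^sub>m n + R * poly_mat (p * q) R = R * poly_mat (p * q) R"
    using R by (intro eq_matI) auto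
  have "poly_mat (pCons a p * q) R = a \<cdot>\<^sub>m poly_mat q R + R * poly_mat (p * q) R"
    using R Z by (simp add: poly_mat_add[OF R] poly_mat_smult[OF R] poly_mat_pCons[OF R])
  also have "\<dots> = poly_mat (pCons a p) R * poly_mat q R"
    unfolding pCons.IH poly_mat_pCons[OF R]
    using R by (subst sq_distrib[where n=n]) (auto simp: mult_smult_assoc_mat[of _ n n _ n])
  finally show ?case .
qed

text \<open>Induction along the Horner scheme. The two matrices may differ in size: the case
  \<open>S = R = Z\<close> gives commutation, off-diagonal blocks give Sylvester equations, and with
  \<open>S\<close> the transposed inverse of \<open>R\<close> a polynomial is moved through a Gram
  matrix.\<close>

lemma poly_mat_intertwine:
  assumes R: "R \<in> carrier_mat n n" and S: "S \<in> carrier_mat k k" and Z: "Z \<in> carrier_mat n k"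
    and RZ: "R * Z = Z * S"
  shows "poly_mat p R * Z = Z * poly_mat p S"
proof (induction p)
  case (pCons a p)
  have "poly_mat (pCons a p) R * Z = a \<cdot>\<^sub>m Z + R * (poly_mat p R * Z)"
    unfolding poly_mat_pCons[OF R] using R Z
    by (subst add_mult_distrib_mat[of _ n n _ _ k])
       (auto simp: mult_smult_assoc_mat[of _ n n _ k] assoc_mult_mat[of _ n n _ n _ k])
  also have "R * (poly_mat p R * Z) = Z * (S * poly_mat p S)"
    unfolding pCons.IH using R S Z RZ assoc_mult_mat[of R n n Z k "poly_mat p S" k]
      assoc_mult_mat[of Z n k S k "poly_mat p S" k] by simp
  also have "a \<cdot>\<^sub>m Z + Z * (S * poly_mat p S) = Z * poly_mat (pCons a p) S"
    unfolding poly_mat_pCons[OF S] using S Z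
    by (subst mult_add_distrib_mat[of _ n k _ k])
       (auto simp: mult_smult_distrib[of _ n k _ k])
  finally show ?case .
qed (use R S Z in auto)

lemma poly_mat_self_commute:
  "R \<in> carrier_mat n n \<Longrightarrow> poly_mat p R * poly_mat q R = poly_mat q R * poly_mat p R"
  by (simp add: poly_mat_mult[symmetric] mult.commute)

lemma poly_mat_transpose:
  assumes R: "R \<in> carrier_mat n n"
  shows "transpose_mat (poly_mat p R) = poly_mat p (transpose_mat R)"
proof (induction p)
  case (pCons a p)
  have R': "transpose_mat R \<in> carrier_mat n n" using R by simp
  have X: "transpose_mat (R * poly_mat p R) = transpose_mat R * poly_mat p (transpose_mat R)"
    using R pCons.IH poly_mat_intertwine[OF R' R', of "transpose_mat R"] by (simp add: sq_transpose_mult[where n=n])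
  have "transpose_mat (poly_mat (pCons a p) R) = a \<cdot>\<^sub>m 1\<^sub>m n + transpose_mat (R * poly_mat p R)"
    unfolding poly_mat_pCons[OF R] using R by (intro eq_matI) auto
  also have "\<dots> = poly_mat (pCons a p) (transpose_mat R)"
    unfolding X poly_mat_pCons[OF R'] ..
  finally show ?case .
qed (use R in auto)

lemma poly_mat_four_block:
  assumes A: "A \<in> carrier_mat n n" and B: "B \<in> carrier_mat k k"
  shows "poly_mat p (four_block_mat A (0\<^sub>m n k) (0\<^sub>m k n) B) =
    four_block_mat (poly_mat p A) (0\<^sub>m n k) (0\<^sub>m k n) (poly_mat p B)"
proof (induction p)
  case 0
  thus ?case using A B by simp
next
  case (pCons a p)
  have AB: "four_block_mat A (0\<^sub>m n k) (0\<^sub>m k n) B \<in> carrier_mat (n+k) (n+k)" using A B by simp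
  show ?case unfolding poly_mat_pCons[OF AB] pCons.IH poly_mat_pCons[OF A] poly_mat_pCons[OF B]
    using A B by (subst mult_four_block_mat[of _ n n _ k _ k _ _ n _ k]) (auto intro!: eq_matI)
qed

lemma poly_mat_similar_wit:
  assumes "X \<in> carrier_mat n n" "Y \<in> carrier_mat n n" "P \<in> carrier (GL n)" "X * P = P * Y"
  shows "poly_mat p X = 0\<^sub>m n n \<longleftrightarrow> poly_mat p Y = 0\<^sub>m n n"
proof -
  have P: "P \<in> carrier_mat n n" using assms GL_carrier by auto
  have *: "poly_mat p X * P = P * poly_mat p Y"
    using poly_mat_intertwine[OF assms(1,2) P assms(4)] .
  show ?thesis
  proof
    assume "poly_mat p X = 0\<^sub>m n n"
    hence "P * poly_mat p Y = P * 0\<^sub>m n n" unfolding *[symmetric] using P by simp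
    thus "poly_mat p Y = 0\<^sub>m n n" using GL_left_cancel[OF assms(3), of "poly_mat p Y" "0\<^sub>m n n"] assms(2) by simp
  next
    assume "poly_mat p Y = 0\<^sub>m n n"
    hence "poly_mat p X * P = 0\<^sub>m n n * P" unfolding * using P by simp
    thus "poly_mat p X = 0\<^sub>m n n" using GL_right_cancel[OF assms(3), of "poly_mat p X" n "0\<^sub>m n n"] assms(1) by simp
  qed
qed

text \<open>Evaluating a Bezout identity a p + b q = 1 at \<open>R\<close>, where q(R) = 0, exhibits
  a(R) as an inverse of p(R).\<close>

lemma poly_mat_comaximal_GL:
  assumes R: "R \<in> carrier_mat n n" and cop: "comaximal p q" and q: "poly_mat q R = 0\<^sub>m n n"
  shows "poly_mat p R \<in> carrier (GL n)"
proof -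
  obtain a b where "a * p + b * q = 1"
    using cop by (auto simp: comaximal_def)
  hence "poly_mat a R * poly_mat p R + poly_mat b R * poly_mat q R = 1\<^sub>m n"
    using R poly_mat_1[OF R] by (simp add: poly_mat_mult[OF R, symmetric] poly_mat_add[OF R, symmetric])
  hence "poly_mat a R * poly_mat p R = 1\<^sub>m n"
    using q R right_add_zero_mat[of "poly_mat a R * poly_mat p R" n n] by simp
  thus ?thesis using R by (intro GL_I2[of _ n "poly_mat a R"]) auto
qed

text \<open>Cayley--Hamilton, entrywise: evaluating \<open>adj(tI - R) (tI - R) = det(tI - R) I\<close> at \<open>t = R\<close>
  kills the row vectors \<open>\<Sum>j (tI - R)_kj(R)_jl = R_kl - R_kl\<close>.\<close>

lemma poly_mat_sum:
  assumes R: "R \<in> carrier_mat n n" and ij: "i < n" "j < n" and "finite I"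
  shows "poly_mat (sum f I) R $$ (i,j) = (\<Sum>k\<in>I. poly_mat (f k) R $$ (i,j))"
  using assms(4) by (induction I) (use R ij in \<open>auto simp: poly_mat_add[OF R]\<close>)

theorem poly_mat_char_poly:
  fixes R :: "'a::field mat"
  assumes R: "R \<in> carrier_mat n n"
  shows "poly_mat (char_poly R) R = 0\<^sub>m n n"
proof (rule eq_matI)
  fix i c assume "i < dim_row (0\<^sub>m n n)" "c < dim_col (0\<^sub>m n n)"
  hence ic: "i < n" "c < n" by auto
  define M where "M = char_poly_matrix R"
  define B where "B = adj_mat M"
  have M: "M \<in> carrier_mat n n" using R by (simp add: M_def)
  have B: "B \<in> carrier_mat n n" "B * M = char_poly R \<cdot>\<^sub>m 1\<^sub>m n" using adj_mat[OF M] by (auto simp: B_def char_poly_def M_def)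
  have Mkj: "M $$ (k,j) = (if k = j then [:- R $$ (k,j), 1:] else [:- R $$ (k,j):])" if "k < n" "j < n" for k j
    using R that by (auto simp: M_def char_poly_matrix_def)
  have row: "(\<Sum>j<n. poly_mat (M $$ (k,j)) R $$ (j,l)) = 0" if kl: "k < n" "l < n" for k l
  proof -
    have "poly_mat (M $$ (k,j)) R $$ (j,l) = (if j = k then R $$ (k,l) else 0) - (if j = l then R $$ (k,l) else 0)" if "j < n" for j
      using that kl R by (simp add: Mkj poly_mat_pCons[OF R] poly_mat_const[OF R])
    hence "(\<Sum>j<n. poly_mat (M $$ (k,j)) R $$ (j,l)) = (\<Sum>j<n. (if j = k then R $$ (k,l) else 0) - (if j = l then R $$ (k,l) else 0))"
      by (intro sum.cong) auto
    also have "\<dots> = 0" using kl by (simp add: sum_subtractf)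
    finally show ?thesis .
  qed
  have "poly_mat (char_poly R) R $$ (i,c) = (\<Sum>j<n. poly_mat ((B * M) $$ (i,j)) R $$ (j,c))"
  proof -
    have "poly_mat ((B * M) $$ (i,j)) R $$ (j,c) = (if j = i then poly_mat (char_poly R) R $$ (j,c) else 0)" if "j < n" for j
      using that ic R unfolding B(2) by simp
    hence "(\<Sum>j<n. poly_mat ((B * M) $$ (i,j)) R $$ (j,c)) = (\<Sum>j<n. if j = i then poly_mat (char_poly R) R $$ (j,c) else 0)"
      by (intro sum.cong) auto
    thus ?thesis using ic by simp
  qed
  also have "\<dots> = (\<Sum>j<n. \<Sum>k<n. poly_mat (B $$ (i,k) * M $$ (k,j)) R $$ (j,c))"
  proof (rule sum.cong[OF refl])
    fix j assume "j \<in> {..<n}"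
    hence "(B * M) $$ (i,j) = (\<Sum>k<n. B $$ (i,k) * M $$ (k,j))"
      using B(1) M ic by (auto simp: scalar_prod_def atLeast0LessThan intro!: sum.cong)
    thus "poly_mat ((B * M) $$ (i,j)) R $$ (j,c) = (\<Sum>k<n. poly_mat (B $$ (i,k) * M $$ (k,j)) R $$ (j,c))"
      using poly_mat_sum[OF R, of j c "{..<n}"] \<open>j \<in> _\<close> ic by simp
  qed
  \<comment> \<open>Polynomials in \<open>R\<close> commute, so the value of the entry of tI - R can
    be written on the left. There the summation over \<open>j\<close> meets only that factor and is
    zero by \<open>row\<close>.\<close>
  also have "\<dots> = (\<Sum>j<n. \<Sum>k<n. \<Sum>l<n. poly_mat (M $$ (k,j)) R $$ (j,l) * poly_mat (B $$ (i,k)) R $$ (l,c))"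
  proof (intro sum.cong refl)
    fix j k assume jk: "j \<in> {..<n}" "k \<in> {..<n}"
    have "poly_mat (B $$ (i,k) * M $$ (k,j)) R = poly_mat (M $$ (k,j)) R * poly_mat (B $$ (i,k)) R"
      by (simp add: poly_mat_mult[OF R, symmetric] mult.commute)
    thus "poly_mat (B $$ (i,k) * M $$ (k,j)) R $$ (j,c) = (\<Sum>l<n. poly_mat (M $$ (k,j)) R $$ (j,l) * poly_mat (B $$ (i,k)) R $$ (l,c))"
      using jk ic R by (auto simp: scalar_prod_def atLeast0LessThan intro!: sum.cong)
  qed
  also have "\<dots> = (\<Sum>k<n. \<Sum>l<n. (\<Sum>j<n. poly_mat (M $$ (k,j)) R $$ (j,l)) * poly_mat (B $$ (i,k)) R $$ (l,c))"
    unfolding sum_distrib_right by (subst sum.swap, rule sum.cong[OF refl], rule sum.swap)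
  also have "\<dots> = 0" by (simp add: row)
  finally show "poly_mat (char_poly R) R $$ (i,c) = 0\<^sub>m n n $$ (i,c)" using ic by simp
qed (use R in auto)

section \<open>Block decompositions\<close>

lemma four_block_ex:
  assumes A: "A \<in> carrier_mat (a + b) (c + d)"
  shows "\<exists>P Q R S. P \<in> carrier_mat a c \<and> Q \<in> carrier_mat a d \<and> R \<in> carrier_mat b c \<and> S \<in> carrier_mat b d
    \<and> A = four_block_mat P Q R S"
proof -
  obtain P Q R S where s: "split_block A a c = (P, Q, R, S)" by (cases "split_block A a c")
  have d: "dim_row A = a + b" "dim_col A = c + d" using A by auto
  show ?thesis
    by (intro exI[of _ P] exI[of _ Q] exI[of _ R] exI[of _ S] conjI) (rule split_block[OF s d])+
qed

lemma mult_index: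
  assumes "A \<in> carrier_mat a b" "B \<in> carrier_mat b c" "i < a" "j < c"
  shows "(A * B) $$ (i,j) = (\<Sum>l<b. A $$ (i,l) * B $$ (l,j))"
  using assms by (auto simp: scalar_prod_def atLeast0LessThan intro!: sum.cong)

lemma four_block_eq_iff:
  assumes "P \<in> carrier_mat a c" "Q \<in> carrier_mat a d" "R \<in> carrier_mat b c" "S \<in> carrier_mat b d"
    and "P' \<in> carrier_mat a c" "Q' \<in> carrier_mat a d" "R' \<in> carrier_mat b c" "S' \<in> carrier_mat b d"
  shows "four_block_mat P Q R S = four_block_mat P' Q' R' S' \<longleftrightarrow> P = P' \<and> Q = Q' \<and> R = R' \<and> S = S'"
proof
  assume eq: "four_block_mat P Q R S = four_block_mat P' Q' R' S'"
  have *: "four_block_mat P Q R S $$ (i,j) = four_block_mat P' Q' R' S' $$ (i,j)" for i j using eq by simp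
  have "P = P'" using *[of i j for i j] assms by (intro eq_matI) (auto split: if_splits, metis (no_types, lifting) * add_leD1 carrier_matD index_mat_four_block(1) trans_less_add1)
  moreover have "Q = Q'"
  proof (rule eq_matI)
    fix i j assume "i < dim_row Q'" "j < dim_col Q'"
    thus "Q $$ (i,j) = Q' $$ (i,j)" using *[of i "c + j"] assms by auto
  qed (use assms in auto)
  moreover have "R = R'"
  proof (rule eq_matI)
    fix i j assume "i < dim_row R'" "j < dim_col R'"
    thus "R $$ (i,j) = R' $$ (i,j)" using *[of "a + i" j] assms by auto
  qed (use assms in auto)
  moreover have "S = S'"
  proof (rule eq_matI)
    fix i j assume "i < dim_row S'" "j < dim_col S'"
    thus "S $$ (i,j) = S' $$ (i,j)" using *[of "a + i" "c + j"] assms by auto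
  qed (use assms in auto)
  ultimately show "P = P' \<and> Q = Q' \<and> R = R' \<and> S = S'" by blast
qed auto

lemma similar_mat_GL_I:
  assumes "X \<in> carrier_mat n n" "Y \<in> carrier_mat n n" "P \<in> carrier (GL n)" "X * P = P * Y"
  shows "similar_mat X Y"
proof (rule similar_matI)
  have P: "P \<in> carrier_mat n n" using assms GL_carrier by auto
  show "{X, Y, P, inv\<^bsub>GL n\<^esub> P} \<subseteq> carrier_mat n n" using assms P by auto
  show "X = P * Y * inv\<^bsub>GL n\<^esub> P" unfolding assms(4)[symmetric]
    using assms(1-3) P by (simp add: assoc_mult_mat[of _ n n _ n _ n])
qed (use assms in auto)

lemma similar_mat_GL_E:
  assumes "similar_mat X Y" "X \<in> carrier_mat n n"
  obtains P where "P \<in> carrier (GL n)" "X * P = P * Y" "Y \<in> carrier_mat n n"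
proof -
  obtain P Q where w: "similar_mat_wit X Y P Q" using assms by (auto simp: similar_mat_def)
  note d = similar_mat_witD2[OF assms(2) w]
  have "X * P = P * Y" unfolding d(3) using d by (simp add: assoc_mult_mat[of _ n n _ n _ n])
  thus ?thesis using that[of P] GL_I[of P n Q] d by auto
qed

section \<open>Row vectors, full row rank and invariant complements\<close>

lemma GL_left_kernel:
  assumes A: "A \<in> carrier_mat n n" and ker: "\<And>a. a \<in> carrier_mat 1 n \<Longrightarrow> a * A = 0\<^sub>m 1 n \<Longrightarrow> a = 0\<^sub>m 1 n"
  shows "A \<in> carrier (GL n)"
proof (rule ccontr)
  assume "\<not> ?thesis"
  hence "det (transpose_mat A) = 0" using GL_det[OF A] det_transpose[OF A] by simp
  then obtain v where v: "v \<in> carrier_vec n" "v \<noteq> 0\<^sub>v n" "transpose_mat A *\<^sub>v v = 0\<^sub>v n"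
    using det_0_iff_vec_prod_zero_field[of "transpose_mat A" n] A by auto
  define a where "a = mat 1 n (\<lambda>(i,j). v $ j)"
  have r: "row a 0 = v" using v by (intro eq_vecI) (auto simp: a_def)
  have "a * A = 0\<^sub>m 1 n"
  proof (rule eq_matI)
    fix i j assume "i < dim_row (0\<^sub>m 1 n)" "j < dim_col (0\<^sub>m 1 n)"
    hence ij: "i = 0" "j < n" by auto
    have "(a * A) $$ (0,j) = v \<bullet> col A j" using ij A r by (simp add: a_def)
    also have "\<dots> = col A j \<bullet> v" using A v(1) by (intro comm_scalar_prod[of v n]) auto
    also have "\<dots> = (transpose_mat A *\<^sub>v v) $ j" using ij A by simp
    finally show "(a * A) $$ (i,j) = 0\<^sub>m 1 n $$ (i,j)" using v ij by simp
  qed (use A in \<open>auto simp: a_def\<close>)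
  moreover have "a \<in> carrier_mat 1 n" by (simp add: a_def)
  ultimately have a0: "a = 0\<^sub>m 1 n" using ker by blast
  have "v $ j = 0" if "j < n" for j
  proof -
    have "a $$ (0,j) = v $ j" using that by (simp add: a_def)
    thus ?thesis unfolding a0 using that by simp
  qed
  thus False using v by auto
qed

text \<open>\<open>v\<close> is completed to a basis by unit vectors; the inverse of the matrix
  \<open>P\<close> of this basis sends \<open>v\<close> to the first unit vector.\<close>

lemma row_to_unit:
  fixes v :: "'a::field mat"
  assumes v: "v \<in> carrier_mat 1 n" "v \<noteq> 0\<^sub>m 1 n"
  shows "\<exists>Q\<in>carrier (GL n). v * Q = mat 1 n (\<lambda>(i,j). if j = 0 then 1 else 0)"
proof -
  obtain j where j: "j < n" "v $$ (0,j) \<noteq> 0"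
  proof (rule ccontr)
    assume "\<not> thesis"
    hence "v = 0\<^sub>m 1 n" using v that by (intro eq_matI) auto
    thus False using v by simp
  qed
  \<comment> \<open>Row 0 is \<open>v\<close>. Since the entry of \<open>v\<close> in column
    \<open>j\<close> is non-zero, the unit vector of index \<open>j\<close> is dropped; if
    \<open>j\<close> is not 0, its row receives the unit vector of index 0, which \<open>v\<close>
    has displaced.\<close>
  define P where "P = mat n n (\<lambda>(i,l). if i = 0 then v $$ (0,l) else if i = j then (if l = 0 then 1 else 0) else if i = l then 1 else 0)"
  have P: "P \<in> carrier_mat n n" by (simp add: P_def)
  have "det P \<noteq> 0"
  proof
    assume "det P = 0"
    then obtain x where x: "x \<in> carrier_vec n" "x \<noteq> 0\<^sub>v n" "P *\<^sub>v x = 0\<^sub>v n"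
      using det_0_iff_vec_prod_zero_field[OF P] by auto
    have e: "(\<Sum>l<n. P $$ (i,l) * x $ l) = 0" if "i < n" for i
    proof -
      have "(P *\<^sub>v x) $ i = (\<Sum>l<n. P $$ (i,l) * x $ l)" using that P x(1) by (auto simp: scalar_prod_def atLeast0LessThan intro!: sum.cong)
      thus ?thesis using x that by simp
    qed
    have x1: "x $ i = 0" if i: "i < n" "i \<noteq> j" for i
    proof (cases "i = 0")
      case False
      have "(\<Sum>l<n. P $$ (i,l) * x $ l) = (\<Sum>l<n. if l = i then x $ i else 0)"
        using i False by (intro sum.cong) (auto simp: P_def)
      thus ?thesis using e[OF i(1)] i by simp
    next
      case True
      hence j0: "j \<noteq> 0" using i by auto
      have "(\<Sum>l<n. P $$ (j,l) * x $ l) = (\<Sum>l<n. if l = 0 then x $ 0 else 0)"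
        using j j0 by (intro sum.cong) (auto simp: P_def)
      thus ?thesis using e[OF j(1)] i True by simp
    qed
    have "(\<Sum>l<n. P $$ (0,l) * x $ l) = (\<Sum>l<n. if l = j then v $$ (0,j) * x $ j else 0)"
      using x1 j by (intro sum.cong) (auto simp: P_def)
    hence "x $ j = 0" using e[of 0] j by simp
    hence "x $ i = 0" if "i < n" for i using x1 that by (cases "i = j") auto
    hence "x = 0\<^sub>v n" using x(1) by (intro eq_vecI) auto
    thus False using x by simp
  qed
  hence PG: "P \<in> carrier (GL n)" using GL_det[OF P] by simp
  define u where "u = mat 1 n (\<lambda>(i,j). if j = 0 then 1 else (0::'a))"
  have u: "u \<in> carrier_mat 1 n" by (simp add: u_def)
  have "u * P = v"
  proof (rule eq_matI)
    fix i l assume "i < dim_row v" "l < dim_col v"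
    hence il: "i = 0" "l < n" using v by auto
    have "(u * P) $$ (0,l) = (\<Sum>k<n. u $$ (0,k) * P $$ (k,l))"
      using il P u by (auto simp: scalar_prod_def atLeast0LessThan intro!: sum.cong)
    also have "\<dots> = (\<Sum>k<n. if k = 0 then P $$ (0,l) else 0)" by (intro sum.cong) (auto simp: u_def)
    also have "\<dots> = v $$ (0,l)" using il by (simp add: P_def)
    finally show "(u * P) $$ (i,l) = v $$ (i,l)" using il by simp
  qed (use u P v in auto)
  hence "v * inv\<^bsub>GL n\<^esub> P = u * (P * inv\<^bsub>GL n\<^esub> P)"
    using assoc_mult_mat[OF u P GL_inv_carrier[OF PG]] by simp
  thus ?thesis using PG u by (intro bexI[of _ "inv\<^bsub>GL n\<^esub> P"]) (auto simp: u_def)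
qed

lemma GL_four_block_diag:
  assumes "A \<in> carrier (GL a)" "B \<in> carrier (GL b)"
  shows "four_block_mat A (0\<^sub>m a b) (0\<^sub>m b a) B \<in> carrier (GL (a + b))"
proof (rule GL_I)
  note c = GL_carrier[OF assms(1)] GL_carrier[OF assms(2)]
  let ?A = "inv\<^bsub>GL a\<^esub> A" and ?B = "inv\<^bsub>GL b\<^esub> B"
  show "four_block_mat A (0\<^sub>m a b) (0\<^sub>m b a) B * four_block_mat ?A (0\<^sub>m a b) (0\<^sub>m b a) ?B = 1\<^sub>m (a + b)"
    unfolding four_block_one_mat[symmetric] using c assms
    by (subst mult_four_block_mat[of _ a a _ b _ b _ _ a _ b])
       (auto simp: left_mult_zero_mat[of _ a a] left_mult_zero_mat[of _ b b] simp del: four_block_one_mat)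
qed (use assms in \<open>auto simp: GL_carrier\<close>)

lemma GL_four_block_lower:
  fixes U :: "'a::field mat"
  assumes U: "U \<in> carrier_mat b a"
  shows "four_block_mat (1\<^sub>m a) (0\<^sub>m a b) U (1\<^sub>m b) \<in> carrier (GL (a + b))"
proof (rule GL_I)
  have "1\<^sub>m a + - 0\<^sub>m a a = (1\<^sub>m a :: 'a mat)" "U + - U = 0\<^sub>m b a" using U by (auto intro!: eq_matI)
  thus "four_block_mat (1\<^sub>m a) (0\<^sub>m a b) U (1\<^sub>m b) * four_block_mat (1\<^sub>m a) (0\<^sub>m a b) (- U) (1\<^sub>m b) = 1\<^sub>m (a + b)"
    unfolding four_block_one_mat[symmetric] using U
    by (subst mult_four_block_mat[of _ a a _ b _ b _ _ a _ b]) (auto simp del: four_block_one_mat)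
qed (use U in auto)

text \<open>The right inverse \<open>W\<close> encodes that the rows are independent, in a form that
  survives the induction: once the first row of \<open>V\<close> is a unit vector, the upper right
  block of Q1^{-1} W vanishes and the lower right block is a right inverse of what remains of
  \<open>V\<close>.\<close>

lemma full_row_rank_normal_form:
  fixes V :: "'a::field mat"
  assumes "V \<in> carrier_mat k n" "W \<in> carrier_mat n k" "V * W = 1\<^sub>m k"
  shows "k \<le> n \<and> (\<exists>Q\<in>carrier (GL n). V * Q = mat k n (\<lambda>(i,j). if i = j then 1 else 0))"
  using assms
proof (induction k arbitrary: n V W)
  case 0
  thus ?case by (intro conjI bexI[of _ "1\<^sub>m n"]) auto
next
  case (Suc k)
  note V = Suc.prems(1) and W = Suc.prems(2)
  define v where "v = mat 1 n (\<lambda>(i,j). V $$ (0,j))"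
  have v: "v \<in> carrier_mat 1 n" by (simp add: v_def)
  have rv: "row v 0 = row V 0" using V by (intro eq_vecI) (auto simp: v_def)
  have "v \<noteq> 0\<^sub>m 1 n"
  proof
    assume "v = 0\<^sub>m 1 n"
    hence "row V 0 = 0\<^sub>v n" using rv by simp
    hence "(V * W) $$ (0,0) = 0" using V W carrier_vecI[of "col W 0" n] by simp
    thus False using Suc.prems(3) by simp
  qed
  then obtain Q1 where Q1: "Q1 \<in> carrier (GL n)" "v * Q1 = mat 1 n (\<lambda>(i,j). if j = 0 then 1 else 0)"
    using row_to_unit[OF v] by blast
  have n0: "n \<noteq> 0" using \<open>v \<noteq> 0\<^sub>m 1 n\<close> v by (intro notI) (auto intro: eq_matI)
  then obtain n' where n': "n = Suc n'" by (cases n) auto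
  have Q1c: "Q1 \<in> carrier_mat n n" using GL_carrier Q1 by auto
  have V1c: "V * Q1 \<in> carrier_mat (1 + k) (1 + n')" using V Q1c n' by auto
  have W1c: "inv\<^bsub>GL n\<^esub> Q1 * W \<in> carrier_mat (1 + n') (1 + k)" using W Q1 n' by (auto intro: mult_carrier_mat[OF GL_inv_carrier])
  obtain p q c V' where V1: "p \<in> carrier_mat 1 1" "q \<in> carrier_mat 1 n'" "c \<in> carrier_mat k 1" "V' \<in> carrier_mat k n'"
    "V * Q1 = four_block_mat p q c V'" using four_block_ex[OF V1c] by blast
  obtain w0 w1 w2 W' where W1: "w0 \<in> carrier_mat 1 1" "w1 \<in> carrier_mat 1 k" "w2 \<in> carrier_mat n' 1" "W' \<in> carrier_mat n' k"
    "inv\<^bsub>GL n\<^esub> Q1 * W = four_block_mat w0 w1 w2 W'" using four_block_ex[OF W1c] by blast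
  have r0: "(V * Q1) $$ (0,j) = (if j = 0 then 1 else 0)" if "j < n" for j
  proof -
    have "(V * Q1) $$ (0,j) = (v * Q1) $$ (0,j)" using that V Q1c v rv by simp
    thus ?thesis unfolding Q1(2) using that by simp
  qed
  have p: "p = 1\<^sub>m 1" using r0[of 0] V1 n' by (intro eq_matI) auto
  have q: "q = 0\<^sub>m 1 n'"
  proof (rule eq_matI)
    fix i j assume "i < dim_row (0\<^sub>m 1 n')" "j < dim_col (0\<^sub>m 1 n')"
    thus "q $$ (i,j) = 0\<^sub>m 1 n' $$ (i,j)" using r0[of "Suc j"] V1 n' by auto
  qed (use V1 in auto)
  have "V * Q1 * (inv\<^bsub>GL n\<^esub> Q1 * W) = V * (Q1 * (inv\<^bsub>GL n\<^esub> Q1 * W))"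
    using V Q1c W1c n' by (intro assoc_mult_mat[of _ "Suc k" n _ n _ "Suc k"]) auto
  also have "\<dots> = four_block_mat (1\<^sub>m 1) (0\<^sub>m 1 k) (0\<^sub>m k 1) (1\<^sub>m k)" using Q1 W Suc.prems(3) by simp
  finally have eq: "four_block_mat (p * w0 + q * w2) (p * w1 + q * W') (c * w0 + V' * w2) (c * w1 + V' * W') =
     four_block_mat (1\<^sub>m 1) (0\<^sub>m 1 k) (0\<^sub>m k 1) (1\<^sub>m k)"
    unfolding V1(5) W1(5) using mult_four_block_mat[OF V1(1-4) W1(1-4)] by simp
  have cs: "p * w0 + q * w2 \<in> carrier_mat 1 1" "p * w1 + q * W' \<in> carrier_mat 1 k"
     "c * w0 + V' * w2 \<in> carrier_mat k 1" "c * w1 + V' * W' \<in> carrier_mat k k" using V1(1-4) W1(1-4) by auto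
  have eq: "p * w1 + q * W' = 0\<^sub>m 1 k" "c * w1 + V' * W' = 1\<^sub>m k"
    using eq four_block_eq_iff[OF cs one_carrier_mat zero_carrier_mat zero_carrier_mat one_carrier_mat] by auto
  have "w1 = 0\<^sub>m 1 k" using eq(1) W1(1-4) unfolding p q by simp
  hence "V' * W' = 1\<^sub>m k" using eq(2) V1(1-4) W1(1-4) by simp
  from Suc.IH[OF V1(4) W1(4) this] obtain Q' where kn: "k \<le> n'" and Q': "Q' \<in> carrier (GL n')"
    "V' * Q' = mat k n' (\<lambda>(i,j). if i = j then 1 else 0)" by blast
  define E where "E = mat k n' (\<lambda>(i,j). if i = j then 1 else (0::'a))"
  \<comment> \<open>The column \<open>c\<close> padded with zeros, so that \<open>E * d = c\<close>.
    The shear \<open>Q3\<close> built from \<open>- d\<close> then clears the entries below the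
    leading 1.\<close>
  define d where "d = mat n' 1 (\<lambda>(i,j). if i < k then c $$ (i,j) else 0)"
  have E: "E \<in> carrier_mat k n'" and d: "d \<in> carrier_mat n' 1" by (auto simp: E_def d_def)
  have Ed: "E * d = c"
  proof (rule eq_matI)
    fix i j assume "i < dim_row c" "j < dim_col c"
    hence ij: "i < k" "j = 0" using V1 by auto
    have "(E * d) $$ (i,j) = (\<Sum>l<n'. E $$ (i,l) * d $$ (l,j))"
      using ij E d by (auto simp: scalar_prod_def atLeast0LessThan intro!: sum.cong)
    also have "\<dots> = (\<Sum>l<n'. if l = i then c $$ (i,j) else 0)" using ij kn by (intro sum.cong) (auto simp: E_def d_def)
    finally show "(E * d) $$ (i,j) = c $$ (i,j)" using ij kn by simp
  qed (use E d V1 in auto)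
  define Q2 where "Q2 = four_block_mat (1\<^sub>m 1) (0\<^sub>m 1 n') (0\<^sub>m n' 1) Q'"
  define Q3 where "Q3 = four_block_mat (1\<^sub>m 1) (0\<^sub>m 1 n') (- d) (1\<^sub>m n')"
  have G: "Q2 \<in> carrier (GL n)" "Q3 \<in> carrier (GL n)"
    using GL_four_block_diag[OF GL_one_closed Q'(1), of 1] GL_four_block_lower[of "- d" n' 1] d
    unfolding Q2_def Q3_def n' by auto
  have Q'c: "Q' \<in> carrier_mat n' n'" using Q' GL_carrier by auto
  have "V * Q1 * Q2 = four_block_mat (1\<^sub>m 1) (0\<^sub>m 1 n') c E"
    unfolding V1(5) Q2_def p q using V1(1-4) Q'c Q'(2)
    by (subst mult_four_block_mat[of _ 1 1 _ n' _ k _ _ 1 _ n']) (auto simp: E_def)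
  hence "V * Q1 * Q2 * Q3 = four_block_mat (1\<^sub>m 1) (0\<^sub>m 1 n') (c + - (E * d)) E"
    unfolding Q3_def using V1(1-4) E d
    unfolding \<open>V * Q1 * Q2 = _\<close>
    by (subst mult_four_block_mat[of _ 1 1 _ n' _ k _ _ 1 _ n']) auto
  also have "\<dots> = mat (Suc k) n (\<lambda>(i,j). if i = j then 1 else 0)"
    unfolding Ed n' using V1 by (intro eq_matI) (auto simp: E_def)
  finally have "V * (Q1 * Q2 * Q3) = mat (Suc k) n (\<lambda>(i,j). if i = j then 1 else 0)"
    using assoc_mult_mat[OF V Q1c GL_carrier[OF G(1)]] assoc_mult_mat[OF V _ GL_carrier[OF G(2)], of "Q1 * Q2"]
      Q1c GL_carrier[OF G(1)] by simp
  thus ?case using kn n' Q1 G by (intro conjI bexI[of _ "Q1 * Q2 * Q3"]) auto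
qed

text \<open>The rows of \<open>V\<close> span an invariant subspace on which \<open>X\<close> acts
  by \<open>C\<close>. The row vectors that annihilate the columns of \<Phi> form another one,
  because X \<Phi> = \<Phi> C2, and invertibility of V \<Phi> makes the two complementary.\<close>

lemma similar_mat_split:
  fixes X :: "'a::field mat"
  assumes X: "X \<in> carrier_mat n n" and V: "V \<in> carrier_mat k n" and \<Phi>: "\<Phi> \<in> carrier_mat n k"
    and C: "C \<in> carrier_mat k k" and C2: "C2 \<in> carrier_mat k k"
    and VX: "V * X = C * V" and X\<Phi>: "X * \<Phi> = \<Phi> * C2" and M: "V * \<Phi> \<in> carrier (GL k)"
  shows "\<exists>r X2. n = k + r \<and> X2 \<in> carrier_mat r r \<and> similar_mat X (four_block_mat C (0\<^sub>m k r) (0\<^sub>m r k) X2)"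
proof -
  define Mi where "Mi = inv\<^bsub>GL k\<^esub> (V * \<Phi>)"
  have Mi: "Mi \<in> carrier_mat k k" using M by (simp add: Mi_def)
  have Mc: "V * \<Phi> \<in> carrier_mat k k" using V \<Phi> by simp
  \<comment> \<open>Normalised to V W = 1. The columns of \<open>W\<close> span the same invariant
    space as those of \<Phi>, with \<open>D\<close> in place of \<open>C2\<close>.\<close>
  define W where "W = \<Phi> * Mi"
  define D where "D = (V * \<Phi>) * (C2 * Mi)"
  have W: "W \<in> carrier_mat n k" using \<Phi> Mi by (simp add: W_def)
  have D: "D \<in> carrier_mat k k" using Mc C2 Mi by (simp add: D_def)
  have VW: "V * W = 1\<^sub>m k" unfolding W_def Mi_def using M assoc_mult_mat[OF V \<Phi> Mi] by (simp add: Mi_def)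
  have XW: "X * W = W * D"
  proof -
    have "X * W = (\<Phi> * C2) * Mi" unfolding W_def using assoc_mult_mat[OF X \<Phi> Mi] X\<Phi> by simp
    also have "\<dots> = \<Phi> * (C2 * Mi)" using \<Phi> C2 Mi by (rule assoc_mult_mat)
    also have "\<dots> = \<Phi> * (Mi * D)" unfolding D_def Mi_def using M C2 Mi by (subst GL_l_inv_cancel) auto
    also have "\<dots> = W * D" unfolding W_def using \<Phi> Mi D by (rule assoc_mult_mat[symmetric])
    finally show ?thesis .
  qed
  from full_row_rank_normal_form[OF V W VW] obtain Q where kn: "k \<le> n" and Q: "Q \<in> carrier (GL n)"
    and VQ: "V * Q = mat k n (\<lambda>(i,j). if i = j then 1 else 0)" by blast
  define r where "r = n - k"
  have n: "n = k + r" using kn by (simp add: r_def)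
  have Qc: "Q \<in> carrier_mat n n" using Q GL_carrier by auto
  define Qi where "Qi = inv\<^bsub>GL n\<^esub> Q"
  have Qi: "Qi \<in> carrier_mat n n" "Q * Qi = 1\<^sub>m n" "Qi * Q = 1\<^sub>m n" using Q by (auto simp: Qi_def)
  have QQi: "Q * (Qi * B) = B" if "dim_row B = n" for B using Q that by (simp add: Qi_def)
  define Y where "Y = Qi * (X * Q)"
  have Yc: "Y \<in> carrier_mat n n" using Qi X Qc by (simp add: Y_def)
  have XQ: "X * Q = Q * Y" unfolding Y_def using QQi X Qc by simp
  \<comment> \<open>The normal form of \<open>V\<close> written as a block matrix with an empty
    lower half, so that block multiplication applies to products with \<open>Y\<close>.\<close>
  define E where "E = four_block_mat (1\<^sub>m k) (0\<^sub>m k r) (0\<^sub>m 0 k) (0\<^sub>m 0 r :: 'a mat)"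
  have Ec: "E \<in> carrier_mat k n" unfolding E_def n using four_block_carrier_mat[of "1\<^sub>m k" k k "0\<^sub>m 0 r" 0 r] by simp
  have E: "V * Q = E" unfolding VQ E_def n by (intro eq_matI) auto
  have EY: "E * Y = C * E"
  proof -
    have "E * Y = V * (Q * Y)" unfolding E[symmetric] using V Qc Yc by (rule assoc_mult_mat)
    also have "\<dots> = (V * X) * Q" unfolding XQ[symmetric] using V X Qc by (rule assoc_mult_mat[symmetric])
    also have "\<dots> = C * E" unfolding VX E[symmetric] using C V Qc by (rule assoc_mult_mat)
    finally show ?thesis .
  qed
  define W' where "W' = Qi * W"
  have W'c: "W' \<in> carrier_mat n k" using Qi W by (simp add: W'_def)
  have EW: "E * W' = 1\<^sub>m k"
    unfolding E[symmetric] W'_def using V Qc W'c[unfolded W'_def] VW QQi[of W] W by (subst assoc_mult_mat[of _ k n _ n _ k]) auto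
  have YW: "Y * W' = W' * D"
  proof -
    have "Y * W' = Qi * (X * Q * W')" unfolding Y_def using Qi X Qc W'c by (subst assoc_mult_mat[of _ n n _ n _ k]) auto
    also have "X * Q * W' = X * (Q * W')" using X Qc W'c by (rule assoc_mult_mat)
    also have "Q * W' = W" unfolding W'_def using QQi W by simp
    also have "Qi * (X * W) = W' * D" unfolding XW W'_def using Qi(1) W D by (rule assoc_mult_mat[symmetric])
    finally show ?thesis .
  qed
  obtain Y1 Y2 Y3 Y4 where Y: "Y1 \<in> carrier_mat k k" "Y2 \<in> carrier_mat k r" "Y3 \<in> carrier_mat r k" "Y4 \<in> carrier_mat r r"
    "Y = four_block_mat Y1 Y2 Y3 Y4" using four_block_ex[of Y k r k r] Yc n by auto
  have "W' \<in> carrier_mat (k + r) (k + 0)" using W'c n by simp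
  then obtain W1 O1 U O2 where W4: "W1 \<in> carrier_mat k k" "O1 \<in> carrier_mat k 0" "U \<in> carrier_mat r k" "O2 \<in> carrier_mat r 0"
    "W' = four_block_mat W1 O1 U O2" using four_block_ex[of W' k r k 0] by blast
  have "E * Y = four_block_mat Y1 Y2 (0\<^sub>m 0 k) (0\<^sub>m 0 r)"
    unfolding E_def Y(5) using Y(1-4) by (subst mult_four_block_mat[of _ k k _ r _ 0 _ _ k _ r]) auto
  moreover have "C * E = four_block_mat C (0\<^sub>m k r) (0\<^sub>m 0 k) (0\<^sub>m 0 r)"
  proof -
    have "C = four_block_mat C (0\<^sub>m k 0) (0\<^sub>m 0 k) (0\<^sub>m 0 0)" using C by (intro eq_matI) auto
    hence "C * E = four_block_mat C (0\<^sub>m k 0) (0\<^sub>m 0 k) (0\<^sub>m 0 0) * E" by simp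
    also have "\<dots> = four_block_mat C (0\<^sub>m k r) (0\<^sub>m 0 k) (0\<^sub>m 0 r)"
      unfolding E_def using C by (subst mult_four_block_mat[of _ k k _ 0 _ 0 _ _ k _ r]) auto
    finally show ?thesis .
  qed
  ultimately have Y12: "Y1 = C" "Y2 = 0\<^sub>m k r"
    using EY four_block_eq_iff[OF Y(1,2) zero_carrier_mat[of 0 k] zero_carrier_mat[of 0 r] C zero_carrier_mat zero_carrier_mat zero_carrier_mat] by auto
  have W1: "W1 = 1\<^sub>m k"
  proof -
    have "E * W' = four_block_mat W1 O1 (0\<^sub>m 0 k) (0\<^sub>m 0 0)"
      unfolding E_def W4(5) using W4(1-4) by (subst mult_four_block_mat[of _ k k _ r _ 0 _ _ k _ 0]) auto
    moreover have "1\<^sub>m k = four_block_mat (1\<^sub>m k) O1 (0\<^sub>m 0 k) (0\<^sub>m 0 0)" using W4 by (intro eq_matI) auto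
    ultimately show ?thesis using EW four_block_eq_iff[OF W4(1,2) zero_carrier_mat[of 0 k] zero_carrier_mat[of 0 0] one_carrier_mat W4(2) zero_carrier_mat zero_carrier_mat] by auto
  qed
  \<comment> \<open>The lower block of Y W' = W' D, in which \<open>D = C\<close> by the upper
    block. This is the equation that makes the shear \<open>L\<close> with entry \<open>U\<close>
    remove \<open>Y3\<close>.\<close>
  have YU: "Y3 + Y4 * U = U * C"
  proof -
    have D4: "D = four_block_mat D (0\<^sub>m k 0) (0\<^sub>m 0 k) (0\<^sub>m 0 0)" using D by (intro eq_matI) auto
    have "W' * D = four_block_mat D O1 (U * D) O2"
      unfolding W4(5) W1 by (subst D4, subst mult_four_block_mat[of _ k k _ 0 _ r _ _ k _ 0]) (use W4 D in \<open>auto intro!: eq_matI cong_four_block_mat\<close>)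
    moreover have "Y * W' = four_block_mat C O1 (Y3 + Y4 * U) O2"
      unfolding W4(5) Y(5) W1 Y12 using W4(1-4) Y(1-4) C
      by (subst mult_four_block_mat[of _ k k _ r _ r _ _ k _ 0]) (auto intro!: eq_matI cong_four_block_mat)
    ultimately have "C = D" "Y3 + Y4 * U = U * D"
      using YW four_block_eq_iff[of C k k O1 0 "Y3 + Y4 * U" r O2 D O1 "U * D" O2] W4 Y D C by auto
    thus ?thesis by simp
  qed
  define L where "L = four_block_mat (1\<^sub>m k) (0\<^sub>m k r) U (1\<^sub>m r)"
  define Z where "Z = four_block_mat C (0\<^sub>m k r) (0\<^sub>m r k) Y4"
  have L: "L \<in> carrier (GL n)" unfolding L_def n using W4 by (intro GL_four_block_lower)
  have Z: "Z \<in> carrier_mat n n" unfolding Z_def n using C Y by simp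
  have "Y * L = four_block_mat C (0\<^sub>m k r) (Y3 + Y4 * U) Y4"
    unfolding Y(5) Y12 L_def using Y(1-4) C W4 by (subst mult_four_block_mat[of _ k k _ r _ r _ _ k _ r]) auto
  moreover have "L * Z = four_block_mat C (0\<^sub>m k r) (U * C) Y4"
    unfolding Z_def L_def using Y(1-4) C W4 by (subst mult_four_block_mat[of _ k k _ r _ r _ _ k _ r]) auto
  ultimately have "Y * L = L * Z" using YU by simp
  hence "similar_mat Y Z" using similar_mat_GL_I Yc Z L by blast
  moreover have "similar_mat X Y" using similar_mat_GL_I X Yc Q XQ by blast
  ultimately have "similar_mat X Z" using similar_mat_trans by blast
  thus ?thesis using n Y(4) unfolding Z_def by blast
qed

section \<open>Companion matrices and Krylov matrices\<close>

lemma companion_mat_carrier [simp]: "companion_mat p \<in> carrier_mat (degree p) (degree p)"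
  by (simp add: companion_mat_def)

definition krylov :: "'a::field mat \<Rightarrow> 'a mat \<Rightarrow> nat \<Rightarrow> 'a mat" where
  "krylov v X d = mat d (dim_col X) (\<lambda>(i,j). (v * X ^\<^sub>m i) $$ (0,j))"

lemma krylov_carrier: "X \<in> carrier_mat n n \<Longrightarrow> krylov v X d \<in> carrier_mat d n"
  by (simp add: krylov_def)

lemma row_poly_mat_index:
  assumes X: "X \<in> carrier_mat n n" and v: "v \<in> carrier_mat 1 n" and "degree p \<le> N" "j < n"
  shows "(v * poly_mat p X) $$ (0,j) = (\<Sum>k\<le>N. coeff p k * (v * X ^\<^sub>m k) $$ (0,j))"
proof -
  have "(v * poly_mat p X) $$ (0,j) = (\<Sum>l<n. v $$ (0,l) * (\<Sum>k\<le>N. coeff p k * (X ^\<^sub>m k) $$ (l,j)))"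
    using mult_index[OF v poly_mat_carrier[OF X], of 0 j] poly_mat_index[OF assms(3)] assms by simp
  also have "\<dots> = (\<Sum>k\<le>N. coeff p k * (\<Sum>l<n. v $$ (0,l) * (X ^\<^sub>m k) $$ (l,j)))"
    unfolding sum_distrib_left by (subst sum.swap) (simp add: ac_simps)
  also have "\<dots> = (\<Sum>k\<le>N. coeff p k * (v * X ^\<^sub>m k) $$ (0,j))"
    using mult_index[OF v pow_carrier_mat[OF X], of 0 j] assms by simp
  finally show ?thesis .
qed

text \<open>The rows are v, v X, v X^2 and so on. Multiplication by \<open>X\<close> shifts them,
  and the vanishing of v p(X) expresses the row beyond the last one through the coefficients in the
  last row of the companion matrix.\<close>

lemma krylov_companion:
  fixes X :: "'a::field mat"
  assumes X: "X \<in> carrier_mat n n" and v: "v \<in> carrier_mat 1 n" and p: "monic p" "v * poly_mat p X = 0\<^sub>m 1 n"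
  shows "krylov v X (degree p) * X = companion_mat p * krylov v X (degree p)"
proof (rule eq_matI)
  let ?d = "degree p" and ?V = "krylov v X (degree p)" and ?C = "companion_mat p"
  fix i j assume "i < dim_row (?C * ?V)" "j < dim_col (?C * ?V)"
  hence ij: "i < ?d" "j < n" using X by (auto simp: companion_mat_def krylov_def)
  have "(?V * X) $$ (i,j) = (\<Sum>l<n. (v * X ^\<^sub>m i) $$ (0,l) * X $$ (l,j))"
    using mult_index[OF krylov_carrier[OF X] X ij] ij X by (simp add: krylov_def)
  also have "\<dots> = (v * X ^\<^sub>m i * X) $$ (0,j)"
    using mult_index[of "v * X ^\<^sub>m i" 1 n X n 0 j] ij X v by simp
  also have "v * X ^\<^sub>m i * X = v * X ^\<^sub>m (Suc i)"
    using assoc_mult_mat[of v 1 n "X ^\<^sub>m i" n X n] X v by simp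
  finally have L: "(?V * X) $$ (i,j) = (v * X ^\<^sub>m (Suc i)) $$ (0,j)" .
  have R: "(?C * ?V) $$ (i,j) = (\<Sum>l<?d. ?C $$ (i,l) * (v * X ^\<^sub>m l) $$ (0,j))"
    using mult_index[OF companion_mat_carrier krylov_carrier[OF X] ij] ij X by (simp add: krylov_def)
  show "(?V * X) $$ (i,j) = (?C * ?V) $$ (i,j)"
  proof (cases "i = ?d - 1")
    case False
    have "(\<Sum>l<?d. ?C $$ (i,l) * (v * X ^\<^sub>m l) $$ (0,j)) = (\<Sum>l<?d. if l = Suc i then (v * X ^\<^sub>m (Suc i)) $$ (0,j) else 0)"
      using False ij by (intro sum.cong) (auto simp: companion_mat_def)
    thus ?thesis unfolding L R using False ij by simp
  next
    case True
    have "0 = (\<Sum>k\<le>?d. coeff p k * (v * X ^\<^sub>m k) $$ (0,j))"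
      using row_poly_mat_index[OF X v order_refl ij(2), of p] p(2) ij by simp
    also have "{..?d} = insert ?d {..<?d}" by auto
    also have "(\<Sum>k\<in>insert ?d {..<?d}. coeff p k * (v * X ^\<^sub>m k) $$ (0,j)) =
      (v * X ^\<^sub>m ?d) $$ (0,j) + (\<Sum>k<?d. coeff p k * (v * X ^\<^sub>m k) $$ (0,j))"
      using p(1) by simp
    finally have "(v * X ^\<^sub>m ?d) $$ (0,j) = - (\<Sum>k<?d. coeff p k * (v * X ^\<^sub>m k) $$ (0,j))"
      by (metis eq_neg_iff_add_eq_0)
    also have "\<dots> = (\<Sum>l<?d. ?C $$ (i,l) * (v * X ^\<^sub>m l) $$ (0,j))"
      unfolding sum_negf[symmetric] using ij True by (intro sum.cong) (auto simp: companion_mat_def)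
    finally show ?thesis unfolding L R using True ij by simp
  qed
qed (use X in \<open>auto simp: companion_mat_def krylov_def\<close>)

text \<open>Turns rank questions about Krylov matrices into divisibility questions: the entries of
  \<open>a\<close> become the coefficients of a polynomial of degree below \<open>d\<close>.\<close>

lemma row_times_krylov:
  fixes X :: "'a::field mat"
  assumes X: "X \<in> carrier_mat n n" and v: "v \<in> carrier_mat 1 n" and a: "a \<in> carrier_mat 1 d"
  shows "\<exists>q. (\<forall>k. coeff q k = (if k < d then a $$ (0,k) else 0)) \<and> a * krylov v X d = v * poly_mat q X"
proof -
  define q where "q = (\<Sum>k<d. monom (a $$ (0,k)) k)"
  have c: "coeff q k = (if k < d then a $$ (0,k) else 0)" for k by (simp add: q_def coeff_sum)
  have dq: "degree q \<le> d" by (rule degree_le) (simp add: c)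
  have "a * krylov v X d = v * poly_mat q X"
  proof (rule eq_matI)
    fix i j assume "i < dim_row (v * poly_mat q X)" "j < dim_col (v * poly_mat q X)"
    hence ij: "i = 0" "j < n" using v X by auto
    have "(a * krylov v X d) $$ (0,j) = (\<Sum>l<d. a $$ (0,l) * (v * X ^\<^sub>m l) $$ (0,j))"
      using mult_index[OF a krylov_carrier[OF X], of 0 j] ij X by (simp add: krylov_def)
    also have "\<dots> = (\<Sum>l\<le>d. coeff q l * (v * X ^\<^sub>m l) $$ (0,j))"
      by (intro sum.mono_neutral_cong_left) (auto simp: c)
    finally show "(a * krylov v X d) $$ (i,j) = (v * poly_mat q X) $$ (i,j)"
      using row_poly_mat_index[OF X v dq ij(2)] ij by simp
  qed (use a v X in \<open>auto simp: krylov_def\<close>)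
  thus ?thesis using c by blast
qed

lemma companion_mat_unit_row:
  assumes "k < degree p" "v = mat 1 (degree p) (\<lambda>(i,j). if j = 0 then 1 else 0)"
  shows "v * companion_mat p ^\<^sub>m k = mat 1 (degree p) (\<lambda>(i,j). if j = k then 1 else (0::'a::field))"
  using assms(1)
proof (induction k)
  case 0
  thus ?case using assms(2) by (simp add: companion_mat_def)
next
  case (Suc k)
  let ?C = "companion_mat p" and ?d = "degree p"
  let ?u = "mat 1 ?d (\<lambda>(i,j). if j = k then 1 else (0::'a))"
  have v: "v \<in> carrier_mat 1 ?d" using assms(2) by simp
  have "v * ?C ^\<^sub>m Suc k = ?u * ?C"
    using Suc v assoc_mult_mat[OF v pow_carrier_mat[OF companion_mat_carrier[of p]] companion_mat_carrier[of p], of k] by simp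
  also have "\<dots> = mat 1 ?d (\<lambda>(i,j). if j = Suc k then 1 else 0)"
  proof (rule eq_matI)
    fix i j assume "i < dim_row (mat 1 ?d (\<lambda>(i,j). if j = Suc k then 1 else (0::'a)))" "j < dim_col (mat 1 ?d (\<lambda>(i,j). if j = Suc k then 1 else (0::'a)))"
    hence ij: "i = 0" "j < ?d" by auto
    have "(?u * ?C) $$ (0,j) = (\<Sum>l<?d. ?u $$ (0,l) * ?C $$ (l,j))"
      using ij by (intro mult_index[of _ 1 ?d]) auto
    also have "\<dots> = (\<Sum>l<?d. if l = k then ?C $$ (k,j) else 0)" by (intro sum.cong) auto
    also have "\<dots> = (if j = Suc k then 1 else 0)" using Suc.prems ij by (auto simp: companion_mat_def)
    finally show "(?u * ?C) $$ (i,j) = mat 1 ?d (\<lambda>(i,j). if j = Suc k then 1 else 0) $$ (i,j)" using ij by simp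
  qed (auto simp: companion_mat_def)
  finally show ?case .
qed

text \<open>The first unit row \<open>v\<close> generates: its Krylov matrix for the companion
  matrix is the identity. Cayley-Hamilton for the characteristic polynomial q and
  \<open>krylov_companion\<close> therefore show that the companion matrices of p and q coincide,
  and the last rows give p = q. In degree 0 there is no last row, hence the separate case.\<close>

theorem char_poly_companion_mat:
  fixes p :: "'a::field poly"
  assumes p: "monic p"
  shows "char_poly (companion_mat p) = p"
proof (cases "degree p = 0")
  case True
  hence "p = 1" using p by (metis degree_0_id lead_coeff_pCons(2) one_pCons degree_eq_zeroE)
  moreover have "degree (char_poly (companion_mat p)) = 0" "monic (char_poly (companion_mat p))"
    using degree_monic_char_poly[OF companion_mat_carrier[of p]] True by auto
  ultimately show ?thesis by (metis degree_0_id lead_coeff_pCons(2) one_pCons degree_eq_zeroE)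
next
  case False
  let ?C = "companion_mat p" and ?d = "degree p"
  have C: "?C \<in> carrier_mat ?d ?d" by simp
  have deg: "degree (char_poly ?C) = ?d" "monic (char_poly ?C)" using degree_monic_char_poly[OF C] by auto
  define v where "v = mat 1 ?d (\<lambda>(i,j). if j = 0 then 1 else (0::'a))"
  have v: "v \<in> carrier_mat 1 ?d" by (simp add: v_def)
  define V where "V = krylov v ?C ?d"
  have V1: "V = 1\<^sub>m ?d" unfolding V_def
    by (intro eq_matI) (auto simp: krylov_def companion_mat_unit_row[OF _ v_def] carrier_matD[OF C])
  let ?q = "char_poly ?C"
  have "v * poly_mat ?q ?C = 0\<^sub>m 1 ?d" using poly_mat_char_poly[OF C] v by simp
  from krylov_companion[OF C v deg(2) this] have "?C = companion_mat ?q"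
    using V1 deg C companion_mat_carrier[of ?q] unfolding V_def by simp
  have "coeff p j = coeff ?q j" if "j < ?d" for j
  proof -
    have "?C $$ (?d - 1, j) = - coeff p j" "companion_mat ?q $$ (?d - 1, j) = - coeff ?q j"
      using that deg by (simp_all add: companion_mat_def)
    thus ?thesis using \<open>?C = companion_mat ?q\<close> by simp
  qed
  moreover have "coeff p j = coeff ?q j" if "j \<ge> ?d" for j
    using that deg p by (cases "j = ?d") (auto simp: coeff_eq_0)
  ultimately show ?thesis by (metis leI poly_eqI)
qed

lemma poly_mat_companion_self:
  fixes p :: "'a::field poly"
  shows "monic p \<Longrightarrow> poly_mat p (companion_mat p) = 0\<^sub>m (degree p) (degree p)"
  using poly_mat_char_poly[OF companion_mat_carrier[of p]] char_poly_companion_mat by metis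

section \<open>Existence of elementary divisors\<close>

lemma irreducible_power_decomp:
  fixes p :: "'a::field poly"
  assumes p: "irreducible p" and q: "q \<noteq> 0"
  shows "\<exists>e h. q = p ^ e * h \<and> \<not> p dvd h"
  using q
proof (induction "degree q" arbitrary: q rule: less_induct)
  case less
  have dp: "p \<noteq> 0" "degree p > 0" using p by (auto simp: irreducible_def is_unit_iff_degree)
  show ?case
  proof (cases "p dvd q")
    case False
    thus ?thesis by (intro exI[of _ 0] exI[of _ q]) simp
  next
    case True
    then obtain r where r: "q = p * r" by (rule dvdE)
    hence "r \<noteq> 0" "degree r < degree q" using less.prems dp by (auto simp: degree_mult_eq)
    from less.hyps[OF this(2,1)] obtain e h where "r = p ^ e * h" "\<not> p dvd h" by blast
    thus ?thesis using r by (intro exI[of _ "Suc e"] exI[of _ h]) (simp add: mult.assoc)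
  qed
qed

text \<open>The pairing of the cyclic spaces of \<open>v\<close> and \<open>f\<close> is perfect, so the annihilator of the cyclic
  space of \<open>f\<close> is an \<open>X\<close>-invariant complement of that of \<open>v\<close>.\<close>

lemma krylov_pairing_GL:
  fixes X :: "'a::field mat"
  assumes X: "X \<in> carrier_mat n n" and v: "v \<in> carrier_mat 1 n" and f: "f \<in> carrier_mat n 1"
    and p: "monic p" "irreducible p"
    and fP: "poly_mat (p ^ Suc e) X * f = 0\<^sub>m n 1"
    and nz: "v * (poly_mat (p ^ e) X * f) \<noteq> 0\<^sub>m 1 1"
    and k: "k = degree (p ^ Suc e)"
  shows "krylov v X k * transpose_mat (krylov (transpose_mat f) (transpose_mat X) k) \<in> carrier (GL k)"
proof (rule GL_left_kernel)
  let ?V = "krylov v X k" and ?W = "krylov (transpose_mat f) (transpose_mat X) k"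
  let ?P = "p ^ Suc e"
  have p0: "p \<noteq> 0" using p by auto
  have V: "?V \<in> carrier_mat k n" and W: "?W \<in> carrier_mat k n"
    using krylov_carrier[OF X] krylov_carrier[of "transpose_mat X" n] X by auto
  show "?V * transpose_mat ?W \<in> carrier_mat k k" using V W by simp
  fix a :: "'a mat" assume a: "a \<in> carrier_mat 1 k" "a * (?V * transpose_mat ?W) = 0\<^sub>m 1 k"
  obtain q where q: "\<And>l. coeff q l = (if l < k then a $$ (0,l) else 0)" "a * ?V = v * poly_mat q X"
    using row_times_krylov[OF X v a(1)] by blast
  \<comment> \<open>The assumption on \<open>a\<close> covers only X^l f with l < k. As p^{e+1}(X) f
    = 0, every polynomial \<open>b\<close> can be reduced modulo p^{e+1}, so that v q(X) pairs to
    zero with the whole cyclic space of \<open>f\<close>.\<close>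
  have b0: "v * poly_mat q X * (poly_mat b X * f) = 0\<^sub>m 1 1" for b
  proof -
    define r where "r = b mod ?P"
    have P0: "?P \<noteq> 0" using p0 by simp
    have rk: "r = 0 \<or> degree r < k" unfolding r_def k using P0 by (rule degree_mod_less)
    have "b = (b div ?P) * ?P + r" unfolding r_def by (rule div_mult_mod_eq[symmetric])
    hence "poly_mat b X = poly_mat (b div ?P) X * poly_mat ?P X + poly_mat r X"
      by (metis poly_mat_add[OF X] poly_mat_mult[OF X])
    hence "poly_mat b X * f = poly_mat (b div ?P) X * (poly_mat ?P X * f) + poly_mat r X * f"
      using X f by (simp add: add_mult_distrib_mat[of _ n n _ _ 1] assoc_mult_mat[of _ n n _ n _ 1])
    also have "\<dots> = poly_mat r X * f"
      unfolding fP using X f left_add_zero_mat[OF mult_carrier_mat[OF poly_mat_carrier[OF X] f]]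
      by (simp add: right_mult_zero_mat[of _ n n])
    finally have bf: "poly_mat b X * f = poly_mat r X * f" .
    define c where "c = mat 1 k (\<lambda>(i,j). coeff r j)"
    have c: "c \<in> carrier_mat 1 k" by (simp add: c_def)
    have f': "transpose_mat f \<in> carrier_mat 1 n" and X': "transpose_mat X \<in> carrier_mat n n" using f X by auto
    obtain r' where r': "\<And>l. coeff r' l = (if l < k then c $$ (0,l) else 0)"
      "c * ?W = transpose_mat f * poly_mat r' (transpose_mat X)"
      using row_times_krylov[OF X' f' c] by blast
    have "r' = r" by (rule poly_eqI) (use rk in \<open>auto simp: r'(1) c_def coeff_eq_0\<close>)
    hence "c * ?W = transpose_mat (poly_mat r X * f)"
      using r'(2) X f by (simp add: poly_mat_transpose transpose_mult[of _ n n _ 1])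
    hence "poly_mat r X * f = transpose_mat ?W * transpose_mat c"
      using transpose_mult[OF c W] by simp
    hence "v * poly_mat q X * (poly_mat b X * f) = (a * ?V) * (transpose_mat ?W * transpose_mat c)"
      unfolding bf q(2) by simp
    also have "\<dots> = (a * ?V * transpose_mat ?W) * transpose_mat c"
      using a V W c by (intro assoc_mult_mat[symmetric, of _ 1 n _ k _ 1]) auto
    also have "a * ?V * transpose_mat ?W = 0\<^sub>m 1 k"
      using a V W assoc_mult_mat[of a 1 k ?V n "transpose_mat ?W" k] by simp
    finally show ?thesis using c by (simp add: left_mult_zero_mat[of _ k 1])
  qed
  have "q = 0"
  proof (rule ccontr)
    assume q0: "q \<noteq> 0"
    have dq: "degree q < k" using q0 q(1) by (metis leading_coeff_0_iff)
    obtain i h where ih: "q = p ^ i * h" "\<not> p dvd h" using irreducible_power_decomp[OF p(2) q0] by blast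
    have ie: "i \<le> e"
    proof (rule ccontr)
      assume "\<not> i \<le> e"
      hence "?P dvd q" unfolding ih by (intro dvd_mult2 le_imp_power_dvd) simp
      thus False using dvd_imp_degree_le[OF _ q0, of ?P] dq k by simp
    qed
    \<comment> \<open>As \<open>h\<close> is prime to \<open>p\<close> and i \<le> e, some multiple
      of q = p^i h is congruent to p^e modulo p^{e+1}. Pairing it with \<open>f\<close> would give v
      p^e(X) f = 0, against \<open>nz\<close>.\<close>
    have "comaximal ?P h" using comaximal_powers[OF irreducible_comaximal[OF p(2) ih(2)], of "Suc e" 1] by simp
    then obtain x y where xy: "x * ?P + y * h = 1" by (auto simp: comaximal_def)
    have "q * (y * p ^ (e - i)) = p ^ e * (y * h)"
      unfolding ih(1) using ie by (simp add: power_add[symmetric] algebra_simps)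
    also have "\<dots> = p ^ e * (1 - x * ?P)" unfolding xy[symmetric] by simp
    also have "\<dots> = p ^ e - (p ^ e * x) * ?P" by (simp add: algebra_simps)
    finally have e1: "q * (y * p ^ (e - i)) = p ^ e - (p ^ e * x) * ?P" .
    have "poly_mat q X * (poly_mat (y * p ^ (e - i)) X * f) = poly_mat (q * (y * p ^ (e - i))) X * f"
      using X f by (simp add: poly_mat_mult[OF X] assoc_mult_mat[of _ n n _ n _ 1])
    also have "\<dots> = poly_mat (p ^ e) X * f - poly_mat (p ^ e * x) X * (poly_mat ?P X * f)"
      unfolding e1 poly_mat_minus[OF X] poly_mat_mult[OF X, of _ ?P] using X f
      by (simp add: minus_mult_distrib_mat[of _ n n _ _ 1] assoc_mult_mat[of _ n n _ n _ 1])
    also have "\<dots> = poly_mat (p ^ e) X * f" unfolding fP using X f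
      by (auto intro!: eq_matI simp: right_mult_zero_mat[of _ n n])
    finally have "v * poly_mat q X * (poly_mat (y * p ^ (e - i)) X * f) = v * (poly_mat (p ^ e) X * f)"
      using v X f by (subst assoc_mult_mat[of v 1 n _ n _ 1]) auto
    thus False using b0 nz by simp
  qed
  hence "a $$ (0,l) = 0" if "l < k" for l using q(1)[of l] that by simp
  thus "a = 0\<^sub>m 1 k" using a(1) by (intro eq_matI) auto
qed

text \<open>With q = p^{e+1} h the minimal polynomial and \<open>p\<close> not dividing
  \<open>h\<close>, generators of the required pair of cyclic spaces are found among the rows and
  columns of h(X), all of which are annihilated by p^{e+1}(X).\<close>

lemma primary_cyclic_split:
  fixes X :: "'a::field mat"
  assumes X: "X \<in> carrier_mat n n" and n: "n > 0"
  shows "\<exists>p e r X2. monic p \<and> irreducible p \<and> n = degree (p ^ Suc e) + r \<and> X2 \<in> carrier_mat r r \<and>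
    similar_mat X (four_block_mat (companion_mat (p ^ Suc e)) (0\<^sub>m (degree (p ^ Suc e)) r) (0\<^sub>m r (degree (p ^ Suc e))) X2)"
proof -
  \<comment> \<open>A non-zero annihilating polynomial of least degree is the minimal polynomial up
    to a scalar; Cayley-Hamilton shows that there is a non-zero annihilating polynomial at
    all.\<close>
  define P where "P q \<longleftrightarrow> q \<noteq> 0 \<and> poly_mat q X = 0\<^sub>m n n" for q
  have "P (char_poly X)" using poly_mat_char_poly[OF X] degree_monic_char_poly[OF X] by (auto simp: P_def)
  then obtain q where q: "P q" and min: "\<And>r. P r \<Longrightarrow> degree q \<le> degree r"
    using ex_has_least_nat[of P "char_poly X" degree] by blast
  have q0: "q \<noteq> 0" and qX: "poly_mat q X = 0\<^sub>m n n" using q by (auto simp: P_def)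
  have qdvd: "q dvd r" if r: "poly_mat r X = 0\<^sub>m n n" for r
  proof (rule ccontr)
    assume nd: "\<not> q dvd r"
    have "r mod q = r - (r div q) * q" by (simp add: minus_div_mult_eq_mod)
    hence "poly_mat (r mod q) X = 0\<^sub>m n n"
      using r qX X by (simp add: poly_mat_minus[OF X] poly_mat_mult[OF X] right_mult_zero_mat[of _ n n])
    hence "P (r mod q)" unfolding P_def using nd by (auto simp: dvd_eq_mod_eq_0)
    from min[OF this] show False using degree_mod_less'[of q r] q0 nd by (auto simp: dvd_eq_mod_eq_0)
  qed
  have "degree q > 0"
  proof (rule ccontr)
    assume "\<not> degree q > 0"
    then obtain c where c: "q = [:c:]" by (auto elim: degree_eq_zeroE)
    hence "c \<cdot>\<^sub>m 1\<^sub>m n = (0\<^sub>m n n :: 'a mat)" using qX poly_mat_const[OF X] by simp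
    hence "(c \<cdot>\<^sub>m 1\<^sub>m n) $$ (0,0) = (0\<^sub>m n n :: 'a mat) $$ (0,0)" by simp
    thus False using n c q0 by simp
  qed
  then obtain p where p: "monic p" "irreducible p" "p dvd q" using exists_monic_irreducible_factor by blast
  obtain e' h where eh: "q = p ^ e' * h" "\<not> p dvd h" using irreducible_power_decomp[OF p(2) q0] by blast
  then obtain e where e: "e' = Suc e" using p(3) by (cases e') auto
  let ?P = "p ^ Suc e"
  define k where "k = degree ?P"
  have P: "monic ?P" using p(1) by (rule monic_power)
  have h0: "h \<noteq> 0" and p0: "p \<noteq> 0" using eh q0 p(1) by auto
  \<comment> \<open>The pairing of row \<open>i\<close> and column \<open>j\<close> of h(X) through
    p^e(X) is the entry (i,j) of r(X). Some entry is non-zero because q = p^{e+1} h does not divide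
    h p^e h.\<close>
  let ?r = "h * (p ^ e * h)"
  define H where "H = poly_mat h X"
  have H: "H \<in> carrier_mat n n" using X by (simp add: H_def)
  define M where "M = poly_mat ?r X"
  have M: "M \<in> carrier_mat n n" using X by (simp add: M_def)
  have "M \<noteq> 0\<^sub>m n n"
  proof
    assume "M = 0\<^sub>m n n"
    hence "q dvd ?r" using qdvd by (simp add: M_def)
    hence "(p ^ e * h) * p dvd (p ^ e * h) * h" unfolding eh e by (simp add: ac_simps)
    thus False using h0 p0 eh(2) by (subst (asm) dvd_mult_cancel_left) auto
  qed
  then obtain i j where ij: "i < n" "j < n" "M $$ (i,j) \<noteq> 0"
    using M eq_matI[of M "0\<^sub>m n n"] by fastforce
  define v where "v = mat 1 n (\<lambda>(_,l). H $$ (i,l))"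
  define f where "f = mat n 1 (\<lambda>(l,_). H $$ (l,j))"
  have v: "v \<in> carrier_mat 1 n" and f: "f \<in> carrier_mat n 1" by (auto simp: v_def f_def)
  have vB: "(v * B) $$ (0,l) = (H * B) $$ (i,l)" if "B \<in> carrier_mat n m" "l < m" for B m l
    using mult_index[OF v that(1), of 0 l] mult_index[OF H that(1) ij(1), of l] that(2) by (simp add: v_def)
  have Bf: "(B * f) $$ (l,0) = (B * H) $$ (l,j)" if "B \<in> carrier_mat m n" "l < m" for B m l
    using mult_index[OF that(1) f, of l 0] mult_index[OF that(1) H that(2) ij(2)] that(2) by (simp add: f_def)
  have HP: "H * poly_mat ?P X = 0\<^sub>m n n" "poly_mat ?P X * H = 0\<^sub>m n n"
    using qX unfolding H_def eh e by (simp_all add: poly_mat_mult[OF X, symmetric] mult.commute)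
  have vP: "v * poly_mat ?P X = 0\<^sub>m 1 n"
  proof (rule eq_matI)
    fix a b assume "a < dim_row (0\<^sub>m 1 n :: 'a mat)" "b < dim_col (0\<^sub>m 1 n :: 'a mat)"
    hence ab: "a = 0" "b < n" by auto
    show "(v * poly_mat ?P X) $$ (a,b) = 0\<^sub>m 1 n $$ (a,b)"
      using vB[OF poly_mat_carrier[OF X] ab(2), of ?P] HP(1) ab ij by simp
  qed (use v X in auto)
  have Pf: "poly_mat ?P X * f = 0\<^sub>m n 1"
  proof (rule eq_matI)
    fix a b assume "a < dim_row (0\<^sub>m n 1 :: 'a mat)" "b < dim_col (0\<^sub>m n 1 :: 'a mat)"
    hence ab: "b = 0" "a < n" by auto
    show "(poly_mat ?P X * f) $$ (a,b) = 0\<^sub>m n 1 $$ (a,b)"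
      using Bf[OF poly_mat_carrier[OF X] ab(2), of ?P] HP(2) ab ij by simp
  qed (use f X in auto)
  have "(v * (poly_mat (p ^ e) X * f)) $$ (0,0) = M $$ (i,j)"
  proof -
    have "(v * (poly_mat (p ^ e) X * f)) $$ (0,0) = (H * (poly_mat (p ^ e) X * f)) $$ (i,0)"
      using X f by (intro vB[where m=1]) auto
    also have "H * (poly_mat (p ^ e) X * f) = (H * poly_mat (p ^ e) X) * f"
      using H X f by (intro assoc_mult_mat[symmetric, of _ n n _ n _ 1]) auto
    also have "\<dots> $$ (i,0) = (H * poly_mat (p ^ e) X * H) $$ (i,j)"
      using H X ij by (intro Bf[where m=n]) auto
    also have "H * poly_mat (p ^ e) X * H = M"
      unfolding M_def poly_mat_mult[OF X] H_def using X by (simp add: sq_assoc[where n=n])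
    finally show ?thesis .
  qed
  hence nz: "v * (poly_mat (p ^ e) X * f) \<noteq> 0\<^sub>m 1 1" using ij(3) by auto
  let ?V = "krylov v X k" and ?W = "krylov (transpose_mat f) (transpose_mat X) k"
  let ?C = "companion_mat ?P"
  have V: "?V \<in> carrier_mat k n" and W: "?W \<in> carrier_mat k n" and C: "?C \<in> carrier_mat k k"
    using krylov_carrier[OF X] krylov_carrier[of "transpose_mat X" n] X companion_mat_carrier[of ?P] by (auto simp: k_def)
  have X': "transpose_mat X \<in> carrier_mat n n" and f': "transpose_mat f \<in> carrier_mat 1 n" using X f by auto
  have VX: "?V * X = ?C * ?V" unfolding k_def by (rule krylov_companion[OF X v P vP])
  have "transpose_mat f * poly_mat ?P (transpose_mat X) = transpose_mat (poly_mat ?P X * f)"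
    using transpose_mult[OF poly_mat_carrier[OF X] f, of ?P] poly_mat_transpose[OF X] by simp
  hence "?W * transpose_mat X = ?C * ?W" unfolding k_def using Pf by (intro krylov_companion[OF X' f' P]) simp
  hence "transpose_mat (?W * transpose_mat X) = transpose_mat (?C * ?W)" by simp
  hence WX: "X * transpose_mat ?W = transpose_mat ?W * transpose_mat ?C"
    using transpose_mult[OF W X'] transpose_mult[OF C W] by simp
  have "?V * transpose_mat ?W \<in> carrier (GL k)"
    by (rule krylov_pairing_GL[OF X v f p(1,2) Pf nz k_def])
  from similar_mat_split[OF X V _ C _ VX WX this] W C
  show ?thesis using p(1,2) unfolding k_def by (simp, blast)
qed

lemma dim_companion_mat [simp]: "dim_row (companion_mat p) = degree p" "dim_col (companion_mat p) = degree p"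
  by (simp_all add: companion_mat_def)

text \<open>Induction on the size: the primary cyclic block split off has positive degree, so the
  complementary block is strictly smaller.\<close>

theorem elementary_divisors_exist:
  fixes X :: "'a::field mat"
  assumes "X \<in> carrier_mat n n"
  shows "\<exists>es. (\<forall>e\<in>set es. \<exists>g l. monic g \<and> irreducible g \<and> l \<ge> 1 \<and> e = g ^ l) \<and>
    similar_mat X (diag_block_mat (map companion_mat es))"
  using assms
proof (induction n arbitrary: X rule: less_induct)
  case (less n)
  show ?case
  proof (cases "n = 0")
    case True
    hence "X = diag_block_mat (map companion_mat [])" using less.prems by auto
    thus ?thesis using less.prems similar_mat_refl by (intro exI[of _ "[]"]) auto
  next
    case False
    then obtain p e r X2 where p: "monic p" "irreducible p" and n: "n = degree (p ^ Suc e) + r" and X2: "X2 \<in> carrier_mat r r"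
      and sim: "similar_mat X (four_block_mat (companion_mat (p ^ Suc e)) (0\<^sub>m (degree (p ^ Suc e)) r) (0\<^sub>m r (degree (p ^ Suc e))) X2)"
      using primary_cyclic_split[OF less.prems] by blast
    let ?P = "p ^ Suc e"
    have "degree ?P > 0" using p by (auto simp: irreducible_def is_unit_iff_degree degree_power_eq degree_mult_eq)
    hence "r < n" using n by simp
    from less.IH[OF this X2] obtain es where es: "\<forall>e\<in>set es. \<exists>g l. monic g \<and> irreducible g \<and> l \<ge> 1 \<and> e = g ^ l"
      and sim2: "similar_mat X2 (diag_block_mat (map companion_mat es))" by blast
    have D: "diag_block_mat (map companion_mat es) \<in> carrier_mat r r"
      using sim2 X2 similar_matD[OF sim2] by auto
    have "similar_mat (four_block_mat (companion_mat ?P) (0\<^sub>m (degree ?P) r) (0\<^sub>m r (degree ?P)) X2)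
      (four_block_mat (companion_mat ?P) (0\<^sub>m (degree ?P) r) (0\<^sub>m r (degree ?P)) (diag_block_mat (map companion_mat es)))"
      using X2 sim2 by (intro similar_mat_four_block_0_0 similar_mat_refl) auto
    also have "four_block_mat (companion_mat ?P) (0\<^sub>m (degree ?P) r) (0\<^sub>m r (degree ?P)) (diag_block_mat (map companion_mat es))
      = diag_block_mat (map companion_mat (?P # es))"
      using D by (simp add: Let_def del: power_Suc)
    finally have "similar_mat X (diag_block_mat (map companion_mat (?P # es)))" by (rule similar_mat_trans[OF sim])
    moreover have "\<forall>e\<in>set (?P # es). \<exists>g l. monic g \<and> irreducible g \<and> l \<ge> 1 \<and> e = g ^ l"
      using es p by (auto simp del: power_Suc intro!: exI[of _ p] exI[of _ "Suc e"])
    ultimately show ?thesis by blast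
  qed
qed

section \<open>Reciprocal polynomials\<close>

lemma poly_mat_monom:
  fixes R :: "'a::field mat"
  shows "R \<in> carrier_mat n n \<Longrightarrow> poly_mat (monom c k) R = c \<cdot>\<^sub>m R ^\<^sub>m k"
proof (induction k)
  case 0
  thus ?case using poly_mat_const[of R n c] by (simp add: monom_0)
next
  case (Suc k)
  have "0 \<cdot>\<^sub>m 1\<^sub>m n = (0\<^sub>m n n :: 'a mat)" by (intro eq_matI) auto
  hence "0 \<cdot>\<^sub>m 1\<^sub>m n + R * (c \<cdot>\<^sub>m R ^\<^sub>m k) = R * (c \<cdot>\<^sub>m R ^\<^sub>m k)" using Suc.prems by simp
  thus ?case using Suc poly_mat_pCons[of R n 0 "monom c k"] pow_mat_Suc_left[of R n k]
    by (simp add: monom_Suc mult_smult_distrib[of _ n n _ n] del: pow_mat.simps)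
qed

lemma GL_pow: "R \<in> carrier (GL n) \<Longrightarrow> R ^\<^sub>m k \<in> carrier (GL n)"
  by (induction k) (auto simp: GL_carrier[THEN carrier_matD(1)])

lemma poly_mat_reflect:
  fixes R :: "'a::field mat"
  assumes R: "R \<in> carrier (GL n)"
  shows "poly_mat (reflect_poly p) R = R ^\<^sub>m degree p * poly_mat p (inv\<^bsub>GL n\<^esub> R)"
proof (induction p)
  case 0
  thus ?case using GL_carrier[OF R] GL_inv_carrier[OF R] by simp
next
  case (pCons c p)
  note c = GL_carrier[OF R] and ci = GL_inv_carrier[OF R]
  show ?case
  proof (cases "p = 0")
    case True
    thus ?thesis using poly_mat_const[OF c, of c] poly_mat_const[OF ci, of c] c by simp
  next
    case False
    let ?d = "degree p"
    have "poly_mat (reflect_poly (pCons c p)) R = R ^\<^sub>m ?d * poly_mat p (inv\<^bsub>GL n\<^esub> R) + c \<cdot>\<^sub>m R ^\<^sub>m (Suc ?d)"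
      using False pCons.IH by (simp add: reflect_poly_pCons' poly_mat_add[OF c] poly_mat_monom[OF c])
    also have "R ^\<^sub>m ?d * poly_mat p (inv\<^bsub>GL n\<^esub> R) = R ^\<^sub>m (Suc ?d) * (inv\<^bsub>GL n\<^esub> R * poly_mat p (inv\<^bsub>GL n\<^esub> R))"
      using c ci R by (simp add: sq_assoc[where n=n] del: GL_inv_carrier)
    also have "\<dots> + c \<cdot>\<^sub>m R ^\<^sub>m (Suc ?d) = R ^\<^sub>m (Suc ?d) * poly_mat (pCons c p) (inv\<^bsub>GL n\<^esub> R)"
      unfolding poly_mat_pCons[OF ci] using c ci
      by (subst sq_distrib(2)[where n=n])
         (auto simp: mult_smult_distrib[of _ n n _ n] comm_add_mat[of "R ^\<^sub>m Suc (degree p) * B" n n for B] simp del: pow_mat.simps)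
    finally show ?thesis using False by simp
  qed
qed

text \<open>The two matrices differ by the factor R^{deg p} and a scalar, both invertible.\<close>

lemma poly_mat_recip_eq_0_iff:
  fixes R :: "'a::field mat"
  assumes R: "R \<in> carrier (GL n)" and p: "poly p 0 \<noteq> 0"
  shows "poly_mat (recip_poly p) R = 0\<^sub>m n n \<longleftrightarrow> poly_mat p (inv\<^bsub>GL n\<^esub> R) = 0\<^sub>m n n"
proof -
  note c = GL_carrier[OF R] and ci = GL_inv_carrier[OF R]
  have 1: "poly_mat (recip_poly p) R = inverse (poly p 0) \<cdot>\<^sub>m (R ^\<^sub>m degree p * poly_mat p (inv\<^bsub>GL n\<^esub> R))"
    unfolding recip_poly_def poly_mat_smult[OF c] poly_mat_reflect[OF R] ..
  show ?thesis
  proof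
    assume "poly_mat p (inv\<^bsub>GL n\<^esub> R) = 0\<^sub>m n n"
    thus "poly_mat (recip_poly p) R = 0\<^sub>m n n" using 1 c by (simp add: right_mult_zero_mat[of _ n n])
  next
    assume "poly_mat (recip_poly p) R = 0\<^sub>m n n"
    hence "poly p 0 \<cdot>\<^sub>m (inverse (poly p 0) \<cdot>\<^sub>m (R ^\<^sub>m degree p * poly_mat p (inv\<^bsub>GL n\<^esub> R))) = 0\<^sub>m n n"
      unfolding 1 by (metis smult_zero_mat)
    moreover have "poly p 0 \<cdot>\<^sub>m (inverse (poly p 0) \<cdot>\<^sub>m M) = M" for M
      using p by (intro eq_matI) auto
    ultimately have "R ^\<^sub>m degree p * poly_mat p (inv\<^bsub>GL n\<^esub> R) = R ^\<^sub>m degree p * 0\<^sub>m n n"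
      using c by (simp add: right_mult_zero_mat[of _ n n])
    thus "poly_mat p (inv\<^bsub>GL n\<^esub> R) = 0\<^sub>m n n"
      using GL_left_cancel[OF GL_pow[OF R], of "poly_mat p (inv\<^bsub>GL n\<^esub> R)" "0\<^sub>m n n"] ci by simp
  qed
qed

lemma recip_poly_mult: "recip_poly (p * q) = recip_poly p * recip_poly (q :: 'a::field poly)"
  by (simp add: recip_poly_def reflect_poly_mult mult.commute)

lemma recip_poly_power: "recip_poly (p ^ k) = recip_poly p ^ k"
  by (induction k) (simp_all add: recip_poly_mult, simp add: recip_poly_def)

lemma poly_0_recip_poly: "poly p 0 \<noteq> 0 \<Longrightarrow> monic p \<Longrightarrow> poly (recip_poly p) 0 = inverse (poly p 0)"
  by (simp add: recip_poly_def)

lemma recip_poly_recip_poly: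
  assumes "poly p 0 \<noteq> 0" "monic p"
  shows "recip_poly (recip_poly p) = p"
proof -
  have "coeff p 0 \<noteq> 0" using assms by (simp add: poly_0_coeff_0)
  thus ?thesis unfolding recip_poly_def[of "recip_poly p"] poly_0_recip_poly[OF assms]
    using assms by (simp add: recip_poly_def reflect_poly_smult)
qed

lemma monic_recip_poly:
  assumes "poly p 0 \<noteq> 0"
  shows "monic (recip_poly p)"
proof -
  have "coeff p 0 \<noteq> 0" using assms by (simp add: poly_0_coeff_0)
  thus ?thesis using assms by (simp add: recip_poly_def coeff_reflect_poly poly_0_coeff_0)
qed

lemma degree_recip_poly: "poly p 0 \<noteq> 0 \<Longrightarrow> degree (recip_poly p) = degree p"
  by (simp add: recip_poly_def poly_0_coeff_0)

lemma irreducible_X: "irreducible ([:0, 1:] :: 'a::field poly)"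
  by (rule irreducible_linear_field_poly) simp

lemma poly_0_irreducible:
  assumes "monic g" "irreducible g" "g \<noteq> [:0, 1:]"
  shows "poly (g :: 'a::field poly) 0 \<noteq> 0"
proof
  assume "poly g 0 = 0"
  hence "[:0, 1:] dvd g" by (simp add: poly_eq_0_iff_dvd)
  hence "[:0, 1:] = g" using assms by (intro monic_irreducible_dvd_eq irreducible_X) auto
  thus False using assms by simp
qed

text \<open>\<open>recip_poly\<close> is multiplicative, preserves degrees when the constant term is
  non-zero, and is an involution on monic polynomials of this kind; a factorisation of the
  reciprocal polynomial thus reflects to one of \<open>g\<close>.\<close>

lemma irreducible_recip_poly:
  fixes g :: "'a::field poly"
  assumes g: "monic g" "irreducible g" and g0: "poly g 0 \<noteq> 0"
  shows "irreducible (recip_poly g)"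
proof (rule irreducibleI)
  have d: "degree (recip_poly g) = degree g" "recip_poly g \<noteq> 0"
    using degree_recip_poly[OF g0] monic_recip_poly[OF g0] by auto
  show "recip_poly g \<noteq> 0" "\<not> is_unit (recip_poly g)"
    using d g by (auto simp: irreducible_def is_unit_iff_degree)
  fix a b assume ab: "recip_poly g = a * b"
  have "poly a 0 \<noteq> 0" "poly b 0 \<noteq> 0" using poly_0_recip_poly[OF g0 g(1)] g0 unfolding ab by auto
  moreover have "g = recip_poly a * recip_poly b" using recip_poly_recip_poly[OF g0 g(1)] ab by (simp add: recip_poly_mult)
  hence "is_unit (recip_poly a) \<or> is_unit (recip_poly b)" using g(2) by (auto dest: irreducibleD)
  ultimately show "is_unit a \<or> is_unit b" using degree_recip_poly[of a] degree_recip_poly[of b]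
    by (metis is_unit_iff_degree poly_0 dvd_0_left_iff zero_neq_one)
qed

section \<open>Block diagonal matrices\<close>

text \<open>The sizes are kept in a list of their own, which makes it possible to say that two block
  diagonal matrices have the same shape and to compare them block by block.\<close>

definition square_blocks :: "'a mat list \<Rightarrow> nat list \<Rightarrow> bool" where
  "square_blocks As ks \<longleftrightarrow> list_all2 (\<lambda>A k. A \<in> carrier_mat k k) As ks"

lemma square_blocks_simps [simp]:
  "square_blocks [] ks \<longleftrightarrow> ks = []"
  "square_blocks As [] \<longleftrightarrow> As = []"
  "square_blocks (A # As) (k # ks) \<longleftrightarrow> A \<in> carrier_mat k k \<and> square_blocks As ks"
  by (auto simp: square_blocks_def)

lemma square_blocks_length: "square_blocks As ks \<Longrightarrow> length As = length ks"
  by (simp add: square_blocks_def list_all2_lengthD)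

lemma square_blocks_nth: "square_blocks As ks \<longleftrightarrow> length As = length ks \<and> (\<forall>i<length ks. As ! i \<in> carrier_mat (ks ! i) (ks ! i))"
  by (auto simp: square_blocks_def list_all2_conv_all_nth)

lemma diag_block_carrier:
  "square_blocks As ks \<Longrightarrow> diag_block_mat As \<in> carrier_mat (sum_list ks) (sum_list ks)"
proof (induction As arbitrary: ks)
  case (Cons A As)
  then obtain k ks' where ks: "ks = k # ks'" by (cases ks) auto
  show ?case using Cons.prems Cons.IH[of ks'] unfolding ks by (auto simp: Let_def)
qed simp

lemma diag_block_Cons:
  assumes "A \<in> carrier_mat k k" "square_blocks As ks"
  shows "diag_block_mat (A # As) =
    four_block_mat A (0\<^sub>m k (sum_list ks)) (0\<^sub>m (sum_list ks) k) (diag_block_mat As)"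
  using assms diag_block_carrier[OF assms(2)] by (simp add: Let_def)

lemma diag_block_induct [consumes 1, case_names Nil Cons]:
  assumes "square_blocks As ks" "P [] []"
    "\<And>A As k ks. A \<in> carrier_mat k k \<Longrightarrow> square_blocks As ks \<Longrightarrow> P As ks \<Longrightarrow> P (A # As) (k # ks)"
  shows "P As ks"
  using assms(1) unfolding square_blocks_def
  by (induction rule: list_all2_induct) (use assms in \<open>auto simp: square_blocks_def\<close>)

lemma square_blocks_Cons_right: "square_blocks Bs (k # ks) \<longleftrightarrow> (\<exists>B Bs'. Bs = B # Bs' \<and> B \<in> carrier_mat k k \<and> square_blocks Bs' ks)"
  by (cases Bs) auto

text \<open>The shape of the product belongs to the same induction, since unfolding the block
  diagonal matrix of the products at its head already requires it. The facts on transposes and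
  negatives have a second conjunct for the same reason.\<close>

lemma diag_block_mult:
  fixes As :: "'a::comm_ring_1 mat list"
  assumes "square_blocks As ks" "square_blocks Bs ks"
  shows "diag_block_mat As * diag_block_mat Bs = diag_block_mat (map2 (*) As Bs) \<and> square_blocks (map2 (*) As Bs) ks"
  using assms
proof (induction As ks arbitrary: Bs rule: diag_block_induct)
  case (Cons A As k ks)
  then obtain B Bs' where Bs: "Bs = B # Bs'" "B \<in> carrier_mat k k" "square_blocks Bs' ks"
    by (auto simp: square_blocks_Cons_right)
  note IH = Cons.IH[OF Bs(3)]
  show ?case
  proof (intro conjI)
    show "diag_block_mat (A # As) * diag_block_mat Bs = diag_block_mat (map2 (*) (A # As) Bs)"
      unfolding Bs(1) list.map zip_Cons_Cons prod.case
      unfolding diag_block_Cons[OF Cons.hyps(1,2)] diag_block_Cons[OF Bs(2,3)]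
        diag_block_Cons[OF sq_mult_carrier[OF Cons.hyps(1) Bs(2)] IH[THEN conjunct2]]
      using Cons.hyps(1) Bs(2) diag_block_carrier[OF Cons.hyps(2)] diag_block_carrier[OF Bs(3)] IH
        diag_block_carrier[OF IH[THEN conjunct2]]
      by (subst mult_four_block_mat[of _ k k _ "sum_list ks" _ "sum_list ks" _ _ k _ "sum_list ks"]) auto
    show "square_blocks (map2 (*) (A # As) Bs) (k # ks)" using Bs Cons.hyps IH by simp
  qed
qed simp

lemma diag_block_transpose:
  assumes "square_blocks As ks"
  shows "transpose_mat (diag_block_mat As) = diag_block_mat (map transpose_mat As) \<and> square_blocks (map transpose_mat As) ks"
  using assms
proof (induction As ks rule: diag_block_induct)
  case (Cons A As k ks)
  have A': "transpose_mat A \<in> carrier_mat k k" using Cons by simp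
  show ?case
    unfolding list.map diag_block_Cons[OF Cons.hyps(1,2)] diag_block_Cons[OF A' Cons.IH[THEN conjunct2]]
    using Cons diag_block_carrier[OF Cons.hyps(2)]
    by (subst transpose_four_block_mat[of _ k k _ "sum_list ks" _ "sum_list ks"]) auto
qed simp

lemma diag_block_uminus:
  fixes As :: "'a::comm_ring_1 mat list"
  assumes "square_blocks As ks"
  shows "- diag_block_mat As = diag_block_mat (map uminus As) \<and> square_blocks (map uminus As) ks"
  using assms
proof (induction As ks rule: diag_block_induct)
  case (Cons A As k ks)
  have A': "- A \<in> carrier_mat k k" using Cons by simp
  note c = diag_block_carrier[OF Cons.hyps(2)]
  have "- four_block_mat A (0\<^sub>m k (sum_list ks)) (0\<^sub>m (sum_list ks) k) (diag_block_mat As) =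
    four_block_mat (- A) (0\<^sub>m k (sum_list ks)) (0\<^sub>m (sum_list ks) k) (- diag_block_mat As)"
    using Cons.hyps c by (intro eq_matI) auto
  thus ?case
    unfolding list.map diag_block_Cons[OF Cons.hyps(1,2)] diag_block_Cons[OF A' Cons.IH[THEN conjunct2]]
    using Cons by simp
qed (auto intro!: eq_matI)

lemma diag_block_eq_iff:
  assumes "square_blocks As ks" "square_blocks Bs ks"
  shows "diag_block_mat As = diag_block_mat Bs \<longleftrightarrow> As = Bs"
  using assms
proof (induction As ks arbitrary: Bs rule: diag_block_induct)
  case (Cons A As k ks)
  then obtain B Bs' where Bs: "Bs = B # Bs'" "B \<in> carrier_mat k k" "square_blocks Bs' ks"
    by (auto simp: square_blocks_Cons_right)
  show ?case
    unfolding Bs(1) diag_block_Cons[OF Cons.hyps(1,2)] diag_block_Cons[OF Bs(2,3)]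
    using Cons.hyps(1) Bs(2) diag_block_carrier[OF Cons.hyps(2)] diag_block_carrier[OF Bs(3)] Cons.IH[OF Bs(3)]
    by (subst four_block_eq_iff[of _ k k _ "sum_list ks" _ "sum_list ks"]) auto
qed simp

lemma GL_four_block_diag_iff:
  fixes A :: "'a::field mat"
  assumes A: "A \<in> carrier_mat a a" and B: "B \<in> carrier_mat b b"
  shows "four_block_mat A (0\<^sub>m a b) (0\<^sub>m b a) B \<in> carrier (GL (a + b)) \<longleftrightarrow> A \<in> carrier (GL a) \<and> B \<in> carrier (GL b)"
  using GL_det[OF A] GL_det[OF B] GL_det[of "four_block_mat A (0\<^sub>m a b) (0\<^sub>m b a) B" "a + b"]
    det_four_block_mat_upper_right_zero[OF A refl zero_carrier_mat B] A B
  by simp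

lemma diag_block_GL_iff:
  fixes As :: "'a::field mat list"
  assumes "square_blocks As ks"
  shows "diag_block_mat As \<in> carrier (GL (sum_list ks)) \<longleftrightarrow> list_all2 (\<lambda>A k. A \<in> carrier (GL k)) As ks"
  using assms
proof (induction As ks rule: diag_block_induct)
  case Nil
  have "0\<^sub>m 0 0 = (1\<^sub>m 0 :: 'a mat)" by (rule eq_matI) simp_all
  thus ?case using GL_one_closed[of 0, where 'a='a] by simp
next
  case (Cons A As k ks)
  show ?case unfolding diag_block_Cons[OF Cons.hyps(1,2)]
    using GL_four_block_diag_iff[OF Cons.hyps(1) diag_block_carrier[OF Cons.hyps(2)]] Cons.IH by simp
qed

lemma diag_block_one:
  "diag_block_mat (map 1\<^sub>m ks) = (1\<^sub>m (sum_list ks) :: 'a::semiring_1 mat)"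
  "square_blocks (map (1\<^sub>m :: nat \<Rightarrow> 'a mat) ks) ks"
proof -
  have z: "0\<^sub>m 0 0 = (1\<^sub>m 0 :: 'a mat)" by (rule eq_matI) simp_all
  show "diag_block_mat (map 1\<^sub>m ks) = (1\<^sub>m (sum_list ks) :: 'a mat)"
    by (induction ks) (simp_all add: Let_def z)
qed (induction ks, simp_all)

lemma poly_mat_diag_block_0:
  assumes "square_blocks As ks" "\<And>A. A \<in> set As \<Longrightarrow> poly_mat p A = 0\<^sub>m (dim_row A) (dim_row A)"
  shows "poly_mat p (diag_block_mat As) = 0\<^sub>m (sum_list ks) (sum_list ks)"
  using assms
proof (induction As ks rule: diag_block_induct)
  case (Cons A As k ks)
  show ?case
    unfolding diag_block_Cons[OF Cons.hyps(1,2)]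
    using Cons diag_block_carrier[OF Cons.hyps(2)] by (simp add: poly_mat_four_block)
qed (auto intro!: eq_matI)

lemma similar_mat_swap:
  fixes A :: "'a::field mat"
  assumes A: "A \<in> carrier_mat a a" and B: "B \<in> carrier_mat b b"
  shows "similar_mat (four_block_mat A (0\<^sub>m a b) (0\<^sub>m b a) B) (four_block_mat B (0\<^sub>m b a) (0\<^sub>m a b) A)"
proof -
  let ?n = "a + b"
  let ?P = "four_block_mat (0\<^sub>m a b) (1\<^sub>m a) (1\<^sub>m b) (0\<^sub>m b a) :: 'a mat"
  let ?Q = "four_block_mat (0\<^sub>m b a) (1\<^sub>m b) (1\<^sub>m a) (0\<^sub>m a b) :: 'a mat"
  have c: "?P \<in> carrier_mat ?n ?n" "?Q \<in> carrier_mat ?n ?n" by (auto simp: add.commute)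
  have PQ: "?P * ?Q = 1\<^sub>m ?n"
    unfolding four_block_one_mat[symmetric] by (subst mult_four_block_mat[of _ a b _ a _ b _ _ a _ b]) (auto simp del: four_block_one_mat)
  hence P: "?P \<in> carrier (GL ?n)" using c by (intro GL_I[of _ _ ?Q])
  have 1: "four_block_mat A (0\<^sub>m a b) (0\<^sub>m b a) B * ?P = four_block_mat (0\<^sub>m a b) A B (0\<^sub>m b a)"
    using A B by (subst mult_four_block_mat[of _ a a _ b _ b _ _ b _ a]) auto
  have 2: "?P * four_block_mat B (0\<^sub>m b a) (0\<^sub>m a b) A = four_block_mat (0\<^sub>m a b) A B (0\<^sub>m b a)"
    using A B by (subst mult_four_block_mat[of _ a b _ a _ b _ _ b _ a]) auto
  show ?thesis using 1 2 A B P by (intro similar_mat_GL_I[of _ ?n _ ?P]) (auto simp: add.commute)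
qed

lemma square_blocks_append:
  "square_blocks As ks \<Longrightarrow> square_blocks Bs ls \<Longrightarrow> square_blocks (As @ Bs) (ks @ ls)"
  by (simp add: square_blocks_def list_all2_appendI)

lemma diag_block_append:
  assumes "square_blocks As ks" "square_blocks Bs ls"
  shows "diag_block_mat (As @ Bs) = four_block_mat (diag_block_mat As) (0\<^sub>m (sum_list ks) (sum_list ls))
    (0\<^sub>m (sum_list ls) (sum_list ks)) (diag_block_mat Bs)"
  using diag_block_carrier[OF assms(1)] diag_block_carrier[OF assms(2)] by (simp add: diag_block_mat_append Let_def)

lemma similar_mat_diag_move:
  fixes A :: "'a::field mat"
  assumes A: "A \<in> carrier_mat a a" and B: "square_blocks Bs ks" and C: "square_blocks Cs ls"
  shows "similar_mat (diag_block_mat (A # Bs @ Cs)) (diag_block_mat (Bs @ A # Cs))"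
proof -
  have AB: "square_blocks (A # Bs) (a # ks)" using A B by simp
  have BA: "square_blocks (Bs @ [A]) (ks @ [a])" using A by (intro square_blocks_append B) simp
  have "diag_block_mat (A # Bs) = four_block_mat A (0\<^sub>m a (sum_list ks)) (0\<^sub>m (sum_list ks) a) (diag_block_mat Bs)"
    by (rule diag_block_Cons[OF A B])
  moreover have "diag_block_mat (Bs @ [A]) = four_block_mat (diag_block_mat Bs) (0\<^sub>m (sum_list ks) a) (0\<^sub>m a (sum_list ks)) A"
    using diag_block_append[OF B, of "[A]" "[a]"] A by (simp del: diag_block_mat.simps)
  ultimately have "similar_mat (diag_block_mat (A # Bs)) (diag_block_mat (Bs @ [A]))"
    using similar_mat_swap[OF A diag_block_carrier[OF B]] by simp
  hence "similar_mat (diag_block_mat ((A # Bs) @ Cs)) (diag_block_mat ((Bs @ [A]) @ Cs))"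
    unfolding diag_block_append[OF AB C] diag_block_append[OF BA C]
    using similar_mat_four_block_0_0[OF _ similar_mat_refl[OF diag_block_carrier[OF C]] diag_block_carrier[OF AB] diag_block_carrier[OF C]]
    by (simp add: add.commute del: diag_block_mat.simps)
  thus ?thesis by simp
qed

lemma similar_mat_diag_Cons:
  fixes A :: "'a::field mat"
  assumes A: "A \<in> carrier_mat a a" and B: "diag_block_mat Bs \<in> carrier_mat n n" and s: "similar_mat (diag_block_mat Bs) (diag_block_mat Cs)"
  shows "similar_mat (diag_block_mat (A # Bs)) (diag_block_mat (A # Cs))"
proof -
  have C: "diag_block_mat Cs \<in> carrier_mat n n" using B similar_matD[OF s] by auto
  show ?thesis using similar_mat_four_block_0_0[OF similar_mat_refl[OF A] s A B] A B C by (simp add: Let_def)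
qed

text \<open>Induction on the list: a head that fails \<open>P\<close> is carried past the blocks
  that satisfy \<open>P\<close> by a permutation of blocks, which is a similarity.\<close>

lemma similar_mat_diag_partition:
  fixes F :: "'b \<Rightarrow> 'a::field mat"
  assumes "\<And>x. F x \<in> carrier_mat (d x) (d x)"
  shows "similar_mat (diag_block_mat (map F xs)) (diag_block_mat (map F (filter P xs) @ map F (filter (\<lambda>x. \<not> P x) xs)))"
proof (induction xs)
  case Nil
  thus ?case by (auto intro: similar_mat_refl[of _ 0])
next
  case (Cons x xs)
  have sb: "square_blocks (map F ys) (map d ys)" for ys using assms by (induction ys) auto
  have 1: "similar_mat (diag_block_mat (map F (x # xs)))
     (diag_block_mat (F x # map F (filter P xs) @ map F (filter (\<lambda>x. \<not> P x) xs)))"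
    unfolding list.map by (rule similar_mat_diag_Cons[OF assms diag_block_carrier[OF sb] Cons.IH])
  show ?case
  proof (cases "P x")
    case False
    thus ?thesis using similar_mat_trans[OF 1 similar_mat_diag_move[OF assms sb sb]] by simp
  qed (use 1 in simp)
qed

section \<open>Primary decomposition\<close>

text \<open>A non-zero constant term makes \<open>t\<close> and \<open>p\<close> comaximal, and the
  companion matrix is the value of \<open>t\<close> at a matrix annihilated by
  \<open>p\<close>.\<close>

lemma companion_mat_GL:
  fixes p :: "'a::field poly"
  assumes p: "monic p" and p0: "poly p 0 \<noteq> 0"
  shows "companion_mat p \<in> carrier (GL (degree p))"
proof -
  have "\<not> [:0, 1:] dvd p" using p0 poly_eq_0_iff_dvd[of p 0] by simp
  hence "comaximal [:0, 1:] p" by (rule irreducible_comaximal[OF irreducible_X])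
  from poly_mat_comaximal_GL[OF companion_mat_carrier this poly_mat_companion_self[OF p]]
  show ?thesis by (simp add: poly_mat_X[OF companion_mat_carrier])
qed

text \<open>The companion matrix of t^l is nilpotent of positive size l. This is what excludes
  \<open>t\<close> from the elementary divisors of an invertible matrix.\<close>

lemma companion_X_power_not_GL:
  assumes "l \<ge> 1"
  shows "companion_mat ([:0, 1::'a::field:] ^ l) \<notin> carrier (GL (degree ([:0, 1::'a:] ^ l)))"
proof
  let ?p = "[:0, 1::'a:] ^ l"
  let ?C = "companion_mat ?p" and ?d = "degree ?p"
  have C: "?C \<in> carrier_mat ?d ?d" by simp
  have d: "?d = l" by (simp add: degree_power_eq)
  assume G: "?C \<in> carrier (GL ?d)"
  have "poly_mat ([:0, 1:] ^ j) ?C \<in> carrier (GL ?d)" for j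
  proof (induction j)
    case (Suc j)
    thus ?case unfolding power_Suc poly_mat_mult[OF C] poly_mat_X[OF C] using G by simp
  qed (simp add: poly_mat_1[OF C])
  hence "poly_mat ?p ?C \<in> carrier (GL ?d)" .
  hence "0\<^sub>m ?d ?d \<in> carrier (GL ?d :: 'a mat monoid)" by (simp add: poly_mat_companion_self monic_power)
  thus False using GL_det[of "0\<^sub>m ?d ?d :: 'a mat" ?d] d assms by simp
qed

lemma square_blocks_companion: "square_blocks (map companion_mat es) (map degree es)"
  by (induction es) auto

lemma primary_blocks_Cons:
  fixes X0 :: "'a::field mat"
  assumes "primary_blocks Xs gs" "k > 0" "X0 \<in> carrier (GL k)" "monic g" "irreducible g" "g \<noteq> [:0, 1:]"
    "elem_divs_powers_of X0 {g, recip_poly g}" "\<And>h. h \<in> set gs \<Longrightarrow> h \<notin> {g, recip_poly g}"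
  shows "primary_blocks (X0 # Xs) (g # gs)"
proof -
  have len: "length gs = length Xs" using assms(1) by (simp add: primary_blocks_def)
  \<comment> \<open>The definition of \<open>primary_blocks\<close> demands separation in both
    orders. The reverse order follows because taking reciprocals is an involution on the polynomials
    that occur.\<close>
  have sym: "g \<notin> {h, recip_poly h}" if h: "h \<in> set gs" for h
  proof -
    have "monic h" "irreducible h" "h \<noteq> [:0, 1:]" using assms(1) h len by (auto simp: primary_blocks_def in_set_conv_nth)
    hence "poly h 0 \<noteq> 0" "monic h" using poly_0_irreducible by auto
    hence "recip_poly (recip_poly h) = h" by (rule recip_poly_recip_poly)
    thus ?thesis using assms(8)[OF h] by auto
  qed
  show ?thesis unfolding primary_blocks_def
  proof (intro conjI allI impI)
    show "length (g # gs) = length (X0 # Xs)" using len by simp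
  next
    fix i assume "i < length (X0 # Xs)"
    thus "(\<exists>k>0. (X0 # Xs) ! i \<in> carrier (GL k))" "monic ((g # gs) ! i)" "irreducible ((g # gs) ! i)" "(g # gs) ! i \<noteq> [:0, 1:]"
      "elem_divs_powers_of ((X0 # Xs) ! i) {(g # gs) ! i, recip_poly ((g # gs) ! i)}"
      using assms by (cases i; auto simp: primary_blocks_def)+
  next
    fix i j assume ij: "i < length (X0 # Xs)" "j < length (X0 # Xs)" "i \<noteq> j"
    show "(g # gs) ! j \<notin> {(g # gs) ! i, recip_poly ((g # gs) ! i)}"
    proof (cases i)
      case 0
      then obtain j' where "j = Suc j'" using ij by (cases j) auto
      thus ?thesis using 0 ij assms(8)[of "gs ! j'"] len by auto
    next
      case (Suc i')
      show ?thesis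
      proof (cases j)
        case 0
        thus ?thesis using Suc ij sym[of "gs ! i'"] len by auto
      next
        case (Suc j')
        thus ?thesis using \<open>i = Suc i'\<close> ij assms(1) by (auto simp: primary_blocks_def)
      qed
    qed
  qed
qed

text \<open>All powers of the polynomial of the first divisor and of its reciprocal are collected
  into one block, and the remaining list is shorter. The last conjunct serves the induction: every
  polynomial used later has a power among the remaining divisors, hence differs from
  \<open>g\<close> and its reciprocal.\<close>

lemma primary_grouping:
  fixes es :: "'a::field poly list"
  assumes "\<forall>e\<in>set es. \<exists>g l. monic g \<and> irreducible g \<and> g \<noteq> [:0, 1:] \<and> l \<ge> 1 \<and> e = g ^ l"
  shows "\<exists>Xs gs. primary_blocks Xs gs \<and> similar_mat (diag_block_mat (map companion_mat es)) (diag_block_mat Xs) \<and>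
    (\<forall>h\<in>set gs. \<exists>e\<in>set es. \<exists>l. e = h ^ l)"
  using assms
proof (induction "length es" arbitrary: es rule: less_induct)
  case less
  show ?case
  proof (cases es)
    case Nil
    thus ?thesis by (intro exI[of _ "[]"]) (auto simp: primary_blocks_def intro: similar_mat_refl[of _ 0])
  next
    case (Cons e0 es')
    then obtain g l0 where g: "monic g" "irreducible g" "g \<noteq> [:0, 1:]" "l0 \<ge> 1" "e0 = g ^ l0" using less.prems by auto
    define P where "P e \<longleftrightarrow> (\<exists>h\<in>{g, recip_poly g}. \<exists>l. e = h ^ l)" for e
    define es1 where "es1 = filter P es"
    define es2 where "es2 = filter (\<lambda>e. \<not> P e) es"
    have P0: "P e0" using g by (auto simp: P_def)
    have "length es2 < length es" unfolding es2_def Cons using P0 by (simp add: le_imp_less_Suc)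
    moreover have "\<forall>e\<in>set es2. \<exists>g l. monic g \<and> irreducible g \<and> g \<noteq> [:0, 1:] \<and> l \<ge> 1 \<and> e = g ^ l"
      using less.prems by (auto simp: es2_def)
    ultimately obtain Xs gs where IH: "primary_blocks Xs gs"
      "similar_mat (diag_block_mat (map companion_mat es2)) (diag_block_mat Xs)"
      "\<forall>h\<in>set gs. \<exists>e\<in>set es2. \<exists>l. e = h ^ l"
      using less.hyps[of es2] by blast
    define X0 where "X0 = diag_block_mat (map companion_mat es1)"
    define k where "k = sum_list (map degree es1)"
    have X0c: "X0 \<in> carrier_mat k k" unfolding X0_def k_def by (rule diag_block_carrier[OF square_blocks_companion])
    have "list_all2 (\<lambda>A k. A \<in> carrier (GL k)) (map companion_mat es1) (map degree es1)"
    proof -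
      have "companion_mat e \<in> carrier (GL (degree e))" if e: "e \<in> set es" for e
      proof -
        obtain h l where h: "monic h" "irreducible h" "h \<noteq> [:0, 1:]" "e = h ^ l" using less.prems e by blast
        have "poly e 0 \<noteq> 0" using poly_0_irreducible[OF h(1-3)] h(4) by simp
        thus ?thesis using monic_power[OF h(1), of l] h(4) by (intro companion_mat_GL) auto
      qed
      hence "\<forall>e\<in>set es1. companion_mat e \<in> carrier (GL (degree e))" by (auto simp: es1_def)
      thus ?thesis by (induction es1) auto
    qed
    hence X0G: "X0 \<in> carrier (GL k)" using diag_block_GL_iff[OF square_blocks_companion] unfolding X0_def k_def by blast
    have k0: "k > 0"
    proof -
      have "degree e0 > 0" using g by (auto simp: degree_power_eq irreducible_def is_unit_iff_degree)
      moreover have "e0 \<in> set es1" using P0 Cons by (simp add: es1_def)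
      ultimately show ?thesis unfolding k_def using member_le_sum_list[of "degree e0" "map degree es1"] by auto
    qed
    have "elementary_divisors X0 (mset es1)"
      unfolding elementary_divisors_def
    proof (intro exI[of _ es1] conjI ballI)
      fix e assume "e \<in> set es1"
      hence "e \<in> set es" by (simp add: es1_def)
      thus "\<exists>g l. monic g \<and> irreducible g \<and> l \<ge> 1 \<and> e = g ^ l" using less.prems by blast
    qed (use X0c in \<open>auto simp: X0_def intro: similar_mat_refl\<close>)
    hence ed: "elem_divs_powers_of X0 {g, recip_poly g}"
      unfolding elem_divs_powers_of_def by (intro exI[of _ "mset es1"]) (auto simp: es1_def P_def)
    have "primary_blocks (X0 # Xs) (g # gs)"
    proof (rule primary_blocks_Cons[OF IH(1) k0 X0G g(1-3) ed])
      fix h assume "h \<in> set gs"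
      then obtain e l where "e \<in> set es2" "e = h ^ l" using IH(3) by blast
      thus "h \<notin> {g, recip_poly g}" by (auto simp: es2_def P_def)
    qed
    moreover have "similar_mat (diag_block_mat (map companion_mat es)) (diag_block_mat (X0 # Xs))"
    proof -
      have "similar_mat (diag_block_mat (map companion_mat es)) (diag_block_mat (map companion_mat es1 @ map companion_mat es2))"
        unfolding es1_def es2_def by (rule similar_mat_diag_partition) (rule companion_mat_carrier)
      also have "diag_block_mat (map companion_mat es1 @ map companion_mat es2) = diag_block_mat (X0 # map companion_mat es2)"
        unfolding X0_def by (simp add: diag_block_mat_append Let_def)
      finally show ?thesis using similar_mat_diag_Cons[OF X0c diag_block_carrier[OF square_blocks_companion] IH(2)] similar_mat_trans by blast
    qed
    moreover have "\<forall>h\<in>set (g # gs). \<exists>e\<in>set es. \<exists>l. e = h ^ l"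
    proof
      fix h assume "h \<in> set (g # gs)"
      then consider "h = g" | "h \<in> set gs" by auto
      thus "\<exists>e\<in>set es. \<exists>l. e = h ^ l"
      proof cases
        case 1
        thus ?thesis using g(5) Cons by auto
      next
        case 2
        then obtain e l where "e \<in> set es2" "e = h ^ l" using IH(3) by blast
        thus ?thesis by (auto simp: es2_def)
      qed
    qed
    ultimately show ?thesis by blast
  qed
qed

lemma similar_conj_class:
  assumes X: "X \<in> carrier (GL n)" and s: "similar_mat X Y"
  shows "Y \<in> conj_class (GL n) X"
proof -
  note Xc = GL_carrier[OF X]
  obtain P where P: "P \<in> carrier (GL n)" "X * P = P * Y" "Y \<in> carrier_mat n n" using similar_mat_GL_E[OF s Xc] by blast
  have "Y = inv\<^bsub>GL n\<^esub> P * (X * P)" using P by simp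
  also have "\<dots> = inv\<^bsub>GL n\<^esub> P * X * P" using P Xc GL_carrier[OF P(1)] by (simp add: sq_assoc[where n=n])
  finally show ?thesis using P by (auto simp: conj_class_def)
qed

theorem primary_blocks_exist:
  fixes X :: "'a::field mat"
  assumes X: "X \<in> carrier (GL n)"
  shows "\<exists>Xs gs. primary_blocks Xs gs \<and> diag_block_mat Xs \<in> conj_class (GL n) X"
proof -
  note Xc = GL_carrier[OF X]
  obtain es where es: "\<forall>e\<in>set es. \<exists>g l. monic g \<and> irreducible g \<and> l \<ge> 1 \<and> e = g ^ l"
    and s: "similar_mat X (diag_block_mat (map companion_mat es))" using elementary_divisors_exist[OF Xc] by blast
  let ?D = "diag_block_mat (map companion_mat es)"
  obtain P where P: "P \<in> carrier (GL n)" "X * P = P * ?D" "?D \<in> carrier_mat n n" using similar_mat_GL_E[OF s Xc] by blast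
  have n: "n = sum_list (map degree es)" using P(3) diag_block_carrier[OF square_blocks_companion, of es] by auto
  have "inv\<^bsub>GL n\<^esub> P * (X * P) \<in> carrier (GL n)" using P(1) X by simp
  hence "?D \<in> carrier (GL n)" unfolding P(2) using P(1,3) by simp
  hence G: "list_all2 (\<lambda>A k. A \<in> carrier (GL k)) (map companion_mat es) (map degree es)"
    unfolding n using diag_block_GL_iff[OF square_blocks_companion] by blast
  have "\<exists>g l. monic g \<and> irreducible g \<and> g \<noteq> [:0, 1:] \<and> l \<ge> 1 \<and> e = g ^ l" if e: "e \<in> set es" for e
  proof -
    obtain g l where g: "monic g" "irreducible g" "l \<ge> 1" "e = g ^ l" using es e by blast
    have "companion_mat e \<in> carrier (GL (degree e))" using G e by (auto simp: list_all2_conv_all_nth in_set_conv_nth)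
    hence "g \<noteq> [:0, 1:]" using companion_X_power_not_GL[OF g(3)] g(4) by auto
    thus ?thesis using g by blast
  qed
  then obtain Xs gs where "primary_blocks Xs gs" "similar_mat ?D (diag_block_mat Xs)" using primary_grouping[of es] by blast
  thus ?thesis using similar_conj_class[OF X similar_mat_trans[OF s]] by blast
qed

section \<open>Annihilating polynomials and block diagonality\<close>

text \<open>Each elementary divisor divides a power of \<open>g * h\<close>, and \<open>N\<close>
  adds up the exponents over the whole list; each companion block is annihilated by its own
  polynomial.\<close>

lemma elem_divs_annihilator:
  fixes Z :: "'a::field mat"
  assumes Z: "Z \<in> carrier_mat n n" and ed: "elem_divs_powers_of Z {g, h}"
  shows "\<exists>N. poly_mat ((g * h) ^ N) Z = 0\<^sub>m n n"
proof -
  obtain es where es: "\<forall>e\<in>set es. \<exists>g l. monic g \<and> irreducible g \<and> l \<ge> 1 \<and> e = g ^ l"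
    and s: "similar_mat Z (diag_block_mat (map companion_mat es))" and pw: "\<forall>e\<in>set es. \<exists>f\<in>{g, h}. \<exists>l. e = f ^ l"
    using ed unfolding elem_divs_powers_of_def elementary_divisors_def by auto
  have "\<forall>e\<in>set es. \<exists>f\<in>{g, h}. \<exists>l. e = f ^ l \<Longrightarrow> \<exists>N. \<forall>e\<in>set es. e dvd (g * h) ^ N" for es
  proof (induction es)
    case (Cons e es)
    then obtain N where N: "\<forall>e\<in>set es. e dvd (g * h) ^ N" by auto
    obtain f l where f: "f \<in> {g, h}" "e = f ^ l" using Cons.prems by auto
    have "e dvd (g * h) ^ l" using f by (auto intro: dvd_power_same)
    hence "e dvd (g * h) ^ (N + l)" unfolding power_add by (rule dvd_mult)
    moreover have "\<forall>e\<in>set es. e dvd (g * h) ^ (N + l)" unfolding power_add using N by auto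
    ultimately show ?case by (intro exI[of _ "N + l"]) auto
  qed auto
  then obtain N where N: "\<forall>e\<in>set es. e dvd (g * h) ^ N" using pw by blast
  let ?D = "diag_block_mat (map companion_mat es)"
  obtain P where P: "P \<in> carrier (GL n)" "Z * P = P * ?D" "?D \<in> carrier_mat n n" using similar_mat_GL_E[OF s Z] by blast
  have n: "n = sum_list (map degree es)" using P(3) diag_block_carrier[OF square_blocks_companion, of es] by auto
  have "poly_mat ((g * h) ^ N) ?D = 0\<^sub>m n n" unfolding n
  proof (rule poly_mat_diag_block_0[OF square_blocks_companion])
    fix A assume "A \<in> set (map companion_mat es)"
    then obtain e where e: "e \<in> set es" "A = companion_mat e" by auto
    hence "e dvd (g * h) ^ N" using N by blast
    then obtain q where q: "(g * h) ^ N = e * q" by (rule dvdE)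
    have "monic e" using es e by (auto simp: monic_power)
    hence "poly_mat e A = 0\<^sub>m (degree e) (degree e)" unfolding e by (rule poly_mat_companion_self)
    thus "poly_mat ((g * h) ^ N) A = 0\<^sub>m (dim_row A) (dim_row A)"
      unfolding q e poly_mat_mult[OF companion_mat_carrier] by (simp add: left_mult_zero_mat[of _ "degree e" "degree e"])
  qed
  thus ?thesis using poly_mat_similar_wit[OF Z P(3,1,2)] by blast
qed

text \<open>p(Y) is invertible since \<open>p\<close> is comaximal to the annihilator
  \<open>q\<close> of \<open>Y\<close>, while M p(Y) = p(X) M = 0.\<close>

lemma sylvester_zero:
  fixes X :: "'a::field mat"
  assumes X: "X \<in> carrier_mat a a" and Y: "Y \<in> carrier_mat b b" and M: "M \<in> carrier_mat a b"
    and XM: "X * M = M * Y" and p: "poly_mat p X = 0\<^sub>m a a" and q: "poly_mat q Y = 0\<^sub>m b b" and cop: "comaximal p q"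
  shows "M = 0\<^sub>m a b"
proof -
  have G: "poly_mat p Y \<in> carrier (GL b)" using poly_mat_comaximal_GL[OF Y cop q] .
  have "M * poly_mat p Y = poly_mat p X * M" by (rule poly_mat_intertwine[OF X Y M XM, symmetric])
  also have "\<dots> = 0\<^sub>m a b * poly_mat p Y" unfolding p left_mult_zero_mat[OF M] left_mult_zero_mat[OF poly_mat_carrier[OF Y]] ..
  finally show ?thesis by (rule GL_right_cancel[OF G M zero_carrier_mat])
qed

text \<open>The first block is compared with all others at once: these are annihilated by the
  product of their polynomials, which is still comaximal to the first, so both off-diagonal blocks
  vanish. Two block lists are allowed because the fact is applied to the centraliser, with
  \<open>Ys = Xs\<close>, and to Gram matrices, with inverses on one side and transposes on the
  other.\<close>

lemma intertwiner_block_diag: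
  fixes Xs Ys :: "'a::field mat list"
  assumes "square_blocks Xs ks" "square_blocks Ys ks" "length ps = length ks"
    and "\<And>i. i < length ks \<Longrightarrow> poly_mat (ps ! i) (Xs ! i) = 0\<^sub>m (ks ! i) (ks ! i)"
    and "\<And>i. i < length ks \<Longrightarrow> poly_mat (ps ! i) (Ys ! i) = 0\<^sub>m (ks ! i) (ks ! i)"
    and "\<And>i j. i < length ks \<Longrightarrow> j < length ks \<Longrightarrow> i \<noteq> j \<Longrightarrow> comaximal (ps ! i) (ps ! j)"
    and "M \<in> carrier_mat (sum_list ks) (sum_list ks)" "diag_block_mat Xs * M = M * diag_block_mat Ys"
  shows "\<exists>Ms. square_blocks Ms ks \<and> M = diag_block_mat Ms"
  using assms
proof (induction Xs ks arbitrary: Ys ps M rule: diag_block_induct)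
  case Nil
  thus ?case by (intro exI[of _ "[]"]) auto
next
  case (Cons X Xs k ks Ys' ps' M)
  from Cons.prems(1) obtain Y Ys where Ys: "Ys' = Y # Ys" "Y \<in> carrier_mat k k" "square_blocks Ys ks"
    by (auto simp: square_blocks_Cons_right)
  obtain p ps where ps: "ps' = p # ps" "length ps = length ks" using Cons.prems(2) by (cases ps') auto
  let ?s = "sum_list ks"
  define q where "q = prod_list ps"
  note DX = diag_block_carrier[OF Cons.hyps(2)] and DY = diag_block_carrier[OF Ys(3)]
  have dvdq: "ps ! i dvd q" if "i < length ks" for i
  proof -
    have "r \<in> set ps \<Longrightarrow> r dvd prod_list ps" for r by (induction ps) auto
    thus ?thesis unfolding q_def using that ps(2) by simp
  qed
  have q0: "poly_mat q A = 0\<^sub>m (dim_row A) (dim_row A)" if As: "square_blocks As ks" "A \<in> set As"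
    "\<And>i. i < length ks \<Longrightarrow> poly_mat (ps ! i) (As ! i) = 0\<^sub>m (ks ! i) (ks ! i)" for A As
  proof -
    obtain i where i: "i < length ks" "A = As ! i" using As(2) square_blocks_length[OF As(1)] by (auto simp: in_set_conv_nth)
    have A: "As ! i \<in> carrier_mat (ks ! i) (ks ! i)" using As(1) i(1) by (auto simp: square_blocks_nth)
    obtain r where r: "q = ps ! i * r" using dvdq[OF i(1)] by (rule dvdE)
    have Ac: "A \<in> carrier_mat (ks ! i) (ks ! i)" unfolding i(2) by (rule A)
    have "poly_mat (ps ! i) A = 0\<^sub>m (ks ! i) (ks ! i)" unfolding i(2) by (rule As(3)[OF i(1)])
    thus ?thesis unfolding r poly_mat_mult[OF Ac] using left_mult_zero_mat[OF poly_mat_carrier[OF Ac], of "ks ! i" r] Ac by simp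
  qed
  have pXY: "poly_mat (ps ! i) (Xs ! i) = 0\<^sub>m (ks ! i) (ks ! i)" "poly_mat (ps ! i) (Ys ! i) = 0\<^sub>m (ks ! i) (ks ! i)" if "i < length ks" for i
    using Cons.prems(3)[of "Suc i"] Cons.prems(4)[of "Suc i"] that unfolding ps Ys by simp_all
  have qX: "poly_mat q (diag_block_mat Xs) = 0\<^sub>m ?s ?s"
    by (rule poly_mat_diag_block_0[OF Cons.hyps(2)]) (rule q0[OF Cons.hyps(2) _ pXY(1)])
  have qY: "poly_mat q (diag_block_mat Ys) = 0\<^sub>m ?s ?s"
    by (rule poly_mat_diag_block_0[OF Ys(3)]) (rule q0[OF Ys(3) _ pXY(2)])
  have pX: "poly_mat p X = 0\<^sub>m k k" and pY: "poly_mat p Y = 0\<^sub>m k k" using Cons.prems(3)[of 0] Cons.prems(4)[of 0] unfolding ps Ys by simp_all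
  have "\<forall>r\<in>set ps. comaximal p r"
  proof
    fix r assume "r \<in> set ps"
    then obtain j where "j < length ps" "r = ps ! j" by (auto simp: in_set_conv_nth)
    thus "comaximal p r" using Cons.prems(5)[of 0 "Suc j"] ps by auto
  qed
  hence cop: "comaximal p q" unfolding q_def by (induction ps) (simp_all add: comaximal_mult)
  have Mc: "M \<in> carrier_mat (k + ?s) (k + ?s)" using Cons.prems(6) by simp
  obtain A B C D where M: "A \<in> carrier_mat k k" "B \<in> carrier_mat k ?s" "C \<in> carrier_mat ?s k" "D \<in> carrier_mat ?s ?s"
    "M = four_block_mat A B C D" using four_block_ex[OF Mc] by blast
  have "diag_block_mat (X # Xs) * M = four_block_mat (X * A) (X * B) (diag_block_mat Xs * C) (diag_block_mat Xs * D)"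
    unfolding diag_block_Cons[OF Cons.hyps(1,2)] M(5) using M(1-4) Cons.hyps(1) DX
    by (subst mult_four_block_mat[of _ k k _ ?s _ ?s _ _ k _ ?s]) (auto intro!: cong_four_block_mat simp: left_add_zero_mat[OF mult_carrier_mat[of _ ?s ?s]] left_add_zero_mat[OF mult_carrier_mat[of _ k k]])
  moreover have "M * diag_block_mat (Y # Ys) = four_block_mat (A * Y) (B * diag_block_mat Ys) (C * Y) (D * diag_block_mat Ys)"
    unfolding diag_block_Cons[OF Ys(2,3)] M(5) using M(1-4) Ys(2) DY
    by (subst mult_four_block_mat[of _ k k _ ?s _ ?s _ _ k _ ?s]) (auto intro!: cong_four_block_mat simp: right_add_zero_mat[OF mult_carrier_mat[of _ _ k]] left_add_zero_mat[OF mult_carrier_mat[of _ _ ?s]])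
  ultimately have eq: "four_block_mat (X * A) (X * B) (diag_block_mat Xs * C) (diag_block_mat Xs * D)
      = four_block_mat (A * Y) (B * diag_block_mat Ys) (C * Y) (D * diag_block_mat Ys)"
    using Cons.prems(7)[unfolded Ys(1)] by simp
  note X = Cons.hyps(1)
  have eqs: "X * B = B * diag_block_mat Ys" "diag_block_mat Xs * C = C * Y" "diag_block_mat Xs * D = D * diag_block_mat Ys"
    using eq four_block_eq_iff[OF mult_carrier_mat[OF X M(1)] mult_carrier_mat[OF X M(2)]
      mult_carrier_mat[OF DX M(3)] mult_carrier_mat[OF DX M(4)] mult_carrier_mat[OF M(1) Ys(2)]
      mult_carrier_mat[OF M(2) DY] mult_carrier_mat[OF M(3) Ys(2)] mult_carrier_mat[OF M(4) DY]] by blast+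
  have "B = 0\<^sub>m k ?s" by (rule sylvester_zero[OF Cons.hyps(1) DY M(2) eqs(1) pX qY cop])
  moreover have "C = 0\<^sub>m ?s k" by (rule sylvester_zero[OF DX Ys(2) M(3) eqs(2) qX pY comaximal_sym[OF cop]])
  moreover have "\<exists>Ms. square_blocks Ms ks \<and> D = diag_block_mat Ms"
  proof (rule Cons.IH[OF Ys(3) ps(2) pXY _ M(4) eqs(3)])
    fix i j assume "i < length ks" "j < length ks" "i \<noteq> j"
    thus "comaximal (ps ! i) (ps ! j)" using Cons.prems(5)[of "Suc i" "Suc j"] ps by auto
  qed auto
  then obtain Ms where Ms: "square_blocks Ms ks" "D = diag_block_mat Ms" by blast
  ultimately have "M = diag_block_mat (A # Ms)" unfolding M(5) diag_block_Cons[OF M(1) Ms(1)] by simp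
  thus ?case using M(1) Ms(1) by (intro exI[of _ "A # Ms"]) simp
qed

section \<open>Gram matrices and centralisers\<close>

lemma GL_inv_dim [simp]:
  "A \<in> carrier (GL n) \<Longrightarrow> dim_row (inv\<^bsub>GL n\<^esub> A) = n" "A \<in> carrier (GL n) \<Longrightarrow> dim_col (inv\<^bsub>GL n\<^esub> A) = n"
  by (rule carrier_matD[OF GL_inv_carrier], assumption)+

lemma centraliser_iff:
  "Z \<in> carrier_mat n n \<Longrightarrow> Y \<in> carrier (centraliser Z) \<longleftrightarrow> Y \<in> carrier (GL n) \<and> Y * Z = Z * Y"
  by (auto simp: centraliser_def)

lemma inv_gram_iff:
  "Z \<in> carrier_mat n n \<Longrightarrow> A \<in> inv_gram Z \<longleftrightarrow> A \<in> carrier (GL n) \<and> A = - transpose_mat A \<and> A = Z * A * transpose_mat Z"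
  by (auto simp: inv_gram_def)

lemma inv_gram_carrier: "A \<in> inv_gram Z \<Longrightarrow> Z \<in> carrier_mat n n \<Longrightarrow> A \<in> carrier_mat n n"
  by (simp add: inv_gram_iff GL_carrier)

lemma commute_inv:
  assumes Y: "Y \<in> carrier (GL n)" and Z: "Z \<in> carrier_mat n n" and c: "Y * Z = Z * Y"
  shows "inv\<^bsub>GL n\<^esub> Y * Z = Z * inv\<^bsub>GL n\<^esub> Y"
proof (rule GL_left_cancel[OF Y])
  note Yc = GL_carrier[OF Y] and Yi = GL_inv_carrier[OF Y]
  have "Y * (Z * inv\<^bsub>GL n\<^esub> Y) = (Y * Z) * inv\<^bsub>GL n\<^esub> Y" using Yc Z Yi by (rule assoc_mult_mat[symmetric])
  also have "\<dots> = Z" unfolding c using Yc Z Yi Y by (simp add: sq_assoc[where n=n])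
  finally show "Y * (inv\<^bsub>GL n\<^esub> Y * Z) = Y * (Z * inv\<^bsub>GL n\<^esub> Y)" using Y Z by simp
qed (use Y Z GL_inv_carrier[OF Y] in auto)

lemma centraliser_closed:
  assumes Z: "Z \<in> carrier_mat n n"
  shows "1\<^sub>m n \<in> carrier (centraliser Z)"
    and "Y \<in> carrier (centraliser Z) \<Longrightarrow> W \<in> carrier (centraliser Z) \<Longrightarrow> Y * W \<in> carrier (centraliser Z)"
    and "Y \<in> carrier (centraliser Z) \<Longrightarrow> inv\<^bsub>GL n\<^esub> Y \<in> carrier (centraliser Z)"
proof -
  show "1\<^sub>m n \<in> carrier (centraliser Z)" using Z by (simp add: centraliser_iff)
  show "inv\<^bsub>GL n\<^esub> Y \<in> carrier (centraliser Z)" if "Y \<in> carrier (centraliser Z)"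
    using that Z commute_inv[of Y n Z] by (simp add: centraliser_iff)
  show "Y * W \<in> carrier (centraliser Z)" if YW: "Y \<in> carrier (centraliser Z)" "W \<in> carrier (centraliser Z)"
  proof -
    have c: "Y \<in> carrier (GL n)" "W \<in> carrier (GL n)" "Y * Z = Z * Y" "W * Z = Z * W" using YW Z by (auto simp: centraliser_iff)
    note cc = GL_carrier[OF c(1)] GL_carrier[OF c(2)]
    have "Y * W * Z = Y * (W * Z)" using cc Z by (simp add: sq_assoc[where n=n])
    also have "\<dots> = Y * Z * W" unfolding c(4) using cc Z by (simp add: sq_assoc[where n=n])
    also have "\<dots> = Z * (Y * W)" unfolding c(3) using cc Z by (simp add: sq_assoc[where n=n])
    finally show ?thesis using c Z by (simp add: centraliser_iff)
  qed
qed

lemma congr_mult: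
  fixes A :: "'a::field mat"
  assumes "A \<in> carrier_mat n n" "Y \<in> carrier_mat n n" "W \<in> carrier_mat n n"
  shows "W * (Y * A * transpose_mat Y) * transpose_mat W = (W * Y) * A * transpose_mat (W * Y)"
  using assms by (simp add: sq_assoc[where n=n] sq_transpose_mult[where n=n])

lemma congr_inv:
  fixes A :: "'a::field mat"
  assumes A: "A \<in> carrier_mat n n" and Y: "Y \<in> carrier (GL n)"
  shows "inv\<^bsub>GL n\<^esub> Y * (Y * A * transpose_mat Y) * transpose_mat (inv\<^bsub>GL n\<^esub> Y) = A"
  unfolding congr_mult[OF A GL_carrier[OF Y] GL_inv_carrier[OF Y]] using Y A by simp

lemma orbit_eq_iff:
  fixes Z :: "'a::field mat"
  assumes Z: "Z \<in> carrier_mat n n" and A: "A \<in> carrier_mat n n" and B: "B \<in> carrier_mat n n"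
  shows "orbit (centraliser Z) congr_act A = orbit (centraliser Z) congr_act B \<longleftrightarrow>
    (\<exists>Y\<in>carrier (centraliser Z). Y * A * transpose_mat Y = B)"
proof
  assume eq: "orbit (centraliser Z) congr_act A = orbit (centraliser Z) congr_act B"
  have "congr_act (1\<^sub>m n) B = B" using B by (simp add: congr_act_def)
  hence "B \<in> orbit (centraliser Z) congr_act B" unfolding orbit_def using centraliser_closed(1)[OF Z] by force
  hence "B \<in> orbit (centraliser Z) congr_act A" using eq by simp
  thus "\<exists>Y\<in>carrier (centraliser Z). Y * A * transpose_mat Y = B"
    unfolding orbit_def congr_act_def by blast
next
  have sub: "orbit (centraliser Z) congr_act (Y * A * transpose_mat Y) \<subseteq> orbit (centraliser Z) congr_act A"
    if "Y \<in> carrier (centraliser Z)" "A \<in> carrier_mat n n" for Y A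
  proof
    fix C assume "C \<in> orbit (centraliser Z) congr_act (Y * A * transpose_mat Y)"
    then obtain W where W: "W \<in> carrier (centraliser Z)" "C = W * (Y * A * transpose_mat Y) * transpose_mat W"
      by (auto simp: orbit_def congr_act_def)
    have "C = (W * Y) * A * transpose_mat (W * Y)" unfolding W(2)
      using that W(1) Z by (intro congr_mult) (auto simp: centraliser_iff GL_carrier)
    thus "C \<in> orbit (centraliser Z) congr_act A"
      unfolding orbit_def congr_act_def using centraliser_closed(2)[OF Z W(1) that(1)] by blast
  qed
  assume "\<exists>Y\<in>carrier (centraliser Z). Y * A * transpose_mat Y = B"
  then obtain Y where Y: "Y \<in> carrier (centraliser Z)" "Y * A * transpose_mat Y = B" by blast
  hence YG: "Y \<in> carrier (GL n)" using Z by (simp add: centraliser_iff)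
  have "orbit (centraliser Z) congr_act (inv\<^bsub>GL n\<^esub> Y * B * transpose_mat (inv\<^bsub>GL n\<^esub> Y)) \<subseteq> orbit (centraliser Z) congr_act B"
    by (rule sub[OF centraliser_closed(3)[OF Z Y(1)] B])
  moreover have "inv\<^bsub>GL n\<^esub> Y * B * transpose_mat (inv\<^bsub>GL n\<^esub> Y) = A" unfolding Y(2)[symmetric] by (rule congr_inv[OF A YG])
  ultimately show "orbit (centraliser Z) congr_act A = orbit (centraliser Z) congr_act B"
    using sub[OF Y(1) A] unfolding Y(2) by auto
qed

lemma congr_inv_gram:
  fixes Z :: "'a::field mat"
  assumes Z: "Z \<in> carrier_mat n n" and A: "A \<in> inv_gram Z" and Y: "Y \<in> carrier (centraliser Z)"
  shows "Y * A * transpose_mat Y \<in> inv_gram Z"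
proof -
  have A: "A \<in> carrier (GL n)" "A = - transpose_mat A" "A = Z * A * transpose_mat Z" using A Z by (auto simp: inv_gram_iff)
  have Y: "Y \<in> carrier (GL n)" "Y * Z = Z * Y" using Y Z by (auto simp: centraliser_iff)
  note c = GL_carrier[OF A(1)] GL_carrier[OF Y(1)]
  let ?B = "Y * A * transpose_mat Y"
  have At: "transpose_mat A = - A" using A(2) by (metis uminus_uminus_mat)
  have "transpose_mat ?B = Y * transpose_mat A * transpose_mat Y"
    using c by (simp add: sq_transpose_mult[where n=n] sq_assoc[where n=n])
  also have "\<dots> = - ?B" unfolding At using c by simp
  finally have 1: "?B = - transpose_mat ?B" by simp
  have "Z * ?B * transpose_mat Z = (Z * Y) * A * transpose_mat (Z * Y)" by (rule congr_mult[OF c Z])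
  also have "\<dots> = Y * (Z * A * transpose_mat Z) * transpose_mat Y" unfolding Y(2)[symmetric] by (rule congr_mult[OF c(1) Z c(2), symmetric])
  also have "\<dots> = ?B" unfolding A(3)[symmetric] ..
  finally have 2: "?B = Z * ?B * transpose_mat Z" ..
  have "?B \<in> carrier (GL n)" using A(1) Y(1) GL_transpose[OF Y(1)] by simp
  with 1 2 show ?thesis using inv_gram_iff[OF Z] by blast
qed

text \<open>Invariance rewritten as an intertwining relation, the form in which polynomials in
  \<open>Z\<close> can be passed through \<open>A\<close>.\<close>

lemma inv_gram_intertwine:
  fixes Z :: "'a::field mat"
  assumes Z: "Z \<in> carrier (GL n)" and A: "A \<in> inv_gram Z"
  shows "inv\<^bsub>GL n\<^esub> Z * A = A * transpose_mat Z" "Z * A = A * transpose_mat (inv\<^bsub>GL n\<^esub> Z)"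
proof -
  note Zc = GL_carrier[OF Z] and Zi = GL_inv_carrier[OF Z]
  have A: "A \<in> carrier (GL n)" "A = Z * A * transpose_mat Z" using A Zc by (auto simp: inv_gram_iff)
  note Ac = GL_carrier[OF A(1)]
  have "inv\<^bsub>GL n\<^esub> Z * A = inv\<^bsub>GL n\<^esub> Z * (Z * A * transpose_mat Z)"
    by (rule arg_cong[OF A(2)])
  also have "\<dots> = inv\<^bsub>GL n\<^esub> Z * (Z * (A * transpose_mat Z))"
    using Ac Zc by (simp add: sq_assoc[where n=n])
  also have "\<dots> = A * transpose_mat Z" using Z Ac by simp
  finally show "inv\<^bsub>GL n\<^esub> Z * A = A * transpose_mat Z" .
  have "A * transpose_mat (inv\<^bsub>GL n\<^esub> Z) = Z * A * transpose_mat Z * transpose_mat (inv\<^bsub>GL n\<^esub> Z)"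
    by (rule arg_cong[OF A(2)])
  also have "\<dots> = Z * A * transpose_mat (inv\<^bsub>GL n\<^esub> Z * Z)"
    unfolding sq_transpose_mult[OF Zi Zc] using Ac Zc Zi by (simp add: sq_assoc[where n=n])
  finally show "Z * A = A * transpose_mat (inv\<^bsub>GL n\<^esub> Z)" using Z Zc Ac by simp
qed

section \<open>Reduction to primary blocks\<close>

text \<open>Each polynomial is a power of \<open>g * recip_poly g\<close> and thus its own
  reciprocal, so it annihilates the inverse of the block along with the block and its transpose. For
  different blocks all four pairs of irreducible factors are distinct, which makes the polynomials
  comaximal.\<close>

lemma primary_annihilators:
  fixes Xs :: "'a::field mat list"
  assumes pb: "primary_blocks Xs gs"
  obtains ks ps where "length ks = length Xs" "length ps = length ks" "\<And>i. i < length ks \<Longrightarrow> Xs ! i \<in> carrier (GL (ks ! i))"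
    "\<And>i. i < length ks \<Longrightarrow> poly_mat (ps ! i) (Xs ! i) = 0\<^sub>m (ks ! i) (ks ! i)"
    "\<And>i. i < length ks \<Longrightarrow> poly_mat (ps ! i) (transpose_mat (Xs ! i)) = 0\<^sub>m (ks ! i) (ks ! i)"
    "\<And>i. i < length ks \<Longrightarrow> poly_mat (ps ! i) (inv\<^bsub>GL (ks ! i)\<^esub> (Xs ! i)) = 0\<^sub>m (ks ! i) (ks ! i)"
    "\<And>i j. i < length ks \<Longrightarrow> j < length ks \<Longrightarrow> i \<noteq> j \<Longrightarrow> comaximal (ps ! i) (ps ! j)"
proof -
  define ks where "ks = map dim_row Xs"
  have XG: "Xs ! i \<in> carrier (GL (ks ! i))" if i: "i < length Xs" for i
  proof -
    obtain k where "Xs ! i \<in> carrier (GL k)" using pb i by (auto simp: primary_blocks_def)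
    thus ?thesis using GL_carrier[of "Xs ! i" k] i by (auto simp: ks_def)
  qed
  have g: "monic (gs ! i)" "irreducible (gs ! i)" "gs ! i \<noteq> [:0, 1:]" "elem_divs_powers_of (Xs ! i) {gs ! i, recip_poly (gs ! i)}"
    if "i < length Xs" for i using pb that by (auto simp: primary_blocks_def)
  define N where "N i = (SOME N. poly_mat ((gs ! i * recip_poly (gs ! i)) ^ N) (Xs ! i) = 0\<^sub>m (ks ! i) (ks ! i))" for i
  have N: "poly_mat ((gs ! i * recip_poly (gs ! i)) ^ N i) (Xs ! i) = 0\<^sub>m (ks ! i) (ks ! i)" if "i < length Xs" for i
    unfolding N_def by (rule someI_ex, rule elem_divs_annihilator[OF GL_carrier[OF XG[OF that]] g(4)[OF that]])
  define ps where "ps = map (\<lambda>i. (gs ! i * recip_poly (gs ! i)) ^ N i) [0..<length Xs]"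
  have psi: "ps ! i = (gs ! i * recip_poly (gs ! i)) ^ N i" if "i < length Xs" for i using that by (simp add: ps_def)
  have g0: "poly (gs ! i) 0 \<noteq> 0" if "i < length Xs" for i using poly_0_irreducible g that by blast
  have rg: "recip_poly (recip_poly (gs ! i)) = gs ! i" if "i < length Xs" for i using recip_poly_recip_poly g0 g that by blast
  have rmi: "monic (recip_poly (gs ! i))" "irreducible (recip_poly (gs ! i))" if "i < length Xs" for i
    using monic_recip_poly irreducible_recip_poly g0 g that by blast+
  show ?thesis
  proof (rule that)
    show "length ks = length Xs" "length ps = length ks" by (auto simp: ks_def ps_def)
  next
    fix i assume i: "i < length ks"
    hence i: "i < length Xs" by (simp add: ks_def)
    show "Xs ! i \<in> carrier (GL (ks ! i))" by (rule XG[OF i])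
    show p0: "poly_mat (ps ! i) (Xs ! i) = 0\<^sub>m (ks ! i) (ks ! i)" using N[OF i] psi[OF i] by simp
    show "poly_mat (ps ! i) (transpose_mat (Xs ! i)) = 0\<^sub>m (ks ! i) (ks ! i)"
      using poly_mat_transpose[OF GL_carrier[OF XG[OF i]], of "ps ! i", symmetric] p0 by simp
    have "recip_poly (ps ! i) = ps ! i" using rg[OF i] psi[OF i] by (simp add: recip_poly_power recip_poly_mult mult.commute)
    moreover have "poly (ps ! i) 0 \<noteq> 0" using psi[OF i] g0[OF i] poly_0_recip_poly[OF g0[OF i] g(1)[OF i]] by simp
    ultimately show "poly_mat (ps ! i) (inv\<^bsub>GL (ks ! i)\<^esub> (Xs ! i)) = 0\<^sub>m (ks ! i) (ks ! i)"
      using poly_mat_recip_eq_0_iff[OF XG[OF i], of "ps ! i"] p0 by simp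
  next
    fix i j assume "i < length ks" "j < length ks" and ij: "i \<noteq> j"
    hence i: "i < length Xs" and j: "j < length Xs" by (simp_all add: ks_def)
    have ne: "gs ! j \<noteq> gs ! i" "gs ! j \<noteq> recip_poly (gs ! i)" using pb i j ij by (auto simp: primary_blocks_def)
    hence ne2: "recip_poly (gs ! j) \<noteq> gs ! i" "recip_poly (gs ! j) \<noteq> recip_poly (gs ! i)" using rg[OF i] rg[OF j] by metis+
    have "comaximal (gs ! i) (gs ! j)" "comaximal (gs ! i) (recip_poly (gs ! j))"
      "comaximal (recip_poly (gs ! i)) (gs ! j)" "comaximal (recip_poly (gs ! i)) (recip_poly (gs ! j))"
      using g(1,2)[OF i] g(1,2)[OF j] rmi[OF i] rmi[OF j] ne ne2
      by (simp_all add: monic_irreducible_comaximal)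
    hence "comaximal (gs ! i) (gs ! j * recip_poly (gs ! j))" "comaximal (recip_poly (gs ! i)) (gs ! j * recip_poly (gs ! j))"
      by (simp_all add: comaximal_mult)
    hence "comaximal (gs ! j * recip_poly (gs ! j)) (gs ! i * recip_poly (gs ! i))"
      by (intro comaximal_mult) (simp_all add: comaximal_sym)
    from comaximal_powers[OF comaximal_sym[OF this]]
    show "comaximal (ps ! i) (ps ! j)" unfolding psi[OF i] psi[OF j] .
  qed
qed

lemma inv_gram_diag_iff:
  fixes Xs As :: "'a::field mat list"
  assumes X: "square_blocks Xs ks" and A: "square_blocks As ks"
  shows "diag_block_mat As \<in> inv_gram (diag_block_mat Xs) \<longleftrightarrow> (\<forall>i<length ks. As ! i \<in> inv_gram (Xs ! i))"
proof -
  note Xt = diag_block_transpose[OF X] and At = diag_block_transpose[OF A]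
  note At' = diag_block_uminus[OF At[THEN conjunct2]]
  note XA = diag_block_mult[OF X A]
  note XAX = diag_block_mult[OF XA[THEN conjunct2] Xt[THEN conjunct2]]
  have len: "length Xs = length ks" "length As = length ks" using X A by (auto dest: square_blocks_length)
  have "diag_block_mat As \<in> inv_gram (diag_block_mat Xs) \<longleftrightarrow> list_all2 (\<lambda>A k. A \<in> carrier (GL k)) As ks \<and>
     As = map uminus (map transpose_mat As) \<and> As = map2 (*) (map2 (*) Xs As) (map transpose_mat Xs)"
    unfolding inv_gram_iff[OF diag_block_carrier[OF X]] diag_block_GL_iff[OF A] Xt[THEN conjunct1] At[THEN conjunct1] At'[THEN conjunct1]
      XA[THEN conjunct1] XAX[THEN conjunct1] diag_block_eq_iff[OF A At'[THEN conjunct2]] diag_block_eq_iff[OF A XAX[THEN conjunct2]] ..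
  also have "\<dots> \<longleftrightarrow> (\<forall>i<length ks. As ! i \<in> carrier (GL (ks ! i)) \<and> As ! i = - transpose_mat (As ! i) \<and> As ! i = Xs ! i * As ! i * transpose_mat (Xs ! i))"
  proof -
    have "list_all2 (\<lambda>A k. A \<in> carrier (GL k)) As ks \<longleftrightarrow> (\<forall>i<length ks. As ! i \<in> carrier (GL (ks ! i)))"
      "As = map uminus (map transpose_mat As) \<longleftrightarrow> (\<forall>i<length ks. As ! i = - transpose_mat (As ! i))"
      "As = map2 (*) (map2 (*) Xs As) (map transpose_mat Xs) \<longleftrightarrow> (\<forall>i<length ks. As ! i = Xs ! i * As ! i * transpose_mat (Xs ! i))"
      unfolding list_all2_conv_all_nth list_eq_iff_nth_eq using len by simp_all
    thus ?thesis by blast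
  qed
  also have "\<dots> \<longleftrightarrow> (\<forall>i<length ks. As ! i \<in> inv_gram (Xs ! i))"
    using X inv_gram_iff[of "Xs ! i" "ks ! i" "As ! i" for i] unfolding square_blocks_nth by blast
  finally show ?thesis .
qed

text \<open>\<open>A\<close> intertwines the inverse of the block diagonal matrix with its
  transpose. Both are block diagonal of the same shape, with the same annihilating polynomials block
  by block.\<close>

theorem inv_gram_primary_block_diag:
  fixes Xs :: "'a::field mat list"
  assumes pb: "primary_blocks Xs gs" and A: "A \<in> inv_gram (diag_block_mat Xs)"
  shows "\<exists>As. length As = length Xs \<and> A = diag_block_mat As \<and> (\<forall>i<length Xs. As ! i \<in> inv_gram (Xs ! i))"
proof -
  obtain ks ps where k: "length ks = length Xs" "length ps = length ks" "\<And>i. i < length ks \<Longrightarrow> Xs ! i \<in> carrier (GL (ks ! i))"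
    "\<And>i. i < length ks \<Longrightarrow> poly_mat (ps ! i) (Xs ! i) = 0\<^sub>m (ks ! i) (ks ! i)"
    "\<And>i. i < length ks \<Longrightarrow> poly_mat (ps ! i) (transpose_mat (Xs ! i)) = 0\<^sub>m (ks ! i) (ks ! i)"
    "\<And>i. i < length ks \<Longrightarrow> poly_mat (ps ! i) (inv\<^bsub>GL (ks ! i)\<^esub> (Xs ! i)) = 0\<^sub>m (ks ! i) (ks ! i)"
    "\<And>i j. i < length ks \<Longrightarrow> j < length ks \<Longrightarrow> i \<noteq> j \<Longrightarrow> comaximal (ps ! i) (ps ! j)"
    using primary_annihilators[OF pb] by blast
  have X: "square_blocks Xs ks" using k(1,3) by (auto simp: square_blocks_nth GL_carrier)
  let ?n = "sum_list ks" and ?X = "diag_block_mat Xs"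
  have XG: "?X \<in> carrier (GL ?n)" using k(1,3) diag_block_GL_iff[OF X] by (auto simp: list_all2_conv_all_nth)
  define Is where "Is = map (\<lambda>i. inv\<^bsub>GL (ks ! i)\<^esub> (Xs ! i)) [0..<length ks]"
  have I: "square_blocks Is ks" using k(3) by (auto simp: square_blocks_nth Is_def)
  note T = diag_block_transpose[OF X]
  have "map2 (*) Xs Is = map 1\<^sub>m ks" using k(1,3) by (intro nth_equalityI) (auto simp: Is_def)
  hence "?X * diag_block_mat Is = 1\<^sub>m ?n" using diag_block_mult[OF X I] diag_block_one(1) by metis
  hence inv: "inv\<^bsub>GL ?n\<^esub> ?X = diag_block_mat Is"
    by (intro GL_inv_unique diag_block_carrier X I)
  have Ac: "A \<in> carrier_mat ?n ?n" using A inv_gram_iff[OF diag_block_carrier[OF X]] GL_carrier by blast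
  have "diag_block_mat Is * A = A * diag_block_mat (map transpose_mat Xs)"
    using inv_gram_intertwine(1)[OF XG A] inv T by simp
  from intertwiner_block_diag[OF I T[THEN conjunct2] k(2) _ _ k(7) Ac this]
  obtain As where As: "square_blocks As ks" "A = diag_block_mat As" using k(1,5,6) by (auto simp: Is_def)
  show ?thesis using As A inv_gram_diag_iff[OF X As(1)] k(1) square_blocks_length[OF As(1)] by auto
qed

text \<open>A matrix that commutes with the block diagonal matrix is itself block diagonal, so the
  action decomposes into independent actions on the blocks.\<close>

theorem orbit_primary_blocks_iff:
  fixes Xs :: "'a::field mat list"
  assumes pb: "primary_blocks Xs gs" and len: "length As = length Xs" "length Bs = length Xs"
    and A: "\<And>i. i < length Xs \<Longrightarrow> As ! i \<in> inv_gram (Xs ! i)" and B: "\<And>i. i < length Xs \<Longrightarrow> Bs ! i \<in> inv_gram (Xs ! i)"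
  shows "orbit (centraliser (diag_block_mat Xs)) congr_act (diag_block_mat As) = orbit (centraliser (diag_block_mat Xs)) congr_act (diag_block_mat Bs)
    \<longleftrightarrow> (\<forall>i<length Xs. orbit (centraliser (Xs ! i)) congr_act (As ! i) = orbit (centraliser (Xs ! i)) congr_act (Bs ! i))"
proof -
  obtain ks ps where k: "length ks = length Xs" "length ps = length ks" "\<And>i. i < length ks \<Longrightarrow> Xs ! i \<in> carrier (GL (ks ! i))"
    "\<And>i. i < length ks \<Longrightarrow> poly_mat (ps ! i) (Xs ! i) = 0\<^sub>m (ks ! i) (ks ! i)"
    "\<And>i. i < length ks \<Longrightarrow> poly_mat (ps ! i) (transpose_mat (Xs ! i)) = 0\<^sub>m (ks ! i) (ks ! i)"
    "\<And>i. i < length ks \<Longrightarrow> poly_mat (ps ! i) (inv\<^bsub>GL (ks ! i)\<^esub> (Xs ! i)) = 0\<^sub>m (ks ! i) (ks ! i)"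
    "\<And>i j. i < length ks \<Longrightarrow> j < length ks \<Longrightarrow> i \<noteq> j \<Longrightarrow> comaximal (ps ! i) (ps ! j)"
    using primary_annihilators[OF pb] by blast
  have X: "square_blocks Xs ks" using k(1,3) by (auto simp: square_blocks_nth GL_carrier)
  let ?n = "sum_list ks" and ?X = "diag_block_mat Xs"
  note Xc = diag_block_carrier[OF X]
  have Xi: "Xs ! i \<in> carrier_mat (ks ! i) (ks ! i)" if "i < length ks" for i using k(3)[OF that] by (rule GL_carrier)
  have Ai: "As ! i \<in> carrier_mat (ks ! i) (ks ! i)" "Bs ! i \<in> carrier_mat (ks ! i) (ks ! i)" if "i < length ks" for i
    using inv_gram_carrier[OF A Xi[OF that]] inv_gram_carrier[OF B Xi[OF that]] that k(1) by simp_all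
  have As: "square_blocks As ks" and Bs: "square_blocks Bs ks" using Ai len k(1) by (auto simp: square_blocks_nth)
  have key: "Y \<in> carrier (centraliser ?X) \<and> Y * diag_block_mat As * transpose_mat Y = diag_block_mat Bs \<longleftrightarrow>
     (\<forall>i<length ks. Ys ! i \<in> carrier (centraliser (Xs ! i)) \<and> Ys ! i * As ! i * transpose_mat (Ys ! i) = Bs ! i)"
    if Ys: "square_blocks Ys ks" "Y = diag_block_mat Ys" for Y Ys
  proof -
    note T = diag_block_transpose[OF Ys(1)] and YA = diag_block_mult[OF Ys(1) As]
    note YAY = diag_block_mult[OF YA[THEN conjunct2] T[THEN conjunct2]]
    note YX = diag_block_mult[OF Ys(1) X] and XY = diag_block_mult[OF X Ys(1)]
    have lY: "length Ys = length ks" using Ys(1) by (rule square_blocks_length)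
    have "Y \<in> carrier (centraliser ?X) \<and> Y * diag_block_mat As * transpose_mat Y = diag_block_mat Bs \<longleftrightarrow>
      list_all2 (\<lambda>A k. A \<in> carrier (GL k)) Ys ks \<and> map2 (*) Ys Xs = map2 (*) Xs Ys \<and>
      map2 (*) (map2 (*) Ys As) (map transpose_mat Ys) = Bs"
      unfolding centraliser_iff[OF Xc] Ys(2) diag_block_GL_iff[OF Ys(1)] T[THEN conjunct1] YA[THEN conjunct1] YAY[THEN conjunct1]
        YX[THEN conjunct1] XY[THEN conjunct1] diag_block_eq_iff[OF YX[THEN conjunct2] XY[THEN conjunct2]]
        diag_block_eq_iff[OF YAY[THEN conjunct2] Bs] by blast
    also have "\<dots> \<longleftrightarrow> (\<forall>i<length ks. Ys ! i \<in> carrier (GL (ks ! i)) \<and> Ys ! i * Xs ! i = Xs ! i * Ys ! i \<and> Ys ! i * As ! i * transpose_mat (Ys ! i) = Bs ! i)"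
      using len k(1) lY by (auto simp: list_all2_conv_all_nth list_eq_iff_nth_eq)
    finally show ?thesis using Xi centraliser_iff[of "Xs ! i" "ks ! i" "Ys ! i" for i] by simp
  qed
  have "orbit (centraliser ?X) congr_act (diag_block_mat As) = orbit (centraliser ?X) congr_act (diag_block_mat Bs) \<longleftrightarrow>
     (\<exists>Y\<in>carrier (centraliser ?X). Y * diag_block_mat As * transpose_mat Y = diag_block_mat Bs)"
    by (rule orbit_eq_iff[OF Xc diag_block_carrier[OF As] diag_block_carrier[OF Bs]])
  also have "\<dots> \<longleftrightarrow> (\<forall>i<length ks. \<exists>Y\<in>carrier (centraliser (Xs ! i)). Y * As ! i * transpose_mat Y = Bs ! i)"
  proof
    assume "\<exists>Y\<in>carrier (centraliser ?X). Y * diag_block_mat As * transpose_mat Y = diag_block_mat Bs"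
    then obtain Y where Y: "Y \<in> carrier (centraliser ?X)" "Y * diag_block_mat As * transpose_mat Y = diag_block_mat Bs" by blast
    have "Y \<in> carrier_mat ?n ?n" "?X * Y = Y * ?X" using Y(1) GL_carrier by (auto simp: centraliser_iff[OF Xc])
    from intertwiner_block_diag[OF X X k(2) k(4) k(4) k(7) this]
    obtain Ys where "square_blocks Ys ks" "Y = diag_block_mat Ys" by blast
    from key[OF this] Y show "\<forall>i<length ks. \<exists>Y\<in>carrier (centraliser (Xs ! i)). Y * As ! i * transpose_mat Y = Bs ! i" by blast
  next
    assume "\<forall>i<length ks. \<exists>Y\<in>carrier (centraliser (Xs ! i)). Y * As ! i * transpose_mat Y = Bs ! i"
    then obtain F where F: "\<And>i. i < length ks \<Longrightarrow> F i \<in> carrier (centraliser (Xs ! i)) \<and> F i * As ! i * transpose_mat (F i) = Bs ! i"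
      by metis
    define Ys where "Ys = map F [0..<length ks]"
    have "F i \<in> carrier_mat (ks ! i) (ks ! i)" if "i < length ks" for i
      using F[OF that] centraliser_iff[OF Xi[OF that]] GL_carrier by blast
    hence "square_blocks Ys ks" by (simp add: square_blocks_nth Ys_def)
    from key[OF this refl] F show "\<exists>Y\<in>carrier (centraliser ?X). Y * diag_block_mat As * transpose_mat Y = diag_block_mat Bs"
      by (auto simp: Ys_def)
  qed
  also have "\<dots> \<longleftrightarrow> (\<forall>i<length ks. orbit (centraliser (Xs ! i)) congr_act (As ! i) = orbit (centraliser (Xs ! i)) congr_act (Bs ! i))"
    using orbit_eq_iff[OF Xi Ai(1) Ai(2)] by auto
  finally show ?thesis unfolding k(1) .
qed

section \<open>Alternating forms and their symplectic groups\<close>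

text \<open>The scalar product \<open>u \<bullet> (A *\<^sub>v v)\<close> is the value u A v' for
  row vectors.\<close>

definition gram_rep :: "nat \<Rightarrow> ('a::field vec \<Rightarrow> 'a vec \<Rightarrow> 'a) \<Rightarrow> 'a mat \<Rightarrow> bool" where
  "gram_rep N f A \<longleftrightarrow> A \<in> carrier_mat N N \<and> (\<forall>u\<in>carrier_vec N. \<forall>v\<in>carrier_vec N. f u v = u \<bullet> (A *\<^sub>v v))"

text \<open>Induction over the truncations of \<open>u\<close>, since \<open>h\<close> is only known
  to be linear on vectors of length \<open>N\<close>.\<close>

lemma linear_functional_eq_sum:
  fixes h :: "'a::field vec \<Rightarrow> 'a"
  assumes add: "\<And>u v. u \<in> carrier_vec N \<Longrightarrow> v \<in> carrier_vec N \<Longrightarrow> h (u + v) = h u + h v"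
    and smult: "\<And>c u. u \<in> carrier_vec N \<Longrightarrow> h (c \<cdot>\<^sub>v u) = c * h u" and u: "u \<in> carrier_vec N"
  shows "h u = (\<Sum>i<N. u $ i * h (unit_vec N i))"
proof -
  define tr where "tr k = vec N (\<lambda>i. if i < k then u $ i else 0)" for k
  have "h (tr k) = (\<Sum>i<k. u $ i * h (unit_vec N i))" if "k \<le> N" for k
    using that
  proof (induction k)
    case 0
    have "tr 0 = 0 \<cdot>\<^sub>v u" using u by (intro eq_vecI) (auto simp: tr_def)
    thus ?case using smult[OF u, of 0] by simp
  next
    case (Suc k)
    have "tr (Suc k) = tr k + u $ k \<cdot>\<^sub>v unit_vec N k"
      using Suc.prems by (intro eq_vecI) (auto simp: tr_def less_Suc_eq)
    hence "h (tr (Suc k)) = h (tr k) + h (u $ k \<cdot>\<^sub>v unit_vec N k)" using add[of "tr k" "u $ k \<cdot>\<^sub>v unit_vec N k"] by (simp add: tr_def)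
    thus ?case using Suc smult[of "unit_vec N k" "u $ k"] by simp
  qed
  from this[of N] have "h (tr N) = (\<Sum>i<N. u $ i * h (unit_vec N i))" by simp
  moreover have "tr N = u" using u by (intro eq_vecI) (auto simp: tr_def)
  ultimately show ?thesis by simp
qed

lemma bilinear_form_index:
  assumes A: "A \<in> carrier_mat N N" and "i < N" "j < N"
  shows "unit_vec N i \<bullet> (A *\<^sub>v unit_vec N j) = (A $$ (i,j) :: 'a::field)"
  using assms by (simp add: scalar_prod_left_unit[of _ N])

lemma gram_rep_exists:
  assumes f: "nondeg_alternating_form N f"
  shows "\<exists>A. gram_rep N f A"
proof -
  have add: "f (u + v) w = f u w + f v w" "f w (u + v) = f w u + f w v" if "u \<in> carrier_vec N" "v \<in> carrier_vec N" "w \<in> carrier_vec N" for u v w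
    using f that by (auto simp: nondeg_alternating_form_def)
  have smult: "f (c \<cdot>\<^sub>v u) v = c * f u v" "f u (c \<cdot>\<^sub>v v) = c * f u v" if "u \<in> carrier_vec N" "v \<in> carrier_vec N" for c u v
    using f that by (auto simp: nondeg_alternating_form_def)
  define A where "A = mat N N (\<lambda>(i,j). f (unit_vec N i) (unit_vec N j))"
  have A: "A \<in> carrier_mat N N" by (simp add: A_def)
  have "f u v = u \<bullet> (A *\<^sub>v v)" if uv: "u \<in> carrier_vec N" "v \<in> carrier_vec N" for u v
  proof -
    have "f u v = (\<Sum>i<N. u $ i * f (unit_vec N i) v)"
      by (rule linear_functional_eq_sum) (use uv add smult in auto)
    also have "\<dots> = (\<Sum>i<N. u $ i * (\<Sum>j<N. v $ j * f (unit_vec N i) (unit_vec N j)))"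
    proof (rule sum.cong[OF refl])
      fix i assume "i \<in> {..<N}"
      have "f (unit_vec N i) v = (\<Sum>j<N. v $ j * f (unit_vec N i) (unit_vec N j))"
        by (rule linear_functional_eq_sum) (use uv add smult in auto)
      thus "u $ i * f (unit_vec N i) v = u $ i * (\<Sum>j<N. v $ j * f (unit_vec N i) (unit_vec N j))" by simp
    qed
    also have "\<dots> = u \<bullet> (A *\<^sub>v v)"
      using uv by (auto simp: scalar_prod_def A_def atLeast0LessThan mult.commute intro!: sum.cong)
    finally show ?thesis .
  qed
  thus ?thesis using A by (auto simp: gram_rep_def)
qed

lemma row_act_form:
  assumes A: "A \<in> carrier_mat N N" and S: "S \<in> carrier_mat N N" and u: "u \<in> carrier_vec N" and v: "v \<in> carrier_vec N"
  shows "row_act u S \<bullet> (A *\<^sub>v row_act v S) = u \<bullet> ((S * A * transpose_mat S) *\<^sub>v v)"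
proof -
  let ?w = "A *\<^sub>v (transpose_mat S *\<^sub>v v)"
  have S': "transpose_mat S \<in> carrier_mat N N" using S by simp
  have w: "?w \<in> carrier_vec N" using A S v by auto
  have "(transpose_mat S *\<^sub>v u) \<bullet> ?w = u \<bullet> (S *\<^sub>v ?w)"
    using transpose_vec_mult_scalar[OF S w u] .
  also have "S *\<^sub>v ?w = (S * A * transpose_mat S) *\<^sub>v v"
    using assoc_mult_mat_vec[OF mult_carrier_mat[OF S A] S' v] assoc_mult_mat_vec[OF S A, of "transpose_mat S *\<^sub>v v"] S' v
    by simp
  finally show ?thesis by (simp add: row_act_def)
qed

lemma Sp_iff:
  assumes g: "gram_rep N f A"
  shows "S \<in> carrier (Sp N f) \<longleftrightarrow> S \<in> carrier (GL N) \<and> S * A * transpose_mat S = A"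
proof -
  have A: "A \<in> carrier_mat N N" and f: "\<And>u v. u \<in> carrier_vec N \<Longrightarrow> v \<in> carrier_vec N \<Longrightarrow> f u v = u \<bullet> (A *\<^sub>v v)"
    using g by (auto simp: gram_rep_def)
  show ?thesis
  proof (cases "S \<in> carrier (GL N)")
    case True
    note Sc = GL_carrier[OF True]
    let ?B = "S * A * transpose_mat S"
    have ra: "row_act u S \<in> carrier_vec N" if "u \<in> carrier_vec N" for u using Sc that by (auto simp: row_act_def)
    have e: "f (row_act u S) (row_act v S) = u \<bullet> (?B *\<^sub>v v)" if "u \<in> carrier_vec N" "v \<in> carrier_vec N" for u v
      using f[OF ra ra] row_act_form[OF A Sc] that by simp
    have "(\<forall>u\<in>carrier_vec N. \<forall>v\<in>carrier_vec N. u \<bullet> (?B *\<^sub>v v) = u \<bullet> (A *\<^sub>v v)) \<longleftrightarrow> ?B = A"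
    proof
      assume *: "\<forall>u\<in>carrier_vec N. \<forall>v\<in>carrier_vec N. u \<bullet> (?B *\<^sub>v v) = u \<bullet> (A *\<^sub>v v)"
      have B: "?B \<in> carrier_mat N N" using Sc A by simp
      show "?B = A"
      proof (rule eq_matI)
        fix i j assume "i < dim_row A" "j < dim_col A"
        hence ij: "i < N" "j < N" using A by auto
        show "?B $$ (i,j) = A $$ (i,j)"
          using *[rule_format, of "unit_vec N i" "unit_vec N j"] bilinear_form_index[OF A ij] bilinear_form_index[OF B ij] by simp
      qed (use B A in auto)
    qed simp
    thus ?thesis using True e f by (simp add: Sp_def)
  qed (simp add: Sp_def)
qed

lemma gram_rep_nondeg:
  assumes f: "nondeg_alternating_form N f" and g: "gram_rep N f A"
  shows "A \<in> carrier (GL N)" "A = - transpose_mat A"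
proof -
  have A: "A \<in> carrier_mat N N" and fA: "\<And>u v. u \<in> carrier_vec N \<Longrightarrow> v \<in> carrier_vec N \<Longrightarrow> f u v = u \<bullet> (A *\<^sub>v v)"
    using g by (auto simp: gram_rep_def)
  have nd: "\<And>u. u \<in> carrier_vec N \<Longrightarrow> (\<forall>v\<in>carrier_vec N. f u v = 0) \<Longrightarrow> u = 0\<^sub>v N" and alt: "\<And>u. u \<in> carrier_vec N \<Longrightarrow> f u u = 0"
    and add: "\<And>u v w. u \<in> carrier_vec N \<Longrightarrow> v \<in> carrier_vec N \<Longrightarrow> w \<in> carrier_vec N \<Longrightarrow> f (u + v) w = f u w + f v w \<and> f w (u + v) = f w u + f w v"
    using f by (auto simp: nondeg_alternating_form_def)
  have A': "transpose_mat A \<in> carrier_mat N N" using A by simp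
  have "det (transpose_mat A) \<noteq> 0"
  proof
    assume "det (transpose_mat A) = 0"
    then obtain u where u: "u \<in> carrier_vec N" "u \<noteq> 0\<^sub>v N" "transpose_mat A *\<^sub>v u = 0\<^sub>v N"
      using det_0_iff_vec_prod_zero_field[OF A'] by blast
    have "f u v = 0" if v: "v \<in> carrier_vec N" for v
      using fA[OF u(1) v] transpose_vec_mult_scalar[OF A v u(1)] u(3) v by simp
    thus False using nd u by blast
  qed
  thus "A \<in> carrier (GL N)" using GL_det[OF A] det_transpose[OF A] by simp
  show "A = - transpose_mat A"
  proof (rule eq_matI)
    fix i j assume "i < dim_row (- transpose_mat A)" "j < dim_col (- transpose_mat A)"
    hence ij: "i < N" "j < N" using A by auto
    let ?a = "unit_vec N i :: 'a vec" and ?b = "unit_vec N j :: 'a vec"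
    have c: "?a \<in> carrier_vec N" "?b \<in> carrier_vec N" by auto
    have "f ?a ?b + f ?b ?a = f (?a + ?b) (?a + ?b)"
      using add[OF c, of "?a + ?b"] add[OF c c(1)] add[OF c c(2)] alt[OF c(1)] alt[OF c(2)] c by simp
    also have "\<dots> = 0" using c by (intro alt) auto
    finally have "A $$ (i,j) + A $$ (j,i) = 0"
      using fA[OF c] fA[OF c(2,1)] bilinear_form_index[OF A] ij by simp
    thus "A $$ (i,j) = (- transpose_mat A) $$ (i,j)" using ij A by (simp add: eq_neg_iff_add_eq_0)
  qed (use A in auto)
qed

lemma Sp_closed:
  assumes g: "gram_rep N f A"
  shows "1\<^sub>m N \<in> carrier (Sp N f)"
    and "h \<in> carrier (Sp N f) \<Longrightarrow> k \<in> carrier (Sp N f) \<Longrightarrow> h * k \<in> carrier (Sp N f)"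
    and "h \<in> carrier (Sp N f) \<Longrightarrow> inv\<^bsub>GL N\<^esub> h \<in> carrier (Sp N f)"
proof -
  have A: "A \<in> carrier_mat N N" using g by (simp add: gram_rep_def)
  show "1\<^sub>m N \<in> carrier (Sp N f)" using A by (simp add: Sp_iff[OF g])
  show "inv\<^bsub>GL N\<^esub> h \<in> carrier (Sp N f)" if h: "h \<in> carrier (Sp N f)"
  proof -
    have h: "h \<in> carrier (GL N)" "h * A * transpose_mat h = A" using h by (auto simp: Sp_iff[OF g])
    have "inv\<^bsub>GL N\<^esub> h * A * transpose_mat (inv\<^bsub>GL N\<^esub> h) = A" using congr_inv[OF A h(1)] unfolding h(2) .
    thus ?thesis using h(1) by (simp add: Sp_iff[OF g])
  qed
  show "h * k \<in> carrier (Sp N f)" if hk: "h \<in> carrier (Sp N f)" "k \<in> carrier (Sp N f)"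
  proof -
    have h: "h \<in> carrier (GL N)" "h * A * transpose_mat h = A" and k: "k \<in> carrier (GL N)" "k * A * transpose_mat k = A"
      using hk by (auto simp: Sp_iff[OF g])
    have "(h * k) * A * transpose_mat (h * k) = A"
      using congr_mult[OF A GL_carrier[OF k(1)] GL_carrier[OF h(1)]] unfolding k(2) h(2) by simp
    thus ?thesis using h k by (simp add: Sp_iff[OF g])
  qed
qed

text \<open>\<open>conj_class\<close> takes inverses in the group to which it is applied; this
  identification permits all computations to take place in the general linear group.\<close>

lemma Sp_inv:
  assumes g: "gram_rep N f A" and h: "h \<in> carrier (Sp N f)"
  shows "inv\<^bsub>Sp N f\<^esub> h = inv\<^bsub>GL N\<^esub> h"
proof -
  let ?H = "carrier (Sp N f)"
  have sub: "?H \<subseteq> carrier (GL N)" by (auto simp: Sp_def)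
  have "subgroup ?H (GL N)"
    by (rule group.subgroupI[OF group_GL sub]) (use Sp_closed[OF g] in auto)
  from group.m_inv_consistent[OF group_GL this h] show ?thesis by (simp add: Sp_def)
qed

lemma conj_class_Sp:
  assumes g: "gram_rep N f A"
  shows "conj_class (Sp N f) x = {inv\<^bsub>GL N\<^esub> h * x * h | h. h \<in> carrier (Sp N f)}"
proof -
  have "x \<otimes>\<^bsub>Sp N f\<^esub> y = x * y" for x y using GL_mult[where n=N and x=x and y=y] by (simp add: Sp_def)
  thus ?thesis unfolding conj_class_def by (intro Collect_cong iff_exI) (auto simp: Sp_inv[OF g])
qed

lemma conj_class_Sp_eq_iff:
  assumes g: "gram_rep N f A" and x: "x \<in> carrier_mat N N" and y: "y \<in> carrier_mat N N"
  shows "conj_class (Sp N f) x = conj_class (Sp N f) y \<longleftrightarrow> (\<exists>h\<in>carrier (Sp N f). h * x = y * h)"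
proof -
  have G: "h \<in> carrier (GL N)" if "h \<in> carrier (Sp N f)" for h using that by (simp add: Sp_def)
  have mem: "z \<in> conj_class (Sp N f) x \<longleftrightarrow> z \<in> carrier_mat N N \<and> (\<exists>h\<in>carrier (Sp N f). h * z = x * h)" if x: "x \<in> carrier_mat N N" for x z
  proof
    assume "z \<in> conj_class (Sp N f) x"
    then obtain h where h: "h \<in> carrier (Sp N f)" "z = inv\<^bsub>GL N\<^esub> h * x * h" by (auto simp: conj_class_Sp[OF g])
    note hc = GL_carrier[OF G[OF h(1)]] GL_inv_carrier[OF G[OF h(1)]]
    have "h * z = x * h" unfolding h(2) using G[OF h(1)] hc x by (simp add: sq_assoc[where n=N])
    thus "z \<in> carrier_mat N N \<and> (\<exists>h\<in>carrier (Sp N f). h * z = x * h)" using h hc x by auto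
  next
    assume "z \<in> carrier_mat N N \<and> (\<exists>h\<in>carrier (Sp N f). h * z = x * h)"
    then obtain h where z: "z \<in> carrier_mat N N" and h: "h \<in> carrier (Sp N f)" "h * z = x * h" by blast
    note hc = GL_carrier[OF G[OF h(1)]] GL_inv_carrier[OF G[OF h(1)]]
    have "z = inv\<^bsub>GL N\<^esub> h * (h * z)" using G[OF h(1)] z by simp
    also have "\<dots> = inv\<^bsub>GL N\<^esub> h * x * h" unfolding h(2) using hc x by (simp add: sq_assoc[where n=N])
    finally show "z \<in> conj_class (Sp N f) x" using h(1) by (auto simp: conj_class_Sp[OF g])
  qed
  have sub: "conj_class (Sp N f) x \<subseteq> conj_class (Sp N f) y" if x: "x \<in> carrier_mat N N" and y: "y \<in> carrier_mat N N"
    and h: "h \<in> carrier (Sp N f)" "h * x = y * h" for x y h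
  proof
    fix z assume "z \<in> conj_class (Sp N f) x"
    then obtain k where z: "z \<in> carrier_mat N N" and k: "k \<in> carrier (Sp N f)" "k * z = x * k" using mem[OF x] by blast
    note c = GL_carrier[OF G[OF h(1)]] GL_carrier[OF G[OF k(1)]]
    have "h * k * z = h * (k * z)" using c z by (simp add: sq_assoc[where n=N])
    also have "\<dots> = h * x * k" unfolding k(2) using c x by (simp add: sq_assoc[where n=N])
    also have "\<dots> = y * (h * k)" unfolding h(2) using c y by (simp add: sq_assoc[where n=N])
    finally show "z \<in> conj_class (Sp N f) y" using mem[OF y] z Sp_closed(2)[OF g h(1) k(1)] by blast
  qed
  show ?thesis
  proof
    assume eq: "conj_class (Sp N f) x = conj_class (Sp N f) y"
    have "x \<in> conj_class (Sp N f) x" using mem[OF x] x Sp_closed(1)[OF g] by (metis left_mult_one_mat right_mult_one_mat)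
    thus "\<exists>h\<in>carrier (Sp N f). h * x = y * h" unfolding eq using mem[OF y] by blast
  next
    assume "\<exists>h\<in>carrier (Sp N f). h * x = y * h"
    then obtain h where h: "h \<in> carrier (Sp N f)" "h * x = y * h" by blast
    have "inv\<^bsub>GL N\<^esub> h * y = x * inv\<^bsub>GL N\<^esub> h"
    proof -
      note c = GL_carrier[OF G[OF h(1)]] GL_inv_carrier[OF G[OF h(1)]]
      have "inv\<^bsub>GL N\<^esub> h * y = inv\<^bsub>GL N\<^esub> h * (y * h) * inv\<^bsub>GL N\<^esub> h" using c y G[OF h(1)] by (simp add: sq_assoc[where n=N])
      also have "\<dots> = x * inv\<^bsub>GL N\<^esub> h" unfolding h(2)[symmetric] using c x G[OF h(1)] by (simp add: sq_assoc[where n=N])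
      finally show ?thesis .
    qed
    from sub[OF x y h] sub[OF y x Sp_closed(3)[OF g h(1)] this]
    show "conj_class (Sp N f) x = conj_class (Sp N f) y" by blast
  qed
qed

text \<open>Transport along \<open>S\<close>: the conjugate S^{-1} X S preserves the form with
  matrix A0 exactly when \<open>X\<close> preserves the form with matrix S A0 S'.\<close>

lemma conj_in_Sp_iff:
  fixes X :: "'a::field mat"
  assumes g: "gram_rep N f A0" and A0: "A0 \<in> carrier (GL N)" "A0 = - transpose_mat A0"
    and X: "X \<in> carrier (GL N)" and S: "S \<in> carrier (GL N)"
  shows "inv\<^bsub>GL N\<^esub> S * X * S \<in> carrier (Sp N f) \<longleftrightarrow> S * A0 * transpose_mat S \<in> inv_gram X"
proof -
  note c = GL_carrier[OF A0(1)] GL_carrier[OF X] GL_carrier[OF S] GL_inv_carrier[OF S]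
  let ?Y = "inv\<^bsub>GL N\<^esub> S * X * S" and ?A = "S * A0 * transpose_mat S"
  have Y: "?Y \<in> carrier (GL N)" using X S by simp
  have AG: "?A \<in> carrier (GL N)" using A0(1) S GL_transpose[OF S] by simp
  have t: "transpose_mat A0 = - A0" using A0(2) by (metis uminus_uminus_mat)
  have "transpose_mat ?A = S * transpose_mat A0 * transpose_mat S"
    using c by (simp add: sq_transpose_mult[where n=N] sq_assoc[where n=N])
  also have "\<dots> = - ?A" unfolding t using c by simp
  finally have sk: "?A = - transpose_mat ?A" by simp
  have XAX: "S * (?Y * A0 * transpose_mat ?Y) * transpose_mat S = X * ?A * transpose_mat X"
  proof -
    have SY: "S * ?Y = X * S" using c S by (simp add: sq_assoc[where n=N])
    have "S * (?Y * A0 * transpose_mat ?Y) * transpose_mat S = (S * ?Y) * A0 * transpose_mat (S * ?Y)"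
      using c by (intro congr_mult[where n=N]) auto
    also have "\<dots> = X * ?A * transpose_mat X" unfolding SY using c by (intro congr_mult[where n=N, symmetric]) auto
    finally show ?thesis .
  qed
  have "?Y * A0 * transpose_mat ?Y = A0 \<longleftrightarrow> X * ?A * transpose_mat X = ?A"
  proof
    assume "?Y * A0 * transpose_mat ?Y = A0"
    thus "X * ?A * transpose_mat X = ?A" using XAX by simp
  next
    assume e: "X * ?A * transpose_mat X = ?A"
    have "?Y * A0 * transpose_mat ?Y = inv\<^bsub>GL N\<^esub> S * (S * (?Y * A0 * transpose_mat ?Y) * transpose_mat S) * transpose_mat (inv\<^bsub>GL N\<^esub> S)"
      using c by (intro congr_inv[OF _ S, symmetric]) auto
    also have "\<dots> = A0" unfolding XAX e by (rule congr_inv[OF c(1) S])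
    finally show "?Y * A0 * transpose_mat ?Y = A0" .
  qed
  thus ?thesis unfolding Sp_iff[OF g] inv_gram_iff[OF c(2)] using Y AG sk by metis
qed

text \<open>A symplectic \<open>h\<close> that conjugates one of the two elements into the other
  corresponds to Y = S2 h S1^{-1}. Commuting with \<open>X\<close> expresses the conjugacy, and
  carrying S1 A0 S1' to S2 A0 S2' expresses that \<open>h\<close> is symplectic.\<close>

lemma conj_class_Sp_eq_iff_orbit:
  fixes X :: "'a::field mat"
  assumes g: "gram_rep N f A0" and X: "X \<in> carrier (GL N)" and S1: "S1 \<in> carrier (GL N)" and S2: "S2 \<in> carrier (GL N)"
  shows "conj_class (Sp N f) (inv\<^bsub>GL N\<^esub> S1 * X * S1) = conj_class (Sp N f) (inv\<^bsub>GL N\<^esub> S2 * X * S2) \<longleftrightarrow>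
    orbit (centraliser X) congr_act (S1 * A0 * transpose_mat S1) = orbit (centraliser X) congr_act (S2 * A0 * transpose_mat S2)"
proof -
  have A0: "A0 \<in> carrier_mat N N" using g by (simp add: gram_rep_def)
  note c = A0 GL_carrier[OF X] GL_carrier[OF S1] GL_carrier[OF S2] GL_inv_carrier[OF S1] GL_inv_carrier[OF S2]
  have "orbit (centraliser X) congr_act (S1 * A0 * transpose_mat S1) = orbit (centraliser X) congr_act (S2 * A0 * transpose_mat S2) \<longleftrightarrow>
    (\<exists>Y\<in>carrier (centraliser X). Y * (S1 * A0 * transpose_mat S1) * transpose_mat Y = S2 * A0 * transpose_mat S2)"
    using c by (intro orbit_eq_iff[where n=N]) auto
  also have "\<dots> \<longleftrightarrow> (\<exists>h\<in>carrier (Sp N f). h * (inv\<^bsub>GL N\<^esub> S1 * X * S1) = (inv\<^bsub>GL N\<^esub> S2 * X * S2) * h)"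
  proof
    assume "\<exists>Y\<in>carrier (centraliser X). Y * (S1 * A0 * transpose_mat S1) * transpose_mat Y = S2 * A0 * transpose_mat S2"
    then obtain Y where Y: "Y \<in> carrier (GL N)" "Y * X = X * Y" "Y * (S1 * A0 * transpose_mat S1) * transpose_mat Y = S2 * A0 * transpose_mat S2"
      using centraliser_iff[OF c(2)] by blast
    note Yc = GL_carrier[OF Y(1)]
    define h where "h = inv\<^bsub>GL N\<^esub> S2 * (Y * S1)"
    have hG: "h \<in> carrier (GL N)" using Y S1 S2 by (simp add: h_def)
    have "h * A0 * transpose_mat h = inv\<^bsub>GL N\<^esub> S2 * ((Y * S1) * A0 * transpose_mat (Y * S1)) * transpose_mat (inv\<^bsub>GL N\<^esub> S2)"
      unfolding h_def using c Yc by (intro congr_mult[where n=N, symmetric]) auto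
    also have "(Y * S1) * A0 * transpose_mat (Y * S1) = S2 * A0 * transpose_mat S2"
      unfolding Y(3)[symmetric] using c Yc by (intro congr_mult[where n=N, symmetric]) auto
    also have "inv\<^bsub>GL N\<^esub> S2 * (S2 * A0 * transpose_mat S2) * transpose_mat (inv\<^bsub>GL N\<^esub> S2) = A0" by (rule congr_inv[OF A0 S2])
    finally have "h \<in> carrier (Sp N f)" using hG by (simp add: Sp_iff[OF g])
    moreover have "h * (inv\<^bsub>GL N\<^esub> S1 * X * S1) = (inv\<^bsub>GL N\<^esub> S2 * X * S2) * h"
    proof -
      have "h * (inv\<^bsub>GL N\<^esub> S1 * X * S1) = inv\<^bsub>GL N\<^esub> S2 * ((Y * X) * S1)"
        unfolding h_def using c Yc S1 by (simp add: sq_assoc[where n=N])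
      also have "\<dots> = (inv\<^bsub>GL N\<^esub> S2 * X * S2) * h"
        unfolding h_def Y(2) using c Yc S2 by (simp add: sq_assoc[where n=N])
      finally show ?thesis .
    qed
    ultimately show "\<exists>h\<in>carrier (Sp N f). h * (inv\<^bsub>GL N\<^esub> S1 * X * S1) = (inv\<^bsub>GL N\<^esub> S2 * X * S2) * h" by blast
  next
    assume "\<exists>h\<in>carrier (Sp N f). h * (inv\<^bsub>GL N\<^esub> S1 * X * S1) = (inv\<^bsub>GL N\<^esub> S2 * X * S2) * h"
    then obtain h where h: "h \<in> carrier (GL N)" "h * A0 * transpose_mat h = A0" "h * (inv\<^bsub>GL N\<^esub> S1 * X * S1) = (inv\<^bsub>GL N\<^esub> S2 * X * S2) * h"
      using Sp_iff[OF g] by blast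
    note hc = GL_carrier[OF h(1)]
    define Y where "Y = S2 * (h * inv\<^bsub>GL N\<^esub> S1)"
    have YG: "Y \<in> carrier (GL N)" using h S1 S2 by (simp add: Y_def)
    have Yc: "Y \<in> carrier_mat N N" using YG by (rule GL_carrier)
    have "Y * X = S2 * (h * (inv\<^bsub>GL N\<^esub> S1 * X * S1)) * inv\<^bsub>GL N\<^esub> S1"
      unfolding Y_def using c hc S1 by (simp add: sq_assoc[where n=N])
    also have "\<dots> = X * Y" unfolding h(3) Y_def using c hc S2 by (simp add: sq_assoc[where n=N])
    finally have "Y \<in> carrier (centraliser X)" using YG c(2) by (simp add: centraliser_iff)
    moreover have "Y * (S1 * A0 * transpose_mat S1) * transpose_mat Y = S2 * A0 * transpose_mat S2"
    proof -
      have "Y * S1 = S2 * h" unfolding Y_def using c hc S1 by (simp add: sq_assoc[where n=N])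
      hence "Y * (S1 * A0 * transpose_mat S1) * transpose_mat Y = (S2 * h) * A0 * transpose_mat (S2 * h)"
        using congr_mult[OF A0 c(3) Yc] by simp
      also have "\<dots> = S2 * (h * A0 * transpose_mat h) * transpose_mat S2" by (rule congr_mult[OF A0 hc c(4), symmetric])
      finally show ?thesis unfolding h(2) .
    qed
    ultimately show "\<exists>Y\<in>carrier (centraliser X). Y * (S1 * A0 * transpose_mat S1) * transpose_mat Y = S2 * A0 * transpose_mat S2" by blast
  qed
  also have "\<dots> \<longleftrightarrow> conj_class (Sp N f) (inv\<^bsub>GL N\<^esub> S1 * X * S1) = conj_class (Sp N f) (inv\<^bsub>GL N\<^esub> S2 * X * S2)"
    using c by (intro conj_class_Sp_eq_iff[OF g, symmetric]) auto
  finally show ?thesis by blast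
qed

section \<open>Splitting off a non-degenerate block\<close>

lemma centraliser_four_block_diag:
  assumes "X1 \<in> carrier_mat a a" "X2 \<in> carrier_mat b b" "Y1 \<in> carrier (centraliser X1)" "Y2 \<in> carrier (centraliser X2)"
  shows "four_block_mat Y1 (0\<^sub>m a b) (0\<^sub>m b a) Y2 \<in> carrier (centraliser (four_block_mat X1 (0\<^sub>m a b) (0\<^sub>m b a) X2))"
proof -
  have Y: "Y1 \<in> carrier (GL a)" "Y1 * X1 = X1 * Y1" "Y2 \<in> carrier (GL b)" "Y2 * X2 = X2 * Y2" using assms by (auto simp: centraliser_iff)
  note c = GL_carrier[OF Y(1)] GL_carrier[OF Y(3)] assms(1,2)
  have "four_block_mat Y1 (0\<^sub>m a b) (0\<^sub>m b a) Y2 * four_block_mat X1 (0\<^sub>m a b) (0\<^sub>m b a) X2 = four_block_mat (Y1 * X1) (0\<^sub>m a b) (0\<^sub>m b a) (Y2 * X2)"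
    using c by (subst mult_four_block_mat[of _ a a _ b _ b _ _ a _ b]) auto
  moreover have "four_block_mat X1 (0\<^sub>m a b) (0\<^sub>m b a) X2 * four_block_mat Y1 (0\<^sub>m a b) (0\<^sub>m b a) Y2 = four_block_mat (X1 * Y1) (0\<^sub>m a b) (0\<^sub>m b a) (X2 * Y2)"
    using c by (subst mult_four_block_mat[of _ a a _ b _ b _ _ a _ b]) auto
  ultimately show ?thesis using Y c GL_four_block_diag[OF Y(1,3)] by (simp add: centraliser_iff[of _ "a + b"])
qed

lemma congr_four_block_diag:
  fixes A :: "'a::field mat"
  assumes "A \<in> carrier_mat a a" "B \<in> carrier_mat b b" "Y \<in> carrier_mat a a" "W \<in> carrier_mat b b"
  shows "four_block_mat Y (0\<^sub>m a b) (0\<^sub>m b a) W * four_block_mat A (0\<^sub>m a b) (0\<^sub>m b a) B * transpose_mat (four_block_mat Y (0\<^sub>m a b) (0\<^sub>m b a) W)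
    = four_block_mat (Y * A * transpose_mat Y) (0\<^sub>m a b) (0\<^sub>m b a) (W * B * transpose_mat W)"
proof -
  have 1: "four_block_mat Y (0\<^sub>m a b) (0\<^sub>m b a) W * four_block_mat A (0\<^sub>m a b) (0\<^sub>m b a) B = four_block_mat (Y * A) (0\<^sub>m a b) (0\<^sub>m b a) (W * B)"
    using assms by (subst mult_four_block_mat[of _ a a _ b _ b _ _ a _ b]) auto
  have 2: "transpose_mat (four_block_mat Y (0\<^sub>m a b) (0\<^sub>m b a) W) = four_block_mat (transpose_mat Y) (0\<^sub>m a b) (0\<^sub>m b a) (transpose_mat W)"
    using assms by (subst transpose_four_block_mat[of _ a a _ b _ b]) auto
  show ?thesis unfolding 1 2 using assms by (subst mult_four_block_mat[of _ a a _ b _ b _ _ a _ b]) auto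
qed

lemma inv_gram_four_block_iff:
  fixes A :: "'a::field mat"
  assumes c: "X1 \<in> carrier_mat a a" "X2 \<in> carrier_mat b b" "A \<in> carrier_mat a a" "B \<in> carrier_mat b b"
  shows "four_block_mat A (0\<^sub>m a b) (0\<^sub>m b a) B \<in> inv_gram (four_block_mat X1 (0\<^sub>m a b) (0\<^sub>m b a) X2) \<longleftrightarrow> A \<in> inv_gram X1 \<and> B \<in> inv_gram X2"
proof -
  have "diag_block_mat [X, Y] = four_block_mat X (0\<^sub>m a b) (0\<^sub>m b a) Y"
    if "X \<in> carrier_mat a a" "Y \<in> carrier_mat b b" for X Y :: "'a mat"
    using diag_block_Cons[of X a "[Y]" "[b]"] that by (simp del: diag_block_mat.simps)
  moreover have "(\<forall>i<length [a, b]. [A, B] ! i \<in> inv_gram ([X1, X2] ! i)) \<longleftrightarrow> A \<in> inv_gram X1 \<and> B \<in> inv_gram X2"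
    by (auto simp: less_Suc_eq)
  ultimately show ?thesis using inv_gram_diag_iff[of "[X1, X2]" "[a, b]" "[A, B]"] c by (simp del: diag_block_mat.simps)
qed

text \<open>Block elimination at an invertible leading block \<open>P\<close>. The point is that the
  eliminating shear commutes with the block diagonal matrix, which the invariance of the blocks
  \<open>P\<close> and \<open>R\<close> ensures.\<close>

lemma schur_step:
  fixes X1 :: "'a::field mat"
  assumes X1: "X1 \<in> carrier (GL a)" and X2: "X2 \<in> carrier (GL b)"
    and A: "four_block_mat P Q R W \<in> inv_gram (four_block_mat X1 (0\<^sub>m a b) (0\<^sub>m b a) X2)"
    and c: "Q \<in> carrier_mat a b" "R \<in> carrier_mat b a" "W \<in> carrier_mat b b" and PG: "P \<in> carrier (GL a)"
  shows "\<exists>L\<in>carrier (centraliser (four_block_mat X1 (0\<^sub>m a b) (0\<^sub>m b a) X2)). \<exists>W'\<in>inv_gram X2.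
     L * four_block_mat P Q R W * transpose_mat L = four_block_mat P (0\<^sub>m a b) (0\<^sub>m b a) W' \<and> P \<in> inv_gram X1"
proof -
  let ?X = "four_block_mat X1 (0\<^sub>m a b) (0\<^sub>m b a) X2" and ?A = "four_block_mat P Q R W"
  note Xc = GL_carrier[OF X1] GL_carrier[OF X2] and Pc = GL_carrier[OF PG] and Pi = GL_inv_carrier[OF PG]
  have X: "?X \<in> carrier_mat (a + b) (a + b)" using Xc by simp
  have A1: "?A = - transpose_mat ?A" "?A = ?X * ?A * transpose_mat ?X" using A unfolding inv_gram_iff[OF X] by blast+
  have At: "- transpose_mat ?A = four_block_mat (- transpose_mat P) (- transpose_mat R) (- transpose_mat Q) (- transpose_mat W)"
    using Pc c by (subst transpose_four_block_mat[of _ a a _ b _ b]) (auto intro!: eq_matI)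
  have "?A = four_block_mat (- transpose_mat P) (- transpose_mat R) (- transpose_mat Q) (- transpose_mat W)"
    using A1(1) unfolding At .
  moreover have "- transpose_mat P \<in> carrier_mat a a" "- transpose_mat R \<in> carrier_mat a b"
    "- transpose_mat Q \<in> carrier_mat b a" "- transpose_mat W \<in> carrier_mat b b" using Pc c by auto
  ultimately have sk: "P = - transpose_mat P" "Q = - transpose_mat R"
    using four_block_eq_iff[OF Pc c] by blast+
  have XA: "?X * ?A = four_block_mat (X1 * P) (X1 * Q) (X2 * R) (X2 * W)"
    using Xc Pc c by (subst mult_four_block_mat[of _ a a _ b _ b _ _ a _ b])
      (auto simp: left_add_zero_mat[OF mult_carrier_mat[of _ b b]] right_add_zero_mat[OF mult_carrier_mat[of _ a a]])
  have Xt: "transpose_mat ?X = four_block_mat (transpose_mat X1) (0\<^sub>m a b) (0\<^sub>m b a) (transpose_mat X2)"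
    using Xc by (subst transpose_four_block_mat[of _ a a _ b _ b]) auto
  have XAX: "?X * ?A * transpose_mat ?X = four_block_mat (X1 * P * transpose_mat X1) (X1 * Q * transpose_mat X2) (X2 * R * transpose_mat X1) (X2 * W * transpose_mat X2)"
    unfolding XA Xt using Xc Pc c by (subst mult_four_block_mat[of _ a a _ b _ b _ _ a _ b])
     (auto simp: left_add_zero_mat[OF mult_carrier_mat[of _ _ b]] right_add_zero_mat[OF mult_carrier_mat[of _ _ a]])
  have "?A = four_block_mat (X1 * P * transpose_mat X1) (X1 * Q * transpose_mat X2) (X2 * R * transpose_mat X1) (X2 * W * transpose_mat X2)"
    using A1(2) unfolding XAX .
  moreover have "X1 * P * transpose_mat X1 \<in> carrier_mat a a" "X1 * Q * transpose_mat X2 \<in> carrier_mat a b"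
     "X2 * R * transpose_mat X1 \<in> carrier_mat b a" "X2 * W * transpose_mat X2 \<in> carrier_mat b b" using Xc Pc c by auto
  ultimately have inv: "P = X1 * P * transpose_mat X1" "R = X2 * R * transpose_mat X1"
    using four_block_eq_iff[OF Pc c] by blast+
  have P: "P \<in> inv_gram X1" unfolding inv_gram_iff[OF Xc(1)] using PG sk(1) inv(1) by blast
  define U where "U = - (R * inv\<^bsub>GL a\<^esub> P)"
  have Uc: "U \<in> carrier_mat b a" using c Pi by (simp add: U_def)
  have UP: "U * P = - R"
    unfolding U_def using c Pi Pc PG by (simp add: assoc_mult_mat[of R b a _ a P a])
  \<comment> \<open>Invariance gives R X1'^{-1} = X2 R and P^{-1} X1 = X1'^{-1} P^{-1}. Together
    they show that R P^{-1} intertwines \<open>X2\<close> with \<open>X1\<close>.\<close>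
  have UX: "U * X1 = X2 * U"
  proof -
    have X1t: "transpose_mat X1 \<in> carrier (GL a)" using X1 by (rule GL_transpose)
    have e1: "inv\<^bsub>GL a\<^esub> P * X1 = inv\<^bsub>GL a\<^esub> (transpose_mat X1) * inv\<^bsub>GL a\<^esub> P"
    proof (rule GL_left_cancel[OF X1t])
      have "transpose_mat X1 * (inv\<^bsub>GL a\<^esub> P * X1) = (inv\<^bsub>GL a\<^esub> P * (P * transpose_mat X1)) * (inv\<^bsub>GL a\<^esub> P * X1)"
        using PG Xc by simp
      also have "P * transpose_mat X1 = inv\<^bsub>GL a\<^esub> X1 * P" using inv_gram_intertwine(1)[OF X1 P] by simp
      also have "(inv\<^bsub>GL a\<^esub> P * (inv\<^bsub>GL a\<^esub> X1 * P)) * (inv\<^bsub>GL a\<^esub> P * X1) = inv\<^bsub>GL a\<^esub> P"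
        using Pc Pi Xc X1 PG GL_inv_carrier[OF X1] by (simp add: sq_assoc[where n=a])
      finally show "transpose_mat X1 * (inv\<^bsub>GL a\<^esub> P * X1) = transpose_mat X1 * (inv\<^bsub>GL a\<^esub> (transpose_mat X1) * inv\<^bsub>GL a\<^esub> P)"
        using X1t PG by simp
    qed (use Pi Xc X1t in auto)
    have X1ti: "inv\<^bsub>GL a\<^esub> (transpose_mat X1) \<in> carrier_mat a a" using X1t by (rule GL_inv_carrier)
    have "R * (inv\<^bsub>GL a\<^esub> P * X1) = R * inv\<^bsub>GL a\<^esub> (transpose_mat X1) * inv\<^bsub>GL a\<^esub> P"
      unfolding e1 using c Pi X1ti by (intro assoc_mult_mat[symmetric, of _ b a _ a _ a]) auto
    also have "R * inv\<^bsub>GL a\<^esub> (transpose_mat X1) = X2 * R * transpose_mat X1 * inv\<^bsub>GL a\<^esub> (transpose_mat X1)"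
      by (rule arg_cong[OF inv(2)])
    also have "\<dots> = X2 * R * (transpose_mat X1 * inv\<^bsub>GL a\<^esub> (transpose_mat X1))"
      by (rule assoc_mult_mat[OF mult_carrier_mat[OF Xc(2) c(2)] GL_carrier[OF X1t] X1ti])
    also have "\<dots> = X2 * R" using X1t Xc c by simp
    finally have e2: "R * (inv\<^bsub>GL a\<^esub> P * X1) = X2 * R * inv\<^bsub>GL a\<^esub> P" .
    have "U * X1 = - (R * (inv\<^bsub>GL a\<^esub> P * X1))" unfolding U_def using c Pi Xc by (simp add: assoc_mult_mat[of R b a _ a X1 a])
    also have "\<dots> = X2 * U" unfolding e2 U_def using c Pi Xc by (simp add: assoc_mult_mat[of X2 b b R a _ a])
    finally show ?thesis .
  qed
  define L where "L = four_block_mat (1\<^sub>m a) (0\<^sub>m a b) U (1\<^sub>m b)"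
  have LG: "L \<in> carrier (GL (a + b))" unfolding L_def by (rule GL_four_block_lower[OF Uc])
  have "L * ?X = four_block_mat X1 (0\<^sub>m a b) (U * X1) X2"
    unfolding L_def using Xc Uc by (subst mult_four_block_mat[of _ a a _ b _ b _ _ a _ b]) auto
  moreover have "?X * L = four_block_mat X1 (0\<^sub>m a b) (X2 * U) X2"
    unfolding L_def using Xc Uc by (subst mult_four_block_mat[of _ a a _ b _ b _ _ a _ b]) auto
  ultimately have LC: "L \<in> carrier (centraliser ?X)" using LG UX by (simp add: centraliser_iff[OF X])
  define W' where "W' = U * Q + W"
  have W'c: "W' \<in> carrier_mat b b" using Uc c by (simp add: W'_def)
  have "L * ?A = four_block_mat P Q (- R + R) W'"
    unfolding L_def using Uc Pc c UP by (subst mult_four_block_mat[of _ a a _ b _ b _ _ a _ b]) (auto simp: W'_def)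
  also have "- R + R = 0\<^sub>m b a" using c by simp
  finally have LA: "L * ?A = four_block_mat P Q (0\<^sub>m b a) W'" .
  \<comment> \<open>By skew-symmetry the shear that clears the lower left block clears the upper
    right one when its transpose acts on the other side.\<close>
  have PU: "P * transpose_mat U + Q = 0\<^sub>m a b"
  proof -
    have "P * transpose_mat U = (- transpose_mat P) * transpose_mat U" by (rule arg_cong[OF sk(1)])
    also have "\<dots> = - (transpose_mat P * transpose_mat U)" using Uc Pc by simp
    also have "transpose_mat P * transpose_mat U = transpose_mat (U * P)" using transpose_mult[OF Uc Pc] by simp
    also have "\<dots> = Q" unfolding UP transpose_uminus sk(2)[symmetric] ..
    finally show ?thesis using c by simp
  qed
  have Lt: "transpose_mat L = four_block_mat (1\<^sub>m a) (transpose_mat U) (0\<^sub>m b a) (1\<^sub>m b)"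
    unfolding L_def using Uc by (subst transpose_four_block_mat[of _ a a _ b _ b]) auto
  have LAL: "L * ?A * transpose_mat L = four_block_mat P (0\<^sub>m a b) (0\<^sub>m b a) W'"
    unfolding LA Lt using PU Pc c W'c Uc by (subst mult_four_block_mat[of _ a a _ b _ b _ _ a _ b]) auto
  have "L * ?A * transpose_mat L \<in> inv_gram ?X" by (rule congr_inv_gram[OF X A LC])
  hence "W' \<in> inv_gram X2" unfolding LAL using inv_gram_four_block_iff[OF Xc Pc W'c] by blast
  thus ?thesis using LC LAL P by blast
qed

section \<open>Normal forms under congruence\<close>

text \<open>The relation of lying in one orbit of the centraliser, without a demand that the
  matrices be invariant or invertible; it can thus be asserted of a leading block before that block
  is known to be invertible.\<close>

definition congruent_over :: "'a::field mat \<Rightarrow> 'a mat \<Rightarrow> 'a mat \<Rightarrow> bool" where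
  "congruent_over X A B \<longleftrightarrow> (\<exists>Y\<in>carrier (centraliser X). Y * A * transpose_mat Y = B)"

lemma congruent_over_trans:
  assumes X: "X \<in> carrier_mat n n" and A: "A \<in> carrier_mat n n" and "congruent_over X A B" "congruent_over X B C"
  shows "congruent_over X A C"
proof -
  obtain Y W where Y: "Y \<in> carrier (centraliser X)" "Y * A * transpose_mat Y = B"
    and W: "W \<in> carrier (centraliser X)" "W * B * transpose_mat W = C" using assms(3,4) by (auto simp: congruent_over_def)
  have "Y \<in> carrier_mat n n" "W \<in> carrier_mat n n" using Y(1) W(1) GL_carrier by (auto simp: centraliser_iff[OF X])
  hence "(W * Y) * A * transpose_mat (W * Y) = C" using congr_mult[OF A, of Y W] Y(2) W(2) by simp
  thus ?thesis using centraliser_closed(2)[OF X W(1) Y(1)] by (auto simp: congruent_over_def)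
qed

lemma congruent_over_sym:
  assumes X: "X \<in> carrier_mat n n" and A: "A \<in> carrier_mat n n" and "congruent_over X A B"
  shows "congruent_over X B A"
proof -
  obtain Y where Y: "Y \<in> carrier (centraliser X)" "Y * A * transpose_mat Y = B" using assms(3) by (auto simp: congruent_over_def)
  have "Y \<in> carrier (GL n)" using Y(1) by (simp add: centraliser_iff[OF X])
  from congr_inv[OF A this] show ?thesis unfolding congruent_over_def Y(2)
    using centraliser_closed(3)[OF X Y(1)] by blast
qed

lemma congruent_over_refl:
  assumes X: "X \<in> carrier_mat n n" and A: "A \<in> carrier_mat n n"
  shows "congruent_over X A A"
  unfolding congruent_over_def using centraliser_closed(1)[OF X] A by (intro bexI[of _ "1\<^sub>m n"]) auto

lemma orbit_eq_iff_congruent: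
  "Z \<in> carrier_mat n n \<Longrightarrow> A \<in> carrier_mat n n \<Longrightarrow> B \<in> carrier_mat n n \<Longrightarrow>
    orbit (centraliser Z) congr_act A = orbit (centraliser Z) congr_act B \<longleftrightarrow> congruent_over Z A B"
  unfolding congruent_over_def by (rule orbit_eq_iff)

lemma congruent_over_four_block:
  assumes c: "X1 \<in> carrier_mat a a" "X2 \<in> carrier_mat b b" "A1 \<in> carrier_mat a a" "A2 \<in> carrier_mat b b"
    and "congruent_over X1 A1 B1" "congruent_over X2 A2 B2"
  shows "congruent_over (four_block_mat X1 (0\<^sub>m a b) (0\<^sub>m b a) X2) (four_block_mat A1 (0\<^sub>m a b) (0\<^sub>m b a) A2)
    (four_block_mat B1 (0\<^sub>m a b) (0\<^sub>m b a) B2)"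
proof -
  obtain Y1 Y2 where Y: "Y1 \<in> carrier (centraliser X1)" "Y1 * A1 * transpose_mat Y1 = B1"
    "Y2 \<in> carrier (centraliser X2)" "Y2 * A2 * transpose_mat Y2 = B2" using assms(5,6) by (auto simp: congruent_over_def)
  have "Y1 \<in> carrier_mat a a" "Y2 \<in> carrier_mat b b" using Y(1,3) GL_carrier by (auto simp: centraliser_iff[OF c(1)] centraliser_iff[OF c(2)])
  from congr_four_block_diag[OF c(3,4) this] show ?thesis
    unfolding congruent_over_def Y(2,4) using centraliser_four_block_diag[OF c(1,2) Y(1,3)] by blast
qed

lemma four_block_diag_mult_left:
  fixes A :: "'a::field mat"
  assumes "A \<in> carrier_mat a a" "B \<in> carrier_mat b b"
    and c: "P \<in> carrier_mat a a" "Q \<in> carrier_mat a b" "R \<in> carrier_mat b a" "W \<in> carrier_mat b b"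
  shows "four_block_mat A (0\<^sub>m a b) (0\<^sub>m b a) B * four_block_mat P Q R W = four_block_mat (A * P) (A * Q) (B * R) (B * W)"
proof -
  have "A * P \<in> carrier_mat a a" "A * Q \<in> carrier_mat a b" "B * R \<in> carrier_mat b a" "B * W \<in> carrier_mat b b"
    using assms by auto
  thus ?thesis using assms by (subst mult_four_block_mat[of _ a a _ b _ b _ _ a _ b]) simp_all
qed

text \<open>If the leading block \<open>P\<close> of \<open>A\<close> vanishes, then \<open>Q G = 1\<close> for the block \<open>G\<close> of \<open>A\<^sup>-\<^sup>1\<close>
  below the diagonal, and the transvections along \<open>V\<close> and \<open>- V\<close>, where \<open>V' = G T\<close>, turn \<open>P\<close> into
  \<open>h\<close> and \<open>h'\<close> with \<open>h - h' = 4 T\<close>; so one of them makes the leading block non-zero.\<close>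

lemma pivot_transvection:
  fixes X1 :: "'a::field mat"
  assumes two: "(2 :: 'a) \<noteq> 0" and a: "a > 0" and X1: "X1 \<in> carrier (GL a)" and X2: "X2 \<in> carrier (GL b)" and T: "T \<in> inv_gram X1"
    and A: "A \<in> inv_gram (four_block_mat X1 (0\<^sub>m a b) (0\<^sub>m b a) X2)"
  shows "\<exists>P\<in>carrier_mat a a. \<exists>Q\<in>carrier_mat a b. \<exists>R\<in>carrier_mat b a. \<exists>W\<in>carrier_mat b b. P \<noteq> 0\<^sub>m a a \<and>
    congruent_over (four_block_mat X1 (0\<^sub>m a b) (0\<^sub>m b a) X2) A (four_block_mat P Q R W)"
proof -
  let ?X = "four_block_mat X1 (0\<^sub>m a b) (0\<^sub>m b a) X2"
  note Xc = GL_carrier[OF X1] GL_carrier[OF X2]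
  have X: "?X \<in> carrier_mat (a + b) (a + b)" using Xc by simp
  have XG: "?X \<in> carrier (GL (a + b))" by (rule GL_four_block_diag[OF X1 X2])
  have Tc: "T \<in> carrier_mat a a" by (rule inv_gram_carrier[OF T Xc(1)])
  have TG: "T \<in> carrier (GL a)" and Tsk: "T = - transpose_mat T" using T inv_gram_iff[OF Xc(1)] by blast+
  have AG: "A \<in> carrier (GL (a + b))" and Ask: "A = - transpose_mat A" using A inv_gram_iff[OF X] by blast+
  note Ac = GL_carrier[OF AG]
  obtain P Q R W where c: "P \<in> carrier_mat a a" "Q \<in> carrier_mat a b" "R \<in> carrier_mat b a" "W \<in> carrier_mat b b"
    and A4: "A = four_block_mat P Q R W" using four_block_ex[OF Ac] by blast
  show ?thesis
  proof (cases "P = 0\<^sub>m a a")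
    case False
    thus ?thesis using c A4 congruent_over_refl[OF X Ac] by blast
  next
    case True
    let ?I = "inv\<^bsub>GL (a + b)\<^esub> A"
    have Ic: "?I \<in> carrier_mat (a + b) (a + b)" using AG by simp
    obtain G1 G2 G G4 where g: "G1 \<in> carrier_mat a a" "G2 \<in> carrier_mat a b" "G \<in> carrier_mat b a" "G4 \<in> carrier_mat b b"
      and I4: "?I = four_block_mat G1 G2 G G4" using four_block_ex[OF Ic] by blast
    have "A * ?I = four_block_mat (P * G1 + Q * G) (P * G2 + Q * G4) (R * G1 + W * G) (R * G2 + W * G4)"
      unfolding A4[symmetric] unfolding I4 unfolding A4 by (rule mult_four_block_mat[OF c g])
    hence "four_block_mat (P * G1 + Q * G) (P * G2 + Q * G4) (R * G1 + W * G) (R * G2 + W * G4) =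
      four_block_mat (1\<^sub>m a) (0\<^sub>m a b) (0\<^sub>m b a) (1\<^sub>m b)" using AG by simp
    moreover have "P * G1 + Q * G \<in> carrier_mat a a" "P * G2 + Q * G4 \<in> carrier_mat a b" "R * G1 + W * G \<in> carrier_mat b a"
      "R * G2 + W * G4 \<in> carrier_mat b b" using c g by auto
    ultimately have "P * G1 + Q * G = 1\<^sub>m a"
      using four_block_eq_iff[of "P * G1 + Q * G" a a _ b _ b _ "1\<^sub>m a" "0\<^sub>m a b" "0\<^sub>m b a" "1\<^sub>m b"] by auto
    hence QG: "Q * G = 1\<^sub>m a" unfolding True using c g by simp
    have Xt: "transpose_mat ?X = four_block_mat (transpose_mat X1) (0\<^sub>m a b) (0\<^sub>m b a) (transpose_mat X2)"
      using Xc by (subst transpose_four_block_mat[of _ a a _ b _ b]) auto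
    \<comment> \<open>The inverse of an invariant Gram matrix is invariant under the transposed
      action. The lower left block of this identity yields the relation for \<open>G\<close> that
      makes \<open>V\<close> intertwine \<open>X1\<close> and \<open>X2\<close>.\<close>
    have "transpose_mat ?X * (?I * ?X) = ?I"
    proof (rule GL_left_cancel[OF AG])
      have "A * transpose_mat ?X = inv\<^bsub>GL (a + b)\<^esub> ?X * A" by (rule inv_gram_intertwine(1)[OF XG A, symmetric])
      hence "A * (transpose_mat ?X * (?I * ?X)) = inv\<^bsub>GL (a + b)\<^esub> ?X * A * (?I * ?X)"
        using Ac Ic X by (subst assoc_mult_mat[symmetric, of _ "a+b" "a+b" _ "a+b" _ "a+b"]) auto
      also have "\<dots> = inv\<^bsub>GL (a + b)\<^esub> ?X * (A * (?I * ?X))"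
        using Ac Ic X GL_inv_carrier[OF XG] by (intro sq_assoc[where n="a+b"]) auto
      also have "\<dots> = A * ?I" using AG XG carrier_matD(1)[OF X] by (simp del: index_mat_four_block)
      finally show "A * (transpose_mat ?X * (?I * ?X)) = A * ?I" .
    qed (use X Ic in auto)
    moreover have "transpose_mat ?X * (?I * ?X) = four_block_mat (transpose_mat X1 * (G1 * X1)) (transpose_mat X1 * (G2 * X2))
      (transpose_mat X2 * (G * X1)) (transpose_mat X2 * (G4 * X2))"
    proof -
      have IX: "?I * ?X = four_block_mat (G1 * X1) (G2 * X2) (G * X1) (G4 * X2)"
        unfolding I4 using Xc g by (subst mult_four_block_mat[of _ a a _ b _ b _ _ a _ b])
         (auto simp: left_add_zero_mat[OF mult_carrier_mat[of _ _ b]] right_add_zero_mat[OF mult_carrier_mat[of _ _ a]])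
      show ?thesis unfolding Xt IX using Xc g by (intro four_block_diag_mult_left) auto
    qed
    ultimately have "four_block_mat (transpose_mat X1 * (G1 * X1)) (transpose_mat X1 * (G2 * X2))
      (transpose_mat X2 * (G * X1)) (transpose_mat X2 * (G4 * X2)) = four_block_mat G1 G2 G G4" using I4 by simp
    moreover have "transpose_mat X1 * (G1 * X1) \<in> carrier_mat a a" "transpose_mat X1 * (G2 * X2) \<in> carrier_mat a b"
      "transpose_mat X2 * (G * X1) \<in> carrier_mat b a" "transpose_mat X2 * (G4 * X2) \<in> carrier_mat b b" using Xc g by auto
    ultimately have XGX: "transpose_mat X2 * (G * X1) = G"
      using four_block_eq_iff[OF _ _ _ _ g] by blast
    define V where "V = transpose_mat (G * T)"
    have V: "V \<in> carrier_mat a b" using g Tc by (simp add: V_def)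
    have QV: "Q * transpose_mat V = T" unfolding V_def using QG c g Tc assoc_mult_mat[OF c(2) g(3) Tc] by simp
    have XV: "X1 * V = V * X2"
    proof -
      have G2: "G * T * transpose_mat X1 = transpose_mat X2 * (G * T)"
      proof -
        have "G * T * transpose_mat X1 = G * (T * transpose_mat X1)" using g Tc Xc by (intro assoc_mult_mat[of _ b a _ a _ a]) auto
        also have "T * transpose_mat X1 = inv\<^bsub>GL a\<^esub> X1 * T" by (rule inv_gram_intertwine(1)[OF X1 T, symmetric])
        also have "G * (inv\<^bsub>GL a\<^esub> X1 * T) = transpose_mat X2 * (G * X1) * (inv\<^bsub>GL a\<^esub> X1 * T)" unfolding XGX ..
        also have "\<dots> = transpose_mat X2 * (G * X1 * (inv\<^bsub>GL a\<^esub> X1 * T))"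
          using Xc g Tc X1 by (intro assoc_mult_mat[of _ b b _ a _ a]) (auto intro!: mult_carrier_mat[of _ a a])
        also have "G * X1 * (inv\<^bsub>GL a\<^esub> X1 * T) = G * (X1 * (inv\<^bsub>GL a\<^esub> X1 * T))"
          using Xc g Tc X1 by (intro assoc_mult_mat[of _ b a _ a _ a]) (auto intro!: mult_carrier_mat[of _ a a])
        also have "\<dots> = G * T" using X1 Tc by simp
        finally show ?thesis .
      qed
      have GT: "G * T \<in> carrier_mat b a" using g Tc by simp
      have "X1 * V = transpose_mat (G * T * transpose_mat X1)" unfolding V_def
        using transpose_mult[OF GT, of "transpose_mat X1" a] Xc by simp
      also have "\<dots> = V * X2" unfolding G2 V_def using transpose_mult[OF _ GT, of "transpose_mat X2" b] Xc by simp
      finally show ?thesis .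
    qed
    have Rsk: "R = - transpose_mat Q"
    proof -
      have "- transpose_mat A = four_block_mat (- transpose_mat P) (- transpose_mat R) (- transpose_mat Q) (- transpose_mat W)"
        unfolding A4 using c by (subst transpose_four_block_mat[of _ a a _ b _ b]) (auto intro!: eq_matI)
      hence "four_block_mat P Q R W = four_block_mat (- transpose_mat P) (- transpose_mat R) (- transpose_mat Q) (- transpose_mat W)"
        using Ask A4 by simp
      moreover have "- transpose_mat P \<in> carrier_mat a a" "- transpose_mat R \<in> carrier_mat a b"
        "- transpose_mat Q \<in> carrier_mat b a" "- transpose_mat W \<in> carrier_mat b b" using c by auto
      ultimately show ?thesis using four_block_eq_iff[OF c] by blast
    qed
    \<comment> \<open>Any \<open>V\<close> that intertwines the two diagonal blocks gives an upper
      shear in the centraliser. It is stated for all such \<open>V\<close> because it is applied to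
      \<open>V\<close> and to \<open>- V\<close>.\<close>
    have tr: "\<exists>Q'\<in>carrier_mat a b. \<exists>R'\<in>carrier_mat b a. \<exists>W'\<in>carrier_mat b b.
      congruent_over ?X A (four_block_mat (V * R + (Q + V * W) * transpose_mat V) Q' R' W')"
      if V: "V \<in> carrier_mat a b" and XV: "X1 * V = V * X2" for V
    proof -
      define L where "L = four_block_mat (1\<^sub>m a) V (0\<^sub>m b a) (1\<^sub>m b)"
      have Lc: "L \<in> carrier_mat (a + b) (a + b)" by (simp add: L_def)
      have Lt: "transpose_mat L = four_block_mat (1\<^sub>m a) (0\<^sub>m a b) (transpose_mat V) (1\<^sub>m b)"
        unfolding L_def using V by (subst transpose_four_block_mat[of _ a a _ b _ b]) auto
      have "transpose_mat L \<in> carrier (GL (a + b))" unfolding Lt using V by (intro GL_four_block_lower) simp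
      hence LG: "L \<in> carrier (GL (a + b))" using GL_transpose by fastforce
      have "L * ?X = four_block_mat X1 (V * X2) (0\<^sub>m b a) X2"
        unfolding L_def using Xc V by (subst mult_four_block_mat[of _ a a _ b _ b _ _ a _ b]) auto
      moreover have "?X * L = four_block_mat X1 (X1 * V) (0\<^sub>m b a) X2"
        unfolding L_def using Xc V by (subst mult_four_block_mat[of _ a a _ b _ b _ _ a _ b]) auto
      ultimately have LC: "L \<in> carrier (centraliser ?X)" using LG XV by (simp add: centraliser_iff[OF X])
      have "L * A = four_block_mat (V * R) (Q + V * W) R W"
        unfolding L_def A4 True using V c by (subst mult_four_block_mat[of _ a a _ b _ b _ _ a _ b]) auto
      hence "L * A * transpose_mat L = four_block_mat (V * R + (Q + V * W) * transpose_mat V) (Q + V * W) (R + W * transpose_mat V) W"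
        unfolding Lt using V c mult_carrier_mat[OF V c(3)] mult_carrier_mat[OF V c(4)] by (simp, subst mult_four_block_mat[of _ a a _ b _ b _ _ a _ b]) auto
      hence "congruent_over ?X A (four_block_mat (V * R + (Q + V * W) * transpose_mat V) (Q + V * W) (R + W * transpose_mat V) W)"
        unfolding congruent_over_def using LC by blast
      moreover have "Q + V * W \<in> carrier_mat a b" "R + W * transpose_mat V \<in> carrier_mat b a" using V c by auto
      ultimately show ?thesis using c(4) by blast
    qed
    have VR: "V * R = T"
    proof -
      have "V * R = - (V * transpose_mat Q)" unfolding Rsk using V c by simp
      also have "V * transpose_mat Q = transpose_mat (Q * transpose_mat V)" using transpose_mult[OF c(2), of "transpose_mat V" a] V by simp
      also have "\<dots> = transpose_mat T" unfolding QV ..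
      also have "- transpose_mat T = T" using Tsk by simp
      finally show ?thesis .
    qed
    \<comment> \<open>The part of the new leading block that is quadratic in \<open>V\<close>, hence
      the same for \<open>V\<close> and \<open>- V\<close>; the linear part is T + T for one and its
      negative for the other.\<close>
    define K where "K = V * W * transpose_mat V"
    have Kc: "K \<in> carrier_mat a a" using V c by (simp add: K_def)
    have h1: "V * R + (Q + V * W) * transpose_mat V = T + (T + K)"
    proof -
      have "(Q + V * W) * transpose_mat V = Q * transpose_mat V + K"
        unfolding K_def using V c by (intro add_mult_distrib_mat[of _ a b]) auto
      thus ?thesis unfolding VR QV by simp
    qed
    have h2: "(- V) * R + (Q + (- V) * W) * transpose_mat (- V) = - T + (- T + K)"
    proof -
      have "(Q + (- V) * W) * transpose_mat (- V) = - ((Q + - (V * W)) * transpose_mat V)"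
        unfolding transpose_uminus using V c by simp
      also have "(Q + - (V * W)) * transpose_mat V = Q * transpose_mat V + - (V * W) * transpose_mat V"
        using V c by (intro add_mult_distrib_mat[of _ a b]) auto
      also have "\<dots> = T + - K" unfolding QV K_def using V c by simp
      also have "- (T + - K) = - T + K" using Tc Kc by (intro eq_matI) auto
      finally have "(Q + (- V) * W) * transpose_mat (- V) = - T + K" .
      moreover have "(- V) * R = - T" using V c VR by simp
      ultimately show ?thesis by simp
    qed
    have "\<not> (T + (T + K) = 0\<^sub>m a a \<and> - T + (- T + K) = 0\<^sub>m a a)"
    proof
      assume e: "T + (T + K) = 0\<^sub>m a a \<and> - T + (- T + K) = 0\<^sub>m a a"
      have "T = 0\<^sub>m a a"
      proof (rule eq_matI)
        fix i j assume "i < dim_row (0\<^sub>m a a :: 'a mat)" "j < dim_col (0\<^sub>m a a :: 'a mat)"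
        hence ij: "i < a" "j < a" by auto
        have "(T + (T + K)) $$ (i,j) = 0" "(- T + (- T + K)) $$ (i,j) = 0" using e ij by simp_all
        hence "T $$ (i,j) + (T $$ (i,j) + K $$ (i,j)) = 0" "- T $$ (i,j) + (- T $$ (i,j) + K $$ (i,j)) = 0"
          using ij Tc Kc by simp_all
        hence "2 * (2 * T $$ (i,j)) = 0" by (simp add: algebra_simps eq_neg_iff_add_eq_0)
        hence "T $$ (i,j) = 0" unfolding mult_eq_0_iff using two by blast
        thus "T $$ (i,j) = 0\<^sub>m a a $$ (i,j)" using ij by simp
      qed (use Tc in auto)
      thus False using TG GL_det[OF Tc] a by simp
    qed
    then consider "T + (T + K) \<noteq> 0\<^sub>m a a" | "- T + (- T + K) \<noteq> 0\<^sub>m a a" by blast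
    thus ?thesis
    proof cases
      case 1
      moreover have "T + (T + K) \<in> carrier_mat a a" using Tc Kc by simp
      ultimately show ?thesis using tr[OF V XV] unfolding h1 by blast
    next
      case 2
      have V': "- V \<in> carrier_mat a b" "X1 * (- V) = (- V) * X2" using V XV Xc by auto
      moreover have "- T + (- T + K) \<in> carrier_mat a a" using Tc Kc by simp
      ultimately show ?thesis using 2 tr[OF V'] unfolding h2 by blast
    qed
  qed
qed

section \<open>Diagonalising an invariant form over a repeated block\<close>

lemma diag_replicate_Suc:
  assumes "R \<in> carrier_mat d d"
  shows "diag_block_mat (replicate (Suc n) R) = four_block_mat R (0\<^sub>m d (n * d)) (0\<^sub>m (n * d) d) (diag_block_mat (replicate n R))"
proof -
  have "square_blocks (replicate n R) (replicate n d)" using assms by (simp add: square_blocks_nth)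
  from diag_block_Cons[OF assms this] show ?thesis by (simp add: sum_list_replicate)
qed

lemma diag_replicate_carrier:
  assumes "R \<in> carrier_mat d d"
  shows "diag_block_mat (replicate n R) \<in> carrier_mat (n * d) (n * d)"
proof -
  have "square_blocks (replicate n R) (replicate n d)" using assms by (simp add: square_blocks_nth)
  from diag_block_carrier[OF this] show ?thesis by (simp add: sum_list_replicate)
qed

lemma diag_replicate_GL:
  fixes R :: "'a::field mat"
  assumes "R \<in> carrier (GL d)"
  shows "diag_block_mat (replicate n R) \<in> carrier (GL (n * d))"
proof -
  have "square_blocks (replicate n R) (replicate n d)" using GL_carrier[OF assms] by (simp add: square_blocks_nth)
  from diag_block_GL_iff[OF this] show ?thesis using assms by (simp add: sum_list_replicate list_all2_conv_all_nth)
qed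

text \<open>The hypothesis \<open>dich\<close> settles a single block. In the induction the pivot
  makes the leading block non-zero, \<open>dich\<close> makes it congruent to \<open>T\<close>, and
  the Schur step splits it off together with an invariant form on the remaining copies.\<close>

theorem congruent_over_diag_replicate:
  fixes R :: "'a::field mat"
  assumes two: "(2 :: 'a) \<noteq> 0" and d: "d > 0" and R: "R \<in> carrier (GL d)" and T: "T \<in> inv_gram R"
    and dich: "\<And>P. P \<in> carrier_mat d d \<Longrightarrow> P = - transpose_mat P \<Longrightarrow> P = R * P * transpose_mat R \<Longrightarrow> P = 0\<^sub>m d d \<or> congruent_over R P T"
    and A: "A \<in> inv_gram (diag_block_mat (replicate n R))"
  shows "congruent_over (diag_block_mat (replicate n R)) A (diag_block_mat (replicate n T))"
  using A
proof (induction n arbitrary: A)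
  case 0
  have "A \<in> carrier_mat 0 0" using inv_gram_carrier[OF 0, of 0] by simp
  hence "A = 0\<^sub>m 0 0" by (intro eq_matI) auto
  thus ?case using congruent_over_refl[of "0\<^sub>m 0 0" 0 A] by simp
next
  case (Suc n)
  note Rc = GL_carrier[OF R] and Tc = inv_gram_carrier[OF T GL_carrier[OF R]]
  let ?Xn = "diag_block_mat (replicate n R)" and ?b = "n * d"
  let ?X = "four_block_mat R (0\<^sub>m d ?b) (0\<^sub>m ?b d) ?Xn"
  have Xn: "?Xn \<in> carrier (GL ?b)" by (rule diag_replicate_GL[OF R])
  note Xnc = GL_carrier[OF Xn]
  have X: "?X \<in> carrier_mat (d + ?b) (d + ?b)" using Rc Xnc by simp
  have A: "A \<in> inv_gram ?X" using Suc.prems unfolding diag_replicate_Suc[OF Rc] .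
  note Ac = inv_gram_carrier[OF A X]
  from pivot_transvection[OF two d R Xn T A] obtain P Q S W where
    c: "P \<in> carrier_mat d d" "Q \<in> carrier_mat d ?b" "S \<in> carrier_mat ?b d" "W \<in> carrier_mat ?b ?b" "P \<noteq> 0\<^sub>m d d"
    and A1: "congruent_over ?X A (four_block_mat P Q S W)" by blast
  let ?A1 = "four_block_mat P Q S W"
  have A1c: "?A1 \<in> carrier_mat (d + ?b) (d + ?b)" using c by simp
  obtain Y where Y: "Y \<in> carrier (centraliser ?X)" "Y * A * transpose_mat Y = ?A1" using A1 by (auto simp: congruent_over_def)
  have A1i: "?A1 \<in> inv_gram ?X" using congr_inv_gram[OF X A Y(1)] unfolding Y(2) .
  hence s: "?A1 = - transpose_mat ?A1" "?A1 = ?X * ?A1 * transpose_mat ?X" unfolding inv_gram_iff[OF X] by blast+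
  have Psk: "P = - transpose_mat P"
  proof -
    have "- transpose_mat ?A1 = four_block_mat (- transpose_mat P) (- transpose_mat S) (- transpose_mat Q) (- transpose_mat W)"
      using c by (subst transpose_four_block_mat[of _ d d _ ?b _ ?b]) (auto intro!: eq_matI)
    hence "?A1 = four_block_mat (- transpose_mat P) (- transpose_mat S) (- transpose_mat Q) (- transpose_mat W)" using s(1) by simp
    moreover have "- transpose_mat P \<in> carrier_mat d d" "- transpose_mat S \<in> carrier_mat d ?b"
      "- transpose_mat Q \<in> carrier_mat ?b d" "- transpose_mat W \<in> carrier_mat ?b ?b" using c by auto
    ultimately show ?thesis using four_block_eq_iff[OF c(1-4)] by blast
  qed
  have Pinv: "P = R * P * transpose_mat R"
  proof -
    have XA: "?X * ?A1 = four_block_mat (R * P) (R * Q) (?Xn * S) (?Xn * W)"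
      using Rc Xnc c by (subst mult_four_block_mat[of _ d d _ ?b _ ?b _ _ d _ ?b])
        (auto simp: left_add_zero_mat[OF mult_carrier_mat[of _ ?b ?b]] right_add_zero_mat[OF mult_carrier_mat[of _ d d]])
    have Xt: "transpose_mat ?X = four_block_mat (transpose_mat R) (0\<^sub>m d ?b) (0\<^sub>m ?b d) (transpose_mat ?Xn)"
      using Rc Xnc by (subst transpose_four_block_mat[of _ d d _ ?b _ ?b]) auto
    have XAX: "?X * ?A1 * transpose_mat ?X = four_block_mat (R * P * transpose_mat R) (R * Q * transpose_mat ?Xn) (?Xn * S * transpose_mat R) (?Xn * W * transpose_mat ?Xn)"
      unfolding XA Xt using Rc Xnc c by (subst mult_four_block_mat[of _ d d _ ?b _ ?b _ _ d _ ?b])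
       (auto simp: left_add_zero_mat[OF mult_carrier_mat[of _ _ ?b]] right_add_zero_mat[OF mult_carrier_mat[of _ _ d]])
    have "?A1 = four_block_mat (R * P * transpose_mat R) (R * Q * transpose_mat ?Xn) (?Xn * S * transpose_mat R) (?Xn * W * transpose_mat ?Xn)"
      using s(2) unfolding XAX .
    moreover have "R * P * transpose_mat R \<in> carrier_mat d d" "R * Q * transpose_mat ?Xn \<in> carrier_mat d ?b"
       "?Xn * S * transpose_mat R \<in> carrier_mat ?b d" "?Xn * W * transpose_mat ?Xn \<in> carrier_mat ?b ?b" using Rc Xnc c by auto
    ultimately show ?thesis using four_block_eq_iff[OF c(1-4)] by blast
  qed
  have PT: "congruent_over R P T" using dich[OF c(1) Psk Pinv] c(5) by blast
  \<comment> \<open>Congruence with the invertible \<open>T\<close> upgrades "non-zero" to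
    "invertible", which the Schur step requires.\<close>
  have PG: "P \<in> carrier (GL d)"
  proof -
    obtain Y where Y: "Y \<in> carrier (centraliser R)" "Y * T * transpose_mat Y = P"
      using congruent_over_sym[OF Rc c(1) PT] by (auto simp: congruent_over_def)
    have YG: "Y \<in> carrier (GL d)" using Y(1) by (simp add: centraliser_iff[OF Rc])
    moreover have "T \<in> carrier (GL d)" using T by (simp add: inv_gram_iff[OF Rc])
    ultimately show ?thesis unfolding Y(2)[symmetric] using GL_transpose[OF YG] by simp
  qed
  from schur_step[OF R Xn A1i c(2-4) PG] obtain L W' where L: "L \<in> carrier (centraliser ?X)" "W' \<in> inv_gram ?Xn"
    "L * ?A1 * transpose_mat L = four_block_mat P (0\<^sub>m d ?b) (0\<^sub>m ?b d) W'" by blast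
  note W'c = inv_gram_carrier[OF L(2) Xnc]
  let ?A2 = "four_block_mat P (0\<^sub>m d ?b) (0\<^sub>m ?b d) W'"
  have "congruent_over ?X ?A1 ?A2" using L by (auto simp: congruent_over_def)
  moreover have "congruent_over ?X ?A2 (four_block_mat T (0\<^sub>m d ?b) (0\<^sub>m ?b d) (diag_block_mat (replicate n T)))"
    by (rule congruent_over_four_block[OF Rc Xnc c(1) W'c PT Suc.IH[OF L(2)]])
  ultimately show ?case unfolding diag_replicate_Suc[OF Rc] diag_replicate_Suc[OF Tc]
    using congruent_over_trans[OF X Ac A1] congruent_over_trans[OF X A1c] by blast
qed

section \<open>Congruence of all non-degenerate alternating forms\<close>

lemma centraliser_one: "Y \<in> carrier (centraliser (1\<^sub>m n)) \<longleftrightarrow> Y \<in> carrier (GL n)"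
  using GL_carrier[of Y n] by (auto simp: centraliser_iff[of _ n])

lemma inv_gram_one: "A \<in> inv_gram (1\<^sub>m n) \<longleftrightarrow> A \<in> carrier (GL n) \<and> A = - transpose_mat A"
proof -
  have "1\<^sub>m n * A * transpose_mat (1\<^sub>m n) = A" if "A \<in> carrier (GL n)" using GL_carrier[OF that] by simp
  thus ?thesis unfolding inv_gram_iff[OF one_carrier_mat] by metis
qed

definition mat2 :: "'a \<Rightarrow> 'a \<Rightarrow> 'a \<Rightarrow> 'a \<Rightarrow> 'a mat" where
  "mat2 a b c d = mat 2 2 (\<lambda>(i,j). if i = 0 then if j = 0 then a else b else if j = 0 then c else d)"

lemma mat2_carrier [simp]: "mat2 a b c d \<in> carrier_mat 2 2"
  by (simp add: mat2_def)

lemma mat2_index: "mat2 a b c d $$ (0,0) = a" "mat2 a b c d $$ (0,Suc 0) = b"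
  "mat2 a b c d $$ (Suc 0,0) = c" "mat2 a b c d $$ (Suc 0,Suc 0) = d"
  by (simp_all add: mat2_def)

lemma mat2_expand:
  assumes M: "M \<in> carrier_mat 2 2"
  shows "M = mat2 (M $$ (0,0)) (M $$ (0,1)) (M $$ (1,0)) (M $$ (1,1))"
  using M by (intro eq_matI) (auto simp: mat2_def less_2_cases_iff)

lemma mat2_mult:
  "mat2 a b c d * mat2 a' b' c' d' =
    mat2 (a * a' + b * c') (a * b' + b * d') (c * a' + d * c') (c * b' + d * d' :: 'a::comm_ring_1)"
proof (rule eq_matI)
  fix i j assume "i < dim_row (mat2 (a * a' + b * c') (a * b' + b * d') (c * a' + d * c') (c * b' + d * d'))"
    "j < dim_col (mat2 (a * a' + b * c') (a * b' + b * d') (c * a' + d * c') (c * b' + d * d'))"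
  hence ij: "i < 2" "j < 2" by (simp_all add: mat2_def)
  show "(mat2 a b c d * mat2 a' b' c' d') $$ (i,j) =
     mat2 (a * a' + b * c') (a * b' + b * d') (c * a' + d * c') (c * b' + d * d') $$ (i,j)"
    unfolding mult_index[OF mat2_carrier mat2_carrier ij] using ij unfolding numeral_2_eq_2
    by (auto simp: less_Suc_eq mat2_index lessThan_Suc add.commute)
qed (simp_all add: mat2_def)

lemma mat2_simps:
  "transpose_mat (mat2 a b c d) = mat2 a c b d" "- mat2 a b c d = mat2 (- a) (- b) (- c) (- d :: 'b::ring)"
  "1\<^sub>m 2 = mat2 1 0 0 (1 :: 'c::semiring_1)" "0\<^sub>m 2 2 = mat2 0 0 0 (0 :: 'd::zero)"
  by (auto simp: mat2_def less_2_cases_iff intro!: eq_matI)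

text \<open>The diagonalisation for \<open>R\<close> the identity of size 2: \<open>m\<close> copies
  of it form the identity of size \<open>2 * m\<close>, whose centraliser is the full general linear
  group. A skew-symmetric matrix of size 2 is a multiple of \<open>J\<close>.\<close>

theorem skew_congruent:
  fixes A B :: "'a::field mat"
  assumes two: "(2 :: 'a) \<noteq> 0" and A: "A \<in> carrier (GL (2 * m))" "A = - transpose_mat A"
    and B: "B \<in> carrier (GL (2 * m))" "B = - transpose_mat B"
  shows "\<exists>S\<in>carrier (GL (2 * m)). S * B * transpose_mat S = A"
proof -
  define J where "J = mat2 0 1 (-1) (0::'a)"
  have JG: "J \<in> carrier (GL 2)"
    by (rule GL_I[of _ 2 "mat2 0 (-1) 1 0"]) (simp_all add: J_def mat2_mult mat2_simps(3))
  have Jsk: "J = - transpose_mat J" by (simp add: J_def mat2_simps)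
  have one: "diag_block_mat (replicate m (1\<^sub>m 2)) = (1\<^sub>m (2 * m) :: 'a mat)"
    using diag_block_one(1)[of "replicate m 2"] by (simp add: sum_list_replicate mult.commute)
  have JI: "J \<in> inv_gram (1\<^sub>m 2)" unfolding inv_gram_one using JG Jsk by blast
  have dich: "P = 0\<^sub>m 2 2 \<or> congruent_over (1\<^sub>m 2) P J" if P: "P \<in> carrier_mat 2 2" "P = - transpose_mat P" for P :: "'a mat"
  proof -
    have sk: "P $$ (i,j) = - P $$ (j,i)" if "i < 2" "j < 2" for i j
    proof -
      have "P $$ (i,j) = (- transpose_mat P) $$ (i,j)" by (rule arg_cong[OF P(2)])
      also have "\<dots> = - P $$ (j,i)" using P(1) that by simp
      finally show ?thesis .
    qed
    \<comment> \<open>A diagonal entry equals its own negative, and 2 is invertible: in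
      characteristic other than 2 skew-symmetric matrices are alternating.\<close>
    have dg: "P $$ (i,i) = 0" if "i < 2" for i
    proof -
      have "P $$ (i,i) + P $$ (i,i) = P $$ (i,i) + - P $$ (i,i)" by (rule arg_cong[OF sk[OF that that]])
      hence "P $$ (i,i) + P $$ (i,i) = 0" unfolding add.right_inverse .
      hence "2 * P $$ (i,i) = 0" unfolding mult_2 .
      thus ?thesis using two by simp
    qed
    define a where "a = P $$ (0,1)"
    have "P $$ (1,0) = - a" using sk[of 1 0] by (simp add: a_def)
    hence "mat2 (P $$ (0,0)) (P $$ (0,1)) (P $$ (1,0)) (P $$ (1,1)) = mat2 0 a (- a) 0"
      using dg[of 0] dg[of 1] by (simp add: a_def)
    hence P2: "P = mat2 0 a (- a) 0" by (rule trans[OF mat2_expand[OF P(1)]])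
    show ?thesis
    proof (cases "a = 0")
      case True
      thus ?thesis using P2 by (simp add: mat2_simps)
    next
      case False
      \<comment> \<open>Scaling the first basis vector by the inverse of \<open>a\<close> scales
        both off-diagonal entries and turns them into 1 and -1.\<close>
      define Y where "Y = mat2 (inverse a) 0 0 1"
      have "Y \<in> carrier (GL 2)"
        using False by (intro GL_I[of _ 2 "mat2 a 0 0 1"]) (simp_all add: Y_def mat2_mult mat2_simps(3))
      moreover have "Y * P * transpose_mat Y = J"
        using False by (simp add: P2 Y_def J_def mat2_mult mat2_simps)
      ultimately show ?thesis unfolding congruent_over_def by (auto simp: centraliser_one)
    qed
  qed
  have 1: "congruent_over (1\<^sub>m (2 * m)) C (diag_block_mat (replicate m J))" if C: "C \<in> carrier (GL (2 * m))" "C = - transpose_mat C" for C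
  proof -
    have "C \<in> inv_gram (diag_block_mat (replicate m (1\<^sub>m 2)))" unfolding one inv_gram_one by (rule conjI[OF C])
    from congruent_over_diag_replicate[OF two zero_less_numeral GL_one_closed JI _ this]
    have "congruent_over (diag_block_mat (replicate m (1\<^sub>m 2))) C (diag_block_mat (replicate m J))"
      using dich .
    thus ?thesis unfolding one .
  qed
  have c: "A \<in> carrier_mat (2 * m) (2 * m)" "B \<in> carrier_mat (2 * m) (2 * m)" by (rule GL_carrier[OF A(1)], rule GL_carrier[OF B(1)])
  have "congruent_over (1\<^sub>m (2 * m)) (diag_block_mat (replicate m J)) A"
    using congruent_over_sym[OF one_carrier_mat c(1) 1[OF A]] .
  from congruent_over_trans[OF one_carrier_mat c(2) 1[OF B] this]
  obtain S where S: "S \<in> carrier (centraliser (1\<^sub>m (2 * m)))" "S * B * transpose_mat S = A"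
    unfolding congruent_over_def by (rule bexE)
  show ?thesis using S unfolding centraliser_one by blast
qed

lemma CHAR_not_2: "CHAR('a::field) \<noteq> 2 \<Longrightarrow> (2::'a) \<noteq> 0"
proof
  assume C: "CHAR('a) \<noteq> 2" and "(2::'a) = 0"
  hence "of_nat 2 = (0::'a)" by simp
  hence d: "CHAR('a) dvd 2" unfolding of_nat_eq_0_iff_char_dvd .
  hence "CHAR('a) \<le> 2" by (rule dvd_imp_le) simp
  moreover have "CHAR('a) \<noteq> 0" using d by (intro notI) simp
  moreover have "CHAR('a) \<noteq> 1" using of_nat_CHAR[where 'a='a] by (intro notI) simp
  ultimately show False using C by linarith
qed

section \<open>The case of distinct reciprocal divisors\<close>

text \<open>Up to a non-zero scalar the value of \<open>recip_poly f\<close> at \<open>X\<close> is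
  X^k f(X^{-1}) with k the degree of \<open>f\<close>. The invertible power X^k commutes with
  \<open>Z\<close> and can be cancelled.\<close>

lemma annihilate_reciprocal:
  fixes X :: "'a::field mat"
  assumes X: "X \<in> carrier (GL n)" and f: "poly f 0 \<noteq> 0" and Z: "Z \<in> carrier_mat n n" and ZX: "X * Z = Z * X"
    and 0: "Z * poly_mat (recip_poly f) X = 0\<^sub>m n n"
  shows "Z * poly_mat f (inv\<^bsub>GL n\<^esub> X) = 0\<^sub>m n n"
proof -
  note c = GL_carrier[OF X] and ci = GL_inv_carrier[OF X]
  let ?F = "poly_mat f (inv\<^bsub>GL n\<^esub> X)" and ?k = "degree f" and ?a = "inverse (poly f 0)"
  have F: "?F \<in> carrier_mat n n" using ci by simp
  have XkG: "X ^\<^sub>m ?k \<in> carrier (GL n)" by (rule GL_pow[OF X])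
  note Xk = GL_carrier[OF XkG]
  have "X ^\<^sub>m ?k * Z = Z * X ^\<^sub>m ?k"
  proof -
    have "1 \<cdot>\<^sub>m M = M" for M :: "'a mat" by (intro eq_matI) auto
    thus ?thesis using poly_mat_intertwine[OF c c Z ZX, of "monom 1 ?k"] by (simp add: poly_mat_monom[OF c])
  qed
  hence "X ^\<^sub>m ?k * (Z * ?F) = Z * (X ^\<^sub>m ?k * ?F)"
    using Z F Xk sq_assoc[of "X ^\<^sub>m ?k" n Z ?F] sq_assoc[of Z n "X ^\<^sub>m ?k" ?F] by simp
  moreover have "poly_mat (recip_poly f) X = ?a \<cdot>\<^sub>m (X ^\<^sub>m ?k * ?F)"
    unfolding recip_poly_def poly_mat_smult[OF c] poly_mat_reflect[OF X] ..
  hence "0\<^sub>m n n = ?a \<cdot>\<^sub>m (Z * (X ^\<^sub>m ?k * ?F))"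
    using 0 mult_smult_distrib[OF Z sq_mult_carrier[OF Xk F], of ?a] by simp
  hence "poly f 0 \<cdot>\<^sub>m (0\<^sub>m n n) = poly f 0 \<cdot>\<^sub>m (?a \<cdot>\<^sub>m (Z * (X ^\<^sub>m ?k * ?F)))" by (rule arg_cong)
  hence "Z * (X ^\<^sub>m ?k * ?F) = 0\<^sub>m n n"
  proof -
    have "poly f 0 \<cdot>\<^sub>m (?a \<cdot>\<^sub>m M) = M" for M using f by (intro eq_matI) auto
    thus ?thesis using \<open>poly f 0 \<cdot>\<^sub>m (0\<^sub>m n n) = _\<close> by (metis smult_zero_mat)
  qed
  ultimately have "X ^\<^sub>m ?k * (Z * ?F) = X ^\<^sub>m ?k * 0\<^sub>m n n" using right_mult_zero_mat[OF Xk, of n] by simp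
  thus ?thesis using GL_left_cancel[OF XkG, of "Z * ?F" "0\<^sub>m n n"] Z by simp
qed

lemma GL_of_congruence:
  fixes Y :: "'a::field mat"
  assumes Y: "Y \<in> carrier_mat n n" and B: "B \<in> carrier_mat n n" and G: "Y * B * transpose_mat Y \<in> carrier (GL n)"
  shows "Y \<in> carrier (GL n)"
proof -
  have Yt: "transpose_mat Y \<in> carrier_mat n n" using Y by simp
  have "det (Y * B * transpose_mat Y) = det Y * det B * det (transpose_mat Y)"
    using det_mult[OF sq_mult_carrier[OF Y B] Yt] det_mult[OF Y B] by simp
  moreover have "det (Y * B * transpose_mat Y) \<noteq> 0" using GL_det[OF GL_carrier[OF G]] G by simp
  ultimately show ?thesis using GL_det[OF Y] by auto
qed

lemma inv_gram_skew:
  fixes Z :: "'a::field mat"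
  assumes "A \<in> inv_gram Z" "Z \<in> carrier_mat n n"
  shows "A \<in> carrier (GL n)" "transpose_mat A = - A" "transpose_mat (inv\<^bsub>GL n\<^esub> A) = - (inv\<^bsub>GL n\<^esub> A)"
proof -
  show G: "A \<in> carrier (GL n)" using assms inv_gram_iff by blast
  have "A = - transpose_mat A" using assms inv_gram_iff by blast
  thus t: "transpose_mat A = - A" by (metis uminus_uminus_mat)
  note c = GL_carrier[OF G] GL_inv_carrier[OF G]
  have "(- A) * (- (inv\<^bsub>GL n\<^esub> A)) = 1\<^sub>m n" using c G by simp
  hence "inv\<^bsub>GL n\<^esub> (- A) = - (inv\<^bsub>GL n\<^esub> A)" using c by (intro GL_inv_unique) auto
  thus "transpose_mat (inv\<^bsub>GL n\<^esub> A) = - (inv\<^bsub>GL n\<^esub> A)" using GL_inv_transpose[OF G] t by simp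
qed

text \<open>Both \<open>A\<close> and \<open>B\<close> intertwine \<open>X\<close> with the
  transpose of its inverse, so A B^{-1} intertwines \<open>X\<close> with itself.\<close>

lemma inv_gram_quotient_commute:
  fixes X :: "'a::field mat"
  assumes X: "X \<in> carrier (GL n)" and A: "A \<in> inv_gram X" and B: "B \<in> inv_gram X"
  shows "X * (A * inv\<^bsub>GL n\<^esub> B) = (A * inv\<^bsub>GL n\<^esub> B) * X"
proof -
  note c = GL_carrier[OF X]
  note AG = inv_gram_skew(1)[OF A c] and BG = inv_gram_skew(1)[OF B c]
  note cc = c GL_carrier[OF AG] GL_carrier[OF BG] GL_inv_carrier[OF BG]
  let ?S = "transpose_mat (inv\<^bsub>GL n\<^esub> X)" and ?Bi = "inv\<^bsub>GL n\<^esub> B"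
  have S: "?S \<in> carrier_mat n n" using X by simp
  have "?S * ?Bi = ?Bi * (B * ?S) * ?Bi" using cc S BG by (simp add: sq_assoc[where n=n])
  also have "B * ?S = X * B" by (rule inv_gram_intertwine(2)[OF X B, symmetric])
  also have "?Bi * (X * B) * ?Bi = ?Bi * X" using cc BG by (simp add: sq_assoc[where n=n])
  finally have e: "?S * ?Bi = ?Bi * X" .
  have "X * (A * ?Bi) = (X * A) * ?Bi" using cc by (simp add: sq_assoc[where n=n])
  also have "\<dots> = A * (?S * ?Bi)" unfolding inv_gram_intertwine(2)[OF X A] using cc S by (simp add: sq_assoc[where n=n])
  also have "\<dots> = (A * ?Bi) * X" unfolding e using cc by (simp add: sq_assoc[where n=n])
  finally show ?thesis .
qed

text \<open>As \<open>g\<close> and its reciprocal are comaximal, the projections \<open>P\<close>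
  and \<open>Q\<close> are polynomials in \<open>X\<close>, and every invariant form pairs the two
  components with each other only.\<close>

theorem distinct_reciprocal_congruent:
  fixes X :: "'a::field mat"
  assumes X: "X \<in> carrier (GL n)" and g: "monic g" "irreducible g" "g \<noteq> [:0, 1:]" "g \<noteq> recip_poly g"
    and ed: "elem_divs_powers_of X {g, recip_poly g}" and A: "A \<in> inv_gram X" and B: "B \<in> inv_gram X"
  shows "congruent_over X A B"
proof -
  note Xc = GL_carrier[OF X] and Xi = GL_inv_carrier[OF X]
  define r where "r = recip_poly g"
  have g0: "poly g 0 \<noteq> 0" by (rule poly_0_irreducible[OF g(1-3)])
  have r: "monic r" "irreducible r" "poly r 0 \<noteq> 0" "recip_poly r = g"
    using monic_recip_poly[OF g0] irreducible_recip_poly[OF g(1,2) g0] poly_0_recip_poly[OF g0 g(1)] recip_poly_recip_poly[OF g0 g(1)] g0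
    by (simp_all add: r_def)
  obtain N where N: "poly_mat ((g * r) ^ N) X = 0\<^sub>m n n" using elem_divs_annihilator[OF Xc] ed unfolding r_def by blast
  have "comaximal g r" using monic_irreducible_comaximal[OF g(1,2) r(1,2)] g(4) by (simp add: r_def)
  hence "comaximal (g ^ N) (r ^ N)" by (rule comaximal_powers)
  then obtain a b where ab: "a * g ^ N + b * r ^ N = 1" by (auto simp: comaximal_def)
  \<comment> \<open>The two terms of the Bezout identity: p + q = 1, while p q annihilates
    \<open>X\<close>. Their values at \<open>X\<close> are therefore complementary projections onto
    the two primary components.\<close>
  define p where "p = r ^ N * b"
  define q where "q = g ^ N * a"
  define P where "P = poly_mat p X"
  define Q where "Q = poly_mat q X"
  have PQc: "P \<in> carrier_mat n n" "Q \<in> carrier_mat n n" using Xc by (simp_all add: P_def Q_def)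
  have "p + q = 1" using ab by (simp add: p_def q_def mult.commute add.commute)
  hence PQ: "P + Q = 1\<^sub>m n" unfolding P_def Q_def poly_mat_add[OF Xc, symmetric] using poly_mat_1[OF Xc] by simp
  \<comment> \<open>If the product of \<open>f\<close> and its reciprocal annihilates
    \<open>X\<close>, then every multiple of \<open>f\<close> gives zero when its values at
    \<open>X\<close> and X^{-1} are multiplied. It is applied to f = r^N and f = g^N, which are
    reciprocal to each other.\<close>
  have kill: "poly_mat (f * h) X * poly_mat (f * h) (inv\<^bsub>GL n\<^esub> X) = 0\<^sub>m n n"
    if f: "poly f 0 \<noteq> 0" "poly_mat (f * recip_poly f) X = 0\<^sub>m n n" for f h
  proof -
    let ?Z = "poly_mat (f * h) X"
    have Z: "?Z \<in> carrier_mat n n" using Xc by simp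
    have "?Z * poly_mat (recip_poly f) X = poly_mat h X * poly_mat (f * recip_poly f) X"
      unfolding poly_mat_mult[OF Xc, symmetric] by (simp add: algebra_simps)
    also have "\<dots> = 0\<^sub>m n n" unfolding f(2) using Xc by (intro right_mult_zero_mat) simp
    finally have 0: "?Z * poly_mat (recip_poly f) X = 0\<^sub>m n n" .
    have "X * ?Z = ?Z * X" using poly_mat_intertwine[OF Xc Xc Xc refl] by simp
    from annihilate_reciprocal[OF X f(1) Z this 0] have "?Z * poly_mat f (inv\<^bsub>GL n\<^esub> X) = 0\<^sub>m n n" .
    hence "?Z * poly_mat f (inv\<^bsub>GL n\<^esub> X) * poly_mat h (inv\<^bsub>GL n\<^esub> X) = 0\<^sub>m n n" using Xi by simp
    thus ?thesis unfolding poly_mat_mult[OF Xi] using sq_assoc[OF Z poly_mat_carrier[OF Xi] poly_mat_carrier[OF Xi]] by simp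
  qed
  have gr: "poly_mat (g ^ N * r ^ N) X = 0\<^sub>m n n" "poly_mat (r ^ N * g ^ N) X = 0\<^sub>m n n"
    using N by (simp_all add: power_mult_distrib mult.commute)
  have kP: "P * poly_mat p (inv\<^bsub>GL n\<^esub> X) = 0\<^sub>m n n" unfolding P_def p_def
    by (rule kill) (use r gr in \<open>simp_all add: recip_poly_power\<close>)
  have kQ: "Q * poly_mat q (inv\<^bsub>GL n\<^esub> X) = 0\<^sub>m n n" unfolding Q_def q_def
    by (rule kill) (use g0 gr in \<open>simp_all add: recip_poly_power r_def\<close>)
  have iso: "poly_mat f X * C * transpose_mat (poly_mat f X) = 0\<^sub>m n n"
    if k: "poly_mat f X * poly_mat f (inv\<^bsub>GL n\<^esub> X) = 0\<^sub>m n n" and C: "C \<in> inv_gram X" for f C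
  proof -
    note Cc = GL_carrier[OF inv_gram_skew(1)[OF C Xc]]
    let ?S = "transpose_mat (inv\<^bsub>GL n\<^esub> X)"
    have S: "?S \<in> carrier_mat n n" using Xi by simp
    have "poly_mat f X * C = C * poly_mat f ?S" by (rule poly_mat_intertwine[OF Xc S Cc inv_gram_intertwine(2)[OF X C]])
    also have "poly_mat f ?S = transpose_mat (poly_mat f (inv\<^bsub>GL n\<^esub> X))" by (rule poly_mat_transpose[OF Xi, symmetric])
    finally have "poly_mat f X * C * transpose_mat (poly_mat f X) = C * transpose_mat (poly_mat f X * poly_mat f (inv\<^bsub>GL n\<^esub> X))"
      using Xc Xi Cc by (simp add: sq_transpose_mult[where n=n] sq_assoc[where n=n])
    thus ?thesis unfolding k using Cc by simp
  qed
  \<comment> \<open>Isotropy of both components in the form used below: passing through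
    \<open>C\<close> exchanges \<open>P\<close> with the transpose of \<open>Q\<close>, and
    \<open>Q\<close> with that of \<open>P\<close>.\<close>
  have half: "P * C = C * transpose_mat Q \<and> Q * C = C * transpose_mat P" if C: "C \<in> inv_gram X" for C
  proof -
    note Cc = GL_carrier[OF inv_gram_skew(1)[OF C Xc]]
    have iP: "P * C * transpose_mat P = 0\<^sub>m n n" and iQ: "Q * C * transpose_mat Q = 0\<^sub>m n n"
      using iso[OF kP[unfolded P_def] C] iso[OF kQ[unfolded Q_def] C] by (simp_all add: P_def Q_def)
    have t: "transpose_mat P + transpose_mat Q = 1\<^sub>m n"
      using transpose_add[OF PQc] PQ by simp
    have tc: "transpose_mat P \<in> carrier_mat n n" "transpose_mat Q \<in> carrier_mat n n" using PQc by auto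
    have PC: "P * C \<in> carrier_mat n n" "Q * C \<in> carrier_mat n n" using PQc Cc by auto
    have "P * C = P * C * (transpose_mat P + transpose_mat Q)" unfolding t right_mult_one_mat[OF PC(1)] ..
    also have "\<dots> = P * C * transpose_mat Q" using mult_add_distrib_mat[OF PC(1) tc] iP PC tc by simp
    finally have 1: "P * C = P * C * transpose_mat Q" .
    have "Q * C = Q * C * (transpose_mat P + transpose_mat Q)" unfolding t right_mult_one_mat[OF PC(2)] ..
    also have "\<dots> = Q * C * transpose_mat P" using mult_add_distrib_mat[OF PC(2) tc] iQ PC tc by simp
    finally have 2: "Q * C = Q * C * transpose_mat P" .
    have s: "C = P * C + Q * C" using add_mult_distrib_mat[OF PQc Cc] PQ Cc by simp
    have "C * transpose_mat Q = (P * C + Q * C) * transpose_mat Q" by (rule arg_cong[OF s])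
    also have "\<dots> = P * C * transpose_mat Q" using add_mult_distrib_mat[OF PC tc(2)] iQ PC tc by simp
    finally have 3: "C * transpose_mat Q = P * C" unfolding 1[symmetric] .
    have "C * transpose_mat P = (P * C + Q * C) * transpose_mat P" by (rule arg_cong[OF s])
    also have "\<dots> = Q * C * transpose_mat P" using add_mult_distrib_mat[OF PC tc(1)] iP PC tc by simp
    finally have 4: "C * transpose_mat P = Q * C" unfolding 2[symmetric] .
    show ?thesis using 3 4 by simp
  qed
  note AG = inv_gram_skew(1)[OF A Xc] and BG = inv_gram_skew(1)[OF B Xc]
  note cc = GL_carrier[OF AG] GL_carrier[OF BG] GL_inv_carrier[OF BG] PQc Xc
  let ?Bi = "inv\<^bsub>GL n\<^esub> B"
  have tc: "transpose_mat P \<in> carrier_mat n n" "transpose_mat Q \<in> carrier_mat n n" using PQc by auto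
  define M where "M = A * ?Bi"
  have M: "M \<in> carrier_mat n n" using cc by (simp add: M_def)
  \<comment> \<open>The component cut out by \<open>P\<close> is multiplied by M = A B^{-1}, and the
    one cut out by \<open>Q\<close> is left as it is.\<close>
  define Y where "Y = P * M + Q"
  have Y: "Y \<in> carrier_mat n n" using M PQc by (simp add: Y_def)
  have MB: "M * B = A" unfolding M_def using cc BG by (simp add: sq_assoc[where n=n])
  have YB: "Y * B = P * A + Q * B"
    unfolding Y_def using add_mult_distrib_mat[OF sq_mult_carrier[OF PQc(1) M] PQc(2) cc(2)] sq_assoc[OF PQc(1) M cc(2)] MB by simp
  have Mt: "transpose_mat M = ?Bi * A"
  proof -
    have "transpose_mat M = transpose_mat ?Bi * transpose_mat A" unfolding M_def by (rule sq_transpose_mult[OF cc(1) cc(3)])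
    also have "\<dots> = (- ?Bi) * (- A)" unfolding inv_gram_skew(2)[OF A Xc] inv_gram_skew(3)[OF B Xc] ..
    also have "\<dots> = ?Bi * A" using cc by simp
    finally show ?thesis .
  qed
  have Yt: "transpose_mat Y = ?Bi * A * transpose_mat P + transpose_mat Q"
    unfolding Y_def using transpose_add[OF sq_mult_carrier[OF PQc(1) M] PQc(2)] sq_transpose_mult[OF PQc(1) M] Mt by simp
  have z1: "P * A * (?Bi * A * transpose_mat P) = 0\<^sub>m n n"
  proof -
    have "?Bi * (P * B) = ?Bi * (B * transpose_mat Q)" using half[OF B] by simp
    also have "\<dots> = transpose_mat Q" using BG tc by simp
    finally have "?Bi * (P * B) * ?Bi = transpose_mat Q * ?Bi" by simp
    moreover have "?Bi * (P * B) * ?Bi = ?Bi * P" using cc BG by (simp add: sq_assoc[where n=n])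
    ultimately have QB: "transpose_mat Q * ?Bi = ?Bi * P" by simp
    have QA: "Q * A = A * transpose_mat P" using half[OF A] by simp
    have PQ0: "P * Q = 0\<^sub>m n n"
    proof -
      have "P * Q = poly_mat (a * b) X * poly_mat (r ^ N * g ^ N) X"
        unfolding P_def Q_def p_def q_def poly_mat_mult[OF Xc, symmetric] by (simp add: algebra_simps)
      thus ?thesis unfolding gr using Xc by (simp add: right_mult_zero_mat[of _ n n])
    qed
    have "P * A * (?Bi * A * transpose_mat P) = (A * transpose_mat Q) * (?Bi * (A * transpose_mat P))"
      using half[OF A] cc tc by (simp add: sq_assoc[where n=n])
    also have "\<dots> = A * (transpose_mat Q * ?Bi) * (Q * A)" unfolding QA using cc tc by (simp add: sq_assoc[where n=n])
    also have "\<dots> = A * ?Bi * (P * Q) * A" unfolding QB using cc tc by (simp add: sq_assoc[where n=n])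
    also have "\<dots> = 0\<^sub>m n n" unfolding PQ0 using cc by simp
    finally show ?thesis .
  qed
  \<comment> \<open>Of the four terms in the expansion of Y B Y' the two that pair a component with
    itself vanish; the mixed ones are P A and Q A, with sum \<open>A\<close>.\<close>
  have YBY: "Y * B * transpose_mat Y = A"
  proof -
    have c1: "P * A \<in> carrier_mat n n" "Q * B \<in> carrier_mat n n" "?Bi * A * transpose_mat P \<in> carrier_mat n n" using cc tc by auto
    have z2: "P * A * transpose_mat Q = P * A"
    proof -
      have t: "transpose_mat P + transpose_mat Q = 1\<^sub>m n" using transpose_add[OF PQc] PQ by simp
      have "P * A * transpose_mat P = 0\<^sub>m n n" using iso[OF kP[unfolded P_def] A] by (simp add: P_def)
      moreover have "P * A = P * A * (transpose_mat P + transpose_mat Q)" unfolding t right_mult_one_mat[OF c1(1)] ..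
      ultimately show ?thesis using mult_add_distrib_mat[OF c1(1) tc] c1 tc by simp
    qed
    have z3: "Q * B * (?Bi * A * transpose_mat P) = Q * A"
    proof -
      have t: "transpose_mat P + transpose_mat Q = 1\<^sub>m n" using transpose_add[OF PQc] PQ by simp
      have QAc: "Q * A \<in> carrier_mat n n" using cc by simp
      have "Q * A * transpose_mat Q = 0\<^sub>m n n" using iso[OF kQ[unfolded Q_def] A] by (simp add: Q_def)
      moreover have "Q * A = Q * A * (transpose_mat P + transpose_mat Q)" unfolding t right_mult_one_mat[OF QAc] ..
      ultimately have "Q * A * transpose_mat P = Q * A" using mult_add_distrib_mat[OF QAc tc] QAc tc by simp
      moreover have "Q * B * (?Bi * A * transpose_mat P) = Q * A * transpose_mat P" using cc tc BG by (simp add: sq_assoc[where n=n])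
      ultimately show ?thesis by simp
    qed
    have z4: "Q * B * transpose_mat Q = 0\<^sub>m n n" using iso[OF kQ[unfolded Q_def] B] by (simp add: Q_def)
    have "Y * B * transpose_mat Y = (P * A * (?Bi * A * transpose_mat P) + P * A * transpose_mat Q) + (Q * B * (?Bi * A * transpose_mat P) + Q * B * transpose_mat Q)"
      unfolding YB Yt using add_mult_distrib_mat[OF c1(1,2) sq_add_carrier[OF c1(3) tc(2)]] mult_add_distrib_mat[OF c1(1) c1(3) tc(2)]
        mult_add_distrib_mat[OF c1(2) c1(3) tc(2)] by simp
    also have "\<dots> = P * A + Q * A" unfolding z1 z2 z3 z4 using cc by simp
    also have "\<dots> = A" using add_mult_distrib_mat[OF PQc cc(1)] PQ cc by simp
    finally show ?thesis .
  qed
  \<comment> \<open>Invertibility of \<open>Y\<close> is read off from determinants in Y B Y' = A,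
    so no inverse has to be constructed.\<close>
  have YG: "Y \<in> carrier (GL n)" by (rule GL_of_congruence[OF Y cc(2)]) (simp add: YBY AG)
  have XM: "X * M = M * X" unfolding M_def by (rule inv_gram_quotient_commute[OF X A B])
  have PX: "P * X = X * P" "Q * X = X * Q" unfolding P_def Q_def by (rule poly_mat_intertwine[OF Xc Xc Xc refl])+
  have "Y * X = P * (M * X) + Q * X"
    unfolding Y_def using add_mult_distrib_mat[OF sq_mult_carrier[OF PQc(1) M] PQc(2) Xc] sq_assoc[OF PQc(1) M Xc] by simp
  also have "\<dots> = X * (P * M) + X * Q"
    unfolding XM[symmetric] PX(2) using sq_assoc[OF PQc(1) Xc M] sq_assoc[OF Xc PQc(1) M] PX(1) by simp
  also have "\<dots> = X * Y" unfolding Y_def using mult_add_distrib_mat[OF Xc sq_mult_carrier[OF PQc(1) M] PQc(2)] by simp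
  finally have "Y \<in> carrier (centraliser X)" using YG by (simp add: centraliser_iff[OF Xc])
  hence "congruent_over X B A" unfolding congruent_over_def using YBY by blast
  thus ?thesis by (rule congruent_over_sym[OF Xc cc(2)])
qed

section \<open>Conjugacy classes in the symplectic group\<close>

lemma conj_class_GL: "conj_class (GL N) X = {inv\<^bsub>GL N\<^esub> S * X * S | S. S \<in> carrier (GL N)}"
  by (simp add: conj_class_def)

text \<open>A form in \<A>(X) is congruent to the given form, whichever that is, so some conjugate
  of \<open>X\<close> is symplectic for it; transitivity on \<A>(X) then leaves no room for a second
  class. The first conclusion is the form used in (b), and both appear in the finite case of
  (c2).\<close>

lemma single_symplectic_class:
  fixes X :: "'a::field mat"
  assumes two: "(2::'a) \<noteq> 0" and X: "X \<in> carrier (GL (2 * m))" and f: "nondeg_alternating_form (2 * m) f"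
    and ne: "inv_gram X \<noteq> {}" and all: "\<And>A B. A \<in> inv_gram X \<Longrightarrow> B \<in> inv_gram X \<Longrightarrow> congruent_over X A B"
  shows "\<exists>Y\<in>carrier (Sp (2 * m) f). conj_class (GL (2 * m)) X \<inter> carrier (Sp (2 * m) f) = conj_class (Sp (2 * m) f) Y"
    and "is_singleton (conj_class (Sp (2 * m) f) ` (conj_class (GL (2 * m)) X \<inter> carrier (Sp (2 * m) f)))"
proof -
  let ?N = "2 * m"
  let ?cl = "conj_class (Sp ?N f)" and ?I = "conj_class (GL ?N) X \<inter> carrier (Sp ?N f)"
  obtain A0 where g: "gram_rep ?N f A0" using gram_rep_exists[OF f] by blast
  note A0 = gram_rep_nondeg[OF f g]
  note Xc = GL_carrier[OF X]
  obtain A where A: "A \<in> inv_gram X" using ne by blast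
  have Ai: "A \<in> carrier (GL ?N)" "A = - transpose_mat A" using A inv_gram_iff[OF Xc] by blast+
  obtain S where S: "S \<in> carrier (GL ?N)" "S * A0 * transpose_mat S = A" using skew_congruent[OF two Ai A0] by blast
  define Y where "Y = inv\<^bsub>GL ?N\<^esub> S * X * S"
  have YSp: "Y \<in> carrier (Sp ?N f)" unfolding Y_def conj_in_Sp_iff[OF g A0 X S(1)] S(2) by (rule A)
  have YI: "Y \<in> ?I" using YSp S(1) unfolding conj_class_GL Y_def by blast
  have cl: "?cl Z = ?cl Y" if Z: "Z \<in> ?I" for Z
  proof -
    obtain S2 where S2: "S2 \<in> carrier (GL ?N)" "Z = inv\<^bsub>GL ?N\<^esub> S2 * X * S2" using Z unfolding conj_class_GL by blast
    hence i: "S2 * A0 * transpose_mat S2 \<in> inv_gram X" using Z conj_in_Sp_iff[OF g A0 X S2(1)] by blast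
    have "congruent_over X (S2 * A0 * transpose_mat S2) A" by (rule all[OF i A])
    hence "orbit (centraliser X) congr_act (S2 * A0 * transpose_mat S2) = orbit (centraliser X) congr_act (S * A0 * transpose_mat S)"
      unfolding S(2) using orbit_eq_iff_congruent[OF Xc inv_gram_carrier[OF i Xc] inv_gram_carrier[OF A Xc]] by blast
    thus ?thesis unfolding S2(2) Y_def conj_class_Sp_eq_iff_orbit[OF g X S2(1) S(1)] .
  qed
  have refl: "Z \<in> ?cl Z" if "Z \<in> carrier (Sp ?N f)" for Z
  proof -
    have "Z \<in> carrier_mat ?N ?N" using that GL_carrier by (auto simp: Sp_def)
    moreover have "inv\<^bsub>GL ?N\<^esub> (1\<^sub>m ?N) = (1\<^sub>m ?N :: 'a mat)" by (rule GL_inv_unique) auto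
    ultimately have "Z = inv\<^bsub>GL ?N\<^esub> (1\<^sub>m ?N) * Z * 1\<^sub>m ?N" by simp
    thus ?thesis unfolding conj_class_Sp[OF g] using Sp_closed(1)[OF g] by blast
  qed
  have "?cl Y \<subseteq> ?I"
  proof
    fix Z assume "Z \<in> ?cl Y"
    then obtain h where h: "h \<in> carrier (Sp ?N f)" "Z = inv\<^bsub>GL ?N\<^esub> h * Y * h" unfolding conj_class_Sp[OF g] by blast
    have hG: "h \<in> carrier (GL ?N)" using h(1) by (simp add: Sp_def)
    have "Z \<in> carrier (Sp ?N f)" unfolding h(2)
      by (rule Sp_closed(2)[OF g Sp_closed(2)[OF g Sp_closed(3)[OF g h(1)] YSp] h(1)])
    moreover have "Z = inv\<^bsub>GL ?N\<^esub> (S * h) * X * (S * h)"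
      unfolding h(2) Y_def GL_inv_mult[OF S(1) hG] using Xc GL_carrier[OF S(1)] GL_carrier[OF hG] GL_inv_carrier[OF S(1)] GL_inv_carrier[OF hG]
      by (simp add: sq_assoc[where n="?N"] del: GL_inv_carrier)
    ultimately show "Z \<in> ?I" unfolding conj_class_GL using GL_mult_closed[OF S(1) hG] by blast
  qed
  moreover have "?I \<subseteq> ?cl Y" using cl refl by blast
  ultimately have "?I = ?cl Y" by blast
  thus "\<exists>Y\<in>carrier (Sp ?N f). ?I = ?cl Y" using YSp by blast
  have "?cl ` ?I = {?cl Y}" using cl YI by blast
  thus "is_singleton (?cl ` ?I)" by (simp only: is_singletonI)
qed

lemma inv_gram_nonempty:
  fixes X :: "'a::field mat"
  assumes f: "nondeg_alternating_form N f" and X: "X \<in> carrier (Sp N f)"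
  shows "inv_gram X \<noteq> {}"
proof -
  obtain A0 where g: "gram_rep N f A0" using gram_rep_exists[OF f] by blast
  have X: "X \<in> carrier (GL N)" "X * A0 * transpose_mat X = A0" using X unfolding Sp_iff[OF g] by blast+
  have "A0 \<in> inv_gram X" unfolding inv_gram_iff[OF GL_carrier[OF X(1)]] using gram_rep_nondeg[OF f g] X(2) by auto
  thus ?thesis by blast
qed

section \<open>A linear self-reciprocal divisor\<close>

lemma elementary_divisors_replicate:
  fixes X :: "'a::field mat"
  assumes X: "X \<in> carrier_mat N N" and ed: "elementary_divisors X (replicate_mset n g)"
  shows "similar_mat X (diag_block_mat (replicate n (companion_mat g)))" "degree g * n = N"
proof -
  obtain es where es: "mset es = replicate_mset n g" "similar_mat X (diag_block_mat (map companion_mat es))"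
    using ed by (auto simp: elementary_divisors_def)
  have "es = replicate n g"
    using es(1) by (metis in_replicate_mset length_replicate replicate_eqI set_mset_mset size_mset size_replicate_mset)
  thus s: "similar_mat X (diag_block_mat (replicate n (companion_mat g)))" using es(2) by simp
  have "diag_block_mat (replicate n (companion_mat g)) \<in> carrier_mat (n * degree g) (n * degree g)"
    by (rule diag_replicate_carrier) simp
  moreover have "diag_block_mat (replicate n (companion_mat g)) \<in> carrier_mat N N"
    using similar_mat_GL_E[OF s X] by blast
  ultimately show "degree g * n = N" using carrier_matD(1) mult.commute by metis
qed

text \<open>A self-reciprocal g = t + c satisfies c = c^{-1}, hence c is 1 or -1. All companion
  blocks are then the scalar - c, and a matrix similar to a scalar matrix is that scalar matrix;
  only the congruence of alternating forms remains.\<close>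

lemma linear_self_reciprocal:
  fixes X :: "'a::field mat"
  assumes two: "(2::'a) \<noteq> 0" and X: "X \<in> carrier (GL (2 * m))" and ne: "inv_gram X \<noteq> {}"
    and g: "monic g" "irreducible g" "g \<noteq> [:0, 1:]" "g = recip_poly g" and d: "degree g = 1"
    and ed: "elementary_divisors X (replicate_mset n g)"
  shows "X = 1\<^sub>m (2 * m) \<or> X = - 1\<^sub>m (2 * m)" "centraliser X = GL (2 * m)"
    "is_singleton (orbits (centraliser X) (inv_gram X) congr_act)"
proof -
  let ?N = "2 * m"
  note Xc = GL_carrier[OF X]
  obtain c where gc: "g = [:c, 1:]"
  proof -
    obtain c b where "g = [:c, b:]" using d by (metis degree1_coeffs)
    thus ?thesis using that g(1) d by (metis coeff_pCons_0 coeff_pCons_Suc One_nat_def)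
  qed
  have c0: "c \<noteq> 0" using poly_0_irreducible[OF g(1-3)] gc by simp
  have "coeff (recip_poly g) 0 = inverse c" using gc c0 by (simp add: recip_poly_def)
  hence "c = inverse c" using g(4) gc by (metis coeff_pCons_0)
  hence "c * c = 1" using c0 by (metis right_inverse)
  hence "(c - 1) * (c + 1) = 0" by (simp add: algebra_simps)
  hence c1: "c = 1 \<or> c = -1" by (auto simp: eq_neg_iff_add_eq_0)
  have comp: "companion_mat g = (- c) \<cdot>\<^sub>m 1\<^sub>m 1" by (intro eq_matI) (auto simp: companion_mat_def gc)
  have Nn: "n = ?N" using elementary_divisors_replicate(2)[OF Xc ed] d by simp
  have dk: "diag_block_mat (replicate k ((- c) \<cdot>\<^sub>m 1\<^sub>m 1)) = (- c) \<cdot>\<^sub>m 1\<^sub>m k" for k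
  proof (induction k)
    case 0
    thus ?case by (auto intro: eq_matI)
  next
    case (Suc k)
    have "(- c) \<cdot>\<^sub>m 1\<^sub>m 1 \<in> carrier_mat 1 1" by simp
    from diag_replicate_Suc[OF this, of k] show ?case unfolding Suc by (auto intro!: eq_matI)
  qed
  obtain P where P: "P \<in> carrier (GL ?N)" "X * P = P * ((- c) \<cdot>\<^sub>m 1\<^sub>m ?N)"
    using similar_mat_GL_E[OF elementary_divisors_replicate(1)[OF Xc ed] Xc] unfolding comp dk Nn by blast
  note Pc = GL_carrier[OF P(1)]
  have "X * P = ((- c) \<cdot>\<^sub>m 1\<^sub>m ?N) * P" unfolding P(2)
    using mult_smult_distrib[OF Pc one_carrier_mat] mult_smult_assoc_mat[OF one_carrier_mat Pc] Pc by simp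
  hence Xe: "X = (- c) \<cdot>\<^sub>m 1\<^sub>m ?N" by (intro GL_right_cancel[OF P(1) Xc]) auto
  show X1: "X = 1\<^sub>m ?N \<or> X = - 1\<^sub>m ?N"
  proof -
    from c1 show ?thesis unfolding Xe by (auto intro!: eq_matI)
  qed
  have comm: "Y * X = X * Y" if "Y \<in> carrier_mat ?N ?N" for Y
    unfolding Xe using mult_smult_distrib[OF that one_carrier_mat] mult_smult_assoc_mat[OF one_carrier_mat that] that by simp
  have "{Y \<in> carrier (GL ?N). Y * X = X * Y} = carrier (GL ?N)" using comm GL_carrier by blast
  moreover have "dim_row X = ?N" using Xc by simp
  ultimately show C: "centraliser X = GL ?N" unfolding centraliser_def by simp
  obtain A where A: "A \<in> inv_gram X" using ne by blast
  have "orbit (centraliser X) congr_act B = orbit (centraliser X) congr_act A" if B: "B \<in> inv_gram X" for B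
  proof -
    have Ai: "A \<in> carrier (GL ?N)" "A = - transpose_mat A" using A inv_gram_iff[OF Xc] by blast+
    have Bi: "B \<in> carrier (GL ?N)" "B = - transpose_mat B" using B inv_gram_iff[OF Xc] by blast+
    from skew_congruent[OF two Ai Bi] have "congruent_over X B A" unfolding congruent_over_def C .
    thus ?thesis using orbit_eq_iff_congruent[OF Xc inv_gram_carrier[OF B Xc] inv_gram_carrier[OF A Xc]] by blast
  qed
  hence "orbits (centraliser X) (inv_gram X) congr_act = {orbit (centraliser X) congr_act A}" unfolding orbits_def using A by blast
  thus "is_singleton (orbits (centraliser X) (inv_gram X) congr_act)" by simp
qed

section \<open>Matrices with an irreducible annihilating polynomial\<close>

text \<open>Every non-zero row is a cyclic vector. A dependency among the rows is a polynomial q of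
  degree below \<open>d\<close> with v q(R) = 0; if q were non-zero it would be comaximal to
  \<open>g\<close>, and q(R) would be invertible.\<close>

lemma krylov_irreducible_GL:
  fixes R :: "'a::field mat"
  assumes R: "R \<in> carrier_mat d d" and g: "irreducible g" "degree g = d" and gR: "poly_mat g R = 0\<^sub>m d d"
    and v: "v \<in> carrier_mat 1 d" "v \<noteq> 0\<^sub>m 1 d"
  shows "krylov v R d \<in> carrier (GL d)"
proof (rule GL_left_kernel[OF krylov_carrier[OF R]])
  fix a :: "'a mat" assume a: "a \<in> carrier_mat 1 d" "a * krylov v R d = 0\<^sub>m 1 d"
  obtain q where q: "\<And>k. coeff q k = (if k < d then a $$ (0,k) else 0)" "a * krylov v R d = v * poly_mat q R"
    using row_times_krylov[OF R v(1) a(1)] by blast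
  have "q = 0"
  proof (rule ccontr)
    assume q0: "q \<noteq> 0"
    have "degree q < d" using q0 q(1) by (metis leading_coeff_0_iff)
    hence "\<not> g dvd q" using q0 g(2) dvd_imp_degree_le[of g q] by auto
    hence "comaximal q g" by (rule comaximal_sym[OF irreducible_comaximal[OF g(1)]])
    hence G: "poly_mat q R \<in> carrier (GL d)" by (rule poly_mat_comaximal_GL[OF R _ gR])
    have "v * poly_mat q R = 0\<^sub>m 1 d * poly_mat q R"
      unfolding q(2)[symmetric] a(2) left_mult_zero_mat[OF poly_mat_carrier[OF R]] ..
    hence "v = 0\<^sub>m 1 d" by (rule GL_right_cancel[OF G v(1) zero_carrier_mat])
    thus False using v(2) by contradiction
  qed
  hence "a $$ (0,k) = 0" if "k < d" for k using q(1)[of k] that by simp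
  thus "a = 0\<^sub>m 1 d" using a(1) by (intro eq_matI) auto
qed

lemma unit_row_nonzero:
  assumes "d > 0"
  shows "mat 1 d (\<lambda>(i,j). if j = 0 then 1 else 0) \<noteq> (0\<^sub>m 1 d :: 'a::field mat)"
proof
  assume "mat 1 d (\<lambda>(i,j). if j = 0 then 1 else 0) = (0\<^sub>m 1 d :: 'a mat)"
  hence "mat 1 d (\<lambda>(i,j). if j = 0 then 1 else 0) $$ (0,0) = (0\<^sub>m 1 d :: 'a mat) $$ (0,0)" by (rule arg_cong)
  thus False using assms by simp
qed

text \<open>The Krylov matrix of a cyclic vector performs the change of basis. Only g(R) = 0 in the
  right size is assumed, so the fact covers \<open>R\<close> as well as the transpose of its
  inverse.\<close>

lemma irreducible_annihilator_similar_companion: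
  fixes R :: "'a::field mat"
  assumes R: "R \<in> carrier_mat d d" and g: "irreducible g" "monic g" "degree g = d" and gR: "poly_mat g R = 0\<^sub>m d d"
  shows "similar_mat R (companion_mat g)"
proof -
  have d0: "d > 0" using g by (metis bot_nat_0.not_eq_extremum irreducible_def is_unit_iff_degree)
  define v where "v = mat 1 d (\<lambda>(i,j). if j = 0 then 1 else (0::'a))"
  have v: "v \<in> carrier_mat 1 d" by (simp add: v_def)
  have v0: "v \<noteq> 0\<^sub>m 1 d" unfolding v_def by (rule unit_row_nonzero[OF d0])
  define V where "V = krylov v R d"
  have "v * poly_mat g R = 0\<^sub>m 1 d" unfolding gR using v by simp
  hence "V * R = companion_mat g * V" using krylov_companion[OF R v g(2)] g(3) unfolding V_def by simp
  moreover have "V \<in> carrier (GL d)" unfolding V_def by (rule krylov_irreducible_GL[OF R g(1,3) gR v v0])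
  moreover have "companion_mat g \<in> carrier_mat d d" using g(3) companion_mat_carrier[of g] by simp
  ultimately have "similar_mat (companion_mat g) R" using similar_mat_GL_I[of "companion_mat g" d R V] R by simp
  thus ?thesis by (rule similar_mat_sym)
qed

lemma krylov_mult_index:
  fixes X :: "'a::field mat"
  assumes X: "X \<in> carrier_mat n n" and Z: "Z \<in> carrier_mat n n" and v: "v \<in> carrier_mat 1 n" and ij: "i < k" "j < n"
  shows "(krylov v X k * Z) $$ (i,j) = (v * X ^\<^sub>m i * Z) $$ (0,j)"
proof -
  have "(krylov v X k * Z) $$ (i,j) = (\<Sum>l<n. (v * X ^\<^sub>m i) $$ (0,l) * Z $$ (l,j))"
    using mult_index[OF krylov_carrier[OF X] Z ij] ij X by (simp add: krylov_def)
  also have "\<dots> = (v * X ^\<^sub>m i * Z) $$ (0,j)"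
    by (rule mult_index[symmetric, OF mult_carrier_mat[OF v pow_carrier_mat[OF X]] Z _ ij(2)]) simp
  finally show ?thesis .
qed

text \<open>For a cyclic vector \<open>v\<close> there is q with v Z = v q(R). Both \<open>Z\<close>
  and q(R) commute with \<open>R\<close>, so they agree on all rows v R^i, which form a
  basis.\<close>

lemma commutant_irreducible:
  fixes R :: "'a::field mat"
  assumes R: "R \<in> carrier_mat d d" and g: "irreducible g" "degree g = d" and gR: "poly_mat g R = 0\<^sub>m d d"
    and Z: "Z \<in> carrier_mat d d" and RZ: "R * Z = Z * R"
  shows "\<exists>p. Z = poly_mat p R"
proof -
  have d0: "d > 0" using g by (metis bot_nat_0.not_eq_extremum irreducible_def is_unit_iff_degree)
  define v where "v = mat 1 d (\<lambda>(i,j). if j = 0 then 1 else (0::'a))"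
  have v: "v \<in> carrier_mat 1 d" by (simp add: v_def)
  have v0: "v \<noteq> 0\<^sub>m 1 d" unfolding v_def by (rule unit_row_nonzero[OF d0])
  let ?V = "krylov v R d"
  have VG: "?V \<in> carrier (GL d)" by (rule krylov_irreducible_GL[OF R g gR v v0])
  have V: "?V \<in> carrier_mat d d" by (rule GL_carrier[OF VG])
  have vZ: "v * Z \<in> carrier_mat 1 d" using v Z by simp
  define a where "a = v * Z * inv\<^bsub>GL d\<^esub> ?V"
  have a: "a \<in> carrier_mat 1 d" unfolding a_def by (rule mult_carrier_mat[OF vZ GL_inv_carrier[OF VG]])
  have "a * ?V = v * Z * (inv\<^bsub>GL d\<^esub> ?V * ?V)" unfolding a_def by (rule assoc_mult_mat[OF vZ GL_inv_carrier[OF VG] V])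
  hence aV: "a * ?V = v * Z" unfolding GL_l_inv[OF VG] right_mult_one_mat[OF vZ] .
  obtain q where q: "a * ?V = v * poly_mat q R" using row_times_krylov[OF R v a] by blast
  let ?W = "poly_mat q R"
  have W: "?W \<in> carrier_mat d d" using R by simp
  have comm: "R ^\<^sub>m i * Z = Z * R ^\<^sub>m i" "R ^\<^sub>m i * ?W = ?W * R ^\<^sub>m i" for i
  proof -
    have one: "1 \<cdot>\<^sub>m M = M" for M :: "'a mat" by (intro eq_matI) auto
    show "R ^\<^sub>m i * Z = Z * R ^\<^sub>m i"
      using poly_mat_intertwine[OF R R Z RZ, of "monom 1 i"] by (simp add: poly_mat_monom[OF R] one)
    show "R ^\<^sub>m i * ?W = ?W * R ^\<^sub>m i"
      using poly_mat_self_commute[OF R, of "monom 1 i" q] by (simp add: poly_mat_monom[OF R] one)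
  qed
  have "?V * Z = ?V * ?W"
  proof (rule eq_matI)
    fix i j assume "i < dim_row (?V * ?W)" "j < dim_col (?V * ?W)"
    hence ij: "i < d" "j < d" using V R by auto
    have Ri: "R ^\<^sub>m i \<in> carrier_mat d d" using R by simp
    have "v * R ^\<^sub>m i * Z = v * Z * R ^\<^sub>m i"
      unfolding assoc_mult_mat[OF v Ri Z] comm(1) by (rule assoc_mult_mat[symmetric, OF v Z Ri])
    also have "v * Z = v * ?W" using aV q by simp
    also have "v * ?W * R ^\<^sub>m i = v * R ^\<^sub>m i * ?W"
      unfolding assoc_mult_mat[OF v W Ri] comm(2)[symmetric] by (rule assoc_mult_mat[symmetric, OF v Ri W])
    finally have "v * R ^\<^sub>m i * Z = v * R ^\<^sub>m i * ?W" .
    thus "(?V * Z) $$ (i,j) = (?V * ?W) $$ (i,j)"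
      unfolding krylov_mult_index[OF R Z v ij] krylov_mult_index[OF R W v ij] by simp
  qed (use V Z R in auto)
  hence "Z = ?W" using GL_left_cancel[OF VG, of Z ?W] Z W R by simp
  thus ?thesis by blast
qed

lemma poly_mat_pcompose:
  fixes R :: "'a::field mat"
  assumes R: "R \<in> carrier_mat n n"
  shows "poly_mat (pcompose p q) R = poly_mat p (poly_mat q R)"
proof (induction p)
  case 0
  thus ?case using R by simp
next
  case (pCons a p)
  have q: "poly_mat q R \<in> carrier_mat n n" using R by simp
  show ?case
    unfolding pcompose_pCons poly_mat_add[OF R] poly_mat_mult[OF R] poly_mat_const[OF R] pCons.IH poly_mat_pCons[OF q] ..
qed

section \<open>Block matrices\<close>

lemma sum_blocks:
  fixes F :: "nat \<Rightarrow> 'b::comm_monoid_add"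
  shows "(\<Sum>l<n * d. F l) = (\<Sum>k<n. \<Sum>b<d. F (k * d + b))"
proof -
  have "(\<Sum>l<n * d. F l) = (\<Sum>k<n. sum F {k * d ..< k * d + d})" by (rule sum.nat_group[symmetric])
  also have "\<dots> = (\<Sum>k<n. \<Sum>b<d. F (k * d + b))"
    using sum.atLeastLessThan_shift_0[of F] by (simp add: atLeast0LessThan)
  finally show ?thesis .
qed

lemma block_index_bounds:
  assumes "i < n * (d::nat)"
  shows "i div d < n" "i mod d < d"
  using assms by (auto simp: less_mult_imp_div_less) (metis mod_less_divisor mult_0_right not_less0 gr0I)

lemma block_index_less: "k < n \<Longrightarrow> b < d \<Longrightarrow> k * d + b < n * (d::nat)"
  by (metis add.commute div_less_iff_less_mult div_mult_self3 div_less add.right_neutral gr_implies_not0 less_nat_zero_code neq0_conv)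

lemma blocks_mat_carrier [simp]: "blocks_mat n d B \<in> carrier_mat (n * d) (n * d)"
  by (simp add: blocks_mat_def)

lemma blocks_mat_index: "i < n * d \<Longrightarrow> j < n * d \<Longrightarrow> blocks_mat n d B $$ (i,j) = B (i div d) (j div d) $$ (i mod d, j mod d)"
  by (simp add: blocks_mat_def)

lemma block_of_blocks_mat:
  assumes "i < n" "j < n" "B i j \<in> carrier_mat d d"
  shows "block_of d (blocks_mat n d B) i j = B i j"
  using assms block_index_less[of i n _ d] block_index_less[of j n _ d]
  by (intro eq_matI) (auto simp: block_of_def blocks_mat_index)

lemma blocks_mat_block_of:
  assumes Y: "Y \<in> carrier_mat (n * d) (n * d)"
  shows "blocks_mat n d (block_of d Y) = Y"
proof (rule eq_matI)
  fix i j assume "i < dim_row Y" "j < dim_col Y"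
  hence ij: "i < n * d" "j < n * d" using Y by auto
  show "blocks_mat n d (block_of d Y) $$ (i,j) = Y $$ (i,j)"
    unfolding blocks_mat_index[OF ij] using block_index_bounds[OF ij(1)] block_index_bounds[OF ij(2)] by (simp add: block_of_def)
qed (use Y in \<open>auto simp: blocks_mat_def\<close>)

lemma blocks_mat_cong:
  assumes "\<And>i j. i < n \<Longrightarrow> j < n \<Longrightarrow> B i j = C i j"
  shows "blocks_mat n d B = blocks_mat n d C"
  using assms block_index_bounds by (intro eq_matI) (auto simp: blocks_mat_def)

lemma blocks_mat_eq_iff:
  assumes "\<And>i j. i < n \<Longrightarrow> j < n \<Longrightarrow> B i j \<in> carrier_mat d d" "\<And>i j. i < n \<Longrightarrow> j < n \<Longrightarrow> C i j \<in> carrier_mat d d"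
  shows "blocks_mat n d B = blocks_mat n d C \<longleftrightarrow> (\<forall>i<n. \<forall>j<n. B i j = C i j)"
proof
  assume eq: "blocks_mat n d B = blocks_mat n d C"
  show "\<forall>i<n. \<forall>j<n. B i j = C i j"
  proof (intro allI impI)
    fix i j assume ij: "i < n" "j < n"
    have "B i j = block_of d (blocks_mat n d B) i j" using block_of_blocks_mat[of i n j B d] ij assms(1)[OF ij] by simp
    also have "\<dots> = C i j" unfolding eq using block_of_blocks_mat[of i n j C d] ij assms(2)[OF ij] by simp
    finally show "B i j = C i j" .
  qed
qed (auto intro: blocks_mat_cong)

lemma transpose_blocks_mat:
  assumes "\<And>i j. i < n \<Longrightarrow> j < n \<Longrightarrow> B i j \<in> carrier_mat d d"
  shows "transpose_mat (blocks_mat n d B) = blocks_mat n d (\<lambda>i j. transpose_mat (B j i))"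
proof (rule eq_matI)
  fix i j assume "i < dim_row (blocks_mat n d (\<lambda>i j. transpose_mat (B j i)))" "j < dim_col (blocks_mat n d (\<lambda>i j. transpose_mat (B j i)))"
  hence ij: "i < n * d" "j < n * d" by (auto simp: blocks_mat_def)
  note b = block_index_bounds[OF ij(1)] block_index_bounds[OF ij(2)]
  show "transpose_mat (blocks_mat n d B) $$ (i,j) = blocks_mat n d (\<lambda>i j. transpose_mat (B j i)) $$ (i,j)"
    using ij b assms[OF b(3) b(1)] by (simp add: blocks_mat_def)
qed (auto simp: blocks_mat_def)

lemma diag_replicate_index:
  assumes T: "T \<in> carrier_mat d d" and "i < n * d" "j < n * d"
  shows "diag_block_mat (replicate n T) $$ (i,j) = (if i div d = j div d then T $$ (i mod d, j mod d) else 0)"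
  using assms(2,3)
proof (induction n arbitrary: i j)
  case (Suc n)
  have d: "d > 0" using Suc.prems by (cases d) auto
  note c = diag_replicate_carrier[OF T, of n]
  have div: "k div d = Suc ((k - d) div d)" "k mod d = (k - d) mod d" if "\<not> k < d" for k
    using that d by (simp_all add: le_div_geq le_mod_geq)
  have "diag_block_mat (replicate (Suc n) T) $$ (i,j) = (if i < d then if j < d then T $$ (i,j) else 0
      else if j < d then 0 else diag_block_mat (replicate n T) $$ (i - d, j - d))"
    unfolding diag_replicate_Suc[OF T] using Suc.prems T c by simp
  moreover have "diag_block_mat (replicate n T) $$ (i - d, j - d) =
      (if (i - d) div d = (j - d) div d then T $$ ((i - d) mod d, (j - d) mod d) else 0)" if "\<not> i < d" "\<not> j < d"
    using that Suc.prems by (intro Suc.IH) auto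
  ultimately show ?case using div[of i] div[of j] by auto
qed simp

lemma blocks_mat_mult_diag:
  fixes T :: "'a::field mat"
  assumes T: "T \<in> carrier_mat d d" and B: "\<And>i j. i < n \<Longrightarrow> j < n \<Longrightarrow> B i j \<in> carrier_mat d d"
  shows "blocks_mat n d B * diag_block_mat (replicate n T) = blocks_mat n d (\<lambda>i j. B i j * T)"
proof (rule eq_matI)
  let ?D = "diag_block_mat (replicate n T)"
  note Dc = diag_replicate_carrier[OF T, of n]
  fix i j assume "i < dim_row (blocks_mat n d (\<lambda>i j. B i j * T))" "j < dim_col (blocks_mat n d (\<lambda>i j. B i j * T))"
  hence ij: "i < n * d" "j < n * d" by (auto simp: blocks_mat_def)
  note b = block_index_bounds[OF ij(1)] block_index_bounds[OF ij(2)]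
  have "(blocks_mat n d B * ?D) $$ (i,j) = (\<Sum>k<n. \<Sum>c<d. blocks_mat n d B $$ (i,k * d + c) * ?D $$ (k * d + c, j))"
    unfolding mult_index[OF blocks_mat_carrier Dc ij] by (rule sum_blocks)
  also have "\<dots> = (\<Sum>k<n. if k = j div d then (\<Sum>c<d. B (i div d) k $$ (i mod d, c) * T $$ (c, j mod d)) else 0)"
  proof (rule sum.cong[OF refl])
    fix k assume "k \<in> {..<n}"
    hence k: "k < n" by simp
    have "blocks_mat n d B $$ (i,k * d + c) * ?D $$ (k * d + c, j) = (if k = j div d then B (i div d) k $$ (i mod d, c) * T $$ (c, j mod d) else 0)"
      if "c < d" for c
      using that ij block_index_less[OF k that] by (simp add: blocks_mat_index diag_replicate_index[OF T])
    thus "(\<Sum>c<d. blocks_mat n d B $$ (i,k * d + c) * ?D $$ (k * d + c, j)) =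
      (if k = j div d then (\<Sum>c<d. B (i div d) k $$ (i mod d, c) * T $$ (c, j mod d)) else 0)" by simp
  qed
  also have "\<dots> = (\<Sum>c<d. B (i div d) (j div d) $$ (i mod d, c) * T $$ (c, j mod d))" using b by simp
  also have "\<dots> = (B (i div d) (j div d) * T) $$ (i mod d, j mod d)"
    by (rule mult_index[symmetric, OF B[OF b(1) b(3)] T b(2) b(4)])
  finally show "(blocks_mat n d B * ?D) $$ (i,j) = blocks_mat n d (\<lambda>i j. B i j * T) $$ (i,j)"
    using ij by (simp add: blocks_mat_index)
qed (use diag_replicate_carrier[OF T, of n] in \<open>auto simp: blocks_mat_def\<close>)

lemma transpose_diag_replicate:
  assumes T: "T \<in> carrier_mat d d"
  shows "transpose_mat (diag_block_mat (replicate n T)) = diag_block_mat (replicate n (transpose_mat T))"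
proof -
  have "square_blocks (replicate n T) (replicate n d)" using T by (simp add: square_blocks_nth)
  from diag_block_transpose[OF this] show ?thesis by simp
qed

text \<open>Obtained by transposition from the product with the diagonal factor on the
  right.\<close>

lemma diag_mult_blocks_mat:
  fixes T :: "'a::field mat"
  assumes T: "T \<in> carrier_mat d d" and B: "\<And>i j. i < n \<Longrightarrow> j < n \<Longrightarrow> B i j \<in> carrier_mat d d"
  shows "diag_block_mat (replicate n T) * blocks_mat n d B = blocks_mat n d (\<lambda>i j. T * B i j)"
proof -
  let ?D = "diag_block_mat (replicate n T)" and ?Bt = "\<lambda>i j. transpose_mat (B j i)"
  note Dc = diag_replicate_carrier[OF T, of n]
  have Tt: "transpose_mat T \<in> carrier_mat d d" using T by simp
  have "transpose_mat (?D * blocks_mat n d B) = transpose_mat (blocks_mat n d B) * transpose_mat ?D"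
    by (rule transpose_mult[OF Dc blocks_mat_carrier])
  also have "\<dots> = blocks_mat n d (\<lambda>i j. ?Bt i j * transpose_mat T)"
  proof -
    have "transpose_mat (blocks_mat n d B) = blocks_mat n d ?Bt" using B by (rule transpose_blocks_mat)
    moreover have "blocks_mat n d ?Bt * diag_block_mat (replicate n (transpose_mat T)) = blocks_mat n d (\<lambda>i j. ?Bt i j * transpose_mat T)"
      using B by (intro blocks_mat_mult_diag[OF Tt]) simp
    ultimately show ?thesis unfolding transpose_diag_replicate[OF T] by simp
  qed
  also have "\<dots> = blocks_mat n d (\<lambda>i j. transpose_mat (T * B j i))"
    using transpose_mult[OF T B] by (intro blocks_mat_cong) simp
  also have "\<dots> = transpose_mat (blocks_mat n d (\<lambda>i j. T * B i j))"
    using T B by (intro transpose_blocks_mat[symmetric]) auto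
  finally show ?thesis unfolding transpose_mat_eq .
qed

section \<open>The field generated by a self-reciprocal block\<close>

text \<open>The bound \<open>d \<ge> 2\<close> excludes t - 1 and t + 1, so that \<open>R\<close>
  differs from its inverse and the involution is not trivial. Elements of F[R] are handled as values
  of polynomials that matter only modulo \<open>g\<close>.\<close>

locale self_reciprocal_block =
  fixes R :: "'a::field mat" and g :: "'a poly" and d :: nat
  assumes R: "R \<in> carrier (GL d)" and g: "monic g" "irreducible g" "degree g = d" "g = recip_poly g" "g \<noteq> [:0, 1:]"
    and d2: "d \<ge> 2" and gR: "poly_mat g R = 0\<^sub>m d d"
begin

abbreviation "Ri \<equiv> inv\<^bsub>GL d\<^esub> R"

lemma Rc: "R \<in> carrier_mat d d" by (rule GL_carrier[OF R])
lemma Ric: "Ri \<in> carrier_mat d d" by (rule GL_inv_carrier[OF R])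
lemma dimR: "dim_row R = d" using Rc by simp

lemma g0: "poly g 0 \<noteq> 0" by (rule poly_0_irreducible[OF g(1,2,5)])

lemma gRi: "poly_mat g Ri = 0\<^sub>m d d"
  using poly_mat_recip_eq_0_iff[OF R g0] gR unfolding g(4)[symmetric] by simp

lemma zero_not_GL: "0\<^sub>m d d \<notin> carrier (GL d :: 'a mat monoid)"
  using GL_det[of "0\<^sub>m d d :: 'a mat" d] d2 by simp

text \<open>The dichotomy of a field: a value at \<open>Z\<close> is zero or invertible, and
  \<open>g\<close> decides which. It is stated for any \<open>Z\<close> annihilated by
  \<open>g\<close> since it is used for \<open>R\<close> and for its inverse.\<close>

lemma poly_mat_GL_iff:
  assumes "Z \<in> carrier_mat d d" "poly_mat g Z = 0\<^sub>m d d"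
  shows "poly_mat p Z \<in> carrier (GL d) \<longleftrightarrow> \<not> g dvd p" "poly_mat p Z = 0\<^sub>m d d \<longleftrightarrow> g dvd p"
proof -
  have 1: "poly_mat p Z = 0\<^sub>m d d" if dv: "g dvd p"
  proof -
    obtain q where q: "p = g * q" using dv by (rule dvdE)
    show ?thesis unfolding q poly_mat_mult[OF assms(1)] assms(2) using assms(1) by (intro left_mult_zero_mat) simp
  qed
  have 2: "poly_mat p Z \<in> carrier (GL d)" if "\<not> g dvd p"
    by (rule poly_mat_comaximal_GL[OF assms(1) comaximal_sym[OF irreducible_comaximal[OF g(2) that]] assms(2)])
  show "poly_mat p Z \<in> carrier (GL d) \<longleftrightarrow> \<not> g dvd p" "poly_mat p Z = 0\<^sub>m d d \<longleftrightarrow> g dvd p"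
    using 1 2 zero_not_GL by metis+
qed

lemmas poly_R_iff = poly_mat_GL_iff[OF Rc gR]
lemmas poly_Ri_iff = poly_mat_GL_iff[OF Ric gRi]

lemma mat_eq_iff_minus:
  fixes A :: "'a mat"
  assumes "A \<in> carrier_mat d d" "B \<in> carrier_mat d d"
  shows "A = B \<longleftrightarrow> A - B = 0\<^sub>m d d"
proof
  assume e: "A - B = 0\<^sub>m d d"
  show "A = B"
  proof (rule eq_matI)
    fix i j assume "i < dim_row B" "j < dim_col B"
    hence ij: "i < d" "j < d" using assms by auto
    have "(A - B) $$ (i,j) = 0" unfolding e using ij by simp
    thus "A $$ (i,j) = B $$ (i,j)" using ij assms by simp
  qed (use assms in auto)
qed (use assms in auto)

lemma poly_R_eq_iff: "poly_mat p R = poly_mat q R \<longleftrightarrow> g dvd p - q"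
  using mat_eq_iff_minus[OF poly_mat_carrier[OF Rc] poly_mat_carrier[OF Rc], of p q]
  unfolding poly_mat_minus[OF Rc, symmetric] poly_R_iff(2) .

lemma poly_Ri_eq_iff: "poly_mat p Ri = poly_mat q Ri \<longleftrightarrow> g dvd p - q"
  using mat_eq_iff_minus[OF poly_mat_carrier[OF Ric] poly_mat_carrier[OF Ric], of p q]
  unfolding poly_mat_minus[OF Ric, symmetric] poly_Ri_iff(2) .

text \<open>Independence of the chosen polynomial: two polynomials agree at \<open>R\<close> exactly
  when \<open>g\<close> divides their difference, which is also the condition for agreement at the
  inverse of \<open>R\<close>.\<close>

lemma poly_conj_poly_mat: "poly_conj R (poly_mat p R) = poly_mat p Ri"
proof -
  let ?q = "SOME q. poly_mat q R = poly_mat p R"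
  have "poly_mat ?q R = poly_mat p R" by (rule someI[of "\<lambda>q. poly_mat q R = poly_mat p R"]) (rule refl)
  hence "poly_mat ?q Ri = poly_mat p Ri" unfolding poly_R_eq_iff poly_Ri_eq_iff .
  thus ?thesis unfolding poly_conj_def dimR .
qed

text \<open>A polynomial \<open>r\<close> inverse to \<open>t\<close> modulo \<open>g\<close>
  represents inversion at every root of \<open>g\<close>, in particular both at \<open>R\<close> and
  at its inverse.\<close>

lemma inverse_poly: "\<exists>r. poly_mat r R = Ri \<and> poly_mat r Ri = R"
proof -
  have "\<not> [:0, 1:] dvd g" using g0 poly_eq_0_iff_dvd[of g 0] by simp
  hence "comaximal [:0, 1:] g" by (rule irreducible_comaximal[OF irreducible_X])
  then obtain r b where rb: "r * [:0, 1:] + b * g = 1" by (auto simp: comaximal_def)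
  have e: "r * [:0, 1:] - 1 = - (b * g)" unfolding rb[symmetric] by simp
  have dv: "g dvd r * [:0, 1:] - 1" unfolding e by simp
  have 1: "poly_mat (r * [:0, 1:]) R = poly_mat 1 R" unfolding poly_R_eq_iff by (rule dv)
  have 2: "poly_mat (r * [:0, 1:]) Ri = poly_mat 1 Ri" unfolding poly_Ri_eq_iff by (rule dv)
  have rR: "poly_mat r R * R = 1\<^sub>m d" using 1 unfolding poly_mat_mult[OF Rc] poly_mat_X[OF Rc] poly_mat_1[OF Rc] .
  have rRi: "poly_mat r Ri * Ri = 1\<^sub>m d" using 2 unfolding poly_mat_mult[OF Ric] poly_mat_X[OF Ric] poly_mat_1[OF Ric] .
  have c: "poly_mat r R \<in> carrier_mat d d" "poly_mat r Ri \<in> carrier_mat d d" using Rc Ric by simp_all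
  have "poly_mat r R = Ri"
    by (rule GL_right_cancel[OF R c(1) Ric]) (use rR R in simp)
  moreover have "poly_mat r Ri = R"
    by (rule GL_right_cancel[OF GL_inv_closed[OF R] c(2) Rc]) (use rRi R in simp)
  ultimately show ?thesis by blast
qed

text \<open>Composition with the polynomial that represents inversion. The first equation shows that
  the conjugation maps F[R] into itself, and the second makes it an involution.\<close>

lemma poly_mat_Ri_in: "\<exists>q. poly_mat p Ri = poly_mat q R \<and> poly_mat q Ri = poly_mat p R"
proof -
  obtain r where r: "poly_mat r R = Ri" "poly_mat r Ri = R" using inverse_poly by blast
  have "poly_mat (pcompose p r) R = poly_mat p Ri" "poly_mat (pcompose p r) Ri = poly_mat p R"
    unfolding poly_mat_pcompose[OF Rc] poly_mat_pcompose[OF Ric] r by (rule refl)+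
  thus ?thesis by metis
qed

text \<open>Otherwise R^2 = 1, and \<open>g\<close> would divide (t - 1)(t + 1); an irreducible
  polynomial of degree at least 2 divides neither factor.\<close>

lemma R_neq_Ri: "R \<noteq> Ri"
proof
  assume e: "R = Ri"
  have "R * R = 1\<^sub>m d" using arg_cong[OF e, of "\<lambda>M. R * M"] GL_r_inv[OF R] by simp
  hence "poly_mat ([:0, 1:] * [:0, 1:]) R = poly_mat 1 R"
    unfolding poly_mat_mult[OF Rc] poly_mat_X[OF Rc] poly_mat_1[OF Rc] .
  hence "g dvd [:0, 1:] * [:0, 1:] - 1" unfolding poly_R_eq_iff .
  also have "[:0, 1:] * [:0, 1:] - 1 = [:-1, 1:] * [:1, 1 :: 'a:]" by (simp add: one_pCons)
  finally have dv: "g dvd [:-1, 1:] * [:1, 1:]" .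
  have nd: "\<not> g dvd [:c, 1:]" for c using dvd_imp_degree_le[of g "[:c, 1:]"] g(3) d2 by auto
  from comaximal_dvd_mult[OF irreducible_comaximal[OF g(2) nd] dv] nd show False by blast
qed

lemma poly_ring_simps:
  "carrier (poly_ring R) = {poly_mat p R | p. True}" "x \<otimes>\<^bsub>poly_ring R\<^esub> y = x * y" "x \<oplus>\<^bsub>poly_ring R\<^esub> y = x + y"
  "\<one>\<^bsub>poly_ring R\<^esub> = 1\<^sub>m d" "\<zero>\<^bsub>poly_ring R\<^esub> = 0\<^sub>m d d"
  by (simp_all add: poly_ring_def ring_mat_simps dimR)

lemma cring_poly_ring: "cring (poly_ring R)"
proof (rule cringI)
  have in_K: "poly_mat p R \<in> carrier (poly_ring R)" for p unfolding poly_ring_simps by blast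
  have cK: "x \<in> carrier_mat d d" if "x \<in> carrier (poly_ring R)" for x using that Rc unfolding poly_ring_simps by auto
  show "abelian_group (poly_ring R)"
  proof (rule abelian_groupI)
    fix x y assume "x \<in> carrier (poly_ring R)" "y \<in> carrier (poly_ring R)"
    then obtain p q where "x = poly_mat p R" "y = poly_mat q R" unfolding poly_ring_simps by blast
    thus "x \<oplus>\<^bsub>poly_ring R\<^esub> y \<in> carrier (poly_ring R)" "x \<oplus>\<^bsub>poly_ring R\<^esub> y = y \<oplus>\<^bsub>poly_ring R\<^esub> x"
      unfolding poly_ring_simps(3) using in_K[of "p + q"] by (simp_all add: poly_mat_add[OF Rc, symmetric] add.commute)
  next
    show "\<zero>\<^bsub>poly_ring R\<^esub> \<in> carrier (poly_ring R)" using in_K[of 0] by (simp add: poly_ring_simps(5) dimR)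
  next
    fix x y z assume "x \<in> carrier (poly_ring R)" "y \<in> carrier (poly_ring R)" "z \<in> carrier (poly_ring R)"
    thus "x \<oplus>\<^bsub>poly_ring R\<^esub> y \<oplus>\<^bsub>poly_ring R\<^esub> z = x \<oplus>\<^bsub>poly_ring R\<^esub> (y \<oplus>\<^bsub>poly_ring R\<^esub> z)"
      unfolding poly_ring_simps(3) using assoc_add_mat cK by blast
  next
    fix x assume x: "x \<in> carrier (poly_ring R)"
    thus "\<zero>\<^bsub>poly_ring R\<^esub> \<oplus>\<^bsub>poly_ring R\<^esub> x = x" unfolding poly_ring_simps(3,5) using left_add_zero_mat[OF cK] by blast
    obtain p where p: "x = poly_mat p R" using x unfolding poly_ring_simps by blast
    have "poly_mat (- p) R + x = 0\<^sub>m d d" unfolding p poly_mat_add[OF Rc, symmetric] by (simp add: dimR)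
    thus "\<exists>y\<in>carrier (poly_ring R). y \<oplus>\<^bsub>poly_ring R\<^esub> x = \<zero>\<^bsub>poly_ring R\<^esub>"
      unfolding poly_ring_simps(3,5) using in_K by blast
  qed
  show "comm_monoid (poly_ring R)"
  proof (rule comm_monoidI)
    fix x y assume "x \<in> carrier (poly_ring R)" "y \<in> carrier (poly_ring R)"
    then obtain p q where "x = poly_mat p R" "y = poly_mat q R" unfolding poly_ring_simps by blast
    thus "x \<otimes>\<^bsub>poly_ring R\<^esub> y \<in> carrier (poly_ring R)" "x \<otimes>\<^bsub>poly_ring R\<^esub> y = y \<otimes>\<^bsub>poly_ring R\<^esub> x"
      unfolding poly_ring_simps(2) using in_K[of "p * q"] by (simp_all add: poly_mat_mult[OF Rc, symmetric] mult.commute)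
  next
    show "\<one>\<^bsub>poly_ring R\<^esub> \<in> carrier (poly_ring R)" using in_K[of 1] by (simp add: poly_ring_simps(4) poly_mat_1[OF Rc])
  next
    fix x y z assume "x \<in> carrier (poly_ring R)" "y \<in> carrier (poly_ring R)" "z \<in> carrier (poly_ring R)"
    thus "x \<otimes>\<^bsub>poly_ring R\<^esub> y \<otimes>\<^bsub>poly_ring R\<^esub> z = x \<otimes>\<^bsub>poly_ring R\<^esub> (y \<otimes>\<^bsub>poly_ring R\<^esub> z)"
      unfolding poly_ring_simps(2) using assoc_mult_mat cK by blast
  next
    fix x assume "x \<in> carrier (poly_ring R)"
    thus "\<one>\<^bsub>poly_ring R\<^esub> \<otimes>\<^bsub>poly_ring R\<^esub> x = x" unfolding poly_ring_simps(2,4) using left_mult_one_mat[OF cK] by blast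
  qed
  fix x y z assume "x \<in> carrier (poly_ring R)" "y \<in> carrier (poly_ring R)" "z \<in> carrier (poly_ring R)"
  thus "(x \<oplus>\<^bsub>poly_ring R\<^esub> y) \<otimes>\<^bsub>poly_ring R\<^esub> z = x \<otimes>\<^bsub>poly_ring R\<^esub> z \<oplus>\<^bsub>poly_ring R\<^esub> y \<otimes>\<^bsub>poly_ring R\<^esub> z"
    unfolding poly_ring_simps(2,3) using add_mult_distrib_mat cK by blast
qed

lemma field_poly_ring: "Ring.field (poly_ring R)"
proof (rule cring.cring_fieldI2[OF cring_poly_ring])
  have "\<one>\<^bsub>poly_ring R\<^esub> \<in> carrier (GL d)" unfolding poly_ring_simps(4) by (rule GL_one_closed)
  thus "\<zero>\<^bsub>poly_ring R\<^esub> \<noteq> \<one>\<^bsub>poly_ring R\<^esub>" unfolding poly_ring_simps(5) using zero_not_GL by metis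
  fix a assume a: "a \<in> carrier (poly_ring R)" "a \<noteq> \<zero>\<^bsub>poly_ring R\<^esub>"
  then obtain p where p: "a = poly_mat p R" unfolding poly_ring_simps by blast
  hence "\<not> g dvd p" using a(2) poly_R_iff(2) unfolding poly_ring_simps(5) by blast
  hence "comaximal g p" by (rule irreducible_comaximal[OF g(2)])
  then obtain x y where xy: "x * g + y * p = 1" by (auto simp: comaximal_def)
  have e: "p * y - 1 = - (x * g)" unfolding xy[symmetric] by (simp add: mult.commute)
  have "g dvd p * y - 1" unfolding e by simp
  hence "poly_mat (p * y) R = poly_mat 1 R" unfolding poly_R_eq_iff .
  hence "a * poly_mat y R = 1\<^sub>m d" unfolding p poly_mat_mult[OF Rc] poly_mat_1[OF Rc] .
  thus "\<exists>b\<in>carrier (poly_ring R). a \<otimes>\<^bsub>poly_ring R\<^esub> b = \<one>\<^bsub>poly_ring R\<^esub>" unfolding poly_ring_simps by blast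
qed

lemma poly_conj_involution: "a \<in> carrier (poly_ring R) \<Longrightarrow> poly_conj R (poly_conj R a) = a"
proof -
  assume "a \<in> carrier (poly_ring R)"
  then obtain p where p: "a = poly_mat p R" unfolding poly_ring_simps by blast
  obtain q where q: "poly_mat p Ri = poly_mat q R" "poly_mat q Ri = poly_mat p R" using poly_mat_Ri_in by blast
  show ?thesis unfolding p poly_conj_poly_mat q(1) by (rule q(2))
qed

lemma poly_conj_closed: "a \<in> carrier (poly_ring R) \<Longrightarrow> poly_conj R a \<in> carrier (poly_ring R)"
proof -
  assume "a \<in> carrier (poly_ring R)"
  then obtain p where p: "a = poly_mat p R" unfolding poly_ring_simps by blast
  obtain q where q: "poly_mat p Ri = poly_mat q R" using poly_mat_Ri_in by blast
  show ?thesis unfolding p poly_conj_poly_mat q poly_ring_simps by blast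
qed

lemma poly_conj_iso: "poly_conj R \<in> ring_iso (poly_ring R) (poly_ring R)"
proof -
  have "poly_conj R \<in> ring_hom (poly_ring R) (poly_ring R)"
  proof (rule ring_hom_memI)
    fix x y assume "x \<in> carrier (poly_ring R)" "y \<in> carrier (poly_ring R)"
    then obtain p q where pq: "x = poly_mat p R" "y = poly_mat q R" unfolding poly_ring_simps by blast
    show "poly_conj R (x \<otimes>\<^bsub>poly_ring R\<^esub> y) = poly_conj R x \<otimes>\<^bsub>poly_ring R\<^esub> poly_conj R y"
      unfolding pq poly_ring_simps(2) poly_mat_mult[OF Rc, symmetric] poly_conj_poly_mat by (rule poly_mat_mult[OF Ric])
    show "poly_conj R (x \<oplus>\<^bsub>poly_ring R\<^esub> y) = poly_conj R x \<oplus>\<^bsub>poly_ring R\<^esub> poly_conj R y"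
      unfolding pq poly_ring_simps(3) poly_mat_add[OF Rc, symmetric] poly_conj_poly_mat by (rule poly_mat_add[OF Ric])
  next
    show "poly_conj R \<one>\<^bsub>poly_ring R\<^esub> = \<one>\<^bsub>poly_ring R\<^esub>"
      unfolding poly_ring_simps(4) using poly_conj_poly_mat[of 1] unfolding poly_mat_1[OF Rc] poly_mat_1[OF Ric] .
  qed (rule poly_conj_closed)
  moreover have "bij_betw (poly_conj R) (carrier (poly_ring R)) (carrier (poly_ring R))"
    by (rule bij_betw_byWitness[where f' = "poly_conj R"]) (use poly_conj_involution poly_conj_closed in blast)+
  ultimately show ?thesis by (simp add: ring_iso_def)
qed

lemma poly_conj_nontrivial: "\<exists>a\<in>carrier (poly_ring R). poly_conj R a \<noteq> a"
proof
  show "R \<in> carrier (poly_ring R)" unfolding poly_ring_simps using poly_mat_X[OF Rc, symmetric] by blast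
  show "poly_conj R R \<noteq> R" using poly_conj_poly_mat[of "[:0, 1:]"] R_neq_Ri unfolding poly_mat_X[OF Rc] poly_mat_X[OF Ric] by metis
qed

lemma commutant: "Z \<in> carrier_mat d d \<Longrightarrow> R * Z = Z * R \<Longrightarrow> \<exists>p. Z = poly_mat p R"
  by (rule commutant_irreducible[OF Rc g(2,3) gR])

text \<open>Commuting with diag(R, ..., R) means that every block commutes with \<open>R\<close>,
  and the commutant of \<open>R\<close> is F[R].\<close>

lemma GLK_eq_centraliser:
  "GLK n R = centraliser (diag_block_mat (replicate n R))"
proof -
  let ?X = "diag_block_mat (replicate n R)" and ?N = "n * d"
  have X: "?X \<in> carrier_mat ?N ?N" by (rule diag_replicate_carrier[OF Rc])
  have "(\<exists>\<phi>. Y = blocks_mat n d (\<lambda>i j. poly_mat (\<phi> i j) R)) \<longleftrightarrow> Y * ?X = ?X * Y" if Y: "Y \<in> carrier_mat ?N ?N" for Y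
  proof
    assume "\<exists>\<phi>. Y = blocks_mat n d (\<lambda>i j. poly_mat (\<phi> i j) R)"
    then obtain \<phi> where \<phi>: "Y = blocks_mat n d (\<lambda>i j. poly_mat (\<phi> i j) R)" by blast
    have 1: "Y * ?X = blocks_mat n d (\<lambda>i j. poly_mat (\<phi> i j) R * R)" unfolding \<phi> using Rc by (intro blocks_mat_mult_diag[OF Rc]) simp
    have 2: "?X * Y = blocks_mat n d (\<lambda>i j. R * poly_mat (\<phi> i j) R)" unfolding \<phi> using Rc by (intro diag_mult_blocks_mat[OF Rc]) simp
    show "Y * ?X = ?X * Y" unfolding 1 2 poly_mat_intertwine[OF Rc Rc Rc refl] ..
  next
    assume e: "Y * ?X = ?X * Y"
    let ?B = "block_of d Y"
    have B: "?B i j \<in> carrier_mat d d" for i j by (simp add: block_of_def)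
    have Ye: "Y = blocks_mat n d ?B" by (rule blocks_mat_block_of[OF Y, symmetric])
    have 1: "Y * ?X = blocks_mat n d (\<lambda>i j. ?B i j * R)"
      using blocks_mat_mult_diag[where B="?B" and n=n, OF Rc B] unfolding blocks_mat_block_of[OF Y] .
    have 2: "?X * Y = blocks_mat n d (\<lambda>i j. R * ?B i j)"
      using diag_mult_blocks_mat[where B="?B" and n=n, OF Rc B] unfolding blocks_mat_block_of[OF Y] .
    have "\<forall>i<n. \<forall>j<n. ?B i j * R = R * ?B i j"
      using e unfolding 1 2 using blocks_mat_eq_iff[of n "\<lambda>i j. ?B i j * R" d "\<lambda>i j. R * ?B i j"] B Rc by simp
    hence "\<forall>i<n. \<forall>j<n. \<exists>p. ?B i j = poly_mat p R" using commutant[OF B] by metis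
    then obtain \<phi> where "\<forall>i<n. \<forall>j<n. ?B i j = poly_mat (\<phi> i j) R" by metis
    hence "Y = blocks_mat n d (\<lambda>i j. poly_mat (\<phi> i j) R)" by (subst Ye) (rule blocks_mat_cong, blast)
    thus "\<exists>\<phi>. Y = blocks_mat n d (\<lambda>i j. poly_mat (\<phi> i j) R)" by blast
  qed
  hence "{Y \<in> carrier (GL ?N). \<exists>\<phi>. Y = blocks_mat n d (\<lambda>i j. poly_mat (\<phi> i j) R)} = {Y \<in> carrier (GL ?N). Y * ?X = ?X * Y}"
    using GL_carrier[of _ ?N] by blast
  thus ?thesis unfolding GLK_def centraliser_def dimR carrier_matD(1)[OF X] by simp
qed

text \<open>P T^{-1} commutes with \<open>R\<close>. Here \<open>P\<close> may be singular or fail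
  to be skew-symmetric, so the fact on quotients of elements of \<A>(R) does not cover it.\<close>

lemma invariant_quotient_poly:
  assumes T: "T \<in> inv_gram R" and P: "P \<in> carrier_mat d d" "P = R * P * transpose_mat R"
  shows "\<exists>p. P = poly_mat p R * T"
proof -
  have TG: "T \<in> carrier (GL d)" using T inv_gram_iff[OF Rc] by blast
  note c = Rc Ric GL_carrier[OF TG] GL_inv_carrier[OF TG] P(1)
  let ?S = "transpose_mat Ri" and ?Ti = "inv\<^bsub>GL d\<^esub> T"
  have S: "?S \<in> carrier_mat d d" using Ric by simp
  have RS: "transpose_mat R * ?S = 1\<^sub>m d" using transpose_mult[OF Ric Rc] GL_l_inv[OF R] by simp
  have "P * ?S = R * P * transpose_mat R * ?S" by (rule arg_cong[OF P(2)])
  also have "\<dots> = R * P" using c S RS by (simp add: sq_assoc[where n=d])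
  finally have RP: "R * P = P * ?S" ..
  have "?S * ?Ti = ?Ti * (T * ?S) * ?Ti" using c S TG by (simp add: sq_assoc[where n=d])
  also have "T * ?S = R * T" by (rule inv_gram_intertwine(2)[OF R T, symmetric])
  also have "?Ti * (R * T) * ?Ti = ?Ti * R" using c TG by (simp add: sq_assoc[where n=d])
  finally have ST: "?S * ?Ti = ?Ti * R" .
  have "R * (P * ?Ti) = (R * P) * ?Ti" using c by (simp add: sq_assoc[where n=d])
  also have "\<dots> = P * (?S * ?Ti)" unfolding RP using c S by (simp add: sq_assoc[where n=d])
  also have "\<dots> = (P * ?Ti) * R" unfolding ST using c by (simp add: sq_assoc[where n=d])
  finally obtain p where p: "P * ?Ti = poly_mat p R" using commutant[OF sq_mult_carrier[OF c(5) c(4)]] by blast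
  have "P = P * ?Ti * T" using c TG by (simp add: sq_assoc[where n=d])
  thus ?thesis unfolding p by blast
qed

text \<open>\<open>R\<close> and the transpose of its inverse are both similar to the companion
  matrix of \<open>g\<close>, and the matrix of this similarity is an invertible T0 with R T0 R' =
  T0. If T0 is not symmetric, its skew part T0 - T0' is non-zero; being p(R) T0 with p(R) in the
  field F[R], it is invertible.\<close>

lemma exists_skew_invariant: "\<exists>T\<in>carrier (GL d). transpose_mat T = - T \<and> R * T * transpose_mat R = T"
proof -
  let ?S = "transpose_mat Ri"
  have S: "?S \<in> carrier_mat d d" using Ric by simp
  have "poly_mat g ?S = transpose_mat (poly_mat g Ri)" by (rule poly_mat_transpose[OF Ric, symmetric])
  hence gS: "poly_mat g ?S = 0\<^sub>m d d" unfolding gRi by simp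
  have "similar_mat R ?S"
    by (rule similar_mat_trans[OF irreducible_annihilator_similar_companion[OF Rc g(2,1,3) gR]
       similar_mat_sym[OF irreducible_annihilator_similar_companion[OF S g(2,1,3) gS]]])
  then obtain T0 where T0: "T0 \<in> carrier (GL d)" "R * T0 = T0 * ?S" using similar_mat_GL_E[OF _ Rc] by blast
  note T0c = GL_carrier[OF T0(1)]
  note c = Rc Ric T0c S
  have SR: "?S * transpose_mat R = 1\<^sub>m d" using transpose_mult[OF Rc Ric] GL_r_inv[OF R] by simp
  have inv0: "R * T0 * transpose_mat R = T0" unfolding T0(2) using c SR by (simp add: sq_assoc[where n=d])
  have tinv: "R * transpose_mat T0 * transpose_mat R = transpose_mat T0"
    using arg_cong[OF inv0, of transpose_mat] c by (simp add: sq_transpose_mult[where n=d] sq_assoc[where n=d])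
  show ?thesis
  proof (cases "T0 = transpose_mat T0")
    case False
    define W where "W = T0 - transpose_mat T0"
    have tc: "transpose_mat T0 \<in> carrier_mat d d" using T0c by simp
    have W: "W \<in> carrier_mat d d" unfolding W_def using T0c tc by simp
    have W0: "W \<noteq> 0\<^sub>m d d" using False mat_eq_iff_minus[OF T0c tc] unfolding W_def by blast
    have Wt: "transpose_mat W = - W" unfolding W_def using T0c by (intro eq_matI) auto
    have "R * W * transpose_mat R = R * T0 * transpose_mat R - R * transpose_mat T0 * transpose_mat R"
    proof -
      have "R * W = R * T0 - R * transpose_mat T0" unfolding W_def by (rule mult_minus_distrib_mat[OF Rc T0c tc])
      thus ?thesis using minus_mult_distrib_mat[of "R * T0" d d "R * transpose_mat T0" "transpose_mat R" d] c tc by simp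
    qed
    hence Winv: "R * W * transpose_mat R = W" unfolding inv0 tinv W_def[symmetric] .
    have WS: "R * W = W * ?S"
    proof -
      have RS: "transpose_mat R * ?S = 1\<^sub>m d" using transpose_mult[OF Ric Rc] GL_l_inv[OF R] by simp
      have "W * ?S = R * W * transpose_mat R * ?S" unfolding Winv ..
      thus ?thesis using c W RS by (simp add: sq_assoc[where n=d])
    qed
    let ?Ti = "inv\<^bsub>GL d\<^esub> T0"
    have Ti: "?Ti \<in> carrier_mat d d" using T0(1) by simp
    have "?S * ?Ti = ?Ti * (T0 * ?S) * ?Ti" using c Ti T0(1) by (simp add: sq_assoc[where n=d])
    also have "\<dots> = ?Ti * R" unfolding T0(2)[symmetric] using c Ti T0(1) by (simp add: sq_assoc[where n=d])
    finally have STi: "?S * ?Ti = ?Ti * R" .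
    have "R * (W * ?Ti) = (R * W) * ?Ti" by (rule sq_assoc[OF Rc W Ti, symmetric])
    also have "\<dots> = W * (?S * ?Ti)" unfolding WS by (rule sq_assoc[OF W S Ti])
    also have "\<dots> = W * ?Ti * R" unfolding STi using c W Ti by (simp add: sq_assoc[where n=d])
    finally obtain p where p: "W * ?Ti = poly_mat p R" using commutant[OF sq_mult_carrier[OF W Ti]] by blast
    have Wp: "W = poly_mat p R * T0" unfolding p[symmetric] using c W Ti T0(1) by (simp add: sq_assoc[where n=d])
    have "poly_mat p R \<noteq> 0\<^sub>m d d"
    proof
      assume "poly_mat p R = 0\<^sub>m d d"
      hence "W = 0\<^sub>m d d" unfolding Wp using T0c by simp
      thus False using W0 by contradiction
    qed
    hence "poly_mat p R \<in> carrier (GL d)" unfolding poly_R_iff .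
    hence "W \<in> carrier (GL d)" unfolding Wp using T0(1) by (rule GL_mult_closed)
    thus ?thesis using Wt Winv by blast
  next
    case True
    \<comment> \<open>An element that the involution negates. Multiplication by it turns the
      symmetric T0 into a skew-symmetric matrix, and it is invertible because it is non-zero in
      F[R].\<close>
    define u where "u = R - Ri"
    have u: "u \<in> carrier_mat d d" unfolding u_def using Rc Ric by simp
    obtain r where r: "poly_mat r R = Ri" using inverse_poly by blast
    have up: "u = poly_mat ([:0, 1:] - r) R" unfolding u_def poly_mat_minus[OF Rc] poly_mat_X[OF Rc] r ..
    have "u \<noteq> 0\<^sub>m d d" unfolding u_def using R_neq_Ri mat_eq_iff_minus[OF Rc Ric] by blast
    hence uG: "u \<in> carrier (GL d)" unfolding up poly_R_iff .
    define T where "T = u * T0"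
    have TG: "T \<in> carrier (GL d)" unfolding T_def using uG T0(1) by (rule GL_mult_closed)
    have "T0 * transpose_mat u = T0 * transpose_mat R - T0 * ?S"
      unfolding u_def transpose_minus[OF Rc Ric] using c by (intro mult_minus_distrib_mat[of _ d d]) auto
    also have "T0 * transpose_mat R = Ri * T0"
    proof -
      have "Ri * T0 = Ri * (R * T0 * transpose_mat R)" unfolding inv0 ..
      also have "\<dots> = Ri * (R * (T0 * transpose_mat R))" using c by (simp add: sq_assoc[where n=d])
      also have "\<dots> = T0 * transpose_mat R" using R T0c by simp
      finally show ?thesis ..
    qed
    also have "Ri * T0 - T0 * ?S = - (R * T0 - Ri * T0)" unfolding T0(2)[symmetric] using c by (intro eq_matI) auto
    also have "R * T0 - Ri * T0 = T" unfolding T_def u_def by (rule minus_mult_distrib_mat[OF Rc Ric T0c, symmetric])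
    finally have T0u: "T0 * transpose_mat u = - T" .
    have "transpose_mat T = transpose_mat T0 * transpose_mat u" unfolding T_def by (rule sq_transpose_mult[OF u T0c])
    also have "transpose_mat T0 = T0" using True ..
    finally have Tt: "transpose_mat T = - T" unfolding T0u .
    have Ru: "R * u = u * R" unfolding up by (rule poly_mat_intertwine[OF Rc Rc Rc refl, symmetric])
    have "R * T * transpose_mat R = R * u * (T0 * transpose_mat R)" unfolding T_def using c u by (simp add: sq_assoc[where n=d])
    also have "\<dots> = u * (R * T0 * transpose_mat R)" unfolding Ru using c u by (simp add: sq_assoc[where n=d])
    finally have "R * T * transpose_mat R = T" unfolding inv0 T_def .
    thus ?thesis using TG Tt by blast
  qed
qed

end

section \<open>Norms over finite fields\<close>

lemma finite_carrier_mat: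
  assumes "finite (UNIV :: 'a set)"
  shows "finite (carrier_mat n m :: 'a mat set)"
proof -
  let ?I = "{..<n} \<times> {..<m}"
  have "carrier_mat n m \<subseteq> mat n m ` (PiE ?I (\<lambda>_. UNIV :: 'a set))"
  proof
    fix A :: "'a mat" assume A: "A \<in> carrier_mat n m"
    have "A = mat n m (restrict (\<lambda>ij. A $$ ij) ?I)" using A by (intro eq_matI) auto
    thus "A \<in> mat n m ` (PiE ?I (\<lambda>_. UNIV))" by (intro image_eqI[of _ _ "restrict (\<lambda>ij. A $$ ij) ?I"]) auto
  qed
  moreover have "finite (PiE ?I (\<lambda>_. UNIV :: 'a set))" using assms by (intro finite_PiE) auto
  ultimately show ?thesis using finite_subset by blast
qed

context self_reciprocal_block
begin

lemma g_dvd_mult: "g dvd a * b \<Longrightarrow> g dvd a \<or> g dvd b"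
  using comaximal_dvd_mult[OF irreducible_comaximal[OF g(2)], of a b] by blast

text \<open>With \<open>u = R - R\<^sup>-\<^sup>1\<close> a norm is \<open>x\<^sup>2 - u\<^sup>2 y\<^sup>2\<close> for \<open>x, y\<close> in the fixed field, and the sets of all
  \<open>x\<^sup>2\<close> and of all \<open>b + u\<^sup>2 y\<^sup>2\<close> meet, as each contains more than half of the fixed field.\<close>

lemma norm_surjective:
  assumes fin: "finite (UNIV :: 'a set)" and p: "poly_mat p Ri = poly_mat p R"
  shows "\<exists>c. poly_mat c R * poly_mat c Ri = poly_mat p R"
proof -
  obtain r where r: "poly_mat r R = Ri" "poly_mat r Ri = R" using inverse_poly by blast
  define u where "u = [:0, 1:] - r"
  have uR: "poly_mat u R = R - Ri" unfolding u_def poly_mat_minus[OF Rc] poly_mat_X[OF Rc] r ..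
  have uRi: "poly_mat u Ri = poly_mat (- u) R"
  proof -
    have "poly_mat (- u) R = Ri - R" unfolding u_def minus_diff_eq poly_mat_minus[OF Rc] poly_mat_X[OF Rc] r ..
    thus ?thesis unfolding u_def poly_mat_minus[OF Ric] poly_mat_X[OF Ric] r by simp
  qed
  have nu: "\<not> g dvd u" using R_neq_Ri mat_eq_iff_minus[OF Rc Ric] uR poly_R_iff(2)[of u] by metis
  \<comment> \<open>The polynomials whose value at \<open>R\<close> is fixed by the
    involution.\<close>
  define S where "S = {q. poly_mat q Ri = poly_mat q R}"
  have S_add: "a + b \<in> S" if "a \<in> S" "b \<in> S" for a b
    using that unfolding S_def by (simp add: poly_mat_add[OF Rc] poly_mat_add[OF Ric])
  have S_mult: "a * b \<in> S" if "a \<in> S" "b \<in> S" for a b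
    using that unfolding S_def by (simp add: poly_mat_mult[OF Rc] poly_mat_mult[OF Ric])
  have uu: "u * u \<in> S"
    unfolding S_def mem_Collect_eq poly_mat_mult[OF Ric] uRi unfolding poly_mat_mult[OF Rc, symmetric] by simp
  have pS: "p \<in> S" using p by (simp add: S_def)
  define ev where "ev q = poly_mat q R" for q
  have ev_eq: "ev a = ev b \<longleftrightarrow> g dvd a - b" for a b unfolding ev_def by (rule poly_R_eq_iff)
  have ev_mult: "ev (a * b) = ev a * ev b" for a b unfolding ev_def by (rule poly_mat_mult[OF Rc])
  \<comment> \<open>In this proof \<open>K\<close> is the fixed field of the involution, not F[R]
    itself.\<close>
  define K where "K = ev ` S"
  have finK: "finite K"
    by (rule finite_subset[OF _ finite_carrier_mat[OF fin, of d d]]) (use Rc in \<open>auto simp: K_def ev_def\<close>)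
  define Sq where "Sq = (\<lambda>x. x * x) ` K"
  have finSq: "finite Sq" unfolding Sq_def using finK by simp
  have SqS: "z \<in> Sq \<longleftrightarrow> (\<exists>q\<in>S. z = ev (q * q))" for z unfolding Sq_def K_def ev_mult by blast
  have SqK: "Sq \<subseteq> K" using SqS S_mult unfolding K_def by blast
  have 0: "ev 0 \<in> Sq"
  proof -
    have "0 \<in> S" unfolding S_def using Rc Ric by simp
    thus ?thesis unfolding SqS by (intro bexI[of _ 0]) simp
  qed
  let ?F = "\<lambda>z. {x \<in> K. x * x = z}"
  have F2: "card (?F z) \<le> 2" if z: "z \<in> Sq" for z
  proof -
    obtain q where q: "z = ev (q * q)" using z SqS by blast
    have "?F z \<subseteq> {ev q, ev (- q)}"
    proof
      fix x assume x: "x \<in> ?F z"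
      then obtain q' where q': "x = ev q'" unfolding K_def by blast
      have "ev (q' * q') = ev (q * q)" using x q q' by (simp add: ev_mult)
      hence "g dvd q' * q' - q * q" unfolding ev_eq .
      also have "q' * q' - q * q = (q' - q) * (q' - - q)" by (simp add: algebra_simps)
      finally have "g dvd q' - q \<or> g dvd q' - - q" by (rule g_dvd_mult)
      thus "x \<in> {ev q, ev (- q)}" unfolding q' insert_iff ev_eq by blast
    qed
    hence "card (?F z) \<le> card {ev q, ev (- q)}" by (intro card_mono) auto
    also have "\<dots> \<le> 2" by (simp add: card_insert_if)
    finally show ?thesis .
  qed
  have F0: "card (?F (ev 0)) \<le> 1"
  proof -
    have "?F (ev 0) \<subseteq> {ev 0}"
    proof
      fix x assume x: "x \<in> ?F (ev 0)"
      then obtain q' where q': "x = ev q'" unfolding K_def by blast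
      have "ev (q' * q') = ev 0" using x q' by (simp add: ev_mult)
      hence "g dvd q'" unfolding ev_eq using g_dvd_mult[of q' q'] by simp
      thus "x \<in> {ev 0}" unfolding q' singleton_iff ev_eq by simp
    qed
    from card_mono[OF _ this] show ?thesis by simp
  qed
  \<comment> \<open>Counting by squares: zero has one square root and every other square at most
    two, so the fixed field has at most 2 |Sq| - 1 elements. The strict inequality
    \<open>big\<close> depends on zero being counted separately.\<close>
  have "(\<Sum>x\<in>K. 1) = (\<Sum>z\<in>Sq. \<Sum>x\<in>?F z. 1 :: nat)" unfolding Sq_def by (rule sum.image_gen[OF finK])
  hence "card K = (\<Sum>z\<in>Sq. card (?F z))" by simp
  moreover have "(\<Sum>z\<in>Sq. card (?F z)) = card (?F (ev 0)) + (\<Sum>z\<in>Sq - {ev 0}. card (?F z))" by (rule sum.remove[OF finSq 0])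
  moreover have "(\<Sum>z\<in>Sq - {ev 0}. card (?F z)) \<le> (\<Sum>z\<in>Sq - {ev 0}. 2)" by (rule sum_mono) (rule F2, blast)
  moreover have "(\<Sum>z\<in>Sq - {ev 0}. 2) = 2 * (card Sq - 1)" by (simp add: card_Diff_singleton[OF 0])
  moreover have "card Sq > 0" using 0 finSq card_gt_0_iff by blast
  ultimately have big: "card K < 2 * card Sq" using F0 by linarith
  define h where "h z = ev p + ev (u * u) * z" for z
  have hev: "h (ev (q * q)) = ev (p + u * u * (q * q))" for q
    unfolding h_def ev_def poly_mat_add[OF Rc] poly_mat_mult[OF Rc] ..
  \<comment> \<open>Multiplication by u^2 can be cancelled since R - R^{-1} is non-zero in the
    field, so the image of \<open>Sq\<close> under \<open>h\<close> is as large as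
    \<open>Sq\<close>.\<close>
  have inj: "inj_on h Sq"
  proof (rule inj_onI)
    fix x y assume "x \<in> Sq" "y \<in> Sq" and e: "h x = h y"
    from \<open>x \<in> Sq\<close> obtain a where a: "x = ev (a * a)" unfolding SqS by (elim bexE)
    from \<open>y \<in> Sq\<close> obtain b where b: "y = ev (b * b)" unfolding SqS by (elim bexE)
    have "g dvd (p + u * u * (a * a)) - (p + u * u * (b * b))" using e unfolding a b hev ev_eq .
    also have "(p + u * u * (a * a)) - (p + u * u * (b * b)) = u * (u * (a * a - b * b))" by (simp add: algebra_simps)
    finally have "g dvd u * (u * (a * a - b * b))" .
    from g_dvd_mult[OF this] nu have "g dvd u * (a * a - b * b)" by (elim disjE) (rule notE, assumption+)
    from g_dvd_mult[OF this] nu have "g dvd a * a - b * b" by (elim disjE) (rule notE, assumption+)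
    thus "x = y" unfolding a b ev_eq .
  qed
  have hK: "h ` Sq \<subseteq> K"
  proof
    fix z assume "z \<in> h ` Sq"
    then obtain x where x: "z = h x" "x \<in> Sq" by (rule imageE)
    from x(2) obtain q where "q \<in> S" "x = ev (q * q)" unfolding SqS by (rule bexE)
    with x(1) have q: "q \<in> S" "z = h (ev (q * q))" by simp_all
    have "p + u * u * (q * q) \<in> S" using S_add[OF pS S_mult[OF uu S_mult[OF q(1) q(1)]]] .
    thus "z \<in> K" unfolding q(2) hev K_def by blast
  qed
  have "Sq \<inter> h ` Sq \<noteq> {}"
  proof
    assume e: "Sq \<inter> h ` Sq = {}"
    have "2 * card Sq = card (Sq \<union> h ` Sq)" using card_Un_disjoint[OF finSq finite_imageI[OF finSq] e] card_image[OF inj] by simp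
    also have "\<dots> \<le> card K" using SqK hK by (intro card_mono finK) blast
    finally show False using big by simp
  qed
  then obtain x y where xy: "x \<in> Sq" "y \<in> Sq" "x = h y" by blast
  from xy(1) obtain q1 where q1: "q1 \<in> S" "x = ev (q1 * q1)" unfolding SqS by (rule bexE)
  from xy(2) obtain q2 where q2: "q2 \<in> S" "y = ev (q2 * q2)" unfolding SqS by (rule bexE)
  have "ev (q1 * q1) = ev (p + u * u * (q2 * q2))" using xy(3) unfolding q1(2) q2(2) hev .
  note q = q1(1) q2(1) this
  \<comment> \<open>The involution fixes the values of \<open>q1\<close> and \<open>q2\<close> and
    negates that of \<open>u\<close>; the norm of \<open>c\<close> is therefore q1^2 - u^2 q2^2,
    which equals \<open>p\<close> modulo \<open>g\<close>.\<close>
  define c where "c = q1 + u * q2"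
  have cRi: "poly_mat c Ri = poly_mat (q1 - u * q2) R"
  proof -
    have "poly_mat c Ri = poly_mat q1 Ri + poly_mat u Ri * poly_mat q2 Ri" unfolding c_def poly_mat_add[OF Ric] poly_mat_mult[OF Ric] ..
    also have "\<dots> = poly_mat (q1 + (- u) * q2) R"
      unfolding uRi poly_mat_add[OF Rc] poly_mat_mult[OF Rc] using q(1,2) by (simp add: S_def)
    finally show ?thesis by simp
  qed
  have "poly_mat c R * poly_mat c Ri = poly_mat (c * (q1 - u * q2)) R" unfolding cRi poly_mat_mult[OF Rc] ..
  also have "\<dots> = poly_mat p R"
  proof -
    have "c * (q1 - u * q2) - p = q1 * q1 - (p + u * u * (q2 * q2))" unfolding c_def by (simp add: algebra_simps)
    moreover have "g dvd q1 * q1 - (p + u * u * (q2 * q2))" using q(3) unfolding ev_eq .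
    ultimately show ?thesis unfolding poly_R_eq_iff by (rule ssubst[where P = "\<lambda>x. g dvd x"])
  qed
  finally show ?thesis by blast
qed

text \<open>\<open>T\<close> realises the involution of F[R] as transposition, which is what allows
  Hermitian conditions to be read as conditions on transposes.\<close>

lemma poly_Ri_T:
  assumes T: "T \<in> inv_gram R"
  shows "poly_mat p Ri * T = T * transpose_mat (poly_mat p R)"
proof -
  have Tc: "T \<in> carrier_mat d d" by (rule inv_gram_carrier[OF T Rc])
  have Rt: "transpose_mat R \<in> carrier_mat d d" using Rc by simp
  show ?thesis unfolding poly_mat_transpose[OF Rc]
    by (rule poly_mat_intertwine[OF Ric Rt Tc inv_gram_intertwine(1)[OF R T]])
qed

text \<open>Write P = p(R) T. Skew-symmetry says that p(R) is fixed by the involution, hence is the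
  norm of some c(R), and then c(R) T c(R)' = P. If \<open>P\<close> is non-zero, so is c(R), which
  makes it invertible.\<close>

lemma finite_congruent:
  assumes fin: "finite (UNIV :: 'a set)" and T: "T \<in> inv_gram R"
    and P: "P \<in> carrier_mat d d" "P = - transpose_mat P" "P = R * P * transpose_mat R"
  shows "P = 0\<^sub>m d d \<or> congruent_over R P T"
proof (cases "P = 0\<^sub>m d d")
  case False
  note TG = inv_gram_skew(1)[OF T Rc] and Tt = inv_gram_skew(2)[OF T Rc]
  note Tc = GL_carrier[OF TG]
  obtain p where p: "P = poly_mat p R * T" using invariant_quotient_poly[OF T P(1,3)] by blast
  have pc: "poly_mat p R \<in> carrier_mat d d" "poly_mat p Ri \<in> carrier_mat d d" using Rc Ric by simp_all
  have "transpose_mat P = transpose_mat T * transpose_mat (poly_mat p R)" unfolding p by (rule sq_transpose_mult[OF pc(1) Tc])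
  also have "\<dots> = - (T * transpose_mat (poly_mat p R))" unfolding Tt using Tc pc by (intro uminus_mult_left_mat) auto
  also have "\<dots> = - (poly_mat p Ri * T)" unfolding poly_Ri_T[OF T] ..
  finally have "- transpose_mat P = poly_mat p Ri * T" by simp
  with P(2) have "P = poly_mat p Ri * T" by (rule trans)
  hence "poly_mat p Ri * T = poly_mat p R * T" using p by (metis trans)
  hence "poly_mat p Ri = poly_mat p R" by (rule GL_right_cancel[OF TG pc(2) pc(1)])
  from norm_surjective[OF fin this] obtain c where c: "poly_mat c R * poly_mat c Ri = poly_mat p R" by blast
  let ?Y = "poly_mat c R"
  have Yc: "?Y \<in> carrier_mat d d" "poly_mat c Ri \<in> carrier_mat d d" using Rc Ric by simp_all
  have YTY: "?Y * T * transpose_mat ?Y = P"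
  proof -
    have "?Y * T * transpose_mat ?Y = ?Y * (T * transpose_mat ?Y)" using Yc Tc by (intro sq_assoc[where n=d]) auto
    also have "\<dots> = ?Y * poly_mat c Ri * T" unfolding poly_Ri_T[OF T, symmetric] by (rule sq_assoc[symmetric, OF Yc Tc])
    finally show ?thesis unfolding c p .
  qed
  have "?Y \<noteq> 0\<^sub>m d d"
  proof
    assume "?Y = 0\<^sub>m d d"
    hence "P = 0\<^sub>m d d" unfolding p c[symmetric] using left_mult_zero_mat[OF Yc(2), of d] left_mult_zero_mat[OF Tc, of d] by simp
    thus False using False by contradiction
  qed
  hence "?Y \<in> carrier (GL d)" unfolding poly_R_iff .
  hence "?Y \<in> carrier (centraliser R)" unfolding centraliser_iff[OF Rc] using poly_mat_intertwine[OF Rc Rc Rc refl] by blast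
  hence "congruent_over R T P" unfolding congruent_over_def using YTY by blast
  thus ?thesis using congruent_over_sym[OF Rc Tc] by blast
qed simp

section \<open>Hermitian matrices and invariant forms\<close>

context
  fixes T :: "'a mat" and n :: nat
  assumes T: "T \<in> inv_gram R"
begin

private abbreviation "D \<equiv> diag_block_mat (replicate n T)"
private abbreviation "X \<equiv> diag_block_mat (replicate n R)"

lemma X_GL: "X \<in> carrier (GL (n * d))" by (rule diag_replicate_GL[OF R])
lemma X_carrier: "X \<in> carrier_mat (n * d) (n * d)" by (rule GL_carrier[OF X_GL])
lemma T_carrier: "T \<in> carrier_mat d d" by (rule inv_gram_carrier[OF T Rc])

lemma D_inv_gram: "D \<in> inv_gram X"
proof -
  have "square_blocks (replicate n R) (replicate n d)" "square_blocks (replicate n T) (replicate n d)"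
    using Rc T_carrier by (simp_all add: square_blocks_nth)
  from inv_gram_diag_iff[OF this] show ?thesis using T by simp
qed

lemma D_GL: "D \<in> carrier (GL (n * d))" by (rule inv_gram_skew(1)[OF D_inv_gram X_carrier])
lemma D_carrier: "D \<in> carrier_mat (n * d) (n * d)" by (rule GL_carrier[OF D_GL])

lemma star_carrier: "star n R Y \<in> carrier_mat (n * d) (n * d)"
  by (simp add: star_def dimR)

text \<open>The relation between \<open>T\<close> and the involution, applied block by block; the
  exchange of block indices in \<open>star\<close> matches the exchange made by the
  transpose.\<close>

lemma star_mult_D:
  assumes Y: "Y \<in> carrier (GLK n R)"
  shows "star n R Y * D = D * transpose_mat Y"
proof -
  obtain \<phi> where \<phi>: "Y = blocks_mat n d (\<lambda>i j. poly_mat (\<phi> i j) R)" using Y by (auto simp: GLK_def dimR)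
  have pc: "poly_mat p R \<in> carrier_mat d d" "poly_mat p Ri \<in> carrier_mat d d" for p using Rc Ric by simp_all
  have "star n R Y = blocks_mat n d (\<lambda>i j. poly_mat (\<phi> j i) Ri)"
    unfolding star_def dimR
  proof (rule blocks_mat_cong)
    fix i j assume "i < n" "j < n"
    hence "block_of d Y j i = poly_mat (\<phi> j i) R" unfolding \<phi> using pc by (subst block_of_blocks_mat) auto
    thus "poly_conj R (block_of d Y j i) = poly_mat (\<phi> j i) Ri" using poly_conj_poly_mat by simp
  qed
  hence "star n R Y * D = blocks_mat n d (\<lambda>i j. poly_mat (\<phi> j i) Ri * T)"
    using blocks_mat_mult_diag[OF T_carrier, of n "\<lambda>i j. poly_mat (\<phi> j i) Ri"] pc(2) by simp
  also have "\<dots> = blocks_mat n d (\<lambda>i j. T * transpose_mat (poly_mat (\<phi> j i) R))"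
    unfolding poly_Ri_T[OF T] ..
  also have "\<dots> = D * blocks_mat n d (\<lambda>i j. transpose_mat (poly_mat (\<phi> j i) R))"
    using diag_mult_blocks_mat[OF T_carrier, of n "\<lambda>i j. transpose_mat (poly_mat (\<phi> j i) R)"] pc(1) by simp
  also have "blocks_mat n d (\<lambda>i j. transpose_mat (poly_mat (\<phi> j i) R)) = transpose_mat Y"
    unfolding \<phi> using pc(1) by (intro transpose_blocks_mat[symmetric]) blast
  finally show ?thesis .
qed

text \<open>Invariance of B D under \<open>X\<close> amounts to \<open>B\<close> commuting with
  \<open>X\<close>, that is, to having blocks in F[R]. For such \<open>B\<close> the negative
  transpose of B D is the star of \<open>B\<close> times \<open>D\<close>, and \<open>D\<close> can
  be cancelled.\<close>

lemma hermitian_iff_inv_gram: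
  assumes B: "B \<in> carrier_mat (n * d) (n * d)"
  shows "B \<in> hermitian_GLK n R \<longleftrightarrow> B * D \<in> inv_gram X"
proof -
  let ?N = "n * d"
  note Dt = inv_gram_skew(2)[OF D_inv_gram X_carrier]
  have BD: "B * D \<in> carrier_mat ?N ?N" using B D_carrier by simp
  have sk: "- transpose_mat (B * D) = star n R B * D" if "B \<in> carrier (GLK n R)"
  proof -
    have "transpose_mat (B * D) = - D * transpose_mat B" unfolding sq_transpose_mult[OF B D_carrier] Dt ..
    also have "\<dots> = - (D * transpose_mat B)" using D_carrier B by simp
    finally show ?thesis unfolding star_mult_D[OF that] by simp
  qed
  show ?thesis
  proof
    assume "B \<in> hermitian_GLK n R"
    hence h: "B \<in> carrier (GLK n R)" "star n R B = B" by (auto simp: hermitian_GLK_def)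
    have BG: "B \<in> carrier (GL ?N)" "B * X = X * B" using h(1) unfolding GLK_eq_centraliser centraliser_iff[OF X_carrier] by blast+
    have "B * D = - transpose_mat (B * D)" unfolding sk[OF h(1)] h(2) ..
    moreover have "B * D = X * (B * D) * transpose_mat X"
    proof -
      have "X * (B * D) * transpose_mat X = (X * B) * D * transpose_mat X" using B D_carrier X_carrier by (simp add: sq_assoc[where n="?N"])
      also have "\<dots> = B * (X * D * transpose_mat X)" unfolding BG(2)[symmetric] using B D_carrier X_carrier by (simp add: sq_assoc[where n="?N"])
      also have "X * D * transpose_mat X = D" using D_inv_gram inv_gram_iff[OF X_carrier] by metis
      finally show ?thesis ..
    qed
    ultimately show "B * D \<in> inv_gram X" unfolding inv_gram_iff[OF X_carrier] using GL_mult_closed[OF BG(1) D_GL] by blast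
  next
    assume i: "B * D \<in> inv_gram X"
    have BDD: "(B * D) * inv\<^bsub>GL ?N\<^esub> D = B" using B D_carrier D_GL by (simp add: sq_assoc[where n="?N"])
    have BDG: "B * D \<in> carrier (GL ?N)" by (rule inv_gram_skew(1)[OF i X_carrier])
    have BG: "B \<in> carrier (GL ?N)" using GL_mult_closed[OF BDG GL_inv_closed[OF D_GL]] unfolding BDD .
    have "X * B = B * X" using inv_gram_quotient_commute[OF X_GL i D_inv_gram] unfolding BDD .
    hence BK: "B \<in> carrier (GLK n R)" unfolding GLK_eq_centraliser centraliser_iff[OF X_carrier] using BG by simp
    have "star n R B * D = - transpose_mat (B * D)" by (rule sk[OF BK, symmetric])
    also have "\<dots> = B * D" unfolding inv_gram_skew(2)[OF i X_carrier] by simp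
    finally have "star n R B = B" by (rule GL_right_cancel[OF D_GL star_carrier B])
    thus "B \<in> hermitian_GLK n R" using BK by (simp add: hermitian_GLK_def)
  qed
qed

text \<open>Right multiplication by the invertible \<open>D\<close> is injective and maps the class
  of \<open>B\<close> onto the orbit of B D under the centraliser.\<close>

lemma star_congr_class_eq_iff:
  assumes B: "B1 \<in> carrier_mat (n * d) (n * d)" "B2 \<in> carrier_mat (n * d) (n * d)"
  shows "star_congr_class n R B1 = star_congr_class n R B2 \<longleftrightarrow>
    orbit (centraliser X) congr_act (B1 * D) = orbit (centraliser X) congr_act (B2 * D)"
proof -
  let ?N = "n * d"
  have Cc: "C \<in> carrier_mat ?N ?N" if "C \<in> carrier (centraliser X)" for C
    using that unfolding centraliser_iff[OF X_carrier] using GL_carrier by blast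
  have eq: "(C * B * star n R C) * D = C * (B * D) * transpose_mat C" if C: "C \<in> carrier (centraliser X)" and B: "B \<in> carrier_mat ?N ?N" for B C
  proof -
    note c = Cc[OF C] B star_carrier[of C] D_carrier
    have "(C * B * star n R C) * D = C * B * (star n R C * D)" using c by (simp add: sq_assoc[where n="?N"])
    also have "star n R C * D = D * transpose_mat C" by (rule star_mult_D) (use C in \<open>simp add: GLK_eq_centraliser\<close>)
    also have "C * B * (D * transpose_mat C) = C * (B * D) * transpose_mat C" using c by (simp add: sq_assoc[where n="?N"])
    finally show ?thesis .
  qed
  have img: "(\<lambda>Z. Z * D) ` star_congr_class n R B = orbit (centraliser X) congr_act (B * D)" if "B \<in> carrier_mat ?N ?N" for B
  proof -
    have "(\<lambda>Z. Z * D) ` star_congr_class n R B = (\<lambda>C. (C * B * star n R C) * D) ` carrier (centraliser X)"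
      unfolding star_congr_class_def GLK_eq_centraliser by blast
    also have "\<dots> = (\<lambda>C. C * (B * D) * transpose_mat C) ` carrier (centraliser X)"
      using eq[OF _ that] by (intro image_cong) auto
    also have "\<dots> = orbit (centraliser X) congr_act (B * D)" unfolding orbit_def congr_act_def by blast
    finally show ?thesis .
  qed
  have sub: "star_congr_class n R B \<subseteq> carrier_mat ?N ?N" if "B \<in> carrier_mat ?N ?N" for B
    unfolding star_congr_class_def GLK_eq_centraliser using Cc that star_carrier by auto
  have inj: "inj_on (\<lambda>Z. Z * D) (carrier_mat ?N ?N)"
    by (rule inj_onI) (rule GL_right_cancel[OF D_GL])
  show ?thesis unfolding img[OF B(1), symmetric] img[OF B(2), symmetric]
    using inj_on_image_eq_iff[OF inj sub[OF B(1)] sub[OF B(2)]] by simp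
qed

end

end

section \<open>Symplectic classes and classes of Hermitian matrices\<close>

lemma bij_betw_of_same_fibres:
  assumes "\<And>x y. x \<in> V \<Longrightarrow> y \<in> V \<Longrightarrow> F x = F y \<longleftrightarrow> G x = G y"
  shows "\<exists>\<Phi>. bij_betw \<Phi> (F ` V) (G ` V) \<and> (\<forall>x\<in>V. \<Phi> (F x) = G x)"
proof -
  \<comment> \<open>The preimage is chosen arbitrarily; equality of the fibres makes the value of
    \<open>G\<close> independent of the choice.\<close>
  define \<Phi> where "\<Phi> c = G (inv_into V F c)" for c
  have e: "\<Phi> (F x) = G x" if x: "x \<in> V" for x
  proof -
    have "inv_into V F (F x) \<in> V" "F (inv_into V F (F x)) = F x" using x by (auto intro: inv_into_into f_inv_into_f)
    thus ?thesis unfolding \<Phi>_def using assms x by blast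
  qed
  have "inj_on \<Phi> (F ` V)"
  proof (rule inj_onI)
    fix a b assume "a \<in> F ` V" "b \<in> F ` V" "\<Phi> a = \<Phi> b"
    then obtain x y where xy: "x \<in> V" "y \<in> V" "a = F x" "b = F y" "\<Phi> a = \<Phi> b" by blast
    have "G x = G y" using xy(5) unfolding xy(3,4) e[OF xy(1)] e[OF xy(2)] .
    thus "a = b" unfolding xy(3,4) using assms[OF xy(1,2)] by blast
  qed
  moreover have "\<Phi> ` F ` V = G ` V" unfolding image_image using e by (rule image_cong[OF refl])
  ultimately show ?thesis using e unfolding bij_betw_def by blast
qed

context self_reciprocal_block
begin

theorem hermitian_classification:
  fixes m n :: nat
  assumes two: "(2::'a) \<noteq> 0" and N: "n * d = 2 * m" and T: "T \<in> inv_gram R"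
    and f: "nondeg_alternating_form (2 * m) f" and gr: "gram_rep (2 * m) f A0"
  defines "X \<equiv> diag_block_mat (replicate n R)" and "D \<equiv> diag_block_mat (replicate n T)"
  shows "\<exists>\<Phi>. bij_betw \<Phi> (conj_class (Sp (2 * m) f) ` (conj_class (GL (2 * m)) X \<inter> carrier (Sp (2 * m) f)))
        (star_congr_class n R ` hermitian_GLK n R) \<and>
      (\<forall>S\<in>carrier (GL (2 * m)). inv\<^bsub>GL (2 * m)\<^esub> S * X * S \<in> carrier (Sp (2 * m) f) \<longrightarrow>
        (\<exists>!B. B \<in> carrier_mat (2 * m) (2 * m) \<and> S * A0 * transpose_mat S = B * D) \<and>
        (\<forall>B\<in>carrier_mat (2 * m) (2 * m). S * A0 * transpose_mat S = B * D \<longrightarrow> B \<in> hermitian_GLK n R \<and>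
           \<Phi> (conj_class (Sp (2 * m) f) (inv\<^bsub>GL (2 * m)\<^esub> S * X * S)) = star_congr_class n R B))"
proof -
  let ?N = "2 * m"
  have XG: "X \<in> carrier (GL ?N)" using X_GL[OF T, of n] unfolding X_def N .
  have DG: "D \<in> carrier (GL ?N)" using D_GL[OF T, of n] unfolding D_def N .
  note herm = hermitian_iff_inv_gram[OF T, of _ n, unfolded N, folded X_def D_def]
  note star_eq = star_congr_class_eq_iff[OF T, of _ n, unfolded N, folded X_def D_def]
  note A0 = gram_rep_nondeg[OF f gr]
  note c = GL_carrier[OF XG] GL_carrier[OF DG] GL_inv_carrier[OF DG] GL_carrier[OF A0(1)]
  \<comment> \<open>The matrices \<open>S\<close> for which the conjugate S^{-1} X S is symplectic.
    Both \<open>F\<close> and \<open>G\<close> have the fibres of the map that sends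
    \<open>S\<close> to the orbit of S A0 S' under the centraliser.\<close>
  define V where "V = {S \<in> carrier (GL ?N). S * A0 * transpose_mat S \<in> inv_gram X}"
  define Bof where "Bof S = S * A0 * transpose_mat S * inv\<^bsub>GL ?N\<^esub> D" for S
  define F where "F S = conj_class (Sp ?N f) (inv\<^bsub>GL ?N\<^esub> S * X * S)" for S
  define G where "G S = star_congr_class n R (Bof S)" for S
  have VSp: "S \<in> V \<longleftrightarrow> S \<in> carrier (GL ?N) \<and> inv\<^bsub>GL ?N\<^esub> S * X * S \<in> carrier (Sp ?N f)" for S
    unfolding V_def using conj_in_Sp_iff[OF gr A0 XG] by blast
  have SAc: "S * A0 * transpose_mat S \<in> carrier_mat ?N ?N" if "S \<in> carrier (GL ?N)" for S using GL_carrier[OF that] c by simp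
  have Bc: "Bof S \<in> carrier_mat ?N ?N" if "S \<in> carrier (GL ?N)" for S unfolding Bof_def by (rule sq_mult_carrier[OF SAc[OF that] c(3)])
  have BD: "Bof S * D = S * A0 * transpose_mat S" if "S \<in> carrier (GL ?N)" for S
    unfolding Bof_def sq_assoc[OF SAc[OF that] c(3) c(2)] GL_l_inv[OF DG] by (rule right_mult_one_mat[OF SAc[OF that]])
  have Bu: "B = Bof S" if "S \<in> carrier (GL ?N)" "B \<in> carrier_mat ?N ?N" "S * A0 * transpose_mat S = B * D" for B S
    by (rule GL_right_cancel[OF DG that(2) Bc[OF that(1)]]) (simp add: BD[OF that(1)] that(3))
  have fib: "F x = F y \<longleftrightarrow> G x = G y" if "x \<in> V" "y \<in> V" for x y
  proof -
    have xy: "x \<in> carrier (GL ?N)" "y \<in> carrier (GL ?N)" using that by (auto simp: V_def)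
    show ?thesis unfolding F_def G_def conj_class_Sp_eq_iff_orbit[OF gr XG xy] star_eq[OF Bc[OF xy(1)] Bc[OF xy(2)]] BD[OF xy(1)] BD[OF xy(2)] ..
  qed
  have "\<exists>\<Phi>. bij_betw \<Phi> (F ` V) (G ` V) \<and> (\<forall>x\<in>V. \<Phi> (F x) = G x)" by (rule bij_betw_of_same_fibres) (rule fib)
  then obtain \<Phi> where \<Phi>: "bij_betw \<Phi> (F ` V) (G ` V)" "\<forall>x\<in>V. \<Phi> (F x) = G x" by (elim exE conjE)
  have FV: "F ` V = conj_class (Sp ?N f) ` (conj_class (GL ?N) X \<inter> carrier (Sp ?N f))"
  proof -
    have "(\<lambda>S. inv\<^bsub>GL ?N\<^esub> S * X * S) ` V = conj_class (GL ?N) X \<inter> carrier (Sp ?N f)"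
      unfolding conj_class_GL using VSp by blast
    hence "conj_class (Sp ?N f) ` (\<lambda>S. inv\<^bsub>GL ?N\<^esub> S * X * S) ` V = conj_class (Sp ?N f) ` (conj_class (GL ?N) X \<inter> carrier (Sp ?N f))"
      by (rule arg_cong)
    thus ?thesis unfolding F_def image_image .
  qed
  have Vh: "Bof S \<in> hermitian_GLK n R" if S: "S \<in> V" for S
  proof -
    have SG: "S \<in> carrier (GL ?N)" and i: "S * A0 * transpose_mat S \<in> inv_gram X" using S by (auto simp: V_def)
    show ?thesis unfolding herm[OF Bc[OF SG]] BD[OF SG] by (rule i)
  qed
  have "Bof ` V = hermitian_GLK n R"
  proof (rule equalityI)
    show "hermitian_GLK n R \<subseteq> Bof ` V"
    proof
      fix B assume B: "B \<in> hermitian_GLK n R"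
      have "B \<in> carrier (GLK n R)" using B by (simp add: hermitian_GLK_def)
      hence "B \<in> carrier (GL (n * d))" by (simp add: GLK_def dimR)
      hence Bcar: "B \<in> carrier_mat ?N ?N" unfolding N by (rule GL_carrier)
      have i: "B * D \<in> inv_gram X" using B herm[OF Bcar] by blast
      have "B * D \<in> carrier (GL ?N)" "B * D = - transpose_mat (B * D)" using i inv_gram_iff[OF c(1)] by blast+
      \<comment> \<open>Surjectivity onto Hermitian matrices: B D is the matrix of a non-degenerate
        alternating form, hence congruent to A0.\<close>
      then obtain S where S: "S \<in> carrier (GL ?N)" "S * A0 * transpose_mat S = B * D" using skew_congruent[OF two _ _ A0] by blast
      have "S \<in> V" unfolding V_def mem_Collect_eq S(2) using S(1) i by blast
      thus "B \<in> Bof ` V" using Bu[OF S(1) Bcar S(2)] by blast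
    qed
  qed (use Vh in blast)
  hence "star_congr_class n R ` Bof ` V = star_congr_class n R ` hermitian_GLK n R" by (rule arg_cong)
  hence GV: "G ` V = star_congr_class n R ` hermitian_GLK n R" unfolding G_def image_image .
  show ?thesis
  proof (intro exI[of _ \<Phi>] conjI ballI impI)
    show "bij_betw \<Phi> (conj_class (Sp ?N f) ` (conj_class (GL ?N) X \<inter> carrier (Sp ?N f))) (star_congr_class n R ` hermitian_GLK n R)"
      using \<Phi>(1) unfolding FV GV .
  next
    fix S assume S: "S \<in> carrier (GL ?N)" and "inv\<^bsub>GL ?N\<^esub> S * X * S \<in> carrier (Sp ?N f)"
    hence SV: "S \<in> V" using VSp by blast
    show "\<exists>!B. B \<in> carrier_mat ?N ?N \<and> S * A0 * transpose_mat S = B * D"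
    proof (rule ex1I, rule conjI)
      show "Bof S \<in> carrier_mat ?N ?N" by (rule Bc[OF S])
      show "S * A0 * transpose_mat S = Bof S * D" by (rule BD[OF S, symmetric])
      show "B = Bof S" if "B \<in> carrier_mat ?N ?N \<and> S * A0 * transpose_mat S = B * D" for B
        by (rule Bu[OF S conjunct1[OF that] conjunct2[OF that]])
    qed
    fix B assume "B \<in> carrier_mat ?N ?N" "S * A0 * transpose_mat S = B * D"
    hence B: "B = Bof S" by (rule Bu[OF S])
    show "B \<in> hermitian_GLK n R" unfolding B by (rule Vh[OF SV])
    show "\<Phi> (conj_class (Sp ?N f) (inv\<^bsub>GL ?N\<^esub> S * X * S)) = star_congr_class n R B"
      using \<Phi>(2) SV unfolding B F_def G_def by blast
  qed
qed

lemma finite_single_orbit: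
  assumes two: "(2::'a) \<noteq> 0" and fin: "finite (UNIV :: 'a set)" and T: "T \<in> inv_gram R"
    and A: "A \<in> inv_gram (diag_block_mat (replicate n R))" and B: "B \<in> inv_gram (diag_block_mat (replicate n R))"
  shows "congruent_over (diag_block_mat (replicate n R)) A B"
proof -
  let ?X = "diag_block_mat (replicate n R)" and ?D = "diag_block_mat (replicate n T)"
  have X: "?X \<in> carrier_mat (n * d) (n * d)" by (rule diag_replicate_carrier[OF Rc])
  have d0: "d > 0" using d2 by simp
  have *: "congruent_over ?X C ?D" if "C \<in> inv_gram ?X" for C
    by (rule congruent_over_diag_replicate[OF two d0 R T finite_congruent[OF fin T] that])
  show ?thesis
    by (rule congruent_over_trans[OF X inv_gram_carrier[OF A X] *[OF A] congruent_over_sym[OF X inv_gram_carrier[OF B X] *[OF B]]])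
qed

end

lemma self_reciprocal_blockI:
  fixes R :: "'a::field mat"
  assumes "R \<in> carrier (GL (degree g))" "char_poly R = g"
    and "monic g" "irreducible g" "g \<noteq> [:0, 1:]" "g = recip_poly g" "degree g \<ge> 2"
  shows "self_reciprocal_block R g (degree g)"
  using poly_mat_char_poly[OF GL_carrier[OF assms(1)]] assms(2)
  by unfold_locales (use assms in simp_all)

lemma similar_diag_replicate:
  fixes A :: "'a::field mat"
  assumes "similar_mat A B" "A \<in> carrier_mat d d" "B \<in> carrier_mat d d"
  shows "similar_mat (diag_block_mat (replicate n A)) (diag_block_mat (replicate n B))"
  using similar_diag_mat_block_mat[of "replicate n (A, B)"] assms by (auto simp: map_replicate_const)

text \<open>A matrix with irreducible characteristic polynomial \<open>g\<close> is similar to the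
  companion matrix of \<open>g\<close>, so the companion blocks of \<open>X\<close> may be exchanged
  for copies of any such \<open>R\<close>.\<close>

lemma replicate_block_conj_class:
  fixes X :: "'a::field mat"
  assumes X: "X \<in> carrier (GL N)" and g: "irreducible g" and ed: "elementary_divisors X (replicate_mset n g)"
    and R: "R \<in> carrier_mat (degree g) (degree g)" "char_poly R = g"
  shows "diag_block_mat (replicate n R) \<in> conj_class (GL N) X"
proof -
  have "monic g" "poly_mat g R = 0\<^sub>m (degree g) (degree g)"
    using degree_monic_char_poly[OF R(1)] poly_mat_char_poly[OF R(1)] R(2) by simp_all
  from irreducible_annihilator_similar_companion[OF R(1) g this(1) refl this(2)]
  have "similar_mat R (companion_mat g)" .
  hence "similar_mat (companion_mat g) R" by (rule similar_mat_sym)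
  hence "similar_mat (diag_block_mat (replicate n (companion_mat g))) (diag_block_mat (replicate n R))"
    by (rule similar_diag_replicate) (use R in \<open>simp_all add: companion_mat_def\<close>)
  with elementary_divisors_replicate(1)[OF GL_carrier[OF X] ed]
  have "similar_mat X (diag_block_mat (replicate n R))" by (rule similar_mat_trans)
  thus ?thesis by (rule similar_conj_class[OF X])
qed

lemma symplectic_classes_self_reciprocal:
  fixes X :: "'a::field mat"
  assumes two: "(2::'a) \<noteq> 0" and ne: "inv_gram X \<noteq> {}"
    and blk: "self_reciprocal_block R g d" and X: "X = diag_block_mat (replicate n R)" "X \<in> carrier (GL (2 * m))"
    and N: "n * d = 2 * m" and T: "T \<in> carrier (GL d)" "transpose_mat T = - T" "R * T * transpose_mat R = T"
    and f: "nondeg_alternating_form (2 * m) f" and gr: "gram_rep (2 * m) f A0"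
  shows "let cl = conj_class (Sp (2 * m) f);
             Cs = cl ` (conj_class (GL (2 * m)) X \<inter> carrier (Sp (2 * m) f));
             D = diag_block_mat (replicate n T)
         in (\<exists>\<Phi>. bij_betw \<Phi> Cs (star_congr_class n R ` hermitian_GLK n R) \<and>
               (\<forall>S\<in>carrier (GL (2 * m)).
                  inv\<^bsub>GL (2 * m)\<^esub> S * X * S \<in> carrier (Sp (2 * m) f) \<longrightarrow>
                  (\<exists>!B. B \<in> carrier_mat (2 * m) (2 * m) \<and> S * A0 * transpose_mat S = B * D) \<and>
                  (\<forall>B\<in>carrier_mat (2 * m) (2 * m). S * A0 * transpose_mat S = B * D \<longrightarrow>
                     B \<in> hermitian_GLK n R \<and>
                     \<Phi> (cl (inv\<^bsub>GL (2 * m)\<^esub> S * X * S)) = star_congr_class n R B))) \<and>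
            (finite (UNIV :: 'a set) \<longrightarrow>
               is_singleton Cs \<and>
               (\<exists>Y\<in>carrier (Sp (2 * m) f).
                  conj_class (GL (2 * m)) X \<inter> carrier (Sp (2 * m) f) = cl Y))"
proof -
  interpret self_reciprocal_block R g d by (rule blk)
  have Tc: "T \<in> carrier_mat d d" by (rule GL_carrier[OF T(1)])
  have "- transpose_mat T = T" unfolding T(2) by simp
  hence TI: "T \<in> inv_gram R" unfolding inv_gram_iff[OF Rc] using T(1,3) by (intro conjI sym[of _ T])
  show ?thesis
    unfolding Let_def
  proof (rule conjI, goal_cases)
    case 1
    show ?case unfolding X(1) by (rule hermitian_classification[OF two N TI f gr])
  next
    case 2
    show ?case
    proof (rule impI)
      assume fin: "finite (UNIV :: 'a set)"
      have all: "congruent_over X A B" if "A \<in> inv_gram X" "B \<in> inv_gram X" for A B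
        unfolding X(1) by (rule finite_single_orbit[OF two fin TI]) (use that X(1) in auto)
      show "is_singleton (conj_class (Sp (2 * m) f) ` (conj_class (GL (2 * m)) X \<inter> carrier (Sp (2 * m) f))) \<and>
          (\<exists>Y\<in>carrier (Sp (2 * m) f). conj_class (GL (2 * m)) X \<inter> carrier (Sp (2 * m) f) = conj_class (Sp (2 * m) f) Y)"
        using single_symplectic_class[OF two X(2) f ne all] by (intro conjI)
    qed
  qed
qed

theorem mainTheorem1:
  fixes X :: "'a::field mat" and m :: nat
  assumes char_ne_2: "CHAR('a) \<noteq> 2"
    and m: "m \<ge> 1"
    and X: "X \<in> carrier (GL (2 * m))"
    and inv: "\<exists>f. nondeg_alternating_form (2 * m) f \<and> X \<in> carrier (Sp (2 * m) f)"
  shows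
    "inv_gram X \<noteq> {} \<and>
     \<comment> \<open>(a)\<close>
     (\<exists>Xs gs. primary_blocks Xs gs \<and> diag_block_mat Xs \<in> conj_class (GL (2 * m)) X) \<and>
     (\<forall>Xs gs. primary_blocks Xs gs \<and> X = diag_block_mat Xs \<longrightarrow>
        (\<forall>A\<in>inv_gram X. \<exists>As. length As = length Xs \<and> A = diag_block_mat As \<and>
           (\<forall>i<length Xs. As ! i \<in> inv_gram (Xs ! i))) \<and>
        (\<forall>As As'. length As = length Xs \<and> length As' = length Xs \<and>
           (\<forall>i<length Xs. As ! i \<in> inv_gram (Xs ! i) \<and> As' ! i \<in> inv_gram (Xs ! i)) \<and>
           diag_block_mat As \<in> inv_gram X \<and> diag_block_mat As' \<in> inv_gram X \<longrightarrow>
           (orbit (centraliser X) congr_act (diag_block_mat As)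
              = orbit (centraliser X) congr_act (diag_block_mat As')
            \<longleftrightarrow> (\<forall>i<length Xs. orbit (centraliser (Xs ! i)) congr_act (As ! i)
                  = orbit (centraliser (Xs ! i)) congr_act (As' ! i))))) \<and>
     \<comment> \<open>(b)\<close>
     (\<forall>g. monic g \<and> irreducible g \<and> g \<noteq> [:0, 1:] \<and> g \<noteq> recip_poly g \<and>
          elem_divs_powers_of X {g, recip_poly g} \<longrightarrow>
        (\<forall>f0. nondeg_alternating_form (2 * m) f0 \<longrightarrow>
           (\<exists>Y\<in>carrier (Sp (2 * m) f0).
              conj_class (GL (2 * m)) X \<inter> carrier (Sp (2 * m) f0) = conj_class (Sp (2 * m) f0) Y))) \<and>
     \<comment> \<open>(c)\<close>
     (\<forall>g n. monic g \<and> irreducible g \<and> g \<noteq> [:0, 1:] \<and> g = recip_poly g \<and>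
          elementary_divisors X (replicate_mset n g) \<longrightarrow>
        degree g * n = 2 * m \<and>
        \<comment> \<open>(c1)\<close>
        (degree g = 1 \<longrightarrow>
           (X = 1\<^sub>m (2 * m) \<or> X = - 1\<^sub>m (2 * m)) \<and>
           centraliser X = GL (2 * m) \<and>
           is_singleton (orbits (centraliser X) (inv_gram X) congr_act)) \<and>
        \<comment> \<open>(c2)\<close>
        (degree g \<ge> 2 \<longrightarrow>
           (\<exists>R\<in>carrier (GL (degree g)). char_poly R = g) \<and>
           (\<forall>R\<in>carrier (GL (degree g)). char_poly R = g \<longrightarrow>
              diag_block_mat (replicate n R) \<in> conj_class (GL (2 * m)) X) \<and>
           (\<forall>R\<in>carrier (GL (degree g)). char_poly R = g \<and> X = diag_block_mat (replicate n R) \<longrightarrow>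
              \<comment> \<open>the field \<open>K\<close>, its automorphism, and \<open>GL\<^sub>n(K)\<close> as the centraliser of \<open>X\<close>\<close>
              Ring.field (poly_ring R) \<and>
              poly_conj R \<in> ring_iso (poly_ring R) (poly_ring R) \<and>
              (\<forall>\<phi>. poly_conj R (poly_mat \<phi> R) = poly_mat \<phi> (inv\<^bsub>GL (degree g)\<^esub> R)) \<and>
              (\<forall>a\<in>carrier (poly_ring R). poly_conj R (poly_conj R a) = a) \<and>
              (\<exists>a\<in>carrier (poly_ring R). poly_conj R a \<noteq> a) \<and>
              GLK n R = centraliser X \<and>
              \<comment> \<open>the classification\<close>
              (\<exists>T\<in>carrier (GL (degree g)). transpose_mat T = - T \<and> R * T * transpose_mat R = T) \<and>
              (\<forall>T\<in>carrier (GL (degree g)). transpose_mat T = - T \<and> R * T * transpose_mat R = T \<longrightarrow>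
                 (\<forall>f0 A0. nondeg_alternating_form (2 * m) f0 \<and>
                    A0 \<in> carrier_mat (2 * m) (2 * m) \<and>
                    (\<forall>u\<in>carrier_vec (2 * m). \<forall>v\<in>carrier_vec (2 * m). f0 u v = u \<bullet> (A0 *\<^sub>v v)) \<longrightarrow>
                    (let cl = conj_class (Sp (2 * m) f0);
                         Cs = cl ` (conj_class (GL (2 * m)) X \<inter> carrier (Sp (2 * m) f0));
                         D = diag_block_mat (replicate n T)
                     in
                       (\<exists>\<Phi>. bij_betw \<Phi> Cs (star_congr_class n R ` hermitian_GLK n R) \<and>
                          (\<forall>S\<in>carrier (GL (2 * m)).
                             inv\<^bsub>GL (2 * m)\<^esub> S * X * S \<in> carrier (Sp (2 * m) f0) \<longrightarrow>
                             (\<exists>!B. B \<in> carrier_mat (2 * m) (2 * m) \<and> S * A0 * transpose_mat S = B * D) \<and>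
                             (\<forall>B\<in>carrier_mat (2 * m) (2 * m). S * A0 * transpose_mat S = B * D \<longrightarrow>
                                B \<in> hermitian_GLK n R \<and>
                                \<Phi> (cl (inv\<^bsub>GL (2 * m)\<^esub> S * X * S)) = star_congr_class n R B))) \<and>
                       (finite (UNIV :: 'a set) \<longrightarrow>
                          is_singleton Cs \<and>
                          (\<exists>Y\<in>carrier (Sp (2 * m) f0).
                             conj_class (GL (2 * m)) X \<inter> carrier (Sp (2 * m) f0)
                               = cl Y))))))))"
proof -
  have two: "(2::'a) \<noteq> 0" by (rule CHAR_not_2[OF char_ne_2])
  note Xc = GL_carrier[OF X]
  obtain f where f: "nondeg_alternating_form (2 * m) f" "X \<in> carrier (Sp (2 * m) f)" using inv by blast
  have ne: "inv_gram X \<noteq> {}" by (rule inv_gram_nonempty[OF f])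
  show ?thesis
  proof (intro conjI allI impI, goal_cases)
    case 1
    show ?case by (rule ne)
  next
    case 2
    show ?case by (rule primary_blocks_exist[OF X])
  next
    case (3 Xs gs)
    hence pb: "primary_blocks Xs gs" and XX: "X = diag_block_mat Xs" by blast+
    show ?case unfolding XX using inv_gram_primary_block_diag[OF pb] by blast
  next
    case (4 Xs gs As As')
    hence pb: "primary_blocks Xs gs" and XX: "X = diag_block_mat Xs" by blast+
    show ?case unfolding XX by (rule orbit_primary_blocks_iff[OF pb]) (use 4(2) in blast)+
  next
    case (5 g f0)
    hence g: "monic g" "irreducible g" "g \<noteq> [:0, 1:]" "g \<noteq> recip_poly g" "elem_divs_powers_of X {g, recip_poly g}" by blast+
    show ?case
      by (rule single_symplectic_class(1)[OF two X 5(2) ne]) (rule distinct_reciprocal_congruent[OF X g])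
  next
    case (6 g n)
    thus ?case using elementary_divisors_replicate(2)[OF Xc] by blast
  next
    case (7 g n)
    hence g: "monic g" "irreducible g" "g \<noteq> [:0, 1:]" "g = recip_poly g" "degree g = 1" "elementary_divisors X (replicate_mset n g)" by blast+
    show ?case by (rule linear_self_reciprocal(1)[OF two X ne g])
  next
    case (8 g n)
    hence g: "monic g" "irreducible g" "g \<noteq> [:0, 1:]" "g = recip_poly g" "degree g = 1" "elementary_divisors X (replicate_mset n g)" by blast+
    show ?case by (rule linear_self_reciprocal(2)[OF two X ne g])
  next
    case (9 g n)
    hence g: "monic g" "irreducible g" "g \<noteq> [:0, 1:]" "g = recip_poly g" "degree g = 1" "elementary_divisors X (replicate_mset n g)" by blast+
    show ?case by (rule linear_self_reciprocal(3)[OF two X ne g])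
  next
    case (10 g n)
    hence g: "monic g" "irreducible g" "g \<noteq> [:0, 1:]" by blast+
    show ?case using companion_mat_GL[OF g(1) poly_0_irreducible[OF g]] char_poly_companion_mat[OF g(1)] by (rule bexI[rotated])
  next
    case (11 g n)
    hence g: "monic g" "irreducible g" "elementary_divisors X (replicate_mset n g)" "degree g \<ge> 2" by blast+
    show ?case
      by (intro ballI impI) (rule replicate_block_conj_class[OF X g(2,3) GL_carrier])
  next
    case (12 g n)
    hence g: "monic g" "irreducible g" "g \<noteq> [:0, 1:]" "g = recip_poly g" "elementary_divisors X (replicate_mset n g)" "degree g \<ge> 2" by blast+
    have N: "n * degree g = 2 * m" using elementary_divisors_replicate(2)[OF Xc g(5)] by (simp only: mult.commute)
    show ?case
    proof (intro ballI impI, elim conjE, goal_cases)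
      case (1 R)
      have blk: "self_reciprocal_block R g (degree g)" by (rule self_reciprocal_blockI[OF 1(1,2) g(1-4,6)])
      interpret self_reciprocal_block R g "degree g" by (rule blk)
      show ?case
      proof (intro conjI ballI allI impI, goal_cases)
        case 1 show ?case by (rule field_poly_ring)
      next
        case 2 show ?case by (rule poly_conj_iso)
      next
        case 3 show ?case by (rule poly_conj_poly_mat)
      next
        case 4 thus ?case by (rule poly_conj_involution)
      next
        case 5 show ?case by (rule poly_conj_nontrivial)
      next
        case 6 show ?case unfolding 1(3) by (rule GLK_eq_centraliser)
      next
        case 7 show ?case by (rule exists_skew_invariant)
      next
        case (8 T f0 A0)
        hence T: "transpose_mat T = - T" "R * T * transpose_mat R = T" and f0: "nondeg_alternating_form (2 * m) f0"
          and gr: "gram_rep (2 * m) f0 A0" unfolding gram_rep_def by blast+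
        show ?case by (rule symplectic_classes_self_reciprocal[OF two ne blk 1(3) X N 8(1) T f0 gr])
      qed
    qed
  qed
qed

end
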